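(* Let $h$ be a solution on $[0,\infty)$ of \[ \partial_{tt}h-\Delta h+h^5+\big(V_1+5W_1^4\big)h+\big(V_2(x-\vec vt)+5W_2^4(x-\vec vt)\big)h+a(x,t)h=F_1+F_2+F+N(h,x,t), \] with $(h,h_t)\in C^0([0,\infty);\dot H^1)\times C^0([0,\infty);L^2)$ and data $(h,h_t)(0)=(f,g)\in\dot H^1\times L^2$. Suppose that, for some $\epsilon>0$, \[ \|h\|_S<\infty,\quad \|\langle x\rangle^{\frac12+\epsilon}F_1\|_{L^2_{t,x}}<\infty,\quad \|\langle x\rangle^{\frac12+\epsilon}F_2^S\|_{L^2_{t,x}}<\infty,\quad \|F\|_{L^1_tL^2_x}<\infty . \] Then there exist free data $(f_0,g_0)\in\dot H^1\times L^2$ such that $\|(h(t),h_t(t))-e^{tJH_F}(f_0,g_0)\|_{\dot H^1\times L^2}\to0$ as $t\to\infty$.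
   Context: All space-time norms are over $[0,\infty)\times\mathbb{R}^3$; $\langle x\rangle=(1+|x|^2)^{1/2}$. Let $V_1,V_2$ be smooth real potentials with $|V_i(x)|\lesssim\langle x\rangle^{-\beta}$, $\beta>3$; let $\vec v=(v,0,0)$, $0<|v|<1$; let $W_1,W_2$ be real continuous functions with $|W_i(x)|\lesssim\langle x\rangle^{-1}$. Define $a=20W_1^3W_2(x-\vec vt)+30W_1^2W_2^2(x-\vec vt)+20W_1W_2^3(x-\vec vt)$, $F_1=5W_1^4W_2(x-\vec vt)+V_1W_2(x-\vec vt)$, $F_2=5W_1W_2^4(x-\vec vt)+W_1V_2(x-\vec vt)$, $F=10W_1^3W_2^2(x-\vec vt)+10W_1^2W_2^3(x-\vec vt)$ (here $W_1=W_1(x)$, $V_1=V_1(x)$), and $N(h,x,t)=\big(10W_1^3+30W_1^2W_2(x-\vec vt)+30W_1W_2^2(x-\vec vt)+10W_2^3(x-\vec vt)\big)h^2+\big(10W_1^2+3W_1W_2(x-\vec vt)+10W_2^2(x-\vec vt)\big)h^3+\big(5W_1+5W_2(x-\vec vt)\big)h^4$. For a function $G(x,t)$, $G^S(x,t):=G(x+\vec vt,t)$. Let $\|h\|_{Stri}=\max_{p\in\{3,4,5\},\,\frac12=\frac1p+\frac3q}\|h\|_{L^p_tL^q_x}$ (i.e. $(p,q)=(3,18),(4,12),(5,10)$). $L^{p,r}$ denotes Lorentz spaces, $\widehat{x_1}=(x_2,x_3)$, and mixed norms are taken in the order written (e.g. $\|G\|_{L^{3/2,1}_xL^\infty_t}=\|\,\|G(x,\cdot)\|_{L^\infty_t}\|_{L^{3/2,1}_x}$).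 Define $\|G\|_D=\max\{\|\langle x\rangle^{-3}G\|_{L^1_{x_1}L^{2,1}_{\widehat{x_1}}L^\infty_t},\|\langle x\rangle^{-3}G\|_{L^{3/2,1}_xL^\infty_t}\}$ and $\|h\|_S=\max\{\|h\|_{Stri},\ \sup_t\|(h,h_t)(t)\|_{\dot H^1\times L^2},\ \|h\|_{L^\infty_xL^2_t},\ \|h^S\|_{L^\infty_xL^2_t},\ \|h\|_D,\ \|h^S\|_D\}$. $e^{tJH_F}$ is the free wave propagator: it maps $(f_0,g_0)$ to $(w(t),\partial_tw(t))$ where $\partial_{tt}w-\Delta w=0$, $(w,\partial_tw)(0)=(f_0,g_0)$. *)

theory Defs
  imports "HOL-Analysis.Analysis" "HOL-Probability.Essential_Supremum"
begin

definition jb :: "real^3 \<Rightarrow> real" where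
  "jb x = sqrt (1 + (norm x)^2)"

definition vv :: "real \<Rightarrow> real^3" where
  "vv v = vector [v, 0, 0]"

text \<open>Space-time functions are written time-first: G t x.\<close>

definition shiftS :: "real \<Rightarrow> (real \<Rightarrow> real^3 \<Rightarrow> 'b) \<Rightarrow> real \<Rightarrow> real^3 \<Rightarrow> 'b" where
  "shiftS v G t x = G t (x + t *\<^sub>R vv v)"

definition acoef :: "(real^3 \<Rightarrow> real) \<Rightarrow> (real^3 \<Rightarrow> real) \<Rightarrow> real \<Rightarrow> real \<Rightarrow> real^3 \<Rightarrow> real" where
  "acoef W1 W2 v t x = (let y = x - t *\<^sub>R vv v in
     20 * W1 x ^ 3 * W2 y + 30 * W1 x ^ 2 * W2 y ^ 2 + 20 * W1 x * W2 y ^ 3)"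

definition F1fn :: "(real^3 \<Rightarrow> real) \<Rightarrow> (real^3 \<Rightarrow> real) \<Rightarrow> (real^3 \<Rightarrow> real) \<Rightarrow> real \<Rightarrow> real \<Rightarrow> real^3 \<Rightarrow> real" where
  "F1fn V1 W1 W2 v t x = (let y = x - t *\<^sub>R vv v in
     5 * W1 x ^ 4 * W2 y + V1 x * W2 y)"

definition F2fn :: "(real^3 \<Rightarrow> real) \<Rightarrow> (real^3 \<Rightarrow> real) \<Rightarrow> (real^3 \<Rightarrow> real) \<Rightarrow> real \<Rightarrow> real \<Rightarrow> real^3 \<Rightarrow> real" where
  "F2fn V2 W1 W2 v t x = (let y = x - t *\<^sub>R vv v in
     5 * W1 x * W2 y ^ 4 + W1 x * V2 y)"

definition Ffn :: "(real^3 \<Rightarrow> real) \<Rightarrow> (real^3 \<Rightarrow> real) \<Rightarrow> real \<Rightarrow> real \<Rightarrow> real^3 \<Rightarrow> real" where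
  "Ffn W1 W2 v t x = (let y = x - t *\<^sub>R vv v in
     10 * W1 x ^ 3 * W2 y ^ 2 + 10 * W1 x ^ 2 * W2 y ^ 3)"

text \<open>N(h,x,t), with h a real number (the coefficient 3 in the cubic term is copied verbatim).\<close>
definition Nfn :: "(real^3 \<Rightarrow> real) \<Rightarrow> (real^3 \<Rightarrow> real) \<Rightarrow> real \<Rightarrow> real \<Rightarrow> real \<Rightarrow> real^3 \<Rightarrow> real" where
  "Nfn W1 W2 v hh t x = (let y = x - t *\<^sub>R vv v in
       (10 * W1 x ^ 3 + 30 * W1 x ^ 2 * W2 y + 30 * W1 x * W2 y ^ 2 + 10 * W2 y ^ 3) * hh ^ 2
     + (10 * W1 x ^ 2 + 3 * W1 x * W2 y + 10 * W2 y ^ 2) * hh ^ 3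
     + (5 * W1 x + 5 * W2 y) * hh ^ 4)"

definition dd :: "'a::real_normed_vector \<Rightarrow> ('a \<Rightarrow> real) \<Rightarrow> 'a \<Rightarrow> real" where
  "dd b f z = frechet_derivative f (at z) b"

fun iter_dd :: "'a::real_normed_vector list \<Rightarrow> ('a \<Rightarrow> real) \<Rightarrow> 'a \<Rightarrow> real" where
  "iter_dd [] f = f"
| "iter_dd (b # bs) f = dd b (iter_dd bs f)"

definition smooth_fn :: "('a::euclidean_space \<Rightarrow> real) \<Rightarrow> bool" where
  "smooth_fn f \<longleftrightarrow> (\<forall>bs. set bs \<subseteq> Basis \<longrightarrow> iter_dd bs f differentiable_on UNIV)"

definition tsupp :: "('a::real_normed_vector \<Rightarrow> real) \<Rightarrow> 'a set" where
  "tsupp f = closure {z. f z \<noteq> 0}"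

definition test_fn :: "'a::euclidean_space set \<Rightarrow> ('a \<Rightarrow> real) \<Rightarrow> bool" where
  "test_fn U \<phi> \<longleftrightarrow> smooth_fn \<phi> \<and> compact (tsupp \<phi>) \<and> tsupp \<phi> \<subseteq> U"

section \<open>Norms (valued in ennreal; finiteness means membership)\<close>

definition epowr :: "ennreal \<Rightarrow> real \<Rightarrow> ennreal" where
  "epowr a p = (if a = \<infinity> then \<infinity> else ennreal (enn2real a powr p))"

definition Lpn :: "real \<Rightarrow> ('a::euclidean_space \<Rightarrow> real) \<Rightarrow> ennreal" where
  "Lpn p f = epowr (\<integral>\<^sup>+ x. ennreal (\<bar>f x\<bar> powr p) \<partial>lborel) (1 / p)"

definition L2mem :: "('a::euclidean_space \<Rightarrow> real) \<Rightarrow> bool" where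
  "L2mem f \<longleftrightarrow> f \<in> borel_measurable lborel \<and> Lpn 2 f < \<infinity>"

definition LpLq :: "real \<Rightarrow> real \<Rightarrow> (real \<Rightarrow> real^3 \<Rightarrow> real) \<Rightarrow> ennreal" where
  "LpLq p q G = epowr (\<integral>\<^sup>+ t\<in>{0..}. epowr (\<integral>\<^sup>+ x. ennreal (\<bar>G t x\<bar> powr q) \<partial>lborel) (p / q) \<partial>lborel) (1 / p)"

definition Strich :: "(real \<Rightarrow> real^3 \<Rightarrow> real) \<Rightarrow> ennreal" where
  "Strich G = max (LpLq 3 18 G) (max (LpLq 4 12 G) (LpLq 5 10 G))"

definition LinfxL2t :: "(real \<Rightarrow> real^3 \<Rightarrow> real) \<Rightarrow> ennreal" where
  "LinfxL2t G = esssup lborel (\<lambda>x. epowr (\<integral>\<^sup>+ t\<in>{0..}. ennreal ((G t x)^2) \<partial>lborel) (1 / 2))"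

definition distf :: "'a measure \<Rightarrow> ('a \<Rightarrow> ennreal) \<Rightarrow> ennreal \<Rightarrow> ennreal" where
  "distf M g lam = emeasure M {x \<in> space M. g x > lam}"

definition rearr :: "'a measure \<Rightarrow> ('a \<Rightarrow> ennreal) \<Rightarrow> real \<Rightarrow> ennreal" where
  "rearr M g s = Inf {lam. distf M g lam \<le> ennreal s}"

definition lorentz1 :: "real \<Rightarrow> 'a measure \<Rightarrow> ('a \<Rightarrow> ennreal) \<Rightarrow> ennreal" where
  "lorentz1 p M g = (\<integral>\<^sup>+ s\<in>{0<..}. ennreal (s powr (1 / p - 1)) * rearr M g s \<partial>lborel)"

definition Linft_w :: "(real \<Rightarrow> real^3 \<Rightarrow> real) \<Rightarrow> real^3 \<Rightarrow> ennreal" where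
  "Linft_w G x = esssup (restrict_space lborel {0::real..}) (\<lambda>t. ennreal (\<bar>G t x\<bar> / jb x ^ 3))"

definition Dnorm :: "(real \<Rightarrow> real^3 \<Rightarrow> real) \<Rightarrow> ennreal" where
  "Dnorm G = max
     (\<integral>\<^sup>+ x1. lorentz1 2 (lborel :: (real \<times> real) measure)
                (\<lambda>(y2, y3). Linft_w G (vector [x1, y2, y3])) \<partial>lborel)
     (lorentz1 (3/2) (lborel :: (real^3) measure) (Linft_w G))"

text \<open>sup_t ||(h,h_t)(t)||_{Hdot^1 x L^2}, the Hdot^1 norm being the L^2 norm of the gradient dh.\<close>
definition energy_sup :: "(real \<Rightarrow> real^3 \<Rightarrow> real^3) \<Rightarrow> (real \<Rightarrow> real^3 \<Rightarrow> real) \<Rightarrow> ennreal" where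
  "energy_sup dh ht = (SUP t\<in>{0..}. Lpn 2 (\<lambda>x. norm (dh t x)) + Lpn 2 (ht t))"

definition Snorm :: "real \<Rightarrow> (real \<Rightarrow> real^3 \<Rightarrow> real) \<Rightarrow> (real \<Rightarrow> real^3 \<Rightarrow> real^3) \<Rightarrow> (real \<Rightarrow> real^3 \<Rightarrow> real) \<Rightarrow> ennreal" where
  "Snorm v h dh ht = Max {Strich h, energy_sup dh ht, LinfxL2t h, LinfxL2t (shiftS v h),
                          Dnorm h, Dnorm (shiftS v h)}"

definition weak_grad :: "(real^3 \<Rightarrow> real) \<Rightarrow> (real^3 \<Rightarrow> real^3) \<Rightarrow> bool" where
  "weak_grad f g \<longleftrightarrow> (\<forall>\<phi>. test_fn UNIV \<phi> \<longrightarrow> (\<forall>i.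
      integrable lborel (\<lambda>x. f x * dd (axis i 1) \<phi> x) \<and>
      integrable lborel (\<lambda>x. g x $ i * \<phi> x) \<and>
      (LINT x|lborel. f x * dd (axis i 1) \<phi> x) = - (LINT x|lborel. g x $ i * \<phi> x)))"

text \<open>f in Hdot^1(R^3) (realised as {f in L^6 : grad f in L^2}) with weak gradient g.\<close>
definition Hdot1 :: "(real^3 \<Rightarrow> real) \<Rightarrow> (real^3 \<Rightarrow> real^3) \<Rightarrow> bool" where
  "Hdot1 f g \<longleftrightarrow> f \<in> borel_measurable lborel \<and> Lpn 6 f < \<infinity> \<and> weak_grad f g \<and>
      g \<in> borel_measurable lborel \<and> Lpn 2 (\<lambda>x. norm (g x)) < \<infinity>"

definition tderiv :: "real \<times> (real^3) \<Rightarrow> (real \<times> (real^3) \<Rightarrow> real) \<Rightarrow> real" where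
  "tderiv z \<psi> = dd (1, 0) \<psi> z"

definition xgrad :: "real \<times> (real^3) \<Rightarrow> (real \<times> (real^3) \<Rightarrow> real) \<Rightarrow> real^3" where
  "xgrad z \<psi> = (\<chi> i. dd (0, axis i 1) \<psi> z)"

definition energy_class :: "(real \<Rightarrow> real^3 \<Rightarrow> real) \<Rightarrow> (real \<Rightarrow> real^3 \<Rightarrow> real^3) \<Rightarrow> (real \<Rightarrow> real^3 \<Rightarrow> real) \<Rightarrow> bool" where
  "energy_class h dh ht \<longleftrightarrow>
     (\<forall>t\<ge>0. Hdot1 (h t) (dh t) \<and> L2mem (ht t)) \<and>
     (\<forall>t\<ge>0. ((\<lambda>s. Lpn 2 (\<lambda>x. norm (dh s x - dh t x))) \<longlongrightarrow> 0) (at t within {0..})) \<and>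
     (\<forall>t\<ge>0. ((\<lambda>s. Lpn 2 (\<lambda>x. ht s x - ht t x)) \<longlongrightarrow> 0) (at t within {0..})) \<and>
     (\<forall>\<psi>. test_fn ({0<..} \<times> UNIV) \<psi> \<longrightarrow>
        integrable lborel (\<lambda>(t, x). h t x * tderiv (t, x) \<psi>) \<and>
        integrable lborel (\<lambda>(t, x). ht t x * \<psi> (t, x)) \<and>
        (LINT z|lborel. (case z of (t, x) \<Rightarrow> h t x * tderiv (t, x) \<psi>)) =
          - (LINT z|lborel. (case z of (t, x) \<Rightarrow> ht t x * \<psi> (t, x))))"

definition weak_wave :: "(real \<Rightarrow> real^3 \<Rightarrow> real) \<Rightarrow> (real \<Rightarrow> real^3 \<Rightarrow> real^3) \<Rightarrow> (real \<Rightarrow> real^3 \<Rightarrow> real)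
    \<Rightarrow> (real \<Rightarrow> real^3 \<Rightarrow> real \<Rightarrow> real) \<Rightarrow> bool" where
  "weak_wave w dw wt P \<longleftrightarrow> (\<forall>\<psi>. test_fn ({0<..} \<times> UNIV) \<psi> \<longrightarrow>
      integrable lborel (\<lambda>(t, x). - wt t x * tderiv (t, x) \<psi> + dw t x \<bullet> xgrad (t, x) \<psi>
                                  + P t x (w t x) * \<psi> (t, x)) \<and>
      (LINT z|lborel. (case z of (t, x) \<Rightarrow> - wt t x * tderiv (t, x) \<psi> + dw t x \<bullet> xgrad (t, x) \<psi>
                                  + P t x (w t x) * \<psi> (t, x))) = 0)"

text \<open>Zero-order and nonlinear terms of the equation for h, moved to the left-hand side.\<close>
definition Pterm :: "(real^3 \<Rightarrow> real) \<Rightarrow> (real^3 \<Rightarrow> real) \<Rightarrow> (real^3 \<Rightarrow> real) \<Rightarrow> (real^3 \<Rightarrow> real) \<Rightarrow> real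
    \<Rightarrow> real \<Rightarrow> real^3 \<Rightarrow> real \<Rightarrow> real" where
  "Pterm V1 V2 W1 W2 v t x y = (let z = x - t *\<^sub>R vv v in
      y ^ 5 + (V1 x + 5 * W1 x ^ 4) * y + (V2 z + 5 * W2 z ^ 4) * y + acoef W1 W2 v t x * y
      - (F1fn V1 W1 W2 v t x + F2fn V2 W1 W2 v t x + Ffn W1 W2 v t x + Nfn W1 W2 v y t x))"

end

theory Submission
  imports Defs
begin

text \<open>
  The equation is tested against \<open>z\<^sub>t\<close>, where \<open>z\<close> runs through the smooth free waves of spatially
  compact support: after time \<open>T\<close> the energy pairing of \<open>(h, h\<^sub>t)\<close> with \<open>z\<close> changes by at most the
  integral of \<open>\<bar>source\<bar> \<bar>z\<^sub>t\<bar>\<close> over \<open>t \<ge> T\<close>. The Morawetz identity bounds weighted space-time norms of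
  \<open>z\<^sub>t\<close> by the energy of \<open>z\<close>, and a Lorentz boost carries this over to weights moving with speed
  \<open>v\<close>. Mixed terms being interpolated by Young's inequality, each part of the source lies in
  \<open>L\<^sup>1L\<^sup>2\<close> or in the dual of one of the two weighted spaces, so the tails of these functionals
  tend to zero. Since finite energy data are approximated by smooth waves (convolution with explicit
  radial waves), duality shows that \<open>(h, h\<^sub>t)\<close> stays close to a smooth wave uniformly in \<open>t \<ge> T\<close>.
  These waves are Cauchy in energy as \<open>T\<close> grows, the functions themselves converge in \<open>L\<^sup>6\<close> by
  Sobolev's inequality, and the limit is the free wave sought.
\<close>

section \<open>Smooth functions\<close>

text \<open>The solution satisfies its equation only against compactly supported test functions, so
  every operation has to fall on the dual side. The multiplier is z_t because the energy pairing of
  two free waves is conserved, and along \<open>h\<close> its defect is, up to sign, the space-time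
  integral of source times z_t; spatially compact waves become admissible test functions after a
  cut-off in time alone. What is needed is therefore a bound for z_t and never one for an
  inhomogeneous solution.

  The decay rates fit as follows. All linear coefficients are O(<x>^(-3)) around one of the two
  centres. If \<open>h\<close> lies in L^infinity_x L^2_t, then <x> <x>^(-3) h lies in L^2_(t,x),
  since <x>^(-4) is integrable on R^3; this is dual to local energy decay of z_t with weight
  <x>^(-2). The exponent 1/2 + \<epsilon> in the hypotheses on F_1 and F_2 is dual to the weight
  <x>^(-1-2\<epsilon>).

  The duality is self-improving: for z the difference of two waves approximating the solution at
  times T and t, the energy E of z is at most 9 sqrt(\<eta> E), hence at most 81 \<eta>.\<close>

lemma dd_eq:
  assumes "(f has_derivative f') (at z)"
  shows "dd b f z = f' b"
  using frechet_derivative_at[OF assms] by (simp add: dd_def)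

lemma has_derivative_dd:
  assumes "f differentiable (at z)"
  shows "(f has_derivative (\<lambda>b. dd b f z)) (at z)"
  using assms frechet_derivative_works[of f "at z"] by (simp add: dd_def[abs_def])

lemma dd_real:
  assumes "\<And>s. (g has_real_derivative g' s) (at s)"
  shows "dd b g = (\<lambda>s. b * g' s)"
proof
  fix s show "dd b g s = b * g' s"
    using dd_eq[OF assms[of s, unfolded has_field_derivative_def], of b] by simp
qed

lemma dd_combination:
  fixes f :: "'a::euclidean_space \<Rightarrow> real"
  assumes "f differentiable (at z)"
  shows "dd b f z = (\<Sum>i\<in>Basis. (b \<bullet> i) * dd i f z)"
proof -
  interpret linear "\<lambda>b. dd b f z"
    using has_derivative_dd[OF assms] by (rule has_derivative_linear)
  have "dd b f z = dd (\<Sum>i\<in>Basis. (b \<bullet> i) *\<^sub>R i) f z" by (simp add: euclidean_representation)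
  also have "\<dots> = (\<Sum>i\<in>Basis. (b \<bullet> i) * dd i f z)"
    by (simp add: sum scale)
  finally show ?thesis .
qed

text \<open>All directions \<open>b\<close> are allowed, not only basis vectors: the derivative of a
  composition with a linear map \<open>L\<close> in direction \<open>b\<close> is a derivative in
  direction \<open>L b\<close>, so the class is stable under affine substitutions such as boosts and
  shifts.\<close>

primrec Ck :: "nat \<Rightarrow> ('a::euclidean_space \<Rightarrow> real) \<Rightarrow> bool" where
  "Ck 0 f = continuous_on UNIV f"
| "Ck (Suc n) f = ((\<forall>x. f differentiable (at x)) \<and> (\<forall>b. Ck n (dd b f)))"

definition Cinf :: "('a::euclidean_space \<Rightarrow> real) \<Rightarrow> bool" where
  "Cinf f \<longleftrightarrow> (\<forall>n. Ck n f)"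

lemma Ck_pred: "Ck (Suc n) f \<Longrightarrow> Ck n f"
proof (induction n arbitrary: f)
  case 0
  then show ?case
    by (auto intro!: continuous_at_imp_continuous_on differentiable_imp_continuous_within)
next
  case (Suc n) then show ?case by (metis Ck.simps(2))
qed

lemma Ck_const: "Ck n (\<lambda>_. c)"
proof (induction n arbitrary: c)
  case (Suc n)
  have "dd b (\<lambda>_::'a. c) = (\<lambda>_. 0)" for b
    by (rule ext, subst dd_eq[OF has_derivative_const]) simp
  with Suc show ?case by simp
qed simp

lemma Ck_add: "Ck n f \<Longrightarrow> Ck n g \<Longrightarrow> Ck n (\<lambda>x. f x + g x)"
proof (induction n arbitrary: f g)
  case 0 then show ?case by (auto intro: continuous_intros)
next
  case (Suc n)
  have "dd b (\<lambda>x. f x + g x) = (\<lambda>x. dd b f x + dd b g x)" for b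
    using Suc.prems by (intro ext dd_eq has_derivative_add has_derivative_dd) auto
  with Suc show ?case by auto
qed

lemma dd_mult:
  fixes f g :: "'a::euclidean_space \<Rightarrow> real"
  assumes "f differentiable (at x)" "g differentiable (at x)"
  shows "dd b (\<lambda>x. f x * g x) x = f x * dd b g x + dd b f x * g x"
  using assms by (intro dd_eq has_derivative_mult has_derivative_dd)

lemma Ck_mult: "Ck n f \<Longrightarrow> Ck n g \<Longrightarrow> Ck n (\<lambda>x. f x * g x)"
proof (induction n arbitrary: f g)
  case 0 then show ?case by (auto intro: continuous_intros)
next
  case (Suc n)
  have "dd b (\<lambda>x. f x * g x) = (\<lambda>x. f x * dd b g x + dd b f x * g x)" for b
    using Suc.prems by (intro ext dd_mult) auto
  moreover have "Ck n f" "Ck n g" using Suc.prems by (auto intro: Ck_pred simp del: Ck.simps)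
  ultimately show ?case using Suc by (auto intro!: Ck_add Suc.IH)
qed

lemma Ck_sum: "(\<And>i. i \<in> I \<Longrightarrow> Ck n (f i)) \<Longrightarrow> Ck n (\<lambda>x. \<Sum>i\<in>I. f i x)"
  by (induction I rule: infinite_finite_induct) (auto intro: Ck_add Ck_const simp del: Ck.simps)

lemma Ck_linear:
  assumes "bounded_linear f" shows "Ck n f"
proof (cases n)
  case 0 then show ?thesis using assms
    by (simp add: linear_continuous_on)
next
  case (Suc m)
  have d: "(f has_derivative f) (at x)" for x using assms by (rule bounded_linear_imp_has_derivative)
  then have "dd b f = (\<lambda>_. f b)" for b using dd_eq by blast
  with Suc d show ?thesis using Ck_const by (auto simp: differentiable_def)
qed

lemma dd_compose_affine:
  fixes f :: "'b::euclidean_space \<Rightarrow> real" and L :: "'a::euclidean_space \<Rightarrow> 'b"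
  assumes "bounded_linear L" "f differentiable (at (L x + c))"
  shows "((\<lambda>x. f (L x + c)) has_derivative (\<lambda>b. dd (L b) f (L x + c))) (at x)"
proof -
  have "((\<lambda>x. L x + c) has_derivative L) (at x)"
    using bounded_linear_imp_has_derivative[OF assms(1), of "at x"] by (auto intro!: derivative_eq_intros)
  from has_derivative_compose[OF this has_derivative_dd[OF assms(2)]] show ?thesis .
qed

lemma Ck_compose_affine:
  fixes f :: "'b::euclidean_space \<Rightarrow> real" and L :: "'a::euclidean_space \<Rightarrow> 'b"
  assumes L: "bounded_linear L"
  shows "Ck n f \<Longrightarrow> Ck n (\<lambda>x. f (L x + c))"
proof (induction n arbitrary: f)
  case 0
  have "continuous_on UNIV (\<lambda>x. L x + c)"
    by (intro continuous_intros linear_continuous_on L)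
  from continuous_on_compose2[OF _ this, of UNIV f] 0 show ?case by auto
next
  case (Suc n)
  note d = dd_compose_affine[OF L, of f]
  have "dd b (\<lambda>x. f (L x + c)) = (\<lambda>x. dd (L b) f (L x + c))" for b
    using Suc.prems d by (auto intro!: dd_eq)
  with Suc d show ?case by (auto simp: differentiable_def)
qed

lemma dd_compose_real:
  fixes f :: "'a::euclidean_space \<Rightarrow> real" and g :: "real \<Rightarrow> real"
  assumes "f differentiable (at x)" "g differentiable (at (f x))"
  shows "((\<lambda>x. g (f x)) has_derivative (\<lambda>b. dd 1 g (f x) * dd b f x)) (at x)"
proof -
  have lin: "dd c g (f x) = c * dd 1 g (f x)" for c
    using dd_combination[OF assms(2), of c] by simp
  show ?thesis
    using has_derivative_compose[OF has_derivative_dd[OF assms(1)] has_derivative_dd[OF assms(2)]]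
    by (subst (asm) lin) (simp add: mult.commute)
qed

lemma Ck_compose_real:
  fixes f :: "'a::euclidean_space \<Rightarrow> real" and g :: "real \<Rightarrow> real"
  shows "Ck n g \<Longrightarrow> Ck n f \<Longrightarrow> Ck n (\<lambda>x. g (f x))"
proof (induction n arbitrary: g)
  case 0
  then show ?case using continuous_on_compose2[of UNIV g UNIV f] by auto
next
  case (Suc n)
  have d: "((\<lambda>x. g (f x)) has_derivative (\<lambda>b. dd 1 g (f x) * dd b f x)) (at x)" for x
    using Suc.prems by (intro dd_compose_real) auto
  have "dd b (\<lambda>x. g (f x)) = (\<lambda>x. dd 1 g (f x) * dd b f x)" for b
    using dd_eq[OF d] by auto
  moreover have "Ck n f" using Suc.prems(2) by (rule Ck_pred)
  ultimately show ?case using Suc d by (auto simp: differentiable_def intro!: Ck_mult)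
qed

lemma Cinf_Ck: "Cinf f \<Longrightarrow> Ck n f" by (simp add: Cinf_def)

lemma Cinf_differentiable: "Cinf f \<Longrightarrow> f differentiable (at x)"
  using Cinf_Ck[of f "Suc 0"] by simp

lemma Cinf_continuous: "Cinf f \<Longrightarrow> continuous_on UNIV f"
  using Cinf_Ck[of f 0] by simp

lemma Cinf_dd: "Cinf f \<Longrightarrow> Cinf (dd b f)"
  unfolding Cinf_def using Ck.simps(2) by blast

text \<open>Suits families, such as the convolutions below, whose derivatives stay in the family
  although no formula for a derivative of order n is at hand.\<close>

lemma Cinf_coinduct:
  assumes "P f" "\<And>f. P f \<Longrightarrow> (\<forall>x. f differentiable (at x)) \<and> (\<forall>b. P (dd b f))"
  shows "Cinf f"
proof -
  have "P f \<Longrightarrow> Ck n f" for n f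
  proof (induction n arbitrary: f)
    case 0 then show ?case using assms(2)[of f]
      by (auto intro!: continuous_at_imp_continuous_on differentiable_imp_continuous_within)
  next
    case (Suc n) then show ?case using assms(2)[of f] by auto
  qed
  then show ?thesis using assms(1) by (simp add: Cinf_def)
qed

lemma Cinf_const [intro]: "Cinf (\<lambda>_. c)" by (simp add: Cinf_def Ck_const)
lemma Cinf_add [intro]: "Cinf f \<Longrightarrow> Cinf g \<Longrightarrow> Cinf (\<lambda>x. f x + g x)" by (simp add: Cinf_def Ck_add)
lemma Cinf_mult [intro]: "Cinf f \<Longrightarrow> Cinf g \<Longrightarrow> Cinf (\<lambda>x. f x * g x)" by (simp add: Cinf_def Ck_mult)
lemma Cinf_sum [intro]: "(\<And>i. i \<in> I \<Longrightarrow> Cinf (f i)) \<Longrightarrow> Cinf (\<lambda>x. \<Sum>i\<in>I. f i x)" by (simp add: Cinf_def Ck_sum)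
lemma Cinf_linear: "bounded_linear f \<Longrightarrow> Cinf f" by (simp add: Cinf_def Ck_linear)
lemma Cinf_compose_affine: "bounded_linear L \<Longrightarrow> Cinf f \<Longrightarrow> Cinf (\<lambda>x. f (L x + c))"
  by (simp add: Cinf_def Ck_compose_affine)
lemma Cinf_compose_real: "Cinf g \<Longrightarrow> Cinf f \<Longrightarrow> Cinf (\<lambda>x. g (f x :: real))"
  by (simp add: Cinf_def Ck_compose_real)
lemma Cinf_diff [intro]: "Cinf f \<Longrightarrow> Cinf g \<Longrightarrow> Cinf (\<lambda>x. f x - g x)"
  using Cinf_add[of f "\<lambda>x. (-1) * g x"] Cinf_mult[of "\<lambda>_. -1" g] by auto

lemma Cinf_inner_self: "Cinf (\<lambda>x::'a::euclidean_space. x \<bullet> x)"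
proof -
  have "(\<lambda>x::'a. x \<bullet> x) = (\<lambda>x. \<Sum>i\<in>Basis. (x \<bullet> i) * (x \<bullet> i))"
    by (rule ext) (rule euclidean_inner)
  then show ?thesis by (auto intro!: Cinf_sum Cinf_mult Cinf_linear[OF bounded_linear_inner_left])
qed

lemma iter_dd_snoc: "iter_dd (bs @ [b]) f = iter_dd bs (dd b f)"
  by (induction bs) auto

text \<open>The two notions differ in the directions they iterate: \<open>smooth_fn\<close> only
  sees basis vectors. Once the function is differentiable, a derivative in any direction is a linear
  combination of those, which is what the direction from \<open>smooth_fn\<close> to
  \<open>Cinf\<close> uses.\<close>

lemma smooth_fn_iff_Cinf: "smooth_fn f \<longleftrightarrow> Cinf f"
proof
  assume "Cinf f"
  then have "Cinf (iter_dd bs f)" for bs by (induction bs) (auto intro: Cinf_dd)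
  then show "smooth_fn f"
    by (auto simp: smooth_fn_def intro!: differentiable_at_imp_differentiable_on Cinf_differentiable)
next
  have "smooth_fn f \<Longrightarrow> Ck n f" for n
  proof (induction n arbitrary: f)
    case 0
    then have "iter_dd [] f differentiable_on UNIV" unfolding smooth_fn_def by (metis empty_set empty_subsetI)
    then show ?case by (simp add: differentiable_imp_continuous_on)
  next
    case (Suc n)
    then have "iter_dd [] f differentiable_on UNIV" unfolding smooth_fn_def by (metis empty_set empty_subsetI)
    then have d: "f differentiable (at x)" for x by (simp add: differentiable_on_def)
    have "smooth_fn (dd i f)" if "i \<in> Basis" for i
      unfolding smooth_fn_def
    proof (intro allI impI)
      fix bs :: "'a list" assume "set bs \<subseteq> Basis"
      \<comment> \<open>\<open>iter_dd\<close> applies the head of the list last, so the derivative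
        taken first has to be appended at the end.\<close>
      then have "set (bs @ [i]) \<subseteq> Basis" using that by auto
      then show "iter_dd bs (dd i f) differentiable_on UNIV"
        using Suc.prems unfolding smooth_fn_def iter_dd_snoc[symmetric] by blast
    qed
    then have C: "Ck n (\<lambda>z. \<Sum>i\<in>Basis. (b \<bullet> i) * dd i f z)" for b
      by (intro Ck_sum Ck_mult Ck_const Suc.IH) auto
    have "dd b f = (\<lambda>z. \<Sum>i\<in>Basis. (b \<bullet> i) * dd i f z)" for b
      using d by (auto intro!: ext dd_combination)
    from C[folded this] d show ?case by simp
  qed
  then show "smooth_fn f \<Longrightarrow> Cinf f" by (simp add: Cinf_def)
qed

subsection \<open>Bump functions\<close>

text \<open>The powers of s in the denominator make the family closed under differentiation up to
  linear combinations, so smoothness at 0 follows for all members at once.\<close>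

definition bump :: "nat \<Rightarrow> real \<Rightarrow> real" where
  "bump n s = (if s > 0 then exp (- 1 / s) / s ^ n else 0)"

text \<open>Raise y \<le> exp y, taken at y = 1 / (s m), to the power m = n + 2. The surplus of 2
  over n leaves the factor s^2, and so makes the difference quotient at 0 vanish.\<close>

lemma bump_le: "s > 0 \<Longrightarrow> bump n s \<le> real (n + 2) ^ (n + 2) * s^2"
proof -
  assume s: "s > 0"
  define m where "m = n + 2"
  have m: "m > 0" by (simp add: m_def)
  have "(1 / (s * m)) ^ m \<le> exp (1 / (s * m)) ^ m"
    using s m exp_ge_add_one_self[of "1 / (s * m)"]
    by (intro power_mono) (auto simp del: exp_ge_add_one_self)
  also have "exp (1 / (s * m)) ^ m = exp (1 / s)"
    using m s by (simp add: exp_of_nat_mult[symmetric])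
  finally have "exp (- 1 / s) \<le> (s * m) ^ m"
    using s m by (simp add: exp_minus field_simps)
  then have "exp (- 1 / s) / s ^ n \<le> (s * m) ^ m / s ^ n"
    using s by (intro divide_right_mono) auto
  also have "\<dots> = real m ^ m * s^2"
    using s by (simp add: m_def power_mult_distrib power_add power2_eq_square)
  finally show ?thesis using s by (simp add: bump_def m_def)
qed

lemma bump_nonneg: "bump n s \<ge> 0" by (simp add: bump_def)

lemma bump_deriv: "(bump n has_real_derivative (bump (n + 2) s - n * bump (n + 1) s)) (at s)"
proof -
  consider "s > 0" | "s < 0" | "s = 0" by linarith
  then show ?thesis
  proof cases
    case 1
    have e: "((\<lambda>s. exp (- 1 / s)) has_real_derivative exp (- 1 / s) * (1 / s)^2) (at s)"
      using 1 by (auto intro!: derivative_eq_intros simp: power2_eq_square)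
    have u: "((\<lambda>s. 1 / s) has_real_derivative - (1 / s)\<^sup>2) (at s)"
      using 1 by (auto intro!: derivative_eq_intros simp: power2_eq_square)
    have "real n * (- (1 / s)\<^sup>2 * (1 / s) ^ (n - Suc 0)) = - (real n * (1 / s) ^ (n + 1))"
      by (cases n) (simp_all add: power2_eq_square)
    then have p: "((\<lambda>s. (1 / s) ^ n) has_real_derivative - (real n * (1 / s) ^ (n + 1))) (at s)"
      using DERIV_power[OF u, of n] by simp
    have "exp (- 1 / s) * (1 / s)^2 * (1 / s) ^ n + - (real n * (1 / s) ^ (n + 1)) * exp (- 1 / s)
        = bump (n + 2) s - n * bump (n + 1) s"
      using 1 by (simp add: bump_def power_divide power_add power2_eq_square)
    from DERIV_cong[OF DERIV_mult[OF e p] this]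
    have "((\<lambda>s. exp (- 1 / s) * (1 / s) ^ n) has_real_derivative (bump (n + 2) s - n * bump (n + 1) s)) (at s)" .
    then show ?thesis
      by (rule has_field_derivative_transform_within_open[where S="{0<..}"])
         (use 1 in \<open>auto simp: bump_def power_divide\<close>)
  next
    case 2
    have "((\<lambda>s. 0) has_real_derivative (bump (n + 2) s - n * bump (n + 1) s)) (at s)"
      using 2 by (auto intro!: derivative_eq_intros simp: bump_def)
    then show ?thesis
      by (rule has_field_derivative_transform_within_open[where S="{..<0}"])
         (use 2 in \<open>auto simp: bump_def\<close>)
  next
    case 3
    \<comment> \<open>At 0 the difference quotient is O(|y|) by \<open>bump_le\<close>, and the
      claimed derivative has the value 0 there by definition.\<close>
    have "((\<lambda>y. real (n + 2) ^ (n + 2) * \<bar>y\<bar>) \<longlongrightarrow> 0) (at 0)"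
      by (auto intro!: tendsto_eq_intros)
    moreover have "\<forall>\<^sub>F y in at 0. norm (bump n y / y) \<le> real (n + 2) ^ (n + 2) * \<bar>y\<bar>"
    proof (rule eventuallyI)
      fix y :: real
      show "norm (bump n y / y) \<le> real (n + 2) ^ (n + 2) * \<bar>y\<bar>"
      proof (cases "y > 0")
        case True
        then show ?thesis using bump_le[OF True, of n] bump_nonneg[of n y]
          by (simp add: field_simps power2_eq_square)
      next
        case False
        then have "norm (bump n y / y) = 0" by (simp add: bump_def)
        then show ?thesis by (simp only: zero_le_mult_iff) simp
      qed
    qed
    ultimately have "((\<lambda>y. bump n y / y) \<longlongrightarrow> 0) (at 0)"
      by (rule Lim_null_comparison[rotated])
    then show ?thesis using 3 by (simp add: has_field_derivative_iff bump_def)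
  qed
qed

lemma Cinf_bump: "Cinf (bump n)"
proof -
  have "Ck k (bump n)" for k n
  proof (induction k arbitrary: n)
    case 0
    show ?case by (auto intro!: continuous_at_imp_continuous_on DERIV_isCont bump_deriv)
  next
    case (Suc k)
    have "dd b (bump n) = (\<lambda>s. b * (bump (Suc (Suc n)) s + (- real n) * bump (Suc n) s))" for b
      by (subst dd_real[OF bump_deriv]) simp
    moreover have "bump n differentiable (at s)" for s
      using bump_deriv by (meson has_field_derivative_imp_has_derivative differentiable_def)
    ultimately show ?case using Suc by (simp only: Ck.simps) (intro conjI allI Ck_mult Ck_add Ck_const; simp)
  qed
  then show ?thesis by (simp add: Cinf_def)
qed

lemma Cinf_real_poly_arg: "Cinf (\<lambda>s::real. a + b * s)"
  by (intro Cinf_add Cinf_mult Cinf_const Cinf_linear bounded_linear_ident)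

lemma Cinf_antiderivative:
  assumes "Cinf g" "\<And>s. (f has_real_derivative g s) (at s)"
  shows "Cinf f"
  unfolding Cinf_def
proof
  fix n show "Ck n f"
  proof (cases n)
    case 0 then show ?thesis
      using assms(2) by (auto intro!: continuous_at_imp_continuous_on DERIV_isCont)
  next
    case (Suc m)
    have "f differentiable (at s)" for s
      using assms(2) by (meson has_field_derivative_imp_has_derivative differentiable_def)
    then show ?thesis using Suc assms(1) by (auto simp: dd_real[OF assms(2)] intro!: Ck_mult Ck_const Cinf_Ck)
  qed
qed

text \<open>A normalised primitive of a bump supported in [0, 1]. The derivative is recorded as well
  because it later serves as an averaging kernel in time.\<close>

lemma smooth_step_exists:
  "\<exists>\<theta> \<theta>'. Cinf \<theta> \<and> Cinf \<theta>' \<and> (\<forall>s::real. (\<theta> has_real_derivative \<theta>' s) (at s) \<and> \<theta>' s \<ge> 0 \<and>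
     (s \<le> 0 \<longrightarrow> \<theta> s = 0 \<and> \<theta>' s = 0) \<and> (s \<ge> 1 \<longrightarrow> \<theta> s = (1::real) \<and> \<theta>' s = 0))"
proof -
  define \<sigma> where "\<sigma> s = bump 0 s * bump 0 (1 + (-1) * s)" for s
  have C\<sigma>: "Cinf \<sigma>" unfolding \<sigma>_def[abs_def]
    by (intro Cinf_mult Cinf_bump Cinf_compose_real[OF Cinf_bump] Cinf_real_poly_arg)
  have pos: "\<sigma> s \<ge> 0" "0 < s \<Longrightarrow> s < 1 \<Longrightarrow> \<sigma> s > 0" "s \<le> 0 \<Longrightarrow> \<sigma> s = 0" "s \<ge> 1 \<Longrightarrow> \<sigma> s = 0" for s
    by (auto simp: \<sigma>_def bump_def)
  have "\<exists>F. \<forall>x. -\<infinity> < ereal x \<longrightarrow> ereal x < \<infinity> \<longrightarrow> (F has_vector_derivative \<sigma> x) (at x)"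
    using Cinf_continuous[OF C\<sigma>]
    by (intro einterval_antiderivative) (auto simp: continuous_on_eq_continuous_at)
  then obtain F where F: "\<And>x. (F has_real_derivative \<sigma> x) (at x)"
    by (auto simp: has_real_derivative_iff_has_vector_derivative)
  have F0: "F s = F 0" if "s \<le> 0" for s
  proof (cases "s = 0")
    case False
    then have "s < 0" using that by simp
    then have "\<exists>z>s. z < 0 \<and> F 0 - F s = (0 - s) * \<sigma> z" by (intro MVT2) (auto intro: F)
    then show ?thesis using pos by auto
  qed simp
  have F1: "F s = F 1" if "s \<ge> 1" for s
  proof (cases "s = 1")
    case False
    then have "1 < s" using that by simp
    then have "\<exists>z>1. z < s \<and> F s - F 1 = (s - 1) * \<sigma> z" by (intro MVT2) (auto intro: F)
    then show ?thesis using pos by auto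
  qed simp
  have "\<exists>z>0. z < 1 \<and> F 1 - F 0 = (1 - 0) * \<sigma> z" by (intro MVT2) (auto intro: F)
  then have c: "F 1 - F 0 > 0" using pos(2) by (metis diff_zero mult_1)
  define \<theta> where "\<theta> s = (F s - F 0) / (F 1 - F 0)" for s
  define \<theta>' where "\<theta>' s = (1 / (F 1 - F 0)) * \<sigma> s" for s
  have d: "(\<theta> has_real_derivative \<theta>' s) (at s)" for s
    unfolding \<theta>_def \<theta>'_def using c by (auto intro!: derivative_eq_intros F)
  have C': "Cinf \<theta>'" unfolding \<theta>'_def[abs_def] using C\<sigma> by (intro Cinf_mult Cinf_const)
  moreover have "Cinf \<theta>" using C' d by (rule Cinf_antiderivative)
  moreover have "\<theta>' s \<ge> 0" for s using pos c by (simp add: \<theta>'_def)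
  moreover have "s \<le> 0 \<Longrightarrow> \<theta> s = 0 \<and> \<theta>' s = 0" for s using F0[of s] pos by (simp add: \<theta>_def \<theta>'_def)
  moreover have "s \<ge> 1 \<Longrightarrow> \<theta> s = 1 \<and> \<theta>' s = 0" for s using F1[of s] pos c by (simp add: \<theta>_def \<theta>'_def)
  ultimately show ?thesis using d by blast
qed

definition sstep :: "real \<Rightarrow> real" where
  "sstep = (SOME \<theta>. \<exists>\<theta>'. Cinf \<theta> \<and> Cinf \<theta>' \<and> (\<forall>s::real. (\<theta> has_real_derivative \<theta>' s) (at s) \<and> \<theta>' s \<ge> 0 \<and>
     (s \<le> 0 \<longrightarrow> \<theta> s = 0 \<and> \<theta>' s = 0) \<and> (s \<ge> 1 \<longrightarrow> \<theta> s = (1::real) \<and> \<theta>' s = 0)))"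

lemma sstep_props:
  shows "Cinf sstep" and "(sstep has_real_derivative dd 1 sstep s) (at s)" and "dd 1 sstep s \<ge> 0"
    and "s \<le> 0 \<Longrightarrow> sstep s = 0" and "s \<le> 0 \<Longrightarrow> dd 1 sstep s = 0"
    and "s \<ge> 1 \<Longrightarrow> sstep s = 1" and "s \<ge> 1 \<Longrightarrow> dd 1 sstep s = 0"
proof -
  obtain \<theta>' where *: "Cinf sstep" "\<And>s. (sstep has_real_derivative \<theta>' s) (at s)" "\<And>s. \<theta>' s \<ge> 0"
     "\<And>s. s \<le> 0 \<Longrightarrow> sstep s = 0 \<and> \<theta>' s = 0" "\<And>s. s \<ge> 1 \<Longrightarrow> sstep s = 1 \<and> \<theta>' s = 0"
    using someI_ex[OF smooth_step_exists] unfolding sstep_def[symmetric] by blast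
  have e: "dd 1 sstep = \<theta>'" using dd_real[OF *(2), of 1] by simp
  show "Cinf sstep" and "(sstep has_real_derivative dd 1 sstep s) (at s)" and "dd 1 sstep s \<ge> 0"
    and "s \<le> 0 \<Longrightarrow> sstep s = 0" and "s \<le> 0 \<Longrightarrow> dd 1 sstep s = 0"
    and "s \<ge> 1 \<Longrightarrow> sstep s = 1" and "s \<ge> 1 \<Longrightarrow> dd 1 sstep s = 0"
    unfolding e using *(1) *(2)[of s] *(3)[of s] *(4)[of s] *(5)[of s] by blast+
qed

lemma sstep_bounds: "0 \<le> sstep s" "sstep s \<le> 1"
proof -
  have m: "sstep a \<le> sstep b" if "a \<le> b" for a b
    using that by (rule DERIV_nonneg_imp_nondecreasing) (use sstep_props(2,3) in blast)
  show "0 \<le> sstep s" using m[of "min s 0" s] sstep_props(4)[of "min s 0"] by simp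
  show "sstep s \<le> 1" using m[of s "max s 1"] sstep_props(6)[of "max s 1"] by simp
qed

text \<open>The squared norm as argument keeps the function smooth at the origin. The transition
  takes place for R \<le> |x| \<le> sqrt 2 R.\<close>

definition cutoff :: "real \<Rightarrow> 'a::euclidean_space \<Rightarrow> real" where
  "cutoff R x = 1 - sstep ((1 / R^2) * (x \<bullet> x) - 1)"

lemma Cinf_cutoff: "Cinf (cutoff R)"
  unfolding cutoff_def[abs_def]
  by (intro Cinf_diff Cinf_const Cinf_compose_real[OF sstep_props(1)] Cinf_mult Cinf_inner_self)

lemma cutoff_eq:
  assumes "R > 0"
  shows "norm x \<le> R \<Longrightarrow> cutoff R x = 1" and "norm x \<ge> 2 * R \<Longrightarrow> cutoff R x = 0"
proof -
  define a where "a = norm x / R"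
  have e: "cutoff R x = 1 - sstep (a^2 - 1)"
    unfolding cutoff_def a_def power_divide dot_square_norm by simp
  have "a \<le> 1 \<Longrightarrow> a^2 - 1 \<le> 0" using power_mono[of a 1 2] assms by (simp add: a_def)
  moreover have "2 \<le> a \<Longrightarrow> 1 \<le> a^2 - 1" using power_mono[of 2 a 2] by simp
  moreover have "norm x \<le> R \<longleftrightarrow> a \<le> 1" "2 * R \<le> norm x \<longleftrightarrow> 2 \<le> a"
    using assms unfolding a_def by (auto simp: pos_le_divide_eq)
  ultimately show "norm x \<le> R \<Longrightarrow> cutoff R x = 1" and "norm x \<ge> 2 * R \<Longrightarrow> cutoff R x = 0"
    using sstep_props(4)[of "a^2 - 1"] sstep_props(6)[of "a^2 - 1"] e by auto
qed

lemma cutoff_bounds: "0 \<le> cutoff R x" "cutoff R x \<le> 1"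
  using sstep_bounds by (auto simp: cutoff_def)

type_synonym spacetime = "real \<times> (real^3)"

abbreviation (input) nnint_lborel :: "('a::euclidean_space \<Rightarrow> ennreal) \<Rightarrow> ennreal" (binder "NNINT " 10) where
  "nnint_lborel f \<equiv> nn_integral lborel f"

section \<open>Integration by parts and conservation laws\<close>

declare split_paired_All [simp del] split_paired_Ex [simp del]

section \<open>Directional derivatives: algebra, mean values, symmetry\<close>

lemma dd_add:
  fixes f g :: "'a::euclidean_space \<Rightarrow> real"
  assumes "f differentiable (at x)" "g differentiable (at x)"
  shows "dd b (\<lambda>x. f x + g x) x = dd b f x + dd b g x"
  using assms by (intro dd_eq has_derivative_add has_derivative_dd)

lemma dd_diff:
  fixes f g :: "'a::euclidean_space \<Rightarrow> real"
  assumes "f differentiable (at x)" "g differentiable (at x)"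
  shows "dd b (\<lambda>x. f x - g x) x = dd b f x - dd b g x"
  using assms by (intro dd_eq has_derivative_diff has_derivative_dd)

lemma dd_const [simp]: "dd b (\<lambda>_. c) x = 0"
  by (rule dd_eq) simp

lemma dd_scale:
  fixes f :: "'a::euclidean_space \<Rightarrow> real"
  assumes "f differentiable (at x)"
  shows "dd (c *\<^sub>R b) f x = c * dd b f x" and "dd (a + b) f x = dd a f x + dd b f x"
proof -
  interpret linear "\<lambda>b. dd b f x"
    using has_derivative_dd[OF assms] by (rule has_derivative_linear)
  show "dd (c *\<^sub>R b) f x = c * dd b f x" "dd (a + b) f x = dd a f x + dd b f x"
    by (simp_all add: scale add)
qed

lemma DERIV_line:
  fixes f :: "'a::euclidean_space \<Rightarrow> real"
  assumes "f differentiable (at (s *\<^sub>R a + c))"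
  shows "((\<lambda>s. f (s *\<^sub>R a + c)) has_real_derivative dd a f (s *\<^sub>R a + c)) (at s)"
  using dd_compose_affine[OF bounded_linear_scaleR_left[of a] assms] assms
  by (simp add: has_field_derivative_def dd_scale mult.commute[of _ "dd a f _"])

text \<open>The mean value theorem applied once in each direction. The mixed second difference on
  the left is symmetric in \<open>a\<close> and \<open>b\<close>, which is how the symmetry of
  second derivatives follows.\<close>

lemma second_difference:
  fixes f :: "'a::euclidean_space \<Rightarrow> real"
  assumes f: "Ck 2 f" and \<sigma>: "\<sigma> > 0"
  shows "\<exists>s t. 0 < s \<and> s < \<sigma> \<and> 0 < t \<and> t < \<sigma> \<and>
    f (x + \<sigma> *\<^sub>R a + \<sigma> *\<^sub>R b) - f (x + \<sigma> *\<^sub>R a) - f (x + \<sigma> *\<^sub>R b) + f x = \<sigma>^2 * dd b (dd a f) (x + s *\<^sub>R a + t *\<^sub>R b)"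
proof -
  have d1: "f differentiable (at y)" and d2: "dd a f differentiable (at y)" for y
    using f by (auto simp: numeral_2_eq_2)
  define \<phi> where "\<phi> s = f (s *\<^sub>R a + (x + \<sigma> *\<^sub>R b)) - f (s *\<^sub>R a + x)" for s
  have "(\<phi> has_real_derivative (dd a f (s *\<^sub>R a + (x + \<sigma> *\<^sub>R b)) - dd a f (s *\<^sub>R a + x))) (at s)" for s
    unfolding \<phi>_def by (intro DERIV_diff DERIV_line d1)
  then have "\<exists>s>0. s < \<sigma> \<and> \<phi> \<sigma> - \<phi> 0 = (\<sigma> - 0) * (dd a f (s *\<^sub>R a + (x + \<sigma> *\<^sub>R b)) - dd a f (s *\<^sub>R a + x))"
    using \<sigma> by (intro MVT2) auto
  then obtain s where s: "0 < s" "s < \<sigma>"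
    "\<phi> \<sigma> - \<phi> 0 = \<sigma> * (dd a f (s *\<^sub>R a + (x + \<sigma> *\<^sub>R b)) - dd a f (s *\<^sub>R a + x))" by auto
  define \<psi> where "\<psi> t = dd a f (t *\<^sub>R b + (x + s *\<^sub>R a))" for t
  have "(\<psi> has_real_derivative (dd b (dd a f) (t *\<^sub>R b + (x + s *\<^sub>R a)))) (at t)" for t
    unfolding \<psi>_def by (intro DERIV_line d2)
  then have "\<exists>t>0. t < \<sigma> \<and> \<psi> \<sigma> - \<psi> 0 = (\<sigma> - 0) * dd b (dd a f) (t *\<^sub>R b + (x + s *\<^sub>R a))"
    using \<sigma> by (intro MVT2) auto
  then obtain t where t: "0 < t" "t < \<sigma>"
    "\<psi> \<sigma> - \<psi> 0 = \<sigma> * dd b (dd a f) (t *\<^sub>R b + (x + s *\<^sub>R a))" by auto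
  have "f (x + \<sigma> *\<^sub>R a + \<sigma> *\<^sub>R b) - f (x + \<sigma> *\<^sub>R a) - f (x + \<sigma> *\<^sub>R b) + f x = \<phi> \<sigma> - \<phi> 0"
    by (simp add: \<phi>_def add_ac)
  also have "\<dots> = \<sigma> * (\<psi> \<sigma> - \<psi> 0)" using s(3) by (simp add: \<psi>_def add_ac)
  also have "\<dots> = \<sigma>^2 * dd b (dd a f) (x + s *\<^sub>R a + t *\<^sub>R b)"
    unfolding t(3) by (simp add: power2_eq_square add_ac)
  finally show ?thesis using s t by blast
qed

lemma dd_commute:
  fixes f :: "'a::euclidean_space \<Rightarrow> real"
  assumes f: "Ck 2 f"
  shows "dd a (dd b f) x = dd b (dd a f) x"
proof (rule ccontr)
  assume ne: "dd a (dd b f) x \<noteq> dd b (dd a f) x"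
  define \<epsilon> where "\<epsilon> = \<bar>dd a (dd b f) x - dd b (dd a f) x\<bar> / 2"
  have \<epsilon>: "\<epsilon> > 0" using ne by (simp add: \<epsilon>_def)
  have c: "continuous_on UNIV (dd a (dd b f))" "continuous_on UNIV (dd b (dd a f))"
    using f by (auto simp: numeral_2_eq_2)
  obtain d1 where d1: "d1 > 0" "\<And>y. dist y x < d1 \<Longrightarrow> dist (dd a (dd b f) y) (dd a (dd b f) x) < \<epsilon>"
    using c(1) \<epsilon> unfolding continuous_on_iff by (metis UNIV_I)
  obtain d2 where d2: "d2 > 0" "\<And>y. dist y x < d2 \<Longrightarrow> dist (dd b (dd a f) y) (dd b (dd a f) x) < \<epsilon>"
    using c(2) \<epsilon> unfolding continuous_on_iff by (metis UNIV_I)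
  define d where "d = min d1 d2"
  \<comment> \<open>The denominator keeps all points x + s a + t b with 0 < s, t < \<sigma> within
    distance d / 2 of x.\<close>
  define \<sigma> where "\<sigma> = d / (2 * (norm a + norm b + 1))"
  have n: "norm a + norm b + 1 > 0" by (smt (verit) norm_ge_zero)
  have \<sigma>: "\<sigma> > 0" using d1 d2 n by (simp add: \<sigma>_def d_def)
  have near: "dist (x + s *\<^sub>R a + t *\<^sub>R b) x < d" if "0 < s" "s < \<sigma>" "0 < t" "t < \<sigma>" for s t
  proof -
    have "dist (x + s *\<^sub>R a + t *\<^sub>R b) x = norm (s *\<^sub>R a + t *\<^sub>R b)" by (simp add: dist_norm add_ac)
    also have "\<dots> \<le> s * norm a + t * norm b" using that by (intro norm_triangle_le) auto
    also have "\<dots> \<le> \<sigma> * norm a + \<sigma> * norm b" using that by (intro add_mono mult_right_mono) auto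
    also have "\<dots> \<le> \<sigma> * (norm a + norm b + 1)" using \<sigma> by (simp add: algebra_simps)
    also have "\<dots> = d / 2" using n unfolding \<sigma>_def by (simp add: field_simps)
    also have "\<dots> < d" using d1(1) d2(1) by (simp add: d_def min_def)
    finally show ?thesis .
  qed
  obtain s t where st: "0 < s" "s < \<sigma>" "0 < t" "t < \<sigma>" and
    e1: "f (x + \<sigma> *\<^sub>R a + \<sigma> *\<^sub>R b) - f (x + \<sigma> *\<^sub>R a) - f (x + \<sigma> *\<^sub>R b) + f x = \<sigma>^2 * dd b (dd a f) (x + s *\<^sub>R a + t *\<^sub>R b)"
    using second_difference[OF f \<sigma>, of x a b] by blast
  obtain s' t' where st': "0 < s'" "s' < \<sigma>" "0 < t'" "t' < \<sigma>" and
    e2: "f (x + \<sigma> *\<^sub>R b + \<sigma> *\<^sub>R a) - f (x + \<sigma> *\<^sub>R b) - f (x + \<sigma> *\<^sub>R a) + f x = \<sigma>^2 * dd a (dd b f) (x + s' *\<^sub>R b + t' *\<^sub>R a)"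
    using second_difference[OF f \<sigma>, of x b a] by blast
  have "\<sigma>^2 * dd b (dd a f) (x + s *\<^sub>R a + t *\<^sub>R b) = \<sigma>^2 * dd a (dd b f) (x + s' *\<^sub>R b + t' *\<^sub>R a)"
    using e1 e2 unfolding add.assoc add.commute[of "\<sigma> *\<^sub>R b" "\<sigma> *\<^sub>R a"] by linarith
  then have eq: "dd b (dd a f) (x + s *\<^sub>R a + t *\<^sub>R b) = dd a (dd b f) (x + s' *\<^sub>R b + t' *\<^sub>R a)"
    using \<sigma> by simp
  have "dist (dd b (dd a f) (x + s *\<^sub>R a + t *\<^sub>R b)) (dd b (dd a f) x) < \<epsilon>"
    using near[OF st] by (intro d2) (simp add: d_def)
  moreover have "dist (x + s' *\<^sub>R b + t' *\<^sub>R a) x < d" using near[OF st'(3,4,1,2)] by (simp add: add_ac)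
  then have "dist (dd a (dd b f) (x + s' *\<^sub>R b + t' *\<^sub>R a)) (dd a (dd b f) x) < \<epsilon>"
    by (intro d1) (simp add: d_def)
  ultimately have "\<bar>dd a (dd b f) x - dd b (dd a f) x\<bar> < 2 * \<epsilon>" unfolding eq dist_real_def by linarith
  then show False by (simp add: \<epsilon>_def)
qed

section \<open>Translation invariance, Fubini on slabs, integrals of derivatives\<close>

lemma lborel_integral_translate:
  fixes f :: "'a::euclidean_space \<Rightarrow> real"
  shows "(LBINT x. f (c + x)) = (LBINT x. f x)"
proof (cases "f \<in> borel_measurable borel")
  case True
  have "(LBINT x. f x) = (LINT x|distr lborel borel ((+) c). f x)"
    by (simp add: lborel_distr_plus)
  also have "\<dots> = (LBINT x. f (c + x))" using True by (intro integral_distr) auto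
  finally show ?thesis by simp
next
  \<comment> \<open>Outside the measurable functions both integrals take the default value
    0.\<close>
  case False
  then have "(\<lambda>x. f (c + x)) \<notin> borel_measurable borel"
    using measurable_compose[of "\<lambda>x. - c + x" borel borel "\<lambda>x. f (c + x)" borel] by auto
  with False have "\<not> integrable lborel f" "\<not> integrable lborel (\<lambda>x. f (c + x))"
    using borel_measurable_integrable[of lborel f] borel_measurable_integrable[of lborel "\<lambda>x. f (c + x)"] by auto
  then show ?thesis by (simp add: not_integrable_integral_eq)
qed

lemma nn_integral_lborel_translate:
  fixes f :: "'a::euclidean_space \<Rightarrow> ennreal"
  assumes [measurable]: "f \<in> borel_measurable borel"
  shows "(NNINT x. f (c + x)) = (NNINT x. f x)"
proof -
  have "(NNINT x. f x) = (\<integral>\<^sup>+x. f x \<partial>distr lborel borel ((+) c))"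
    by (simp add: lborel_distr_plus)
  also have "\<dots> = (NNINT x. f (c + x))" by (intro nn_integral_distr) auto
  finally show ?thesis by simp
qed

lemma integrable_lborel_compact_support:
  fixes f :: "'a::euclidean_space \<Rightarrow> real"
  assumes "continuous_on UNIV f" "\<And>x. norm x > R \<Longrightarrow> f x = 0"
  shows "integrable lborel f"
proof -
  have "integrable lborel (\<lambda>x. indicator (cball 0 R) x *\<^sub>R f x)"
    using assms(1) by (intro borel_integrable_compact) (auto intro: continuous_on_subset)
  moreover have "(\<lambda>x. indicator (cball 0 R) x *\<^sub>R f x) = f"
    using assms(2) by (auto simp: fun_eq_iff indicator_def not_le)
  ultimately show ?thesis by simp
qed

lemma integrable_slab:
  fixes F :: "real \<times> 'a::euclidean_space \<Rightarrow> real"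
  assumes F: "continuous_on UNIV F" "\<And>t x. a \<le> t \<Longrightarrow> t \<le> b \<Longrightarrow> norm x > R \<Longrightarrow> F (t, x) = 0"
  shows "integrable lborel (\<lambda>p. indicator {a..b} (fst p) * F p)"
proof -
  have "integrable lborel (\<lambda>p. indicator ({a..b} \<times> cball 0 R) p *\<^sub>R F p)"
    using F(1) by (intro borel_integrable_compact) (auto intro: continuous_on_subset compact_Times)
  moreover have "(\<lambda>p. indicator ({a..b} \<times> cball 0 R) p *\<^sub>R F p) = (\<lambda>p. indicator {a..b} (fst p) * F p)"
    using F(2) by (force simp: fun_eq_iff indicator_def not_le)
  ultimately show ?thesis by simp
qed

lemma slab_Fubini:
  fixes F :: "real \<times> 'a::euclidean_space \<Rightarrow> real"
  assumes F: "continuous_on UNIV F" "\<And>t x. a \<le> t \<Longrightarrow> t \<le> b \<Longrightarrow> norm x > R \<Longrightarrow> F (t, x) = 0"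
  shows "(LBINT p. indicator {a..b} (fst p) * F p) = (LBINT t. indicator {a..b} t * (LBINT x. F (t, x)))"
    and "(LBINT p. indicator {a..b} (fst p) * F p) = (LBINT x. (LBINT t. indicator {a..b} t * F (t, x)))"
proof -
  have i: "integrable (lborel \<Otimes>\<^sub>M lborel) (\<lambda>p. indicator {a..b} (fst p) * F p)"
    using integrable_slab[OF F] by (simp add: lborel_prod)
  from lborel_pair.integral_fst'[OF i]
  show "(LBINT p. indicator {a..b} (fst p) * F p) = (LBINT t. indicator {a..b} t * (LBINT x. F (t, x)))"
    by (simp add: lborel_prod)
  have i': "integrable (lborel \<Otimes>\<^sub>M lborel) (case_prod (\<lambda>t x. indicator {a..b} t * F (t, x)))"
    using i by (simp add: case_prod_unfold)
  from lborel_pair.integral_snd[OF i']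
  show "(LBINT p. indicator {a..b} (fst p) * F p) = (LBINT x. (LBINT t. indicator {a..b} t * F (t, x)))"
    by (simp add: lborel_prod case_prod_unfold)
qed

lemma FTC_line:
  fixes f :: "'a::euclidean_space \<Rightarrow> real"
  assumes d: "\<And>x. f differentiable (at x)" and c: "continuous_on UNIV (dd b f)" and le: "l \<le> u"
  shows "(LBINT s. indicator {l..u} s * dd b f (s *\<^sub>R b + x)) = f (u *\<^sub>R b + x) - f (l *\<^sub>R b + x)"
proof -
  have "continuous_on {l..u} (\<lambda>s. dd b f (s *\<^sub>R b + x))"
    by (intro continuous_on_compose2[OF c] continuous_intros) auto
  then have "(LBINT s. indicator {l..u} s *\<^sub>R dd b f (s *\<^sub>R b + x)) = f (u *\<^sub>R b + x) - f (l *\<^sub>R b + x)"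
    by (intro integral_FTC_atLeastAtMost[OF le])
       (auto intro!: has_field_derivative_at_within DERIV_line d simp: has_real_derivative_iff_has_vector_derivative[symmetric])
  then show ?thesis by simp
qed

lemma dd_zero_outside:
  fixes f :: "'a::euclidean_space \<Rightarrow> real"
  assumes "\<And>x. norm x > R \<Longrightarrow> f x = 0" "norm x > R"
  shows "dd b f x = 0"
proof -
  have "open {x::'a. norm x > R}" by (intro open_Collect_less continuous_intros)
  then have "(f has_derivative (\<lambda>_. 0)) (at x)"
    by (rule has_derivative_transform_within_open[OF has_derivative_const[of 0]]) (use assms in auto)
  then show ?thesis by (rule dd_eq)
qed

text \<open>Averaging over translations along \<open>b\<close> replaces an iterated integral in
  coordinates: the integral of D_b f equals that of D_b f(x + t b) for every t, and integrating over
  t in [0, 1] turns it into the integral of f(x + b) - f(x), which is 0. Any direction in any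
  Euclidean space is covered in this way, space-time included.\<close>

lemma integral_dd_eq_0:
  fixes f :: "'a::euclidean_space \<Rightarrow> real"
  assumes d: "\<And>x. f differentiable (at x)" and c: "continuous_on UNIV (dd b f)"
    and s: "\<And>x. norm x > R \<Longrightarrow> f x = 0"
  shows "(LBINT x. dd b f x) = 0"
proof -
  have s': "dd b f x = 0" if "norm x > R" for x using s that by (rule dd_zero_outside)
  define F where "F p = dd b f (fst p *\<^sub>R b + snd p)" for p :: "real \<times> 'a"
  have F: "continuous_on UNIV F" unfolding F_def
    by (intro continuous_on_compose2[OF c] continuous_intros) auto
  have F0: "F (t, x) = 0" if "0 \<le> t" "t \<le> 1" "norm x > R + norm b" for t x
  proof -
    have "norm x \<le> norm (t *\<^sub>R b + x) + norm (t *\<^sub>R b)" by (metis add_diff_cancel_left' norm_triangle_sub add.commute norm_triangle_ineq4)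
    also have "norm (t *\<^sub>R b) \<le> norm b" using that by (simp add: mult_left_le_one_le)
    finally show ?thesis using that s' by (simp add: F_def)
  qed
  have fi: "integrable lborel f"
    using d s by (intro integrable_lborel_compact_support[of _ R])
      (auto intro!: continuous_at_imp_continuous_on differentiable_imp_continuous_within)
  have "(LBINT x. dd b f x) = (LBINT t. indicator {0..1} t * (LBINT x. F (t, x)))"
    by (simp add: F_def lborel_integral_translate)
  also have "\<dots> = (LBINT x. (LBINT t. indicator {0..1} t * F (t, x)))"
    using slab_Fubini[OF F, of 0 1 "R + norm b"] F0 by simp
  also have "\<dots> = (LBINT x. f (b + x) - f x)"
    using FTC_line[OF d c, of 0 1] by (simp add: F_def)
  also have "\<dots> = 0"
  proof -
    have "integrable lborel (\<lambda>x. f (b + x))"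
    proof (rule integrable_lborel_compact_support[of _ "R + norm b"])
      have "continuous_on UNIV f"
        using d by (auto intro!: continuous_at_imp_continuous_on differentiable_imp_continuous_within)
      then show "continuous_on UNIV (\<lambda>x. f (b + x))"
        by (rule continuous_on_compose2) (auto intro!: continuous_intros)
      show "f (b + x) = 0" if "R + norm b < norm x" for x
        using that norm_diff_ineq[of x b] by (intro s) (simp add: add.commute)
    qed
    then show ?thesis using fi by (simp add: lborel_integral_translate)
  qed
  finally show ?thesis .
qed

lemma slice_has_derivative:
  fixes f :: "real \<times> 'a::euclidean_space \<Rightarrow> real"
  assumes "f differentiable (at (t, x))"
  shows "((\<lambda>x. f (t, x)) has_derivative (\<lambda>b. dd (0, b) f (t, x))) (at x)"
    and "((\<lambda>t. f (t, x)) has_real_derivative dd (1, 0) f (t, x)) (at t)"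
proof -
  have "bounded_linear (\<lambda>x::'a. (0::real, x))" by (intro bounded_linear_intros)
  from dd_compose_affine[OF this, of f x "(t, 0)"] assms
  show "((\<lambda>x. f (t, x)) has_derivative (\<lambda>b. dd (0, b) f (t, x))) (at x)" by simp
  show "((\<lambda>t. f (t, x)) has_real_derivative dd (1, 0) f (t, x)) (at t)"
    using DERIV_line[of f t "(1, 0)" "(0, x)"] assms by simp
qed

lemma dd_slice:
  fixes f :: "real \<times> 'a::euclidean_space \<Rightarrow> real"
  assumes "f differentiable (at (t, x))"
  shows "dd b (\<lambda>x. f (t, x)) x = dd (0, b) f (t, x)"
  by (rule dd_eq[OF slice_has_derivative(1)[OF assms]])

lemma Ck_slice: "Ck n f \<Longrightarrow> Ck n (\<lambda>x. f (t, x))"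
  using Ck_compose_affine[of "\<lambda>x. (0, x)" n f "(t, 0)"] by (simp add: bounded_linear_Pair bounded_linear_zero bounded_linear_ident)

lemma Cinf_slice: "Cinf f \<Longrightarrow> Cinf (\<lambda>x. f (t, x))"
  by (simp add: Cinf_def Ck_slice)

text \<open>The divergence theorem on the slab between the times \<open>a\<close> and
  \<open>b\<close>: F is the density, G the flux, H the production. Vanishing far out is demanded
  only inside the slab because the supports of waves grow with time.\<close>

lemma conservation_law:
  fixes F H :: "real \<times> 'a::euclidean_space \<Rightarrow> real" and G :: "'i \<Rightarrow> real \<times> 'a \<Rightarrow> real"
  assumes F: "Ck 1 F" and G: "\<And>i. i \<in> I \<Longrightarrow> Ck 1 (G i)" and H: "continuous_on UNIV H" and fin: "finite I"
    and eq: "\<And>p. dd (1, 0) F p = (\<Sum>i\<in>I. dd (0, e i) (G i) p) + H p"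
    and sF: "\<And>t x. a \<le> t \<Longrightarrow> t \<le> b \<Longrightarrow> norm x > R \<Longrightarrow> F (t, x) = 0 \<and> dd (1, 0) F (t, x) = 0"
    and sG: "\<And>t x i. a \<le> t \<Longrightarrow> t \<le> b \<Longrightarrow> norm x > R \<Longrightarrow> i \<in> I \<Longrightarrow> G i (t, x) = 0"
    and sH: "\<And>t x. a \<le> t \<Longrightarrow> t \<le> b \<Longrightarrow> norm x > R \<Longrightarrow> H (t, x) = 0"
    and le: "a \<le> b"
  shows "(LBINT x. F (b, x)) - (LBINT x. F (a, x)) = (LBINT p. indicator {a..b} (fst p) * H p)"
proof -
  have dF: "F differentiable (at p)" and cF: "continuous_on UNIV (dd c F)" for p c using F unfolding One_nat_def Ck.simps by blast+
  have dG: "G i differentiable (at p)" and cG: "continuous_on UNIV (dd c (G i))" if "i \<in> I" for p c i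
    using G[OF that] unfolding One_nat_def Ck.simps by blast+
  have cs: "continuous_on UNIV (\<lambda>x. K (t, x))" if "continuous_on UNIV K" for K :: "real \<times> 'a \<Rightarrow> real" and t
    by (intro continuous_on_compose2[OF that] continuous_intros) auto
  have iF: "integrable lborel (\<lambda>x. F (t, x))" if "a \<le> t" "t \<le> b" for t
    using sF that by (intro integrable_lborel_compact_support[of _ R] cs)
      (auto intro!: continuous_at_imp_continuous_on differentiable_imp_continuous_within dF)
  have "(LBINT x. F (b, x)) - (LBINT x. F (a, x)) = (LBINT x. F (b, x) - F (a, x))"
    using iF le by simp
  also have "\<dots> = (LBINT x. (LBINT t. indicator {a..b} t * dd (1, 0) F (t, x)))"
    using FTC_line[OF dF cF le, of "(1,0)" "(0, _)"] by simp
  also have "\<dots> = (LBINT t. indicator {a..b} t * (LBINT x. dd (1, 0) F (t, x)))"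
    using slab_Fubini[OF cF[of "(1,0)"], of a b R] sF by simp
  also have "\<dots> = (LBINT t. indicator {a..b} t * (LBINT x. H (t, x)))"
  proof (intro Bochner_Integration.integral_cong refl)
    fix t :: real
    show "indicator {a..b} t * (LBINT x. dd (1, 0) F (t, x)) = indicator {a..b} t * (LBINT x. H (t, x))"
    proof (cases "t \<in> {a..b}")
      case True
      have z: "dd (0, e i) (G i) (t, x) = dd (e i) (\<lambda>x. G i (t, x)) x" if "i \<in> I" for i x
        using dG[OF that] by (simp add: dd_slice)
      have G1: "Ck 1 (\<lambda>x. G i (t, x))" if "i \<in> I" for i using G[OF that] by (rule Ck_slice)
      have 0: "(LBINT x. dd (0, e i) (G i) (t, x)) = 0" if "i \<in> I" for i
        unfolding z[OF that] using G1[OF that] sG[of t _ i] True that by (intro integral_dd_eq_0[of _ _ R]) auto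
      have ig: "integrable lborel (\<lambda>x. dd (0, e i) (G i) (t, x))" if i: "i \<in> I" for i
      proof (rule integrable_lborel_compact_support[of _ R])
        show "continuous_on UNIV (\<lambda>x. dd (0, e i) (G i) (t, x))" using cG[OF i] by (rule cs)
        fix x :: 'a assume x: "R < norm x"
        show "dd (0, e i) (G i) (t, x) = 0" unfolding z[OF i] by (rule dd_zero_outside[OF _ x]) (use sG i True in auto)
      qed
      have iH: "integrable lborel (\<lambda>x. H (t, x))"
        using sH True by (intro integrable_lborel_compact_support[of _ R] cs H) auto
      show ?thesis unfolding eq using ig 0 iH by simp
    qed simp
  qed
  also have "\<dots> = (LBINT p. indicator {a..b} (fst p) * H p)"
    using slab_Fubini(1)[OF H, of a b R] sH by simp
  finally show ?thesis .
qed

section \<open>Smooth waves of spatially compact support\<close>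

abbreviation Dt :: "(spacetime \<Rightarrow> real) \<Rightarrow> spacetime \<Rightarrow> real" where
  "Dt \<equiv> dd (1, 0)"
abbreviation Dx :: "3 \<Rightarrow> (spacetime \<Rightarrow> real) \<Rightarrow> spacetime \<Rightarrow> real" where
  "Dx i \<equiv> dd (0, axis i 1)"

text \<open>Finite speed of propagation in both time directions. Every time slice is then compactly
  supported, and no integration by parts in space leaves a boundary term.\<close>

definition cone_supp :: "real \<Rightarrow> (spacetime \<Rightarrow> real) \<Rightarrow> bool" where
  "cone_supp R f \<longleftrightarrow> (\<forall>t x. norm x > R + \<bar>t\<bar> \<longrightarrow> f (t, x) = 0)"

definition nice_wave :: "(spacetime \<Rightarrow> real) \<Rightarrow> bool" where
  "nice_wave z \<longleftrightarrow> Cinf z \<and> (\<exists>R. cone_supp R z) \<and> (\<forall>p. Dt (Dt z) p = (\<Sum>i\<in>UNIV. Dx i (Dx i z) p))"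

definition edens :: "(spacetime \<Rightarrow> real) \<Rightarrow> spacetime \<Rightarrow> real" where
  "edens z p = (Dt z p)^2 + (\<Sum>i\<in>UNIV. (Dx i z p)^2)"

text \<open>The polarised form of \<open>edens\<close>.\<close>

definition wpair :: "(spacetime \<Rightarrow> real) \<Rightarrow> (spacetime \<Rightarrow> real) \<Rightarrow> spacetime \<Rightarrow> real" where
  "wpair z w p = Dt z p * Dt w p + (\<Sum>i\<in>UNIV. Dx i z p * Dx i w p)"

definition en :: "(spacetime \<Rightarrow> real) \<Rightarrow> real" where
  "en z = (LBINT x. edens z (0, x))"

lemma nice_wave_Cinf: "nice_wave z \<Longrightarrow> Cinf z" by (simp add: nice_wave_def)

lemma nice_wave_eq: "nice_wave z \<Longrightarrow> Dt (Dt z) p = Dx 1 (Dx 1 z) p + Dx 2 (Dx 2 z) p + Dx 3 (Dx 3 z) p"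
  by (simp add: nice_wave_def sum_3)

lemma Cinf_dd_commute: "Cinf f \<Longrightarrow> dd a (dd b f) = dd b (dd a f)"
  by (intro ext dd_commute Cinf_Ck)

lemma cone_supp_mono: "cone_supp R f \<Longrightarrow> R \<le> R' \<Longrightarrow> cone_supp R' f"
  unfolding cone_supp_def by force

lemma cone_supp_dd: "cone_supp R f \<Longrightarrow> cone_supp R (dd b f)"
  unfolding cone_supp_def
proof (intro allI impI)
  fix t and x :: "real^3"
  assume f: "\<forall>t x. norm x > R + \<bar>t\<bar> \<longrightarrow> f (t, x) = 0" and "norm x > R + \<bar>t\<bar>"
  have "open {p::spacetime. R + \<bar>fst p\<bar> < norm (snd p)}"
    by (intro open_Collect_less continuous_intros)
  then have "(f has_derivative (\<lambda>_. 0)) (at (t, x))"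
    by (rule has_derivative_transform_within_open[OF has_derivative_const[of 0]])
       (use f \<open>norm x > R + \<bar>t\<bar>\<close> in auto)
  then show "dd b f (t, x) = 0" by (rule dd_eq)
qed

lemma edens_nonneg: "edens z p \<ge> 0"
  by (auto simp: edens_def intro!: add_nonneg_nonneg sum_nonneg)

lemma edens_wpair: "edens z p = wpair z z p"
  by (simp add: edens_def wpair_def power2_eq_square)

lemma wpair_sum3: "wpair z w p = Dt z p * Dt w p + (Dx 1 z p * Dx 1 w p + Dx 2 z p * Dx 2 w p + Dx 3 z p * Dx 3 w p)"
  by (simp add: wpair_def sum_3)

lemma Cinf_wpair: "Cinf z \<Longrightarrow> Cinf w \<Longrightarrow> Cinf (wpair z w)"
  unfolding wpair_def[abs_def] by (intro Cinf_add Cinf_mult Cinf_sum Cinf_dd)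

lemma cone_supp_wpair: "cone_supp R z \<Longrightarrow> cone_supp R (wpair z w)"
  using cone_supp_dd[of R z] unfolding wpair_def cone_supp_def by simp

text \<open>Differentiating in time and using both wave equations leaves the divergence of the field
  with components z_i w_t + z_t w_i.\<close>

lemma wpair_conserved:
  assumes z: "nice_wave z" and w: "nice_wave w"
  shows "(LBINT x. wpair z w (t, x)) = (LBINT x. wpair z w (0, x))"
proof -
  obtain R where R: "cone_supp R z" using z by (auto simp: nice_wave_def)
  have C: "Cinf z" "Cinf w" using z w by (simp_all add: nice_wave_def)
  define G where "G i p = Dx i z p * Dt w p + Dt z p * Dx i w p" for i p
  have d: "dd a z differentiable (at p)" "dd a w differentiable (at p)" for a p
    using C by (auto intro!: Cinf_differentiable Cinf_dd)
  have eq: "Dt (wpair z w) p = (\<Sum>i\<in>UNIV. Dx i (G i) p) + 0" for p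
    unfolding wpair_sum3[abs_def] G_def[abs_def] sum_3
    by (simp add: dd_add dd_mult d Cinf_dd_commute[OF C(1), of "(1,0)" "(0, _)"]
       Cinf_dd_commute[OF C(2), of "(1,0)" "(0, _)"] nice_wave_eq[OF z] nice_wave_eq[OF w] algebra_simps)
  have aux: "(LBINT x. wpair z w (b, x)) - (LBINT x. wpair z w (a, x)) = 0" if "a \<le> b" for a b
  proof -
    define R' where "R' = R + \<bar>a\<bar> + \<bar>b\<bar>"
    have big: "norm x > R + \<bar>t\<bar>" if "a \<le> t" "t \<le> b" "norm x > R'" for t and x :: "real^3"
      using that by (auto simp: R'_def)
    have cs: "cone_supp R (Dt (wpair z w))" "cone_supp R (wpair z w)"
      by (intro cone_supp_dd cone_supp_wpair R)+
    have "(LBINT x. wpair z w (b, x)) - (LBINT x. wpair z w (a, x)) =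
       (LINT p|(lborel :: (spacetime) measure). indicator {a..b} (fst p) * 0)"
    proof (rule conservation_law[where F="wpair z w" and H="\<lambda>_. 0" and I=UNIV and G=G and e="\<lambda>i. axis i 1" and R=R'])
      show "Ck 1 (wpair z w)" using C by (intro Cinf_Ck Cinf_wpair)
      show "Ck 1 (G i)" for i unfolding G_def[abs_def] using C by (intro Cinf_Ck Cinf_add Cinf_mult Cinf_dd)
      show "Dt (wpair z w) p = (\<Sum>i\<in>UNIV. Dx i (G i) p) + 0" for p by (rule eq)
      show "wpair z w (t, x) = 0 \<and> Dt (wpair z w) (t, x) = 0" if "a \<le> t" "t \<le> b" "norm x > R'" for t x
        using cs big[OF that] by (auto simp: cone_supp_def)
      show "G i (t, x) = 0" if "a \<le> t" "t \<le> b" "norm x > R'" for t x i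
        using cone_supp_dd[OF R] big[OF that(1-3)] by (auto simp: cone_supp_def G_def)
    qed (use that in auto)
    then show ?thesis by simp
  qed
  show ?thesis using aux[of 0 t] aux[of t 0] by (cases "0 \<le> t") auto
qed

lemma edens_conserved:
  assumes "nice_wave z"
  shows "(LBINT x. edens z (t, x)) = en z" and "integrable lborel (\<lambda>x. edens z (t, x))"
    and "(NNINT x. ennreal (edens z (t, x))) = ennreal (en z)" and "en z \<ge> 0"
proof -
  obtain R where R: "cone_supp R z" using assms by (auto simp: nice_wave_def)
  show 1: "(LBINT x. edens z (t, x)) = en z"
    unfolding en_def edens_wpair by (rule wpair_conserved[OF assms assms])
  show 2: "integrable lborel (\<lambda>x. edens z (t, x))"
    unfolding edens_wpair
  proof (rule integrable_lborel_compact_support)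
    have C: "Cinf z" using assms by (rule nice_wave_Cinf)
    show "continuous_on UNIV (\<lambda>x. wpair z z (t, x))"
      by (intro Cinf_continuous Cinf_slice Cinf_wpair C)
    show "norm x > R + \<bar>t\<bar> \<Longrightarrow> wpair z z (t, x) = 0" for x
      using cone_supp_wpair[OF R, of z] by (simp add: cone_supp_def)
  qed
  show "(NNINT x. ennreal (edens z (t, x))) = ennreal (en z)"
    using nn_integral_eq_integral[OF 2] 1 edens_nonneg by simp
  show "en z \<ge> 0" unfolding en_def by (intro integral_nonneg_AE) (simp add: edens_nonneg)
qed

lemma nice_wave_diff:
  assumes "nice_wave z" "nice_wave w"
  shows "nice_wave (\<lambda>p. z p - w p)"
proof -
  obtain R S where "cone_supp R z" "cone_supp S w" using assms by (auto simp: nice_wave_def)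
  then have "cone_supp (max R S) (\<lambda>p. z p - w p)" by (auto simp: cone_supp_def)
  moreover have C: "Cinf z" "Cinf w" using assms by (auto simp: nice_wave_def)
  then have d: "dd a (\<lambda>p. z p - w p) = (\<lambda>p. dd a z p - dd a w p)" for a
    by (auto simp: fun_eq_iff intro!: dd_diff Cinf_differentiable)
  have "dd a (dd a (\<lambda>p. z p - w p)) p = dd a (dd a z) p - dd a (dd a w) p" for a p
    unfolding d using C by (intro dd_diff Cinf_differentiable Cinf_dd)
  ultimately show ?thesis using assms C by (auto simp: nice_wave_def sum_subtractf intro!: Cinf_diff)
qed

subsection \<open>The Morawetz estimate\<close>

text \<open>A substitute at scale R, smooth at the origin, for the singular weight 1 / |x| of the
  classical Morawetz estimate.\<close>

definition mwt :: "real \<Rightarrow> spacetime \<Rightarrow> real" where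
  "mwt R p = 1 / sqrt (R^2 + snd p \<bullet> snd p)"

lemma mwt_deriv:
  assumes "R > 0"
  shows "(mwt R has_derivative (\<lambda>b. - (snd b \<bullet> snd p) * (mwt R p * mwt R p * mwt R p))) (at p)"
proof -
  define s where "s = R^2 + snd p \<bullet> snd p"
  have s: "s > 0" using assms by (simp add: s_def add_pos_nonneg)
  have 1: "((\<lambda>p. R^2 + snd p \<bullet> snd p) has_derivative (\<lambda>b. 2 * (snd b \<bullet> snd p))) (at p)"
    by (auto intro!: derivative_eq_intros simp: inner_commute)
  define q where "q = sqrt s"
  have q: "q > 0" "s = q * q" using s by (simp_all add: q_def)
  have "((\<lambda>s. 1 / sqrt s) has_real_derivative - (1 / 2) * (1 / q * (1 / q) * (1 / q))) (at s)"
    using s q by (auto intro!: derivative_eq_intros simp: q_def[symmetric] field_simps)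
  then have "((\<lambda>p. 1 / sqrt (R^2 + snd p \<bullet> snd p)) has_derivative
      (\<lambda>b. 2 * (snd b \<bullet> snd p) * (- (1 / 2) * (1 / q * (1 / q) * (1 / q))))) (at p)"
    by (intro DERIV_compose_FDERIV[OF _ 1]) (simp add: s_def)
  then show ?thesis unfolding mwt_def[abs_def] s_def[symmetric] q_def[symmetric] by simp
qed

lemma mwt_rel: "R > 0 \<Longrightarrow> (mwt R p)^2 * (R^2 + snd p \<bullet> snd p) = 1" "R > 0 \<Longrightarrow> mwt R p > 0"
proof -
  assume "R > 0"
  then have "R^2 + snd p \<bullet> snd p > 0" by (simp add: add_pos_nonneg)
  then show "(mwt R p)^2 * (R^2 + snd p \<bullet> snd p) = 1" "mwt R p > 0" by (simp_all add: mwt_def power_divide)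
qed

lemma Ck_mwt:
  assumes "R > 0" shows "Ck 1 (mwt R)"
proof -
  have c: "continuous_on UNIV (mwt R)"
    using mwt_deriv[OF assms] by (auto intro!: continuous_at_imp_continuous_on has_derivative_continuous)
  have "dd b (mwt R) = (\<lambda>p. - (snd b \<bullet> snd p) * (mwt R p * mwt R p * mwt R p))" for b
    by (intro ext dd_eq[OF mwt_deriv[OF assms]])
  moreover have "mwt R differentiable (at p)" for p
    using mwt_deriv[OF assms, of p] unfolding differentiable_def by blast
  ultimately show ?thesis by (auto intro!: continuous_intros c)
qed

text \<open>The bulk term of the Morawetz identity for the multiplier 2 \<phi> (x . grad z + z) with
  \<phi> = \<open>mwt R\<close>. Here X is x . grad z and g2 is the squared length of grad
  z.\<close>

definition mbulk :: "real \<Rightarrow> (spacetime \<Rightarrow> real) \<Rightarrow> spacetime \<Rightarrow> real" where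
  "mbulk R z p = (let \<phi> = mwt R p; r2 = snd p \<bullet> snd p; X = snd p $ 1 * Dx 1 z p + snd p $ 2 * Dx 2 z p + snd p $ 3 * Dx 3 z p;
      g2 = Dx 1 z p * Dx 1 z p + Dx 2 z p * Dx 2 z p + Dx 3 z p * Dx 3 z p in
     Dt z p * Dt z p * (\<phi> - r2 * (\<phi> * \<phi> * \<phi>)) + 4 * \<phi> * g2 - (3 * \<phi> - r2 * (\<phi> * \<phi> * \<phi>)) * g2
      - 2 * (\<phi> * \<phi> * \<phi> * (X * X)) + (3 * (\<phi> * \<phi> * \<phi>) - 3 * r2 * (\<phi> * \<phi> * \<phi> * \<phi> * \<phi>)) * (z p * z p))"

text \<open>From \<phi>^2 (R^2 + r2) = 1 follows r2 \<phi>^3 = \<phi> - R^2 \<phi>^3. The term in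
  X^2 is absorbed by Cauchy-Schwarz, X^2 \<le> r2 g2, and the coefficient of z^2 collapses to 3 R^2
  \<phi>^5, which is nonnegative.\<close>

lemma mbulk_ge:
  assumes R: "R > 0"
  shows "mbulk R z p \<ge> R^2 * (mwt R p)^3 * edens z p"
proof -
  define \<phi> where "\<phi> = mwt R p"
  define r2 where "r2 = snd p \<bullet> snd p"
  define g where "g = (\<chi> i. Dx i z p)"
  define g2 where "g2 = g \<bullet> g"
  define a where "a = Dt z p * Dt z p"
  have rel: "\<phi>^2 * (R^2 + r2) = 1" and pos: "\<phi> > 0" using mwt_rel[OF R, of p] by (simp_all add: \<phi>_def r2_def)
  have X: "snd p $ 1 * Dx 1 z p + snd p $ 2 * Dx 2 z p + snd p $ 3 * Dx 3 z p = snd p \<bullet> g"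
    by (simp add: g_def inner_vec_def sum_3)
  have G: "Dx 1 z p * Dx 1 z p + Dx 2 z p * Dx 2 z p + Dx 3 z p * Dx 3 z p = g2"
    by (simp add: g_def g2_def inner_vec_def sum_3)
  have CS: "(snd p \<bullet> g) * (snd p \<bullet> g) \<le> r2 * g2"
    using Cauchy_Schwarz_ineq[of "snd p" g] by (simp add: r2_def g2_def power2_eq_square)
  have e: "edens z p = a + g2"
    by (simp add: edens_def a_def g2_def g_def inner_vec_def power2_eq_square)
  have r2\<phi>: "r2 * (\<phi> * \<phi> * \<phi>) = \<phi> - R\<^sup>2 * \<phi>^3"
    using rel by algebra
  have r2\<phi>5: "3 * r2 * (\<phi> * \<phi> * \<phi> * \<phi> * \<phi>) = 3 * (\<phi>^3 - R\<^sup>2 * \<phi>^5)"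
  proof -
    have "3 * r2 * (\<phi> * \<phi> * \<phi> * \<phi> * \<phi>) = 3 * (r2 * (\<phi> * \<phi> * \<phi>)) * (\<phi> * \<phi>)" by (simp add: mult_ac)
    also have "\<dots> = 3 * (\<phi>^3 - R\<^sup>2 * \<phi>^5)" unfolding r2\<phi> by (simp add: algebra_simps power3_eq_cube power_numeral_reduce)
    finally show ?thesis .
  qed
  have "\<phi> * \<phi> * \<phi> * ((snd p \<bullet> g) * (snd p \<bullet> g)) \<le> \<phi> * \<phi> * \<phi> * (r2 * g2)"
    using CS pos by (intro mult_left_mono) auto
  also have "\<dots> = (\<phi> - R\<^sup>2 * \<phi>^3) * g2" unfolding r2\<phi>[symmetric] by (simp add: mult_ac)
  finally have 1: "\<phi> * \<phi> * \<phi> * ((snd p \<bullet> g) * (snd p \<bullet> g)) \<le> (\<phi> - R\<^sup>2 * \<phi>^3) * g2" .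
  have 2: "0 \<le> R^2 * \<phi>^5 * (z p * z p)" using pos by simp
  have "mbulk R z p = a * (R^2 * \<phi>^3) + 4 * \<phi> * g2 - (3 * \<phi> - (\<phi> - R\<^sup>2 * \<phi>^3)) * g2
      - 2 * (\<phi> * \<phi> * \<phi> * ((snd p \<bullet> g) * (snd p \<bullet> g))) + (3 * (\<phi> * \<phi> * \<phi>) - 3 * (\<phi>^3 - R\<^sup>2 * \<phi>^5)) * (z p * z p)"
    unfolding mbulk_def Let_def X G \<phi>_def[symmetric] r2_def[symmetric] r2\<phi> r2\<phi>5 a_def[symmetric]
    by simp
  also have "\<dots> = R^2 * \<phi>^3 * (a + g2) + 2 * ((\<phi> - R\<^sup>2 * \<phi>^3) * g2 - \<phi> * \<phi> * \<phi> * ((snd p \<bullet> g) * (snd p \<bullet> g)))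
      + 3 * (R^2 * \<phi>^5 * (z p * z p))" by algebra
  finally have eq: "mbulk R z p = \<dots>" .
  \<comment> \<open>A purely arithmetic form keeps the large expressions opaque.\<close>
  have gen: "A \<le> m" if "m = A + 2 * (B - C) + 3 * D" "C \<le> B" "0 \<le> D" for A B C D m :: real
    unfolding that(1) using that(2,3) by (simp add: add_nonneg_nonneg add.assoc)
  show ?thesis unfolding e \<phi>_def[symmetric] by (rule gen[OF eq 1 2])
qed

text \<open>The density is 2 z_t M with M = \<phi> (x . grad z + z), and the bulk term dominates the
  integrand on the left. What remains is to bound both boundary terms by the energy alone, in spite
  of the zero-order term in M; the field Q serves for that.\<close>

lemma morawetz:
  assumes z: "nice_wave z" and R: "R > 0" and ab: "a \<le> b"
  shows "(LBINT p. indicator {a..b} (fst p) * (R^2 * (mwt R p)^3 * edens z p)) \<le> 2 * en z"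
proof -
  obtain K where K: "cone_supp K z" using z by (auto simp: nice_wave_def)
  have C: "Cinf z" using z by (rule nice_wave_Cinf)
  define x where "x i p = snd p $ i" for i :: 3 and p :: "spacetime"
  have xb: "bounded_linear (x i)" for i
    unfolding x_def by (intro bounded_linear_intros bounded_linear_vec_nth[THEN bounded_linear_compose])
  have xC: "Cinf (x i)" for i by (rule Cinf_linear[OF xb])
  have dx: "dd b (x i) p = snd b $ i" for b i p
    using dd_eq[OF bounded_linear_imp_has_derivative[OF xb]] by (simp add: x_def)
  \<comment> \<open>The coefficient 1 of z is (n - 1) / 2 in dimension n = 3.\<close>
  define M where "M p = mwt R p * (x 1 p * Dx 1 z p + x 2 p * Dx 2 z p + x 3 p * Dx 3 z p + z p)" for p
  define F where "F p = 2 * (Dt z p * M p)" for p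
  define G where "G i p = 2 * (Dx i z p * M p) + mwt R p * x i p * (Dt z p * Dt z p)
     - mwt R p * x i p * (Dx 1 z p * Dx 1 z p + Dx 2 z p * Dx 2 z p + Dx 3 z p * Dx 3 z p)
     + x i p * (mwt R p * mwt R p * mwt R p) * (z p * z p)" for i p
  \<comment> \<open>Subtracting the divergence of Q from M^2 removes the cross term z x . grad z and
    makes the coefficient of z^2 nonpositive. Hence the integral of M^2 is at most that of |grad
    z|^2: a Hardy inequality in disguise.\<close>
  define Q where "Q i p = mwt R p * mwt R p * x i p * (z p * z p)" for i p
  have CM: "Ck 1 M" unfolding M_def[abs_def]
    by (intro Ck_mult Ck_add Ck_mwt R Cinf_Ck xC Cinf_dd C)
  have CF: "Ck 1 F" unfolding F_def[abs_def] by (intro Ck_mult Ck_const CM Cinf_Ck Cinf_dd C)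
  have sub: "Ck 1 f \<Longrightarrow> Ck 1 g \<Longrightarrow> Ck 1 (\<lambda>p. f p - g p)" for f g :: "spacetime \<Rightarrow> real"
    using Ck_add[of 1 f "\<lambda>p. (-1) * g p"] Ck_mult[of 1 "\<lambda>_. -1" g] Ck_const[of 1 "-1"] by simp
  have CG: "Ck 1 (G i)" for i unfolding G_def[abs_def]
    by (intro Ck_add sub Ck_mult CM Ck_const Ck_mwt R Cinf_Ck xC Cinf_dd C)
  have CQ: "Ck 1 (Q i)" for i unfolding Q_def[abs_def]
    by (intro Ck_mult Ck_mwt R Cinf_Ck xC C)
  have d: "dd a z differentiable (at p)" "z differentiable (at p)" "x i differentiable (at p)" "mwt R differentiable (at p)" for a p i
    using Cinf_differentiable[OF Cinf_dd[OF C]] Cinf_differentiable[OF C] Cinf_differentiable[OF xC]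
      Ck_mwt[OF R] by auto
  have dm: "dd b (mwt R) p = - (snd b $ 1 * x 1 p + snd b $ 2 * x 2 p + snd b $ 3 * x 3 p) * (mwt R p * mwt R p * mwt R p)" for b p
    by (subst dd_eq[OF mwt_deriv[OF R]]) (simp add: x_def inner_vec_def sum_3)
  have ax: "axis i (1::real) $ j = (if j = i then 1 else 0)" for i j :: 3 by (simp add: axis_def)
  have ne: "(1::3) \<noteq> 2" "(2::3) \<noteq> 1" "(1::3) \<noteq> 3" "(3::3) \<noteq> 1" "(2::3) \<noteq> 3" "(3::3) \<noteq> 2" by simp_all
  note cm = Cinf_dd_commute[OF C, of "(1,0)" "(0, _)"] Cinf_dd_commute[OF C, of "(0, axis 2 1)" "(0, axis 1 1)"]
     Cinf_dd_commute[OF C, of "(0, axis 3 1)" "(0, axis 1 1)"] Cinf_dd_commute[OF C, of "(0, axis 3 1)" "(0, axis 2 1)"]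
  have r2: "snd p \<bullet> snd p = x 1 p * x 1 p + x 2 p * x 2 p + x 3 p * x 3 p" for p
    by (simp add: x_def inner_vec_def sum_3)
  have eq: "Dt F p = (\<Sum>i\<in>UNIV. Dx i (G i) p) + (- mbulk R z p)" for p
  proof -
    have "Dt F p - (Dx 1 (G 1) p + Dx 2 (G 2) p + Dx 3 (G 3) p) + mbulk R z p = 0"
      unfolding F_def[abs_def] G_def[abs_def] M_def[abs_def] mbulk_def Let_def r2 x_def[symmetric]
      by (simp add: dd_add dd_diff dd_mult d dm dx ax ne cm nice_wave_eq[OF z]) algebra
    then show ?thesis by (simp add: sum_3)
  qed
  have eqQ: "(M p)^2 \<le> edens z p - (Dt z p)\<^sup>2 + (\<Sum>i\<in>UNIV. Dx i (Q i) p)" for p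
  proof -
    define \<phi> where "\<phi> = mwt R p"
    define g where "g = (\<chi> i. Dx i z p)"
    have rel: "\<phi>^2 * (R^2 + snd p \<bullet> snd p) = 1" and pos: "\<phi> > 0" using mwt_rel[OF R, of p] by (simp_all add: \<phi>_def)
    have X: "x 1 p * Dx 1 z p + x 2 p * Dx 2 z p + x 3 p * Dx 3 z p = snd p \<bullet> g"
      by (simp add: g_def inner_vec_def sum_3 x_def)
    have "Dx 1 (Q 1) p + Dx 2 (Q 2) p + Dx 3 (Q 3) p =
       (3 * (\<phi> * \<phi>) - 2 * (snd p \<bullet> snd p) * (\<phi> * \<phi> * (\<phi> * \<phi>))) * (z p * z p) + 2 * (\<phi> * \<phi>) * z p * (x 1 p * Dx 1 z p + x 2 p * Dx 2 z p + x 3 p * Dx 3 z p)"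
      unfolding Q_def[abs_def] r2 \<phi>_def
      by (simp add: dd_mult d dm dx ax ne) algebra
    then have Q: "(\<Sum>i\<in>UNIV. Dx i (Q i) p) = (3 * \<phi>^2 - 2 * (snd p \<bullet> snd p) * (\<phi>^2 * \<phi>^2)) * (z p)^2 + 2 * \<phi>^2 * z p * (snd p \<bullet> g)"
      by (simp add: sum_3 X power2_eq_square)
    have "\<phi>^2 * (snd p \<bullet> snd p) \<le> 1" using rel pos by (simp add: algebra_simps) (smt (verit) mult_nonneg_nonneg zero_le_power2)
    then have "(\<phi>^2 * (snd p \<bullet> snd p)) * (g \<bullet> g) \<le> 1 * (g \<bullet> g)" by (intro mult_right_mono) auto
    moreover have "\<phi>^2 * (snd p \<bullet> g)^2 \<le> \<phi>^2 * ((snd p \<bullet> snd p) * (g \<bullet> g))"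
      by (intro mult_left_mono Cauchy_Schwarz_ineq) auto
    ultimately have 1: "\<phi>^2 * (snd p \<bullet> g)^2 \<le> g \<bullet> g" by simp
    have "(\<phi>^2 * (snd p \<bullet> snd p)) * (\<phi>^2 * (z p)^2) \<le> 1 * (\<phi>^2 * (z p)^2)"
      using \<open>\<phi>\<^sup>2 * (snd p \<bullet> snd p) \<le> 1\<close> by (intro mult_right_mono) auto
    then have 2: "(snd p \<bullet> snd p) * (\<phi>^2 * \<phi>^2) * (z p)^2 \<le> \<phi>^2 * (z p)^2" by (simp add: mult_ac)
    have "(M p)^2 = \<phi>^2 * (snd p \<bullet> g)^2 + 2 * \<phi>^2 * z p * (snd p \<bullet> g) + \<phi>^2 * (z p)^2"
      unfolding M_def X \<phi>_def[symmetric] by (simp add: power2_eq_square algebra_simps)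
    moreover have "edens z p - (Dt z p)\<^sup>2 = g \<bullet> g" by (simp add: edens_def g_def inner_vec_def power2_eq_square)
    ultimately show ?thesis unfolding Q using 1 2 by (simp add: algebra_simps)
  qed
  have sz: "f (t, y) = 0" if "cone_supp K f" "norm y > K + \<bar>t\<bar>" for f t y using that by (simp add: cone_supp_def)
  have cs: "cone_supp K F" "cone_supp K M" "cone_supp K (G i)" "cone_supp K (Q i)" "cone_supp K (\<lambda>p. - mbulk R z p)" "cone_supp K (edens z)" for i
    using sz[OF K] sz[OF cone_supp_dd[OF K]]
    by (auto simp: cone_supp_def F_def G_def Q_def M_def mbulk_def Let_def edens_def)
  have cm: "continuous_on UNIV (mwt R)" using Ck_pred[of 0 "mwt R"] Ck_mwt[OF R] by simp
  have cD: "continuous_on UNIV (dd v z)" for v by (intro Cinf_continuous Cinf_dd C)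
  have cz: "continuous_on UNIV z" by (intro Cinf_continuous C)
  have cB: "continuous_on UNIV (\<lambda>p. - mbulk R z p)"
    unfolding mbulk_def Let_def by (intro continuous_intros cm cD cz)
  have cE: "continuous_on UNIV (edens z)"
    unfolding edens_def by (intro continuous_intros cD)
  define T where "T = K + \<bar>a\<bar> + \<bar>b\<bar>"
  have big: "norm y > K + \<bar>t\<bar>" if "a \<le> t" "t \<le> b" "norm y > T" for t and y :: "real^3"
    using that by (auto simp: T_def)
  have law: "(LBINT y. F (b, y)) - (LBINT y. F (a, y)) = (LBINT p. indicator {a..b} (fst p) * (- mbulk R z p))"
  proof (rule conservation_law[where I=UNIV and G=G and e="\<lambda>i. axis i 1" and R=T])
    show "F (t, y) = 0 \<and> Dt F (t, y) = 0" if "a \<le> t" "t \<le> b" "norm y > T" for t y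
      using sz cs(1) cone_supp_dd[OF cs(1)] big[OF that] by blast
    show "G i (t, y) = 0" if "a \<le> t" "t \<le> b" "norm y > T" for t y i
      using sz[OF cs(3)] big[OF that] by blast
    show "- mbulk R z (t, y) = 0" if "a \<le> t" "t \<le> b" "norm y > T" for t y
      using sz[OF cs(5)] big[OF that] by blast
  qed (use CF CG cB eq ab in \<open>simp_all only: finite\<close>)
  have cs0: "continuous_on UNIV (\<lambda>x. f (t, x))" if "continuous_on UNIV f" for f :: "spacetime \<Rightarrow> real" and t
    by (intro continuous_on_compose2[OF that] continuous_intros) auto
  have int: "integrable lborel (\<lambda>y. f (t, y))" if "cone_supp K f" "continuous_on UNIV f" for f t
    using that by (intro integrable_lborel_compact_support[of _ "K + \<bar>t\<bar>"] cs0) (auto simp: cone_supp_def)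
  have cM: "continuous_on UNIV M" using CM Ck_pred[of 0 M] by simp
  have cF: "continuous_on UNIV F" using CF Ck_pred[of 0 F] by simp
  have bd: "\<bar>LBINT y. F (t, y)\<bar> \<le> en z" for t
  proof -
    have iQ: "integrable lborel (\<lambda>y. Dx i (Q i) (t, y))" and zQ: "(LBINT y. Dx i (Q i) (t, y)) = 0" for i
    proof -
      have "continuous_on UNIV (Dx i (Q i))" using CQ[of i] unfolding One_nat_def Ck.simps by blast
      then show "integrable lborel (\<lambda>y. Dx i (Q i) (t, y))" by (intro int cone_supp_dd cs)
      have "Q i differentiable (at p)" for p using CQ[of i] unfolding One_nat_def Ck.simps by blast
      then have e: "(\<lambda>y. Dx i (Q i) (t, y)) = dd (axis i 1) (\<lambda>y. Q i (t, y))" by (auto simp: dd_slice)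
      show "(LBINT y. Dx i (Q i) (t, y)) = 0"
        unfolding e using Ck_slice[OF CQ[of i], of t] sz[OF cs(4)[of i]]
        by (intro integral_dd_eq_0[of _ _ "K + \<bar>t\<bar>"]) auto
    qed
    have iM: "integrable lborel (\<lambda>y. (M (t, y))^2)"
      using cs(2) by (intro int[of "\<lambda>p. (M p)^2"] continuous_intros cM) (auto simp: cone_supp_def)
    have iD: "integrable lborel (\<lambda>y. (Dt z (t, y))^2)"
      using cone_supp_dd[OF K] by (intro int[of "\<lambda>p. (Dt z p)^2"] continuous_intros cD) (auto simp: cone_supp_def)
    have iE: "integrable lborel (\<lambda>y. edens z (t, y))" by (rule edens_conserved(2)[OF z])
    have "(LBINT y. (M (t, y))^2) \<le> (LBINT y. edens z (t, y) - (Dt z (t, y))\<^sup>2 + (\<Sum>i\<in>UNIV. Dx i (Q i) (t, y)))"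
      using iM iD iE iQ eqQ by (intro integral_mono) auto
    also have "\<dots> = en z - (LBINT y. (Dt z (t, y))^2)"
      using iD iE iQ zQ edens_conserved(1)[OF z] by simp
    finally have MM: "(LBINT y. (M (t, y))^2) \<le> en z - (LBINT y. (Dt z (t, y))^2)" .
    have "\<bar>LBINT y. F (t, y)\<bar> \<le> (LBINT y. \<bar>F (t, y)\<bar>)" by (rule integral_abs_bound)
    \<comment> \<open>The bound for M^2 leaves room for exactly the integral of z_t^2, so each
      boundary term costs one energy; this is the origin of the factor 2.\<close>
    also have "\<dots> \<le> (LBINT y. (Dt z (t, y))^2 + (M (t, y))^2)"
    proof (intro integral_mono)
      show "integrable lborel (\<lambda>y. \<bar>F (t, y)\<bar>)" using int[OF cs(1) cF] by auto
      show "integrable lborel (\<lambda>y. (Dt z (t, y))^2 + (M (t, y))^2)" using iM iD by auto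
      show "\<bar>F (t, y)\<bar> \<le> (Dt z (t, y))^2 + (M (t, y))^2" for y
        using sum_squares_bound[of "\<bar>Dt z (t, y)\<bar>" "\<bar>M (t, y)\<bar>"] by (simp add: F_def abs_mult)
    qed
    also have "\<dots> \<le> en z" using MM iM iD by simp
    finally show ?thesis .
  qed
  have iB: "integrable lborel (\<lambda>p. indicator {a..b} (fst p) * (- mbulk R z p))"
    using sz[OF cs(5)] big by (intro integrable_slab[of _ a b T] cB) auto
  have iE: "integrable lborel (\<lambda>p. indicator {a..b} (fst p) * (R^2 * (mwt R p)^3 * edens z p))"
    using sz[OF cs(6)] big by (intro integrable_slab[of _ a b T] continuous_intros cm cE) auto
  have "(LBINT p. indicator {a..b} (fst p) * (R^2 * (mwt R p)^3 * edens z p)) \<le>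
     (LBINT p. - (indicator {a..b} (fst p) * (- mbulk R z p)))"
  proof (intro integral_mono)
    show "integrable lborel (\<lambda>p. - (indicator {a..b} (fst p) * (- mbulk R z p)))" using iB by (rule integrable_minus)
    show "indicator {a..b} (fst p) * (R^2 * (mwt R p)^3 * edens z p) \<le> - (indicator {a..b} (fst p) * (- mbulk R z p))" for p
      using mbulk_ge[OF R, of p z] by (simp add: indicator_def)
  qed (rule iE)
  also have "\<dots> = - ((LBINT y. F (b, y)) - (LBINT y. F (a, y)))"
    unfolding law by (rule integral_minus)
  also have "\<dots> \<le> 2 * en z" using bd[of a] bd[of b] by linarith
  finally show ?thesis .
qed

lemma borel_measurable_continuous_UNIV: "continuous_on UNIV f \<Longrightarrow> f \<in> borel_measurable borel"
  by (rule borel_measurable_continuous_onI)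

lemma Cinf_measurable: "Cinf f \<Longrightarrow> f \<in> borel_measurable borel"
  by (intro borel_measurable_continuous_UNIV Cinf_continuous)

lemma borel_product_measurable [measurable]:
  "(\<lambda>p. p) \<in> (borel :: ('a::second_countable_topology \<times> 'b::second_countable_topology) measure) \<rightarrow>\<^sub>M borel \<Otimes>\<^sub>M borel"
  "(\<lambda>p. p) \<in> (lborel :: ('c::euclidean_space \<times> 'd::euclidean_space) measure) \<rightarrow>\<^sub>M borel \<Otimes>\<^sub>M borel"
  "fst \<in> (borel :: ('a \<times> 'b) measure) \<rightarrow>\<^sub>M borel"
  "snd \<in> (borel :: ('a \<times> 'b) measure) \<rightarrow>\<^sub>M borel"
  by (auto simp: borel_prod lborel_prod intro!: borel_measurable_continuous_onI continuous_intros)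

lemma Cinf_edens: "Cinf z \<Longrightarrow> Cinf (edens z)"
  using Cinf_wpair[of z z] by (simp add: edens_wpair[abs_def])

lemma mwt_measurable [measurable]: "mwt R \<in> borel_measurable borel"
  unfolding mwt_def[abs_def] by measurable

text \<open>The Morawetz bound does not depend on the time window, so monotone convergence extends
  it to all times.\<close>

lemma morawetz_nn:
  assumes z: "nice_wave z" and R: "R > 0"
  shows "(NNINT p. ennreal (R^2 * (mwt R p)^3 * edens z p)) \<le> ennreal (2 * en z)"
proof -
  have C: "Cinf z" using z by (rule nice_wave_Cinf)
  have [measurable]: "edens z \<in> borel_measurable borel" by (intro Cinf_measurable Cinf_edens C)
  have nn: "0 \<le> R^2 * (mwt R p)^3 * edens z p" for p
    using mwt_rel(2)[OF R, of p] edens_nonneg[of z p] by simp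
  define f where "f n p = ennreal (indicator {- real n..real n} (fst p) * (R^2 * (mwt R p)^3 * edens z p))" for n and p :: "spacetime"
  have inc: "incseq f"
    unfolding incseq_def le_fun_def f_def
    by (intro allI impI ennreal_leI mult_right_mono nn) (auto simp: indicator_def)
  have [measurable]: "f n \<in> borel_measurable lborel" for n
    unfolding f_def by measurable
  have lim: "(SUP n. f n p) = ennreal (R^2 * (mwt R p)^3 * edens z p)" for p
  proof (rule antisym)
    show "(SUP n. f n p) \<le> ennreal (R^2 * (mwt R p)^3 * edens z p)"
      using nn[of p] by (intro SUP_least) (auto simp: f_def indicator_def)
    obtain n where "\<bar>fst p\<bar> \<le> real n" using real_arch_simple by blast
    then have "f n p = ennreal (R^2 * (mwt R p)^3 * edens z p)" by (auto simp: f_def indicator_def)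
    then show "ennreal (R^2 * (mwt R p)^3 * edens z p) \<le> (SUP n. f n p)" by (metis SUP_upper UNIV_I)
  qed
  have "(NNINT p. ennreal (R^2 * (mwt R p)^3 * edens z p)) = (SUP n. NNINT p. f n p)"
    unfolding lim[symmetric] by (intro nn_integral_monotone_convergence_SUP inc) auto
  also have "\<dots> \<le> ennreal (2 * en z)"
  proof (rule SUP_least)
    fix n
    obtain K where K: "cone_supp K z" using z by (auto simp: nice_wave_def)
    have "integrable lborel (\<lambda>p. indicator {- real n..real n} (fst p) * (R^2 * (mwt R p)^3 * edens z p))"
    proof (rule integrable_slab[of _ _ _ "K + real n"])
      have "continuous_on UNIV (mwt R)" using Ck_pred[of 0 "mwt R"] Ck_mwt[OF R] by simp
      then show "continuous_on UNIV (\<lambda>p. R^2 * mwt R p ^ 3 * edens z p)"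
        by (intro continuous_intros Cinf_continuous[OF Cinf_edens[OF C]])
      show "R^2 * mwt R (t, x) ^ 3 * edens z (t, x) = 0" if "- real n \<le> t" "t \<le> real n" "K + real n < norm x" for t x
      proof -
        have "K + \<bar>t\<bar> < norm x" using that by auto
        then have "edens z (t, x) = 0" using cone_supp_wpair[OF K, of z] by (auto simp: edens_wpair cone_supp_def)
        then show ?thesis by simp
      qed
    qed
    then have "(NNINT p. f n p) = ennreal (LBINT p. indicator {- real n..real n} (fst p) * (R^2 * (mwt R p)^3 * edens z p))"
      unfolding f_def using nn by (intro nn_integral_eq_integral) auto
    also have "\<dots> \<le> ennreal (2 * en z)" by (intro ennreal_leI morawetz z R) auto
    finally show "(NNINT p. f n p) \<le> ennreal (2 * en z)" .
  qed
  finally show ?thesis .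
qed

lemma jb_ge_1: "jb x \<ge> 1" and jb_pos: "jb x > 0"
proof -
  show 1: "jb x \<ge> 1" by (simp add: jb_def)
  then show "jb x > 0" by linarith
qed

lemma jb_measurable [measurable]: "jb \<in> borel_measurable borel"
  unfolding jb_def[abs_def] by measurable

text \<open>For r = 2^k between <x> and 2 <x>, the weight r^2 (\<open>mwt r\<close>)^3 is at least 1
  / (8 r), while <x>^(-1-\<delta>) is at most a constant times r^(-\<delta>) / r. At each point a
  single dyadic scale therefore suffices.\<close>

lemma jb_dyadic:
  assumes "\<delta> > 0"
  shows "\<exists>k. jb x powr (- 1 - \<delta>) \<le> 8 * 2 powr (1 + \<delta>) * ((2 powr (- \<delta>)) ^ k * ((2^k)^2 * (mwt (2^k) (t, x))^3))"
proof -
  define k where "k = nat \<lceil>log 2 (jb x)\<rceil>"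
  have l0: "log 2 (jb x) \<ge> 0" using jb_ge_1[of x] by simp
  have kk: "real k = of_int \<lceil>log 2 (jb x)\<rceil>" using l0 by (simp add: k_def)
  have "log 2 (jb x) \<le> real k" unfolding kk by linarith
  then have "2 powr (log 2 (jb x)) \<le> 2 powr real k" by (intro powr_mono) auto
  then have le: "jb x \<le> 2 ^ k" using jb_pos[of x] by (simp add: powr_realpow)
  have "real k \<le> log 2 (jb x) + 1" unfolding kk by linarith
  then have "2 powr (real k) \<le> 2 powr (log 2 (jb x) + 1)" by (intro powr_mono) auto
  then have ge: "2 ^ k \<le> 2 * jb x" using jb_pos[of x] by (simp add: powr_realpow powr_add)
  define r :: real where "r = 2 ^ k"
  have r: "r > 0" by (simp add: r_def)
  have "(norm x)^2 \<le> r^2"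
  proof -
    have "norm x \<le> jb x" unfolding jb_def by (simp add: real_le_rsqrt)
    then show ?thesis using le unfolding r_def by (intro power_mono) auto
  qed
  then have "sqrt (r^2 + x \<bullet> x) \<le> sqrt ((2 * r)^2)"
    unfolding dot_square_norm power_mult_distrib
    by (intro real_sqrt_le_mono) (use zero_le_power2[of r] in \<open>simp only: power2_eq_square; linarith\<close>)
  also have "sqrt ((2 * r)^2) = 2 * r" using r by (intro real_sqrt_unique) auto
  finally have "sqrt (r^2 + x \<bullet> x) \<le> 2 * r" .
  then have m: "mwt r (t, x) \<ge> 1 / (2 * r)"
    unfolding mwt_def using r by (simp add: frac_le add_pos_nonneg)
  have "(1 / (2 * r)) ^ 3 \<le> (mwt r (t, x)) ^ 3" using m r by (intro power_mono) auto
  then have "r^2 * (1 / (2 * r)) ^ 3 \<le> r^2 * (mwt r (t, x)) ^ 3" by (intro mult_left_mono) auto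
  moreover have "r^2 * (1 / (2 * r)) ^ 3 = 1 / (8 * r)" using r by (simp add: power_divide power2_eq_square power3_eq_cube)
  ultimately have "1 / (8 * r) \<le> r^2 * (mwt r (t, x)) ^ 3" by (simp only:)
  moreover have "1 / r = 8 * (1 / (8 * r))" by simp
  ultimately have a: "1 / r \<le> 8 * (r^2 * (mwt r (t, x)) ^ 3)" by linarith
  have b: "(2 powr (- \<delta>)) ^ k = r powr (- \<delta>)"
  proof -
    have "(2 powr (- \<delta>)) ^ k = (2 powr (- \<delta>)) powr (real k)" by (simp add: powr_realpow)
    also have "\<dots> = (2 powr real k) powr (- \<delta>)" by (simp add: powr_powr mult.commute)
    also have "2 powr real k = r" by (simp add: r_def powr_realpow)
    finally show ?thesis .
  qed
  have "jb x powr (- 1 - \<delta>) \<le> (r / 2) powr (- 1 - \<delta>)"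
    using ge r assms unfolding r_def[symmetric] by (intro powr_mono2') auto
  also have "\<dots> = r powr (- \<delta>) * (1 / r) * 2 powr (1 + \<delta>)"
  proof -
    have "(r / 2) powr (- 1 - \<delta>) = r powr (- 1 - \<delta>) / 2 powr (- 1 - \<delta>)" using r by (intro powr_divide)
    also have "r powr (- 1 - \<delta>) = r powr (- \<delta>) * (1 / r)"
      using r powr_add[of r "- \<delta>" "- 1"] by (simp add: powr_minus_divide minus_diff_commute)
    also have "r powr (- \<delta>) * (1 / r) / 2 powr (- 1 - \<delta>) = r powr (- \<delta>) * (1 / r) * 2 powr (1 + \<delta>)"
      using powr_minus[of 2 "1 + \<delta>"] by (simp add: divide_inverse)
    finally show ?thesis .
  qed
  also have "\<dots> \<le> r powr (- \<delta>) * (8 * (r^2 * (mwt r (t, x)) ^ 3)) * 2 powr (1 + \<delta>)"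
    using a by (intro mult_right_mono mult_left_mono) auto
  finally show ?thesis unfolding b[symmetric] by (intro exI[of _ k]) (simp add: r_def mult_ac)
qed

text \<open>The Morawetz bounds at the scales 2^k are summed with weights 2^(-\<delta> k); the
  geometric series converges because \<delta> > 0.\<close>

lemma local_energy_decay:
  assumes "\<delta> > 0"
  shows "\<exists>C\<ge>0. \<forall>z. nice_wave z \<longrightarrow> (NNINT p. ennreal (jb (snd p) powr (- 1 - \<delta>) * edens z p)) \<le> ennreal (C * en z)"
proof -
  define c where "c = 2 powr (- \<delta>)"
  have c: "0 < c" "c < 1" using assms by (simp_all add: c_def powr_less_one)
  define D where "D = 8 * 2 powr (1 + \<delta>)"
  have D: "D > 0" by (simp add: D_def)
  show ?thesis
  proof (intro exI[of _ "D * (\<Sum>k. c ^ k) * 2"] conjI allI impI)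
    have sc: "(\<Sum>k. c ^ k) \<ge> 0" using c by (intro suminf_nonneg) (auto intro: summable_geometric)
    then show "0 \<le> D * (\<Sum>k. c ^ k) * 2" using D by simp
    fix z assume z: "nice_wave z"
    have [measurable]: "edens z \<in> borel_measurable borel"
      by (intro Cinf_measurable Cinf_edens nice_wave_Cinf z)
    have pw: "ennreal (jb (snd p) powr (- 1 - \<delta>) * edens z p) \<le> (\<Sum>k. ennreal (D * c ^ k) * ennreal ((2^k)^2 * (mwt (2^k) p)^3 * edens z p))" for p
    proof -
      obtain k where k: "jb (snd p) powr (- 1 - \<delta>) \<le> D * (c ^ k * ((2^k)^2 * (mwt (2^k) p)^3))"
        using jb_dyadic[OF assms, of "snd p" "fst p"] unfolding D_def c_def by auto
      have "ennreal (jb (snd p) powr (- 1 - \<delta>) * edens z p) \<le> ennreal (D * (c ^ k * ((2^k)^2 * (mwt (2^k) p)^3)) * edens z p)"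
        using k edens_nonneg by (intro ennreal_leI mult_right_mono)
      also have "\<dots> = ennreal (D * c ^ k) * ennreal ((2^k)^2 * (mwt (2^k) p)^3 * edens z p)"
        using c D by (subst ennreal_mult'[symmetric]) (auto simp: mult_ac)
      also have "\<dots> \<le> (\<Sum>k. ennreal (D * c ^ k) * ennreal ((2^k)^2 * (mwt (2^k) p)^3 * edens z p))"
        using sum_le_suminf[of "\<lambda>k. ennreal (D * c ^ k) * ennreal ((2^k)^2 * (mwt (2^k) p)^3 * edens z p)" "{k}"] by simp
      finally show ?thesis .
    qed
    have "(NNINT p. ennreal (jb (snd p) powr (- 1 - \<delta>) * edens z p))
        \<le> (NNINT p. (\<Sum>k. ennreal (D * c ^ k) * ennreal ((2^k)^2 * (mwt (2^k) p)^3 * edens z p)))"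
      by (intro nn_integral_mono pw)
    also have "\<dots> = (\<Sum>k. ennreal (D * c ^ k) * (NNINT p. ennreal ((2^k)^2 * (mwt (2^k) p)^3 * edens z p)))"
      by (subst nn_integral_suminf) (auto simp: nn_integral_cmult)
    also have "\<dots> \<le> (\<Sum>k. ennreal (D * c ^ k) * ennreal (2 * en z))"
      by (intro suminf_le mult_left_mono morawetz_nn z) auto
    also have "\<dots> = (\<Sum>k. ennreal (D * c ^ k * (2 * en z)))"
      using c D edens_conserved(4)[OF z] by (simp add: ennreal_mult'')
    also have "\<dots> = ennreal (\<Sum>k. D * c ^ k * (2 * en z))"
      using c D edens_conserved(4)[OF z] by (intro suminf_ennreal2) (auto intro!: summable_mult summable_mult2 summable_geometric)
    also have "(\<Sum>k. D * c ^ k * (2 * en z)) = D * (\<Sum>k. c ^ k) * 2 * en z"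
      using c by (simp add: suminf_mult suminf_mult2[symmetric] summable_geometric summable_mult mult_ac)
    finally show "(NNINT p. ennreal (jb (snd p) powr (- 1 - \<delta>) * edens z p)) \<le> ennreal (D * (\<Sum>k. c ^ k) * 2 * en z)" .
  qed
qed

subsection \<open>Lorentz boosts and the moving estimate\<close>

definition lgam :: "real \<Rightarrow> real" where "lgam v = 1 / sqrt (1 - v\<^sup>2)"

lemma lgam:
  assumes "\<bar>v\<bar> < 1"
  shows "lgam v \<ge> 1" and "(lgam v)^2 * (1 - v\<^sup>2) = 1" and "(lgam v)^2 = 1 + (lgam v)^2 * v^2"
proof -
  have v: "0 < 1 - v\<^sup>2" using assms by (simp add: abs_square_less_1)
  then show "lgam v \<ge> 1" by (simp add: lgam_def)
  show "(lgam v)^2 * (1 - v\<^sup>2) = 1" using v by (simp add: lgam_def power_divide)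
  then show "(lgam v)^2 = 1 + (lgam v)^2 * v^2" by (simp add: algebra_simps)
qed

lemma lgam_minus [simp]: "lgam (- v) = lgam v" by (simp add: lgam_def)

text \<open>The Lorentz boost with velocity v along the first axis. Its spatial part is written as
  the identity plus a multiple of \<open>axis 1 1\<close>, using \<gamma> x_1 = x_1 + (\<gamma> - 1)
  x_1.\<close>

definition boost :: "real \<Rightarrow> spacetime \<Rightarrow> spacetime" where
  "boost v p = (lgam v * (fst p + v * snd p $ 1), snd p + ((lgam v - 1) * snd p $ 1 + lgam v * v * fst p) *\<^sub>R axis 1 1)"

lemma boost_linear: "bounded_linear (boost v)"
  unfolding boost_def[abs_def]
  by (intro bounded_linear_Pair bounded_linear_add bounded_linear_const_mult bounded_linear_fst bounded_linear_snd
      bounded_linear_scaleR_const bounded_linear_compose[OF bounded_linear_vec_nth bounded_linear_snd])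

lemma boost_simps:
  "fst (boost v p) = lgam v * (fst p + v * snd p $ 1)"
  "snd (boost v p) $ 1 = lgam v * (snd p $ 1 + v * fst p)"
  "snd (boost v p) $ 2 = snd p $ 2" "snd (boost v p) $ 3 = snd p $ 3"
  by (simp_all add: boost_def axis_def algebra_simps)

lemma boost_inverse:
  assumes "\<bar>v\<bar> < 1" shows "boost v (boost (- v) p) = p"
proof (rule prod_eqI)
  have g: "lgam v * lgam v * (1 - v * v) = 1" using lgam(2)[OF assms] by (simp add: power2_eq_square)
  have "fst (boost v (boost (- v) p)) = (lgam v * lgam v * (1 - v * v)) * fst p"
    by (simp add: boost_simps algebra_simps)
  then show "fst (boost v (boost (- v) p)) = fst p" by (simp add: g)
  have "snd (boost v (boost (- v) p)) $ 1 = (lgam v * lgam v * (1 - v * v)) * snd p $ 1"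
    by (simp add: boost_simps algebra_simps)
  then have 1: "snd (boost v (boost (- v) p)) $ 1 = snd p $ 1" by (simp add: g)
  show "snd (boost v (boost (- v) p)) = snd p"
    by (simp add: vec_eq_iff forall_3 1) (simp add: boost_simps)
qed

lemma norm3: "(norm (x::real^3))^2 = (x $ 1)^2 + (x $ 2)^2 + (x $ 3)^2"
  unfolding dot_square_norm[symmetric] by (simp add: inner_vec_def sum_3 power2_eq_square)

lemma boost_dd:
  assumes "Cinf z"
  shows "Dt (\<lambda>p. z (boost v p)) = (\<lambda>p. lgam v * (Dt z (boost v p) + v * Dx 1 z (boost v p)))"
    and "Dx 1 (\<lambda>p. z (boost v p)) = (\<lambda>p. lgam v * (v * Dt z (boost v p) + Dx 1 z (boost v p)))"
    and "Dx 2 (\<lambda>p. z (boost v p)) = (\<lambda>p. Dx 2 z (boost v p))"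
    and "Dx 3 (\<lambda>p. z (boost v p)) = (\<lambda>p. Dx 3 z (boost v p))"
proof -
  have d: "z differentiable (at p)" for p by (rule Cinf_differentiable[OF assms])
  have *: "dd b (\<lambda>p. z (boost v p)) p = dd (boost v b) z (boost v p)" for b p
    using dd_compose_affine[OF boost_linear[of v], of z p 0] d dd_eq by fastforce
  have 1: "boost v (1, 0) = lgam v *\<^sub>R (1, 0) + (lgam v * v) *\<^sub>R (0, axis 1 1)"
    by (simp add: boost_def)
  have 2: "boost v (0, axis 1 1) = (lgam v * v) *\<^sub>R (1, 0) + lgam v *\<^sub>R (0, axis 1 1)"
    by (auto simp: boost_def vec_eq_iff forall_3 axis_def)
  have 3: "boost v (0, axis 2 1) = (0, axis 2 1)" "boost v (0, axis 3 1) = (0, axis 3 1)"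
    by (auto simp: boost_def axis_def)
  show "Dt (\<lambda>p. z (boost v p)) = (\<lambda>p. lgam v * (Dt z (boost v p) + v * Dx 1 z (boost v p)))"
    by (rule ext) (simp add: * 1 dd_scale[OF d] algebra_simps del: scaleR_Pair)
  show "Dx 1 (\<lambda>p. z (boost v p)) = (\<lambda>p. lgam v * (v * Dt z (boost v p) + Dx 1 z (boost v p)))"
    by (rule ext) (simp add: * 2 dd_scale[OF d] algebra_simps del: scaleR_Pair)
  show "Dx 2 (\<lambda>p. z (boost v p)) = (\<lambda>p. Dx 2 z (boost v p))" "Dx 3 (\<lambda>p. z (boost v p)) = (\<lambda>p. Dx 3 z (boost v p))"
    by (rule ext, simp add: * 3)+
qed

lemma Cinf_boost: "Cinf z \<Longrightarrow> Cinf (\<lambda>p. z (boost v p))"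
  using Cinf_compose_affine[OF boost_linear, of z v 0] by simp

text \<open>The form |x|^2 - t^2 is invariant, and |x| + |t| is at most 2 \<gamma> (|y| + |s|).
  Dividing the one by the other bounds |x| - |t| from below.\<close>

lemma cone_supp_boost:
  assumes v: "\<bar>v\<bar> < 1" and z: "cone_supp R z" and R: "R \<ge> 0"
  shows "cone_supp (2 * lgam v * R) (\<lambda>p. z (boost v p))"
  unfolding cone_supp_def
proof (intro allI impI)
  fix s and y :: "real^3" assume ys: "norm y > 2 * lgam v * R + \<bar>s\<bar>"
  define t x where "t = fst (boost v (s, y))" and "x = snd (boost v (s, y))"
  have g: "lgam v \<ge> 1" "(lgam v)^2 * (1 - v\<^sup>2) = 1" by (rule lgam[OF v])+
  have y1: "\<bar>y $ 1\<bar> \<le> norm y" by (rule component_le_norm_cart)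
  have inv: "(norm x)^2 - t\<^sup>2 = (norm y)^2 - s\<^sup>2"
  proof -
    have "(norm x)^2 - t\<^sup>2 = (lgam v)^2 * (1 - v\<^sup>2) * ((y $ 1)^2 - s\<^sup>2) + (y $ 2)^2 + (y $ 3)^2"
      unfolding norm3 x_def t_def boost_simps by (simp add: power2_eq_square algebra_simps)
    then show ?thesis unfolding norm3 g by simp
  qed
  have "\<bar>t\<bar> \<le> lgam v * (\<bar>s\<bar> + norm y)"
  proof -
    have "\<bar>v * y $ 1\<bar> \<le> 1 * norm y" using v y1 unfolding abs_mult by (intro mult_mono) auto
    then have "\<bar>s + v * y $ 1\<bar> \<le> \<bar>s\<bar> + norm y" by linarith
    then show ?thesis using g unfolding t_def boost_simps by (simp add: abs_mult)
  qed
  moreover have "norm x \<le> lgam v * (\<bar>s\<bar> + norm y)"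
  proof -
    have a: "\<bar>(lgam v - 1) * y $ 1\<bar> \<le> (lgam v - 1) * norm y" using g y1 by (simp add: abs_mult mult_left_mono)
    have "\<bar>v * s\<bar> \<le> 1 * \<bar>s\<bar>" using v unfolding abs_mult by (intro mult_mono) auto
    then have "lgam v * \<bar>v * s\<bar> \<le> lgam v * \<bar>s\<bar>" using g by (intro mult_left_mono) auto
    then have b: "\<bar>lgam v * v * s\<bar> \<le> lgam v * \<bar>s\<bar>" using g by (simp add: abs_mult mult.assoc)
    have "norm x \<le> norm y + \<bar>(lgam v - 1) * y $ 1 + lgam v * v * s\<bar>"
      unfolding x_def boost_def by (simp, rule norm_triangle_le) simp
    also have "\<dots> \<le> norm y + ((lgam v - 1) * norm y + lgam v * \<bar>s\<bar>)" using a b by linarith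
    finally show ?thesis by (simp add: algebra_simps)
  qed
  ultimately have sum: "norm x + \<bar>t\<bar> \<le> 2 * lgam v * (\<bar>s\<bar> + norm y)" by simp
  have "R + \<bar>t\<bar> < norm x"
  proof (rule ccontr)
    assume "\<not> ?thesis"
    then have le: "norm x - \<bar>t\<bar> \<le> R" by simp
    have pos: "norm y - \<bar>s\<bar> > 2 * lgam v * R" using ys by simp
    have n0: "norm y + \<bar>s\<bar> > 0" using ys g R by (smt (verit) mult_nonneg_nonneg norm_ge_zero abs_ge_zero)
    have "2 * lgam v * R * (norm y + \<bar>s\<bar>) < (norm y - \<bar>s\<bar>) * (norm y + \<bar>s\<bar>)"
      using pos n0 by (rule mult_strict_right_mono)
    also have "\<dots> = (norm x)^2 - t\<^sup>2" unfolding inv by (simp add: power2_eq_square algebra_simps)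
    also have "\<dots> = (norm x - \<bar>t\<bar>) * (norm x + \<bar>t\<bar>)" by (simp add: power2_eq_square algebra_simps)
    also have "\<dots> \<le> R * (norm x + \<bar>t\<bar>)" using le by (intro mult_right_mono) auto
    also have "\<dots> \<le> R * (2 * lgam v * (\<bar>s\<bar> + norm y))" using sum R by (intro mult_left_mono) auto
    finally show False by (simp add: algebra_simps)
  qed
  then have "z (t, x) = 0" using z by (simp add: cone_supp_def)
  then show "z (boost v (s, y)) = 0" by (simp add: t_def x_def)
qed

text \<open>The wave operator commutes with the boost: the mixed terms cancel and the remaining ones
  carry the factor \<gamma>^2 (1 - v^2) = 1.\<close>

lemma nice_wave_boost:
  assumes v: "\<bar>v\<bar> < 1" and z: "nice_wave z"
  shows "nice_wave (\<lambda>p. z (boost v p))"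
  unfolding nice_wave_def
proof (intro conjI allI)
  have C: "Cinf z" using z by (rule nice_wave_Cinf)
  show "Cinf (\<lambda>p. z (boost v p))" by (rule Cinf_boost[OF C])
  obtain R where "cone_supp R z" using z by (auto simp: nice_wave_def)
  then have "cone_supp (max R 0) z" by (rule cone_supp_mono) simp
  then show "\<exists>R. cone_supp R (\<lambda>p. z (boost v p))" using cone_supp_boost[OF v] by (metis max.cobounded2)
  fix p
  have D: "Cinf (dd b z)" for b by (rule Cinf_dd[OF C])
  have d: "(\<lambda>p. dd b z (boost v p)) differentiable (at p)" for b
    by (intro Cinf_differentiable Cinf_boost D)
  have c: "dd b (\<lambda>p. lgam v * (f p + v * h p)) p = lgam v * (dd b f p + v * dd b h p)"
      "dd b (\<lambda>p. lgam v * (v * f p + h p)) p = lgam v * (v * dd b f p + dd b h p)"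
    if "f differentiable (at p)" "h differentiable (at p)" for f h b
    using that by (simp_all add: dd_mult dd_add)
  have 1: "Dt (Dt (\<lambda>p. z (boost v p))) p = (lgam v)^2 * (Dt (Dt z) (boost v p) + 2 * v * Dx 1 (Dt z) (boost v p) + v^2 * Dx 1 (Dx 1 z) (boost v p))"
    unfolding boost_dd[OF C] c[OF d d] unfolding boost_dd[OF D] Cinf_dd_commute[OF C, of "(1,0)" "(0, _)"]
    by (simp add: power2_eq_square algebra_simps)
  have 2: "Dx 1 (Dx 1 (\<lambda>p. z (boost v p))) p = (lgam v)^2 * (v^2 * Dt (Dt z) (boost v p) + 2 * v * Dx 1 (Dt z) (boost v p) + Dx 1 (Dx 1 z) (boost v p))"
    unfolding boost_dd[OF C] c[OF d d] unfolding boost_dd[OF D] Cinf_dd_commute[OF C, of "(1,0)" "(0, _)"]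
    by (simp add: power2_eq_square algebra_simps)
  have 3: "Dx 2 (Dx 2 (\<lambda>p. z (boost v p))) p = Dx 2 (Dx 2 z) (boost v p)"
      "Dx 3 (Dx 3 (\<lambda>p. z (boost v p))) p = Dx 3 (Dx 3 z) (boost v p)"
    unfolding boost_dd[OF C] unfolding boost_dd[OF D] by simp_all
  have "Dt (Dt (\<lambda>p. z (boost v p))) p - Dx 1 (Dx 1 (\<lambda>p. z (boost v p))) p =
     ((lgam v)^2 * (1 - v\<^sup>2)) * (Dt (Dt z) (boost v p) - Dx 1 (Dx 1 z) (boost v p))"
    unfolding 1 2 by (simp add: algebra_simps)
  also have "\<dots> = Dx 2 (Dx 2 z) (boost v p) + Dx 3 (Dx 3 z) (boost v p)"
    unfolding lgam(2)[OF v] nice_wave_eq[OF z] by simp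
  finally show "Dt (Dt (\<lambda>p. z (boost v p))) p = (\<Sum>i\<in>UNIV. Dx i (Dx i (\<lambda>p. z (boost v p))) p)"
    unfolding sum_3 3 by linarith
qed

lemma nn_integral_shear_space:
  fixes f :: "spacetime \<Rightarrow> ennreal"
  assumes f[measurable]: "f \<in> borel_measurable borel"
  shows "(NNINT p. f (fst p, snd p + (b * fst p) *\<^sub>R e)) = (NNINT p. f p)"
proof -
  have m: "(\<lambda>p. f (fst p, snd p + (b * fst p) *\<^sub>R e)) \<in> borel_measurable borel"
    by (rule measurable_compose[OF _ f]) (auto intro!: borel_measurable_continuous_onI continuous_intros)
  have "(NNINT p. f (fst p, snd p + (b * fst p) *\<^sub>R e)) = (NNINT t x. f (t, x + (b * t) *\<^sub>R e))"
    unfolding lborel_prod[symmetric] using m by (subst lborel.nn_integral_fst[symmetric]) (auto simp: borel_prod lborel_prod)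
  also have "\<dots> = (NNINT t x. f (t, x))"
  proof (rule nn_integral_cong)
    fix t :: real
    have "(\<lambda>x. f (t, x)) \<in> borel_measurable borel"
      by (rule measurable_compose[OF _ f]) (auto intro!: borel_measurable_continuous_onI continuous_intros)
    from nn_integral_lborel_translate[OF this, of "(b * t) *\<^sub>R e"]
    show "(NNINT x. f (t, x + (b * t) *\<^sub>R e)) = (NNINT x. f (t, x))" by (simp add: add.commute)
  qed
  also have "\<dots> = (NNINT p. f p)"
    unfolding lborel_prod[symmetric] using f by (subst lborel.nn_integral_fst) (auto simp: lborel_prod)
  finally show ?thesis .
qed

lemma nn_integral_shear_time:
  fixes f :: "spacetime \<Rightarrow> ennreal"
  assumes f[measurable]: "f \<in> borel_measurable borel"
  shows "(NNINT p. f (fst p + a * snd p $ 1, snd p)) = (NNINT p. f p)"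
proof -
  have m: "(\<lambda>p. f (fst p + a * snd p $ 1, snd p)) \<in> borel_measurable borel"
    by (rule measurable_compose[OF _ f]) (auto intro!: borel_measurable_continuous_onI continuous_intros)
  have "(NNINT p. f (fst p + a * snd p $ 1, snd p)) = (NNINT x t. f (t + a * x $ 1, x))"
    unfolding lborel_prod[symmetric] using m by (subst lborel_pair.nn_integral_snd[symmetric]) (auto simp: borel_prod lborel_prod case_prod_unfold)
  also have "\<dots> = (NNINT x t. f (t, x))"
  proof (rule nn_integral_cong)
    fix x :: "real^3"
    have "(\<lambda>t. f (t, x)) \<in> borel_measurable borel"
      by (rule measurable_compose[OF _ f]) (auto intro!: borel_measurable_continuous_onI continuous_intros)
    from nn_integral_lborel_translate[OF this, of "a * x $ 1"]
    show "(NNINT t. f (t + a * x $ 1, x)) = (NNINT t. f (t, x))" by (simp add: add.commute)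
  qed
  also have "\<dots> = (NNINT p. f p)"
    unfolding lborel_prod[symmetric] using f by (subst lborel_pair.nn_integral_snd) (auto simp: lborel_prod)
  finally show ?thesis .
qed

text \<open>A boost is a product of three shears, hence volume preserving.\<close>

lemma nn_integral_boost:
  fixes f :: "spacetime \<Rightarrow> ennreal"
  assumes v: "\<bar>v\<bar> < 1" and f[measurable]: "f \<in> borel_measurable borel"
  shows "(NNINT p. f (boost v p)) = (NNINT p. f p)"
proof -
  define g where "g = lgam v"
  \<comment> \<open>For shears with parameters a, \<gamma> v, a to compose to the boost, 1 + a
    \<gamma> v = \<gamma> is required; it holds because \<gamma>^2 v^2 = (\<gamma> - 1) (\<gamma> +
    1).\<close>
  define a where "a = g * v / (g + 1)"
  have g: "g \<ge> 1" "g^2 = 1 + g^2 * v^2" unfolding g_def by (rule lgam[OF v])+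
  have g1: "g + 1 > 0" using g by simp
  have ab: "1 + a * (g * v) = g"
  proof -
    have "1 + a * (g * v) = 1 + (g^2 * v^2) / (g + 1)" by (simp add: a_def power2_eq_square)
    also have "g^2 * v^2 = (g - 1) * (g + 1)" using g(2) by algebra
    also have "1 + (g - 1) * (g + 1) / (g + 1) = g" using g1 by simp
    finally show ?thesis .
  qed
  have "a * (g + 1) = g * v" using g1 by (simp add: a_def)
  then have aa: "a * g + a = g * v" by (simp add: algebra_simps)
  define T where "T p = (fst p + a * snd p $ 1, snd p)" for p :: "spacetime"
  define S where "S p = (fst p, snd p + ((g * v) * fst p) *\<^sub>R axis 1 (1::real))" for p :: "spacetime"
  have "boost v p = T (S (T p))" for p
  proof (rule prod_eqI)
    have "fst (T (S (T p))) = (1 + a * (g * v)) * fst p + (a * (1 + a * (g * v)) + a) * snd p $ 1"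
      by (simp add: T_def S_def axis_def algebra_simps)
    then show "fst (boost v p) = fst (T (S (T p)))"
      unfolding ab aa boost_simps g_def[symmetric] by (simp add: algebra_simps)
    have "snd (T (S (T p))) $ 1 = (g * v) * fst p + (1 + a * (g * v)) * snd p $ 1"
      by (simp add: T_def S_def axis_def algebra_simps)
    then have 1: "snd (boost v p) $ 1 = snd (T (S (T p))) $ 1"
      unfolding ab boost_simps g_def[symmetric] by (simp add: algebra_simps)
    show "snd (boost v p) = snd (T (S (T p)))"
      by (simp add: vec_eq_iff forall_3 1) (simp add: boost_simps T_def S_def axis_def)
  qed
  moreover have mT: "(\<lambda>p. f (T p)) \<in> borel_measurable borel"
    unfolding T_def by (rule measurable_compose[OF _ f]) (auto intro!: borel_measurable_continuous_onI continuous_intros)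
  moreover have mS: "(\<lambda>p. f (T (S p))) \<in> borel_measurable borel"
    unfolding S_def by (rule measurable_compose[OF _ mT]) (auto intro!: borel_measurable_continuous_onI continuous_intros)
  ultimately show ?thesis
    using nn_integral_shear_time[OF mS, of a] nn_integral_shear_space[OF mT, of "g * v" "axis 1 1"] nn_integral_shear_time[OF f, of a]
    by (simp add: T_def[symmetric] S_def[symmetric])
qed

section \<open>Energy on tilted slices and energy of boosted waves\<close>

lemma spacetime_integral_by_parts:
  fixes f g :: "spacetime \<Rightarrow> real"
  assumes "Cinf f" "Cinf g" and s: "\<And>p. norm p > R \<Longrightarrow> f p * g p = 0"
  shows "(LBINT p. dd b (\<lambda>p. f p * g p) p) = 0"
    and "integrable lborel (dd b (\<lambda>p. f p * g p))"
proof -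
  have C: "Cinf (\<lambda>p. f p * g p)" using assms by (intro Cinf_mult)
  show "(LBINT p. dd b (\<lambda>p. f p * g p) p) = 0"
    by (intro integral_dd_eq_0[of _ _ R] Cinf_differentiable Cinf_continuous Cinf_dd C s)
  show "integrable lborel (dd b (\<lambda>p. f p * g p))"
    by (rule integrable_lborel_compact_support[OF Cinf_continuous[OF Cinf_dd[OF C]] dd_zero_outside[OF s]])
qed

abbreviation "sig \<equiv> dd (1::real) sstep"

lemma sig_integral: "(NNINT t. ennreal (sig t)) = 1"
proof -
  have c: "continuous_on UNIV sig" by (intro Cinf_continuous Cinf_dd sstep_props)
  have z: "sig t = 0" if "norm t > 1" for t using that sstep_props(5,7)[of t] by fastforce
  have i: "integrable lborel sig" by (rule integrable_lborel_compact_support[OF c z])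
  have "sig t = indicator {0..1} t *\<^sub>R sig t" for t
    using sstep_props(5)[of t] sstep_props(7)[of t] by (cases "t \<le> 0"; cases "t \<ge> 1") (auto simp: indicator_def)
  then have "(LBINT t. sig t) = (LBINT t. indicator {0..1} t *\<^sub>R sig t)"
    by (intro Bochner_Integration.integral_cong refl)
  also have "\<dots> = sstep 1 - sstep 0"
    using sstep_props(2) continuous_on_subset[OF c]
    by (intro integral_FTC_atLeastAtMost) (auto simp: has_real_derivative_iff_has_vector_derivative[symmetric] intro: has_field_derivative_at_within)
  finally have "(LBINT t. sig t) = 1" by (simp add: sstep_props)
  then show ?thesis using nn_integral_eq_integral[OF i] sstep_props(3) by simp
qed

text \<open>The weight \<open>sig\<close> has mass one and the energy is conserved. In contrast to a
  single time slice, a space-time integral can be transported by the volume preserving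
  boost.\<close>

lemma sig_energy:
  assumes z: "nice_wave z"
  shows "(NNINT p. ennreal (sig (fst p) * edens z p)) = ennreal (en z)"
proof -
  have [measurable]: "edens z \<in> borel_measurable borel" "sig \<in> borel_measurable borel"
    by (intro Cinf_measurable Cinf_edens nice_wave_Cinf z Cinf_dd sstep_props)+
  have [measurable]: "(\<lambda>x. edens z (t, x)) \<in> borel_measurable borel" for t
    by (intro Cinf_measurable Cinf_slice Cinf_edens nice_wave_Cinf z)
  have m: "(\<lambda>p. ennreal (sig (fst p) * edens z p)) \<in> borel_measurable borel" by measurable
  have "(NNINT p. ennreal (sig (fst p) * edens z p)) = (NNINT t x. ennreal (sig t * edens z (t, x)))"
    unfolding lborel_prod[symmetric] using m by (subst lborel.nn_integral_fst[symmetric]) (auto simp: borel_prod lborel_prod)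
  also have "\<dots> = (NNINT t. ennreal (sig t) * ennreal (en z))"
    by (simp add: ennreal_mult sstep_props(3) edens_nonneg nn_integral_cmult edens_conserved(3)[OF z])
  also have "\<dots> = ennreal (en z)" by (simp add: nn_integral_multc sig_integral)
  finally show ?thesis .
qed

text \<open>The energy current is integrated against \<eta>, the difference of a step in the boosted
  time and a step in t. On the support of z this \<eta> vanishes for large |t|, so the averaged
  fluxes through tilted and through flat slices agree. The tilted flux density e + v m_1 is at least
  (1 - |v|) e, because |m_1| \<le> e.\<close>

lemma tilted_energy:
  assumes z: "nice_wave z" and v: "\<bar>v\<bar> < 1"
  shows "(NNINT p. ennreal (sig (fst (boost (- v) p)) * edens z p)) \<le> ennreal (en z / (1 - \<bar>v\<bar>))"
proof -
  obtain R where "cone_supp R z" using z by (auto simp: nice_wave_def)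
  then have K: "cone_supp (max R 0) z" by (rule cone_supp_mono) simp
  define K where "K = max R 0"
  have K0: "K \<ge> 0" and Kz: "cone_supp K z" using K by (simp_all add: K_def)
  have C: "Cinf z" using z by (rule nice_wave_Cinf)
  define g where "g = lgam v"
  have g: "g \<ge> 1" unfolding g_def by (rule lgam[OF v])
  define tau where "tau p = fst (boost (- v) p)" for p
  have tau: "tau p = g * (fst p - v * snd p $ 1)" for p by (simp add: tau_def boost_simps g_def)
  have taub: "bounded_linear tau" unfolding tau_def
    by (rule bounded_linear_compose[OF bounded_linear_fst boost_linear])
  have tauC: "Cinf tau" by (rule Cinf_linear[OF taub])
  have fC: "Cinf (fst :: spacetime \<Rightarrow> real)" by (rule Cinf_linear[OF bounded_linear_fst])
  \<comment> \<open>For |t| > T and |x| \<le> K + |t| one has |t - v x_1| \<ge> |t| - |v| (K + |t|)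
    \<ge> 1, so both steps have reached the same constant value there.\<close>
  define T where "T = (1 + \<bar>v\<bar> * K) / (1 - \<bar>v\<bar>)"
  have T: "T \<ge> 1" using v K0 by (simp add: T_def field_simps)
  have far: "tau p \<ge> 1 \<and> fst p \<ge> 1 \<or> tau p \<le> -1 \<and> fst p \<le> -1" if "norm (snd p) \<le> K + \<bar>fst p\<bar>" "\<bar>fst p\<bar> > T" for p
  proof -
    have "\<bar>snd p $ 1\<bar> \<le> K + \<bar>fst p\<bar>" using that component_le_norm_cart[of "snd p" 1] by simp
    then have a: "\<bar>v * snd p $ 1\<bar> \<le> \<bar>v\<bar> * (K + \<bar>fst p\<bar>)" by (simp add: abs_mult mult_left_mono)
    have "T * (1 - \<bar>v\<bar>) = 1 + \<bar>v\<bar> * K" using v by (simp add: T_def)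
    moreover have "T * (1 - \<bar>v\<bar>) \<le> \<bar>fst p\<bar> * (1 - \<bar>v\<bar>)" using that v by (intro mult_right_mono) auto
    ultimately have b: "\<bar>fst p\<bar> - \<bar>v\<bar> * (K + \<bar>fst p\<bar>) \<ge> 1" by (simp add: algebra_simps)
    have k: "g * s \<ge> 1" if "s \<ge> 1" for s using g that mult_mono[of 1 g 1 s] by simp
    show ?thesis
    proof (cases "fst p \<ge> 0")
      case True
      then have "fst p - v * snd p $ 1 \<ge> 1" "fst p \<ge> 1" using a b that T by linarith+
      then show ?thesis using k tau by simp
    next
      case False
      then have "- (fst p - v * snd p $ 1) \<ge> 1" "fst p \<le> -1" using a b that T by linarith+
      then show ?thesis using k[of "- (fst p - v * snd p $ 1)"] unfolding tau mult_minus_right by linarith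
    qed
  qed
  define \<eta> where "\<eta> p = sstep (tau p) - sstep (fst p)" for p
  have C\<eta>: "Cinf \<eta>" unfolding \<eta>_def
    by (intro Cinf_diff Cinf_compose_real[OF sstep_props(1)] tauC fC)
  have npair: "norm p \<le> \<bar>fst p\<bar> + norm (snd p)" for p :: "spacetime"
    using norm_Pair_le[of "fst p" "snd p"] by simp
  have far2: "f p = 0 \<or> (sig (tau p) = 0 \<and> sig (fst p) = 0 \<and> \<eta> p = 0)" if "norm p > K + 2 * T" "cone_supp K f" for p f
  proof (cases "norm (snd p) \<le> K + \<bar>fst p\<bar>")
    case True
    then have "\<bar>fst p\<bar> > T" using that npair[of p] by linarith
    then have "tau p \<ge> 1 \<and> fst p \<ge> 1 \<or> tau p \<le> -1 \<and> fst p \<le> -1" using far True by blast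
    then show ?thesis unfolding \<eta>_def using sstep_props(4-7) by auto
  next
    case False
    then have "f (fst p, snd p) = 0" using that(2) unfolding cone_supp_def by (metis not_le)
    then show ?thesis by simp
  qed
  \<comment> \<open>The energy flux: the time derivative of \<open>edens z\<close> is the divergence
    of m.\<close>
  define m where "m i p = 2 * (Dt z p * Dx i z p)" for i p
  have Cm: "Cinf (m i)" for i unfolding m_def by (intro Cinf_mult Cinf_const Cinf_dd C)
  have CE: "Cinf (edens z)" by (rule Cinf_edens[OF C])
  have sm: "cone_supp K (m i)" for i using cone_supp_dd[OF Kz] unfolding m_def cone_supp_def by simp
  have sE: "cone_supp K (edens z)" using cone_supp_wpair[OF Kz] by (simp add: edens_wpair[abs_def])
  have dz: "dd b z differentiable (at p)" for b p by (intro Cinf_differentiable Cinf_dd C)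
  have div: "Dt (edens z) p = Dx 1 (m 1) p + Dx 2 (m 2) p + Dx 3 (m 3) p" for p
    unfolding edens_wpair[abs_def] wpair_sum3 m_def
    by (simp add: dd_add dd_mult dz Cinf_dd_commute[OF C, of "(1,0)" "(0, _)"] nice_wave_eq[OF z]) algebra
  have d\<eta>: "dd b \<eta> p = sig (tau p) * tau b - sig (fst p) * fst b" for b p
  proof -
    have "((\<lambda>p. sstep (tau p)) has_derivative (\<lambda>b. sig (tau p) * dd b tau p)) (at p)"
      by (intro dd_compose_real Cinf_differentiable tauC sstep_props)
    moreover have "((\<lambda>p. sstep (fst p)) has_derivative (\<lambda>b. sig (fst p) * dd b fst p)) (at p)"
      by (intro dd_compose_real Cinf_differentiable fC sstep_props)
    moreover have "dd b tau p = tau b" "dd b fst p = fst b"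
      by (rule dd_eq[OF bounded_linear_imp_has_derivative[OF taub]], rule dd_eq[OF bounded_linear_imp_has_derivative[OF bounded_linear_fst]])
    ultimately show ?thesis unfolding \<eta>_def[abs_def] using dd_eq[OF has_derivative_diff] by fastforce
  qed
  have tb: "tau (1, 0) = g" "tau (0, axis 1 1) = - g * v" "tau (0, axis 2 1) = 0" "tau (0, axis 3 1) = 0"
    by (simp_all add: tau axis_def)
  have d: "\<eta> differentiable (at p)" "edens z differentiable (at p)" "m i differentiable (at p)" for p i
    by (intro Cinf_differentiable C\<eta> CE Cm)+
  have id: "Dt (\<lambda>p. \<eta> p * edens z p) p - Dx 1 (\<lambda>p. \<eta> p * m 1 p) p - Dx 2 (\<lambda>p. \<eta> p * m 2 p) p - Dx 3 (\<lambda>p. \<eta> p * m 3 p) p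
     = g * (sig (tau p) * (edens z p + v * m 1 p)) - sig (fst p) * edens z p" for p
    by (simp add: dd_mult d d\<eta> tb div algebra_simps)
  have s0: "\<eta> p * f p = 0" if "norm p > K + 2 * T" "cone_supp K f" for p f using far2[OF that] by auto
  note ibp = spacetime_integral_by_parts[OF C\<eta> CE s0[OF _ sE], of "K + 2 * T", simplified]
    spacetime_integral_by_parts[OF C\<eta> Cm s0[OF _ sm], of "K + 2 * T", simplified]
  have "(LBINT p. Dt (\<lambda>p. \<eta> p * edens z p) p - Dx 1 (\<lambda>p. \<eta> p * m 1 p) p - Dx 2 (\<lambda>p. \<eta> p * m 2 p) p - Dx 3 (\<lambda>p. \<eta> p * m 3 p) p) = 0"
    using ibp by simp
  then have bal0: "(LBINT p. g * (sig (tau p) * (edens z p + v * m 1 p)) - sig (fst p) * edens z p) = 0"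
    unfolding id .
  have csig: "continuous_on UNIV sig" by (intro Cinf_continuous Cinf_dd sstep_props)
  have Csig: "Cinf sig" by (intro Cinf_dd sstep_props)
  have i1: "integrable lborel (\<lambda>p. sig (tau p) * f p)" if "Cinf f" "cone_supp K f" for f
    using far2[OF _ that(2)] by (intro integrable_lborel_compact_support[of _ "K + 2 * T"] Cinf_continuous Cinf_mult that
       Cinf_compose_real[OF Csig] tauC) auto
  have i2: "integrable lborel (\<lambda>p. sig (fst p) * f p)" if "Cinf f" "cone_supp K f" for f
    using far2[OF _ that(2)] by (intro integrable_lborel_compact_support[of _ "K + 2 * T"] Cinf_continuous Cinf_mult that
       Cinf_compose_real[OF Csig] fC) auto
  have CEm: "Cinf (\<lambda>p. edens z p + v * m 1 p)" by (intro Cinf_add Cinf_mult Cinf_const CE Cm)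
  have sEm: "cone_supp K (\<lambda>p. edens z p + v * m 1 p)" using sE sm[of 1] by (simp add: cone_supp_def)
  have bal: "g * (LBINT p. sig (tau p) * (edens z p + v * m 1 p)) = (LBINT p. sig (fst p) * edens z p)"
    using bal0 i1[OF CEm sEm] i2[OF CE sE] by simp
  have enz: "(LBINT p. sig (fst p) * edens z p) = en z"
    using sig_energy[OF z] nn_integral_eq_integral[OF i2[OF CE sE]] edens_conserved(4)[OF z]
    by (simp add: sstep_props(3) edens_nonneg integral_nonneg_AE)
  have low: "(1 - \<bar>v\<bar>) * edens z p \<le> edens z p + v * m 1 p" for p
  proof -
    have "\<bar>2 * (Dt z p * Dx 1 z p)\<bar> \<le> (Dt z p)^2 + (Dx 1 z p)^2"
      using sum_squares_bound[of "\<bar>Dt z p\<bar>" "\<bar>Dx 1 z p\<bar>"] by (simp add: abs_mult)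
    also have "\<dots> \<le> edens z p" by (simp add: edens_def sum_3)
    finally have "\<bar>v * m 1 p\<bar> \<le> \<bar>v\<bar> * edens z p" unfolding m_def abs_mult[of v] by (intro mult_left_mono) auto
    then show ?thesis by (simp add: algebra_simps)
  qed
  have "(1 - \<bar>v\<bar>) * (LBINT p. sig (tau p) * edens z p) = (LBINT p. sig (tau p) * ((1 - \<bar>v\<bar>) * edens z p))"
    by (subst integral_mult_right_zero[symmetric]) (simp add: mult_ac)
  also have "\<dots> \<le> (LBINT p. sig (tau p) * (edens z p + v * m 1 p))"
    using i1[OF CE sE] i1[OF CEm sEm] low
    by (intro integral_mono mult_left_mono sstep_props(3)) (auto simp: mult.left_commute[of _ "1 - \<bar>v\<bar>"])
  also have "\<dots> \<le> g * (LBINT p. sig (tau p) * (edens z p + v * m 1 p))"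
  proof -
    have "0 \<le> edens z p + v * m 1 p" for p
      using low[of p] edens_nonneg[of z p] v by (smt (verit) mult_nonneg_nonneg)
    then have "0 \<le> (LBINT p. sig (tau p) * (edens z p + v * m 1 p))"
      by (intro integral_nonneg_AE) (simp add: sstep_props(3))
    then show ?thesis using g mult_right_mono[of 1 g] by simp
  qed
  finally have "(LBINT p. sig (tau p) * edens z p) \<le> en z / (1 - \<bar>v\<bar>)"
    unfolding bal enz using v by (simp add: pos_le_divide_eq mult.commute)
  then show ?thesis unfolding tau_def[symmetric]
    using nn_integral_eq_integral[OF i1[OF CE sE]] by (simp add: sstep_props(3) edens_nonneg ennreal_leI)
qed

text \<open>Pointwise the energy density of the boosted wave is at most 4 \<gamma>^2 times the
  transported one. The change of variables turns the flat time weight into a tilted one, for which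
  \<open>tilted_energy\<close> supplies 1 / (1 - |v|).\<close>

lemma boost_energy:
  assumes z: "nice_wave z" and v: "\<bar>v\<bar> < 1"
  shows "en (\<lambda>p. z (boost v p)) \<le> 4 * (lgam v)^2 / (1 - \<bar>v\<bar>) * en z"
proof -
  define w where "w p = z (boost v p)" for p
  have w: "nice_wave w" unfolding w_def by (rule nice_wave_boost[OF v z])
  have C: "Cinf z" using z by (rule nice_wave_Cinf)
  define g where "g = lgam v"
  have g: "g \<ge> 1" unfolding g_def by (rule lgam[OF v])
  have g2: "g^2 \<ge> 1" using g by (simp add: one_le_power)
  have pw: "edens w p \<le> 4 * g^2 * edens z (boost v p)" for p
  proof -
    define a b c d where "a = Dt z (boost v p)" and "b = Dx 1 z (boost v p)" and "c = Dx 2 z (boost v p)" and "d = Dx 3 z (boost v p)"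
    have vv: "(v * x)^2 \<le> x^2" for x using v by (simp add: abs_le_square_iff[symmetric] abs_mult mult_left_le_one_le)
    have "(a + v * b)^2 \<le> 2 * a^2 + 2 * b^2" "(v * a + b)^2 \<le> 2 * a^2 + 2 * b^2"
      using sum_squares_bound[of a "v * b"] sum_squares_bound[of "v * a" b] vv[of a] vv[of b] by (simp_all add: power2_sum)
    then have "g^2 * ((a + v * b)^2 + (v * a + b)^2) \<le> g^2 * (4 * a^2 + 4 * b^2)" by (intro mult_left_mono) auto
    moreover have "1 * (c^2 + d^2) \<le> (4 * g^2) * (c^2 + d^2)" using g2 by (intro mult_right_mono) auto
    moreover have "edens w p = g^2 * ((a + v * b)^2 + (v * a + b)^2) + (c^2 + d^2)"
      unfolding edens_def sum_3 w_def[abs_def] boost_dd[OF C] a_def b_def c_def d_def g_def power_mult_distrib by (simp add: distrib_left)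
    moreover have "edens z (boost v p) = a^2 + (b^2 + c^2 + d^2)"
      unfolding edens_def sum_3 a_def b_def c_def d_def by simp
    ultimately show ?thesis by (simp add: algebra_simps)
  qed
  have mE [measurable]: "edens z \<in> borel_measurable borel" "sig \<in> borel_measurable borel"
    by (intro Cinf_measurable Cinf_edens C Cinf_dd sstep_props)+
  define F where "F p = ennreal (4 * g^2) * ennreal (sig (fst (boost (- v) p)) * edens z p)" for p
  have bm[measurable]: "boost u \<in> borel_measurable borel" for u
    by (intro borel_measurable_continuous_onI linear_continuous_on boost_linear)
  have fbm: "(\<lambda>p. fst (boost u p)) \<in> borel_measurable borel" for u
    by (intro borel_measurable_continuous_onI linear_continuous_on bounded_linear_compose[OF bounded_linear_fst boost_linear])
  have sbm [measurable]: "(\<lambda>p. sig (fst (boost u p))) \<in> borel_measurable borel" for u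
    by (rule measurable_compose[OF fbm mE(2)])
  have Fm [measurable]: "F \<in> borel_measurable borel" unfolding F_def[abs_def] by measurable
  have inv: "boost (- v) (boost v p) = p" for p using boost_inverse[of "- v" p] v by simp
  have "ennreal (en w) = (NNINT p. ennreal (sig (fst p) * edens w p))" using sig_energy[OF w] by simp
  also have "\<dots> \<le> (NNINT p. F (boost v p))"
  proof (rule nn_integral_mono)
    fix p
    have "ennreal (sig (fst p) * edens w p) \<le> ennreal (4 * g^2 * (sig (fst p) * edens z (boost v p)))"
      using mult_left_mono[OF pw[of p] sstep_props(3)[of "fst p"]] by (intro ennreal_leI) (simp add: mult_ac)
    then show "ennreal (sig (fst p) * edens w p) \<le> F (boost v p)"
      unfolding F_def inv using g2 by (simp add: ennreal_mult' sstep_props(3) edens_nonneg)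
  qed
  also have "\<dots> = (NNINT p. F p)" by (rule nn_integral_boost[OF v Fm])
  also have "\<dots> = ennreal (4 * g^2) * (NNINT p. ennreal (sig (fst (boost (- v) p)) * edens z p))"
    unfolding F_def by (intro nn_integral_cmult) measurable
  also have "\<dots> \<le> ennreal (4 * g^2) * ennreal (en z / (1 - \<bar>v\<bar>))"
    by (intro mult_left_mono tilted_energy[OF z v]) simp
  also have "\<dots> = ennreal (4 * g^2 / (1 - \<bar>v\<bar>) * en z)"
    using v edens_conserved(4)[OF z] by (simp add: ennreal_mult'[symmetric] mult_ac)
  finally show ?thesis unfolding w_def[abs_def] g_def[symmetric]
    using v edens_conserved(4)[OF z] by (subst (asm) ennreal_le_iff) auto
qed

lemma vv_eq: "vv v = v *\<^sub>R axis 1 1"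
  by (simp add: vv_def vec_eq_iff forall_3 axis_def)

text \<open>Composing z with the boost gives a wave w for which the moving centre is at rest: with y
  = x - v t, the spatial part of the inverse boost has squared norm \<gamma>^2 y_1^2 + y_2^2 +
  y_3^2, at most \<gamma>^2 |y|^2. The static estimate for w, the energy bound for boosted waves and
  invariance of volume then combine.\<close>

lemma moving_local_energy_decay:
  assumes v: "\<bar>v\<bar> < 1" and "\<delta> > 0"
  shows "\<exists>C\<ge>0. \<forall>z. nice_wave z \<longrightarrow> (NNINT p. ennreal (jb (snd p - fst p *\<^sub>R vv v) powr (- 1 - \<delta>) * (Dt z p)^2)) \<le> ennreal (C * en z)"
proof -
  obtain C where C0: "C \<ge> 0" and C: "\<And>z. nice_wave z \<Longrightarrow> (NNINT p. ennreal (jb (snd p) powr (- 1 - \<delta>) * edens z p)) \<le> ennreal (C * en z)"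
    using local_energy_decay[OF \<open>\<delta> > 0\<close>] by blast
  define g where "g = lgam v"
  have g: "g \<ge> 1" unfolding g_def by (rule lgam[OF v])
  define B where "B = 4 * g^2 / (1 - \<bar>v\<bar>)"
  have B: "B \<ge> 0" using v by (simp add: B_def)
  define A where "A = 2 * g^2 * g powr (1 + \<delta>)"
  have A: "A \<ge> 0" by (simp add: A_def)
  show ?thesis
  proof (intro exI[of _ "A * (C * B)"] conjI allI impI)
    show "0 \<le> A * (C * B)" using A B C0 by simp
    fix z assume z: "nice_wave z"
    define w where "w p = z (boost v p)" for p
    have w: "nice_wave w" unfolding w_def by (rule nice_wave_boost[OF v z])
    have Cw: "Cinf w" using w by (rule nice_wave_Cinf)
    have zw: "z = (\<lambda>p. w (boost (- v) p))" unfolding w_def by (rule ext) (simp add: boost_inverse[OF v])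
    have Dz: "Dt z p = g * (Dt w (boost (- v) p) - v * Dx 1 w (boost (- v) p))" for p
      unfolding zw boost_dd[OF Cw] by (simp add: g_def)
    have weight: "jb (snd p - fst p *\<^sub>R vv v) powr (- 1 - \<delta>) \<le> g powr (1 + \<delta>) * jb (snd (boost (- v) p)) powr (- 1 - \<delta>)" for p
    proof -
      define y where "y = snd p - fst p *\<^sub>R vv v"
      have y: "y $ 1 = snd p $ 1 - v * fst p" "y $ 2 = snd p $ 2" "y $ 3 = snd p $ 3"
        by (simp_all add: y_def vv_eq axis_def)
      have g2: "g^2 \<ge> 1" using g by (simp add: one_le_power)
      have "(norm (snd (boost (- v) p)))^2 = g^2 * (y $ 1)^2 + (y $ 2)^2 + (y $ 3)^2"
        unfolding norm3 boost_simps y g_def by (simp add: power_mult_distrib)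
      also have "\<dots> \<le> g^2 * (norm y)^2"
        unfolding norm3 using mult_right_mono[OF g2, of "(y $ 2)^2"] mult_right_mono[OF g2, of "(y $ 3)^2"] by (simp add: algebra_simps)
      finally have "1 + (norm (snd (boost (- v) p)))^2 \<le> g^2 * (1 + (norm y)^2)" using g2 by (simp add: algebra_simps)
      then have "jb (snd (boost (- v) p)) \<le> sqrt (g^2 * (1 + (norm y)^2))" unfolding jb_def by (rule real_sqrt_le_mono)
      also have "\<dots> = g * jb y" using g by (simp add: real_sqrt_mult jb_def)
      finally have le: "jb (snd (boost (- v) p)) \<le> g * jb y" .
      have "(g * jb y) powr (- 1 - \<delta>) \<le> jb (snd (boost (- v) p)) powr (- 1 - \<delta>)"
        using le jb_pos assms(2) by (intro powr_mono2') auto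
      then have "g powr (1 + \<delta>) * (g * jb y) powr (- 1 - \<delta>) \<le> g powr (1 + \<delta>) * jb (snd (boost (- v) p)) powr (- 1 - \<delta>)"
        by (intro mult_left_mono) auto
      moreover have "g powr (1 + \<delta>) * (g * jb y) powr (- 1 - \<delta>) = jb y powr (- 1 - \<delta>)"
      proof -
        have "(g * jb y) powr (- 1 - \<delta>) = g powr (- 1 - \<delta>) * jb y powr (- 1 - \<delta>)"
          by (rule powr_mult)
        moreover have "g powr (1 + \<delta>) * g powr (- 1 - \<delta>) = 1" using g by (simp add: powr_add[symmetric])
        ultimately show ?thesis by (metis mult.assoc mult_1)
      qed
      ultimately show ?thesis unfolding y_def by simp
    qed
    have dt: "(Dt z p)^2 \<le> 2 * g^2 * edens w (boost (- v) p)" for p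
    proof -
      define a b where "a = Dt w (boost (- v) p)" and "b = Dx 1 w (boost (- v) p)"
      have vb: "(v * b)^2 \<le> b^2" using v by (simp add: abs_le_square_iff[symmetric] abs_mult mult_left_le_one_le)
      have "(a - v * b)^2 \<le> 2 * (a^2 + b^2)" using sum_squares_bound[of a "- (v * b)"] vb by (simp add: power2_diff)
      also have "\<dots> \<le> 2 * edens w (boost (- v) p)" by (simp add: edens_def sum_3 a_def b_def)
      finally show ?thesis unfolding Dz a_def[symmetric] b_def[symmetric]
        using mult_left_mono[of "(a - v * b)^2" "2 * edens w (boost (- v) p)" "g^2"] by (simp add: power_mult_distrib mult_ac)
    qed
    define F where "F q = ennreal A * ennreal (jb (snd q) powr (- 1 - \<delta>) * edens w q)" for q
    have [measurable]: "edens w \<in> borel_measurable borel" by (intro Cinf_measurable Cinf_edens Cw)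
    have Fm [measurable]: "F \<in> borel_measurable borel" unfolding F_def[abs_def] by measurable
    have "(NNINT p. ennreal (jb (snd p - fst p *\<^sub>R vv v) powr (- 1 - \<delta>) * (Dt z p)^2)) \<le> (NNINT p. F (boost (- v) p))"
    proof (rule nn_integral_mono)
      fix p
      have "jb (snd p - fst p *\<^sub>R vv v) powr (- 1 - \<delta>) * (Dt z p)^2 \<le>
         (g powr (1 + \<delta>) * jb (snd (boost (- v) p)) powr (- 1 - \<delta>)) * (2 * g^2 * edens w (boost (- v) p))"
        by (intro mult_mono weight dt) auto
      also have "\<dots> = A * (jb (snd (boost (- v) p)) powr (- 1 - \<delta>) * edens w (boost (- v) p))" by (simp add: A_def)
      finally show "ennreal (jb (snd p - fst p *\<^sub>R vv v) powr (- 1 - \<delta>) * (Dt z p)^2) \<le> F (boost (- v) p)"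
        unfolding F_def using A by (simp add: ennreal_mult'[symmetric] ennreal_leI)
    qed
    also have "\<dots> = (NNINT p. F p)" using v by (intro nn_integral_boost Fm) auto
    also have "\<dots> = ennreal A * (NNINT p. ennreal (jb (snd p) powr (- 1 - \<delta>) * edens w p))"
      unfolding F_def by (intro nn_integral_cmult) measurable
    also have "\<dots> \<le> ennreal A * ennreal (C * en w)" by (intro mult_left_mono C w) auto
    also have "\<dots> \<le> ennreal A * ennreal (C * (B * en z))"
      using boost_energy[OF z v] C0 unfolding B_def g_def w_def[abs_def] by (intro mult_left_mono ennreal_leI) auto
    also have "\<dots> = ennreal (A * (C * B) * en z)" using A by (simp add: ennreal_mult'[symmetric] mult_ac)
    finally show "(NNINT p. ennreal (jb (snd p - fst p *\<^sub>R vv v) powr (- 1 - \<delta>) * (Dt z p)^2)) \<le> ennreal (A * (C * B) * en z)" .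
  qed
qed

section \<open>Radial waves and mollification\<close>

text \<open>Normalised so that the derivative of the weight with index k + 1 is -s times the weight
  with index k. The weights of positive index vanish at both ends, so a factor s under the integral
  can be traded for one more derivative of p.\<close>

definition kwt :: "nat \<Rightarrow> real \<Rightarrow> real" where
  "kwt k s = (1 - s\<^sup>2) ^ k / (2 ^ k * fact k)"

lemma kwt_deriv: "(kwt (Suc k) has_real_derivative - s * kwt k s) (at s)"
proof -
  have 1: "((\<lambda>s. 1 - s\<^sup>2) has_real_derivative - (2 * s)) (at s)"
    by (auto intro!: derivative_eq_intros)
  have "((\<lambda>s. (1 - s\<^sup>2) ^ Suc k / (2 ^ Suc k * fact (Suc k))) has_real_derivative
     (1 + real k) * (- (2 * s) * (1 - s\<^sup>2) ^ k) / (2 ^ Suc k * fact (Suc k))) (at s)"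
    by (intro DERIV_cdivide DERIV_power_Suc 1)
  also have "(1 + real k) * (- (2 * s) * (1 - s\<^sup>2) ^ k) / (2 ^ Suc k * fact (Suc k)) = - s * kwt k s"
    unfolding kwt_def fact_Suc of_nat_mult power_Suc of_nat_Suc by (simp add: divide_simps)
  finally show ?thesis by (simp add: kwt_def[abs_def])
qed

lemma kwt_continuous: "continuous_on A (kwt k)"
  unfolding kwt_def[abs_def] by (intro continuous_intros) auto

text \<open>For k = 0 and r > 0 this is (P(t + r) - P(t - r)) / r with P a primitive of p, the
  radial wave of d'Alembert type in dimension three, in a form that is regular at r = 0.\<close>

definition J :: "nat \<Rightarrow> (real \<Rightarrow> real) \<Rightarrow> real \<times> real \<Rightarrow> real" where
  "J k p q = integral {-1..1} (\<lambda>s. kwt k s * p (fst q + s * snd q))"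

lemma Cinf_real_deriv: "Cinf p \<Longrightarrow> (p has_real_derivative dd 1 p s) (at s)"
  using DERIV_line[of p s 1 0] Cinf_differentiable[of p] by simp

lemma Cinf_real_deriv_affine:
  assumes "Cinf p" shows "((\<lambda>s. p (t + s * r)) has_real_derivative r * dd 1 p (t + s * r)) (at s)"
proof -
  have "((\<lambda>s. t + s * r) has_real_derivative r) (at s)" by (auto intro!: derivative_eq_intros)
  from DERIV_chain2[OF Cinf_real_deriv[OF assms] this] show ?thesis by (simp add: mult.commute)
qed

lemma J_integrand_continuous:
  fixes p :: "real \<Rightarrow> real"
  assumes "Cinf p" shows "continuous_on A (\<lambda>s. p (t + s * r))"
proof -
  have "continuous_on A (\<lambda>s. t + s * r)" by (intro continuous_intros)
  then show ?thesis by (rule continuous_on_compose2[OF Cinf_continuous[OF assms]]) auto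
qed

lemma integral_FTC_vanishing:
  fixes F :: "real \<Rightarrow> real"
  assumes "\<And>s. (F has_real_derivative f s) (at s)"
  shows "integral {-1..1} f = F 1 - F (-1)"
  by (rule integral_unique, rule fundamental_theorem_of_calculus)
     (auto simp: has_real_derivative_iff_has_vector_derivative[symmetric] intro!: has_field_derivative_at_within assms)

lemma J_by_parts:
  assumes p: "Cinf p"
  shows "integral {-1..1} (\<lambda>s. s * kwt k s * p (t + s * r)) = r * J (Suc k) (dd 1 p) (t, r)"
proof -
  have "((\<lambda>s. kwt (Suc k) s * p (t + s * r)) has_real_derivative
      - s * kwt k s * p (t + s * r) + r * dd 1 p (t + s * r) * kwt (Suc k) s) (at s)" for s
    by (intro DERIV_mult kwt_deriv Cinf_real_deriv_affine p)
  from integral_FTC_vanishing[OF this]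
  have "integral {-1..1} (\<lambda>s. - s * kwt k s * p (t + s * r) + r * dd 1 p (t + s * r) * kwt (Suc k) s) = 0"
    by (simp add: kwt_def)
  moreover have "integral {-1..1} (\<lambda>s. - s * kwt k s * p (t + s * r) + r * dd 1 p (t + s * r) * kwt (Suc k) s)
     = integral {-1..1} (\<lambda>s. - (s * kwt k s * p (t + s * r))) + integral {-1..1} (\<lambda>s. r * (kwt (Suc k) s * dd 1 p (t + s * r)))"
    by (subst integral_add[symmetric])
       (auto intro!: integrable_continuous_real continuous_intros kwt_continuous J_integrand_continuous p Cinf_dd simp: mult_ac)
  ultimately show ?thesis by (simp add: J_def)
qed

text \<open>The r-derivative produces a factor s, which integration by parts turns into a factor r.
  After the substitution r = |x| this factor cancels the denominator of x / |x|.\<close>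

lemma J_has_derivative:
  assumes p: "Cinf p"
  shows "(J k p has_derivative (\<lambda>h. fst h * J k (dd 1 p) q + snd h * (snd q * J (Suc k) (dd 1 (dd 1 p)) q))) (at q)"
proof -
  \<comment> \<open>The two projections as bounded linear functions, the form in which
    differentiation under the integral sign expects its derivative.\<close>
  define B0 :: "(real \<times> real) \<Rightarrow>\<^sub>L real" where "B0 = Blinfun fst"
  define B1 :: "(real \<times> real) \<Rightarrow>\<^sub>L real" where "B1 = Blinfun snd"
  have B: "blinfun_apply B0 = fst" "blinfun_apply B1 = snd"
    unfolding B0_def B1_def by (intro bounded_linear_Blinfun_apply bounded_linear_fst bounded_linear_snd)+
  define fx where "fx q s = (kwt k s * dd 1 p (fst q + s * snd q)) *\<^sub>R (B0 + s *\<^sub>R B1)" for q :: "real \<times> real" and s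
  have "((\<lambda>q. integral (cbox (-1) 1) ((\<lambda>q s. kwt k s * p (fst q + s * snd q)) q)) has_derivative
     blinfun_apply (integral (cbox (-1) 1) (fx q))) (at q within UNIV)"
  proof (rule leibniz_rule)
    fix q :: "real \<times> real" and s :: real
    have "((\<lambda>q. fst q + s * snd q) has_derivative (\<lambda>h. fst h + s * snd h)) (at q)"
      by (auto intro!: derivative_eq_intros)
    from DERIV_compose_FDERIV[OF Cinf_real_deriv[OF p] this]
    have "((\<lambda>q. kwt k s * p (fst q + s * snd q)) has_derivative (\<lambda>h. kwt k s * ((fst h + s * snd h) * dd 1 p (fst q + s * snd q)))) (at q)"
      by (rule has_derivative_mult_right)
    moreover have "blinfun_apply (fx q s) = (\<lambda>h. kwt k s * ((fst h + s * snd h) * dd 1 p (fst q + s * snd q)))"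
      by (rule ext) (simp add: fx_def blinfun.add_left blinfun.scaleR_left B mult_ac)
    ultimately show "((\<lambda>q. kwt k s * p (fst q + s * snd q)) has_derivative blinfun_apply (fx q s)) (at q within UNIV)"
      by simp
    show "(\<lambda>s. kwt k s * p (fst q + s * snd q)) integrable_on cbox (-1) 1"
      by (simp, intro integrable_continuous_real continuous_intros kwt_continuous J_integrand_continuous p)
  next
    show "continuous_on (UNIV \<times> cbox (-1) 1) (\<lambda>(q, s). fx q s)"
      unfolding fx_def case_prod_unfold
      by (intro continuous_intros continuous_on_compose2[OF kwt_continuous[of UNIV k]] continuous_on_compose2[OF Cinf_continuous[OF Cinf_dd[OF p]]]) auto
  qed auto
  moreover have "blinfun_apply (integral (cbox (-1) 1) (fx q)) h = fst h * J k (dd 1 p) q + snd h * (snd q * J (Suc k) (dd 1 (dd 1 p)) q)" for h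
  proof -
    have c: "continuous_on {-1..1} (fx q)"
      unfolding fx_def by (intro continuous_intros kwt_continuous J_integrand_continuous p Cinf_dd)
    have "blinfun_apply (integral (cbox (-1) 1) (fx q)) h = integral {-1..1} ((\<lambda>b. blinfun_apply b h) \<circ> fx q)"
      using c by (subst integral_linear) (auto intro!: integrable_continuous_real blinfun.bounded_linear_left)
    also have "\<dots> = integral {-1..1} (\<lambda>s. fst h * (kwt k s * dd 1 p (fst q + s * snd q)) + snd h * (s * kwt k s * dd 1 p (fst q + s * snd q)))"
      by (intro integral_cong) (simp add: fx_def blinfun.add_left blinfun.scaleR_left B algebra_simps)
    also have "\<dots> = integral {-1..1} (\<lambda>s. fst h * (kwt k s * dd 1 p (fst q + s * snd q))) + integral {-1..1} (\<lambda>s. snd h * (s * kwt k s * dd 1 p (fst q + s * snd q)))"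
      by (intro integral_add integrable_continuous_real continuous_intros kwt_continuous J_integrand_continuous p Cinf_dd)
    also have "\<dots> = fst h * J k (dd 1 p) q + snd h * (snd q * J (Suc k) (dd 1 (dd 1 p)) q)"
      using J_by_parts[OF Cinf_dd[OF p], of k 1 "fst q" "snd q"] by (simp add: J_def)
    finally show ?thesis .
  qed
  then have "blinfun_apply (integral (cbox (-1) 1) (fx q)) = (\<lambda>h. fst h * J k (dd 1 p) q + snd h * (snd q * J (Suc k) (dd 1 (dd 1 p)) q))"
    by (rule ext)
  moreover have "J k p = (\<lambda>q. integral (cbox (-1) 1) ((\<lambda>q s. kwt k s * p (fst q + s * snd q)) q))"
    by (simp add: J_def[abs_def])
  ultimately show ?thesis by (simp only:)
qed

definition Kr :: "nat \<Rightarrow> (real \<Rightarrow> real) \<Rightarrow> spacetime \<Rightarrow> real" where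
  "Kr k p q = J k p (fst q, norm (snd q))"

text \<open>Away from x = 0 this is the chain rule, with the factor |x| cancelling the denominator
  of grad |x|. At x = 0 the norm is not differentiable, but \<open>J\<close> has vanishing
  r-derivative there, and replacing x by |x| keeps the distance to the base point, so the difference
  quotient of \<open>J\<close> transfers directly.\<close>

lemma Kr_has_derivative:
  assumes p: "Cinf p"
  shows "(Kr k p has_derivative (\<lambda>h. fst h * Kr k (dd 1 p) q + (snd q \<bullet> snd h) * Kr (Suc k) (dd 1 (dd 1 p)) q)) (at q)"
proof (cases "snd q = 0")
  case False
  have "(norm has_derivative (\<lambda>h. sgn (snd q) \<bullet> h)) (at (snd q))"
    using has_derivative_norm[OF False] by (simp add: inner_commute)
  from has_derivative_compose[OF has_derivative_snd[OF has_derivative_ident] this]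
  have "((\<lambda>q. (fst q, norm (snd q))) has_derivative (\<lambda>h. (fst h, sgn (snd q) \<bullet> snd h))) (at q)"
    by (intro has_derivative_Pair has_derivative_fst has_derivative_ident)
  from has_derivative_compose[OF this J_has_derivative[OF p]]
  have "(Kr k p has_derivative (\<lambda>h. fst h * J k (dd 1 p) (fst q, norm (snd q)) +
      (sgn (snd q) \<bullet> snd h) * (norm (snd q) * J (Suc k) (dd 1 (dd 1 p)) (fst q, norm (snd q))))) (at q)"
    by (simp add: Kr_def[abs_def])
  moreover have "(sgn (snd q) \<bullet> y) * norm (snd q) = snd q \<bullet> y" for y
    using False by (simp add: sgn_div_norm)
  ultimately show ?thesis by (simp add: Kr_def mult.assoc[symmetric])
next
  case True
  have J: "\<forall>e>0. \<exists>d>0. \<forall>y. norm (y - (fst q, 0)) < d \<longrightarrow>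
      norm (J k p y - J k p (fst q, 0) - fst (y - (fst q, 0)) * J k (dd 1 p) (fst q, 0)) \<le> e * norm (y - (fst q, 0))"
    using J_has_derivative[OF p, of k "(fst q, 0)"] unfolding has_derivative_at_alt by simp
  show ?thesis unfolding has_derivative_at_alt
  proof (intro conjI allI impI)
    show "bounded_linear (\<lambda>h. fst h * Kr k (dd 1 p) q + (snd q \<bullet> snd h) * Kr (Suc k) (dd 1 (dd 1 p)) q)"
      by (intro bounded_linear_add bounded_linear_mult_left[THEN bounded_linear_compose] bounded_linear_fst
          bounded_linear_inner_right[THEN bounded_linear_compose] bounded_linear_snd)
    fix e :: real assume "e > 0"
    then obtain d where d: "d > 0" "\<And>y. norm (y - (fst q, 0)) < d \<Longrightarrow>
      norm (J k p y - J k p (fst q, 0) - fst (y - (fst q, 0)) * J k (dd 1 p) (fst q, 0)) \<le> e * norm (y - (fst q, 0))"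
      using J by blast
    have n: "norm ((fst y, norm (snd y)) - (fst q, 0::real)) = norm (y - q)" for y :: "spacetime"
      using True by (cases y; cases q) (simp add: norm_Pair)
    show "\<exists>d>0. \<forall>y. norm (y - q) < d \<longrightarrow>
       norm (Kr k p y - Kr k p q - (fst (y - q) * Kr k (dd 1 p) q + (snd q \<bullet> snd (y - q)) * Kr (Suc k) (dd 1 (dd 1 p)) q)) \<le> e * norm (y - q)"
    proof (intro exI[of _ d] conjI allI impI d(1))
      fix y assume "norm (y - q) < d"
      then show "norm (Kr k p y - Kr k p q - (fst (y - q) * Kr k (dd 1 p) q + (snd q \<bullet> snd (y - q)) * Kr (Suc k) (dd 1 (dd 1 p)) q)) \<le> e * norm (y - q)"
        using d(2)[of "(fst y, norm (snd y))"] True unfolding n Kr_def by simp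
    qed
  qed
qed

lemma dd_Kr:
  assumes "Cinf p"
  shows "dd b (Kr k p) = (\<lambda>q. fst b * Kr k (dd 1 p) q + (snd q \<bullet> snd b) * Kr (Suc k) (dd 1 (dd 1 p)) q)"
  by (intro ext dd_eq Kr_has_derivative assms)

text \<open>The induction has to vary k and p together, because a spatial derivative raises k by one
  and replaces p by its second derivative.\<close>

lemma Cinf_Kr: "Cinf p \<Longrightarrow> Cinf (Kr k p)"
proof -
  have "Cinf p \<Longrightarrow> Ck n (Kr k p)" for n
  proof (induction n arbitrary: k p)
    case 0
    then show ?case using has_derivative_continuous[OF Kr_has_derivative]
      by (auto intro!: continuous_at_imp_continuous_on)
  next
    case (Suc n)
    have "Ck n (\<lambda>q::spacetime. snd q \<bullet> y)" for y
      by (intro Ck_linear bounded_linear_inner_left[THEN bounded_linear_compose] bounded_linear_snd)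
    then have "Ck n (dd b (Kr k p))" for b
      unfolding dd_Kr[OF Suc.prems] by (intro Ck_add Ck_mult Ck_const Suc.IH Cinf_dd Suc.prems)
    moreover have "Kr k p differentiable (at q)" for q
      using Kr_has_derivative[OF Suc.prems] unfolding differentiable_def by blast
    ultimately show ?case by simp
  qed
  then show "Cinf p \<Longrightarrow> Cinf (Kr k p)" by (simp add: Cinf_def)
qed

text \<open>With u = p'' the Laplacian is 3 J_1(u) + r^2 J_2(u''). Two integrations by parts bring
  the second term to an integral over u as well, and the total weight is 3 (1 - s^2) / 2 - (1 - 3
  s^2) / 2 = 1, the weight of J_0.\<close>

lemma Kr_wave:
  assumes p: "Cinf p"
  shows "Dt (Dt (Kr 0 p)) q = (\<Sum>i\<in>UNIV. Dx i (Dx i (Kr 0 p)) q)"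
proof -
  define r t where "r = norm (snd q)" and "t = fst q"
  define u where "u = dd 1 (dd 1 p)"
  have u: "Cinf u" unfolding u_def by (intro Cinf_dd p)
  have xi: "Cinf (\<lambda>q::spacetime. snd q $ i)" for i
    by (intro Cinf_linear bounded_linear_compose[OF bounded_linear_vec_nth bounded_linear_snd])
  have dxi: "dd b (\<lambda>q::spacetime. snd q $ i) q = snd b $ i" for b i
    by (rule dd_eq[OF bounded_linear_imp_has_derivative[OF bounded_linear_compose[OF bounded_linear_vec_nth bounded_linear_snd]]])
  have "Dx i (Kr 0 p) = (\<lambda>q. snd q $ i * Kr 1 u q)" for i
    unfolding dd_Kr[OF p] u_def by (simp add: inner_axis)
  then have "Dx i (Dx i (Kr 0 p)) q = snd q $ i * Dx i (Kr 1 u) q + Kr 1 u q" for i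
    using Cinf_differentiable[OF xi[of i]] Cinf_differentiable[OF Cinf_Kr[OF u]] by (simp add: dd_mult dxi axis_def)
  then have "Dx i (Dx i (Kr 0 p)) q = (snd q $ i)^2 * Kr 2 (dd 1 (dd 1 u)) q + Kr 1 u q" for i
    unfolding dd_Kr[OF u] by (simp add: inner_axis power2_eq_square numeral_2_eq_2)
  then have "(\<Sum>i\<in>UNIV. Dx i (Dx i (Kr 0 p)) q) = 3 * Kr 1 u q + r^2 * Kr 2 (dd 1 (dd 1 u)) q"
    unfolding r_def norm3 sum_3 by (simp add: algebra_simps)
  also have "\<dots> = 3 * J 1 u (t, r) + r^2 * J 2 (dd 1 (dd 1 u)) (t, r)" by (simp add: Kr_def r_def t_def)
  also have "\<dots> = J 0 u (t, r)"
  proof -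
    have "r * J 2 (dd 1 (dd 1 u)) (t, r) = integral {-1..1} (\<lambda>s. s * kwt 1 s * dd 1 u (t + s * r))"
      using J_by_parts[OF Cinf_dd[OF u], of 1 1 t r] by (simp add: numeral_2_eq_2)
    then have "r^2 * J 2 (dd 1 (dd 1 u)) (t, r) = integral {-1..1} (\<lambda>s. r * (s * kwt 1 s * dd 1 u (t + s * r)))"
      by (simp add: power2_eq_square)
    also have "\<dots> = integral {-1..1} (\<lambda>s. - ((1 - 3 * s^2) / 2 * u (t + s * r)))"
    proof -
      have k1: "((\<lambda>s. s * kwt 1 s) has_real_derivative (1 - 3 * s^2) / 2) (at s)" for s
        unfolding kwt_def by (auto intro!: derivative_eq_intros simp: power2_eq_square field_simps)
      have "((\<lambda>s. s * kwt 1 s * u (t + s * r)) has_real_derivative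
         (1 - 3 * s^2) / 2 * u (t + s * r) + r * dd 1 u (t + s * r) * (s * kwt 1 s)) (at s)" for s
        by (intro DERIV_mult k1 Cinf_real_deriv_affine u)
      from integral_FTC_vanishing[OF this]
      have "integral {-1..1} (\<lambda>s. (1 - 3 * s^2) / 2 * u (t + s * r) + r * dd 1 u (t + s * r) * (s * kwt 1 s)) = 0"
        by (simp add: kwt_def)
      moreover have "integral {-1..1} (\<lambda>s. (1 - 3 * s^2) / 2 * u (t + s * r) + r * dd 1 u (t + s * r) * (s * kwt 1 s))
        = integral {-1..1} (\<lambda>s. (1 - 3 * s^2) / 2 * u (t + s * r)) + integral {-1..1} (\<lambda>s. r * (s * kwt 1 s * dd 1 u (t + s * r)))"
        by (subst integral_add[symmetric])
           (auto intro!: integrable_continuous_real continuous_intros kwt_continuous J_integrand_continuous u Cinf_dd simp: mult_ac)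
      ultimately show ?thesis by (simp only: integral_neg)
    qed
    finally have *: "r^2 * J 2 (dd 1 (dd 1 u)) (t, r) = integral {-1..1} (\<lambda>s. - ((1 - 3 * s^2) / 2 * u (t + s * r)))" .
    have "3 * J 1 u (t, r) = integral {-1..1} (\<lambda>s. 3 * (kwt 1 s * u (t + s * r)))" by (simp add: J_def)
    then have "3 * J 1 u (t, r) + r^2 * J 2 (dd 1 (dd 1 u)) (t, r) =
       integral {-1..1} (\<lambda>s. 3 * (kwt 1 s * u (t + s * r)) + - ((1 - 3 * s^2) / 2 * u (t + s * r)))"
      unfolding * by (subst integral_add) (auto intro!: integrable_continuous_real continuous_intros kwt_continuous J_integrand_continuous u)
    also have "\<dots> = J 0 u (t, r)" unfolding J_def
      by (intro integral_cong) (simp add: kwt_def power2_eq_square field_simps)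
    finally show ?thesis .
  qed
  also have "\<dots> = Dt (Dt (Kr 0 p)) q"
    unfolding dd_Kr[OF p] by (simp add: dd_Kr[OF Cinf_dd[OF p]] r_def t_def u_def) (simp add: Kr_def)
  finally show ?thesis by simp
qed

lemma J0_primitive:
  assumes "\<And>s. (P has_real_derivative p s) (at s)"
  shows "r * J 0 p (t, r) = P (t + r) - P (t - r)"
proof -
  have "((\<lambda>s. P (t + s * r)) has_real_derivative r * p (t + s * r)) (at s)" for s
  proof -
    have "((\<lambda>s. t + s * r) has_real_derivative r) (at s)" by (auto intro!: derivative_eq_intros)
    from DERIV_chain2[OF assms this] show ?thesis by (simp add: mult.commute)
  qed
  from integral_FTC_vanishing[OF this] show ?thesis by (simp add: J_def kwt_def)
qed

text \<open>Let p be odd and zero outside [-\<epsilon>, \<epsilon>]. Its primitive P is even and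
  constant beyond \<epsilon>, so P(t + r) - P(t - r) vanishes for r > \<epsilon> + |t|. At t = 0
  oddness kills E and E_tt, and E_t(0, x) = 2 p(|x|) / |x| is a bump. After normalisation this is
  the wave with zero initial position and a mollifier as initial velocity.\<close>

lemma mollifier_wave:
  assumes e: "\<epsilon> > 0"
  shows "\<exists>E. nice_wave E \<and> cone_supp \<epsilon> E \<and> (\<forall>x. E (0, x) = 0) \<and> (\<forall>x. Dt E (0, x) \<ge> 0) \<and>
     (LBINT x. Dt E (0, x)) = 1 \<and> (\<forall>x. Dt (Dt E) (0, x) = 0)"
proof -
  \<comment> \<open>The factor s makes p odd and is divided out again in E_t(0, x).\<close>
  define p where "p s = s * bump 0 (\<epsilon>^2 - s * s)" for s
  have p: "Cinf p" unfolding p_def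
    by (intro Cinf_mult Cinf_linear[OF bounded_linear_ident] Cinf_compose_real[OF Cinf_bump] Cinf_diff Cinf_const)
  have odd: "p (- s) = - p s" for s by (simp add: p_def)
  have p0: "p s = 0" if "\<bar>s\<bar> \<ge> \<epsilon>" for s
  proof -
    have "\<epsilon>^2 \<le> s^2" using that e by (metis abs_le_square_iff abs_of_pos)
    then show ?thesis by (simp add: p_def bump_def power2_eq_square)
  qed
  have "\<exists>F. \<forall>x. -\<infinity> < ereal x \<longrightarrow> ereal x < \<infinity> \<longrightarrow> (F has_vector_derivative p x) (at x)"
    using Cinf_continuous[OF p]
    by (intro einterval_antiderivative) (auto simp: continuous_on_eq_continuous_at)
  then obtain P where P: "\<And>x. (P has_real_derivative p x) (at x)"
    by (auto simp: has_real_derivative_iff_has_vector_derivative)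
  have even: "P (- s) = P s" for s
  proof -
    have "((\<lambda>s. P (- s) - P s) has_real_derivative 0) (at s)" for s
    proof -
      have "((\<lambda>s. P (- s)) has_real_derivative p (- s) * (- 1)) (at s)"
        by (rule DERIV_chain2[OF P]) (auto intro!: derivative_eq_intros)
      from DERIV_diff[OF this P[of s]] show ?thesis by (simp add: odd)
    qed
    then have "P (- s) - P s = P (- 0) - P 0" using DERIV_isconst_all[of "\<lambda>s. P (- s) - P s" s 0] by blast
    then show ?thesis by simp
  qed
  have Pc: "P s = P \<epsilon>" if "s \<ge> \<epsilon>" for s
  proof (cases "s = \<epsilon>")
    case False
    then have "\<exists>z>\<epsilon>. z < s \<and> P s - P \<epsilon> = (s - \<epsilon>) * p z" using that by (intro MVT2) (auto intro: P)
    then show ?thesis using p0 e by auto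
  qed simp
  define E where "E = Kr 0 p"
  have CE: "Cinf E" unfolding E_def by (rule Cinf_Kr[OF p])
  have cone: "cone_supp \<epsilon> E" unfolding cone_supp_def
  proof (intro allI impI)
    fix t and x :: "real^3" assume x: "\<epsilon> + \<bar>t\<bar> < norm x"
    have "P (t + norm x) = P \<epsilon>" using x by (intro Pc) linarith
    moreover have "P (t - norm x) = P (norm x - t)" using even[of "norm x - t"] by simp
    moreover have "P (norm x - t) = P \<epsilon>" using x by (intro Pc) linarith
    ultimately have "norm x * J 0 p (t, norm x) = 0" using J0_primitive[OF P, of "norm x" t] by simp
    moreover have "norm x \<noteq> 0" using x e by linarith
    ultimately show "E (t, x) = 0" by (simp add: E_def Kr_def)
  qed
  have oddJ: "J 0 f (0, r) = 0" if "\<forall>s. f (- s) = - f s" for f r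
  proof -
    have "J 0 f (0, r) = integral {- 1..- (- 1)} (\<lambda>s. f (s * r))" by (simp add: J_def kwt_def)
    also have "\<dots> = integral {- 1..- (- 1)} (\<lambda>s. f (- s * r))"
      using Henstock_Kurzweil_Integration.integral_reflect_real[of 1 "- 1" "\<lambda>s. f (s * r)"] by simp
    also have "\<dots> = - J 0 f (0, r)" using that by (simp add: J_def kwt_def)
    finally show ?thesis by simp
  qed
  have d_odd: "dd 1 f (- s) = dd 1 f s" if "Cinf f" "\<And>s. f (- s) = - f s" for f :: "real \<Rightarrow> real" and s
  proof -
    have "((\<lambda>s. f (- s)) has_real_derivative dd 1 f (- s) * (- 1)) (at s)"
      by (rule DERIV_chain2[OF Cinf_real_deriv[OF that(1)]]) (auto intro!: derivative_eq_intros)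
    moreover have "((\<lambda>s. f (- s)) has_real_derivative - dd 1 f s) (at s)"
      unfolding that(2) by (intro DERIV_minus Cinf_real_deriv that(1))
    ultimately show ?thesis using DERIV_unique by fastforce
  qed
  have d_even: "dd 1 f (- s) = - dd 1 f s" if "Cinf f" "\<And>s. f (- s) = f s" for f :: "real \<Rightarrow> real" and s
  proof -
    have "((\<lambda>s. f (- s)) has_real_derivative dd 1 f (- s) * (- 1)) (at s)"
      by (rule DERIV_chain2[OF Cinf_real_deriv[OF that(1)]]) (auto intro!: derivative_eq_intros)
    moreover have "((\<lambda>s. f (- s)) has_real_derivative dd 1 f s) (at s)"
      unfolding that(2) by (intro Cinf_real_deriv that(1))
    ultimately show ?thesis using DERIV_unique by fastforce
  qed
  have DtE: "Dt E = Kr 0 (dd 1 p)" unfolding E_def dd_Kr[OF p] by simp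
  have DttE: "Dt (Dt E) = Kr 0 (dd 1 (dd 1 p))" unfolding DtE dd_Kr[OF Cinf_dd[OF p]] by simp
  have E0: "E (0, x) = 0" for x unfolding E_def Kr_def using oddJ[of p] odd by simp
  have Ett: "Dt (Dt E) (0, x) = 0" for x unfolding DttE Kr_def
    using oddJ[of "dd 1 (dd 1 p)"] d_even[OF Cinf_dd[OF p] d_odd[OF p odd]] by simp
  have m: "Dt E (0, x) = 2 * bump 0 (\<epsilon>^2 - x \<bullet> x)" for x
  proof (cases "x = 0")
    case False
    have "norm x * J 0 (dd 1 p) (0, norm x) = 2 * p (norm x)"
      using J0_primitive[OF Cinf_real_deriv[OF p], of "norm x" 0] odd by simp
    also have "\<dots> = norm x * (2 * bump 0 (\<epsilon>^2 - x \<bullet> x))" by (simp add: p_def dot_square_norm power2_eq_square)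
    finally show ?thesis using False by (simp add: DtE Kr_def)
  next
    case True
    have "(p has_real_derivative bump 0 (\<epsilon>^2 - 0 * 0)) (at 0)"
    proof -
      have 1: "((\<lambda>s. bump 0 (\<epsilon>^2 - s * s)) has_real_derivative (bump (0 + 2) (\<epsilon>^2 - 0 * 0) - real 0 * bump (0 + 1) (\<epsilon>^2 - 0 * 0)) * 0) (at 0)"
        by (rule DERIV_chain2[OF bump_deriv]) (auto intro!: derivative_eq_intros)
      from DERIV_mult[OF DERIV_ident 1] show ?thesis by (simp add: p_def[abs_def])
    qed
    then have "dd 1 p 0 = bump 0 (\<epsilon>^2)" using DERIV_unique[OF Cinf_real_deriv[OF p, of 0]] by simp
    then show ?thesis using True by (simp add: DtE Kr_def J_def kwt_def)
  qed
  define N where "N = (LBINT x. Dt E (0::real, x::real^3))"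
  have mi: "integrable lborel (\<lambda>x::real^3. Dt E (0, x))"
    using cone_supp_dd[OF cone, of "(1,0)"]
    by (intro integrable_lborel_compact_support[of _ \<epsilon>] Cinf_continuous Cinf_slice Cinf_dd CE) (auto simp: cone_supp_def)
  have N: "N > 0"
  proof -
    have "N \<ge> 0" unfolding N_def by (intro integral_nonneg_AE) (simp add: m bump_nonneg)
    moreover have "N \<noteq> 0"
    proof
      assume "N = 0"
      then have "AE x in lborel. Dt E (0::real, x::real^3) = 0"
        using integral_nonneg_eq_0_iff_AE[OF mi] unfolding N_def by (simp add: m bump_nonneg)
      then have "AE x in lborel. x \<notin> ball (0::real^3) \<epsilon>"
      proof eventually_elim
        case (elim x)
        show ?case
        proof
          assume "x \<in> ball 0 \<epsilon>"
          then have "(norm x)^2 < \<epsilon>^2" using e by (intro power_strict_mono) auto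
          then have "bump 0 (\<epsilon>^2 - x \<bullet> x) > 0" by (simp add: bump_def dot_square_norm)
          then show False using elim m by simp
        qed
      qed
      then have "emeasure lborel (ball (0::real^3) \<epsilon>) = 0" by (subst (asm) AE_iff_measurable[OF _ refl]) (auto simp: ball_def)
      then show False using content_ball_pos[OF e, of "0::real^3"] by (simp add: measure_def)
    qed
    ultimately show ?thesis by simp
  qed
  define W where "W q = (1 / N) * E q" for q
  have CW: "Cinf W" unfolding W_def by (intro Cinf_mult Cinf_const CE)
  have dW: "dd b (\<lambda>q. (1 / N) * f q) = (\<lambda>q. (1 / N) * dd b f q)" if "Cinf f" for f :: "spacetime \<Rightarrow> real" and b
    using Cinf_differentiable[OF that] by (intro ext) (simp only: dd_mult differentiable_const dd_const mult_zero_left add_0_right)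
  have dW1: "dd b W = (\<lambda>q. (1 / N) * dd b E q)" for b unfolding W_def[abs_def] by (rule dW[OF CE])
  have dW2: "dd a (dd b W) = (\<lambda>q. (1 / N) * dd a (dd b E) q)" for a b unfolding dW1 by (rule dW[OF Cinf_dd[OF CE]])
  have "nice_wave W" unfolding nice_wave_def
  proof (intro conjI CW allI)
    show "\<exists>R. cone_supp R W" using cone by (intro exI[of _ \<epsilon>]) (auto simp: cone_supp_def W_def)
    show "Dt (Dt W) q = (\<Sum>i\<in>UNIV. Dx i (Dx i W) q)" for q
      unfolding dW2 sum_distrib_left[symmetric] using Kr_wave[OF p, of q] by (simp add: E_def)
  qed
  moreover have "cone_supp \<epsilon> W" using cone by (auto simp: cone_supp_def W_def)
  moreover have "(LBINT x. Dt W (0, x)) = 1" unfolding dW1 using N by (simp add: N_def)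
  moreover have "W (0, x) = 0" "Dt W (0, x) \<ge> 0" "Dt (Dt W) (0, x) = 0" for x
    unfolding dW2 unfolding dW1 unfolding W_def E0 Ett m using N by (simp_all add: bump_nonneg)
  ultimately show ?thesis by blast
qed

subsection \<open>Continuity of translations and mollification in the quadratic norm\<close>

lemma integrable_translate:
  fixes f :: "'a::euclidean_space \<Rightarrow> real"
  assumes "integrable lborel f"
  shows "integrable lborel (\<lambda>x. f (x + c))"
proof -
  have f: "f \<in> borel_measurable borel" using borel_measurable_integrable[OF assms] by simp
  have "integrable (distr lborel borel ((+) c)) f" using assms by (simp add: lborel_distr_plus)
  then have "integrable lborel (\<lambda>x. f (c + x))" by (subst (asm) integrable_distr_eq) (use f in auto)
  then show ?thesis by (simp add: add.commute)
qed

lemma integral_translate: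
  fixes f :: "'a::euclidean_space \<Rightarrow> real"
  shows "(LBINT x. f (x + c)) = (LBINT x. f x)"
  using lborel_integral_translate[of f c] by (simp add: add.commute)

text \<open>Open sets of finite measure come first: if x lies in U, so does x + X_n eventually.
  Outer regularity passes to measurable sets; linear combinations and dominated limits reach all
  integrable functions. The sequential form is what dominated convergence asks for.\<close>

lemma L1_translation_continuous:
  fixes f :: "'a::euclidean_space \<Rightarrow> real"
  assumes "integrable lborel f"
  shows "\<forall>X. X \<longlonglongrightarrow> 0 \<longrightarrow> (\<lambda>n. LBINT x. \<bar>f (x + X n) - f x\<bar>) \<longlonglongrightarrow> 0"
proof -
  define P where "P f \<longleftrightarrow> (\<forall>X. X \<longlonglongrightarrow> 0 \<longrightarrow> (\<lambda>n. LBINT x. \<bar>f (x + X n) - f x\<bar>) \<longlonglongrightarrow> 0)" for f :: "'a \<Rightarrow> real"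
  have approx: "P f" if f: "integrable lborel f" and g: "\<And>e. e > 0 \<Longrightarrow> \<exists>g. integrable lborel g \<and> P g \<and> (LBINT x. \<bar>f x - g x\<bar>) < e" for f
    unfolding P_def
  proof (intro allI impI LIMSEQ_I)
    fix X :: "nat \<Rightarrow> 'a" and e :: real assume X: "X \<longlonglongrightarrow> 0" and e: "e > 0"
    obtain g where gi: "integrable lborel g" and Pg: "P g" and fg: "(LBINT x. \<bar>f x - g x\<bar>) < e / 4"
      using g[of "e / 4"] e by auto
    have lg: "(\<lambda>n. LBINT x. \<bar>g (x + X n) - g x\<bar>) \<longlonglongrightarrow> 0" using Pg X by (simp add: P_def)
    obtain N where N: "\<And>n. n \<ge> N \<Longrightarrow> \<bar>LBINT x. \<bar>g (x + X n) - g x\<bar>\<bar> < e / 4"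
      using LIMSEQ_D[OF lg, of "e / 4"] e by auto
    have "\<bar>LBINT x. \<bar>f (x + X n) - f x\<bar>\<bar> < e" if "n \<ge> N" for n
    proof -
      have ff: "integrable lborel (\<lambda>x. \<bar>f x - g x\<bar>)" by (intro integrable_abs Bochner_Integration.integrable_diff f gi)
      note ffx = integrable_translate[OF ff, of "X n"]
      have gg: "integrable lborel (\<lambda>x. \<bar>g (x + X n) - g x\<bar>)" by (rule integrable_abs[OF Bochner_Integration.integrable_diff[OF integrable_translate[OF gi] gi]])
      have fx: "integrable lborel (\<lambda>x. \<bar>f (x + X n) - f x\<bar>)" by (rule integrable_abs[OF Bochner_Integration.integrable_diff[OF integrable_translate[OF f] f]])
      have "(LBINT x. \<bar>f (x + X n) - f x\<bar>) \<le> (LBINT x. (\<bar>f (x + X n) - g (x + X n)\<bar> + \<bar>g (x + X n) - g x\<bar>) + \<bar>f x - g x\<bar>)"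
        by (intro integral_mono fx Bochner_Integration.integrable_add ffx gg ff) linarith
      also have "\<dots> = (LBINT x. \<bar>f (x + X n) - g (x + X n)\<bar>) + (LBINT x. \<bar>g (x + X n) - g x\<bar>) + (LBINT x. \<bar>f x - g x\<bar>)"
        by (subst Bochner_Integration.integral_add[OF Bochner_Integration.integrable_add[OF ffx gg] ff],
            subst Bochner_Integration.integral_add[OF ffx gg], rule refl)
      also have "(LBINT x. \<bar>f (x + X n) - g (x + X n)\<bar>) = (LBINT x. \<bar>f x - g x\<bar>)"
        by (rule integral_translate[of "\<lambda>x. \<bar>f x - g x\<bar>"])
      finally have "(LBINT x. \<bar>f (x + X n) - f x\<bar>) < e" using fg N[OF that] by linarith
      then show ?thesis by (simp add: integral_nonneg_AE)
    qed
    then show "\<exists>N. \<forall>n\<ge>N. norm ((LBINT x. \<bar>f (x + X n) - f x\<bar>) - 0) < e" by auto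
  qed
  have opn: "P (indicator U)" if U: "open U" "emeasure lborel U < \<infinity>" for U :: "'a set"
    unfolding P_def
  proof (intro allI impI)
    fix X :: "nat \<Rightarrow> 'a" assume X: "X \<longlonglongrightarrow> 0"
    have [measurable]: "U \<in> sets borel" using U by simp
    have i: "integrable lborel (indicator U :: 'a \<Rightarrow> real)" using U by (simp add: integrable_indicator_iff)
    have ix: "integrable lborel (\<lambda>x. indicator U (x + X n) :: real)" for n by (rule integrable_translate[OF i])
    have "(\<lambda>n. LBINT x. indicator U x * (1 - indicator U (x + X n))) \<longlonglongrightarrow> (LINT x|(lborel::'a measure). (0::real))"
    proof (rule integral_dominated_convergence[where w="indicator U"])
      show "AE x in lborel. (\<lambda>n. indicator U x * (1 - indicator U (x + X n))) \<longlonglongrightarrow> (0::real)"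
      proof (intro AE_I2)
        fix x
        show "(\<lambda>n. indicator U x * (1 - indicator U (x + X n))) \<longlonglongrightarrow> (0::real)"
        proof (cases "x \<in> U")
          case True
          have "(\<lambda>n. x + X n) \<longlonglongrightarrow> x + 0" by (intro tendsto_add tendsto_const X)
          then have "eventually (\<lambda>n. x + X n \<in> U) sequentially" using True U(1) topological_tendstoD by fastforce
          then have "eventually (\<lambda>n. indicator U x * (1 - indicator U (x + X n)) = (0::real)) sequentially"
            by eventually_elim simp
          then show ?thesis by (rule tendsto_eventually)
        qed simp
      qed
      show "AE x in lborel. norm (indicator U x * (1 - indicator U (x + X n)) :: real) \<le> indicator U x" for n
        by (auto simp: indicator_def)
      show "(\<lambda>x. indicator U x * (1 - indicator U (x + X n)) :: real) \<in> borel_measurable lborel" for n by measurable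
    qed (simp, rule i)
    \<comment> \<open>Translation preserves the measure of U, so both halves of the symmetric
      difference weigh the same, and only the half inside U has to be controlled.\<close>
    moreover have "(LBINT x. \<bar>indicator U (x + X n) - indicator U x :: real\<bar>) = 2 * (LBINT x. indicator U x * (1 - indicator U (x + X n)))" for n
    proof -
      have j: "integrable lborel (\<lambda>x. indicator U x * (1 - indicator U (x + X n)) :: real)"
        by (rule Bochner_Integration.integrable_bound[OF i]) (auto simp: indicator_def)
      have "\<bar>indicator U (x + X n) - indicator U x :: real\<bar> = 2 * (indicator U x * (1 - indicator U (x + X n))) + (indicator U (x + X n) - indicator U x)" for x
        by (auto simp: indicator_def)
      then have "(LBINT x. \<bar>indicator U (x + X n) - indicator U x :: real\<bar>) = 2 * (LBINT x. indicator U x * (1 - indicator U (x + X n))) +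
          ((LBINT x. indicator U (x + X n)) - (LBINT x. indicator U x :: real))"
        by (simp only: Bochner_Integration.integral_add[OF integrable_mult_right[OF j] Bochner_Integration.integrable_diff[OF ix[of n] i]]
            Bochner_Integration.integral_diff[OF ix[of n] i] integral_mult_right_zero)
      then show ?thesis using integral_translate[of "indicator U" "X n"] by simp
    qed
    ultimately show "(\<lambda>n. LBINT x. \<bar>indicator U (x + X n) - indicator U x :: real\<bar>) \<longlonglongrightarrow> 0"
      using tendsto_mult_right_zero by simp
  qed
  have "P f"
  using assms
  proof (induction rule: integrable_induct)
    case (base A c)
    have A: "P (indicator A)"
    proof (rule approx)
      show iA: "integrable lborel (indicator A :: 'a \<Rightarrow> real)" using base by (simp add: integrable_indicator_iff)
      fix e :: real assume e: "e > 0"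
      obtain U where U: "open U" "A \<subseteq> U" "emeasure lborel (U - A) < e"
        using outer_regular_lborel[of A e] base e by auto
      have "emeasure lborel U \<le> emeasure lborel A + emeasure lborel (U - A)"
        using U base by (intro order.trans[OF _ emeasure_subadditive] emeasure_mono) auto
      also have "\<dots> < \<infinity>" using base order.strict_trans[OF U(3) ennreal_less_top] by (simp add: ennreal_add_less_top)
      finally have fin: "emeasure lborel U < \<infinity>" .
      have [measurable]: "U \<in> sets borel" "A \<in> sets borel" using U base by auto
      have "(LBINT x. \<bar>indicator A x - indicator U x :: real\<bar>) = (LBINT x. indicator (U - A) x)"
        using U by (intro Bochner_Integration.integral_cong refl) (auto simp: indicator_def)
      also have "\<dots> = measure lborel (U - A)" by simp
      also have "\<dots> < e"
      proof -
        have "emeasure lborel (U - A) \<noteq> top" using order.strict_trans[OF U(3) ennreal_less_top] by simp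
        then show ?thesis using U(3) by (simp add: emeasure_eq_ennreal_measure ennreal_less_iff)
      qed
      finally show "\<exists>g. integrable lborel g \<and> P g \<and> (LBINT x. \<bar>indicator A x - g x\<bar>) < e"
        using opn[OF U(1) fin] fin by (intro exI[of _ "indicator U"]) (auto simp: integrable_indicator_iff)
    qed
    show ?case unfolding P_def
    proof (intro allI impI)
      fix X :: "nat \<Rightarrow> 'a" assume "X \<longlonglongrightarrow> 0"
      then have "(\<lambda>n. LBINT x. \<bar>indicator A (x + X n) - indicator A x :: real\<bar>) \<longlonglongrightarrow> 0" using A by (simp add: P_def)
      then have "(\<lambda>n. \<bar>c\<bar> * (LBINT x. \<bar>indicator A (x + X n) - indicator A x :: real\<bar>)) \<longlonglongrightarrow> 0" by (rule tendsto_mult_right_zero)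
      moreover have "\<bar>c\<bar> * (LBINT x. \<bar>indicator A (x + X n) - indicator A x :: real\<bar>) = (LBINT x. \<bar>indicator A (x + X n) *\<^sub>R c - indicator A x *\<^sub>R c\<bar>)" for n
        by (subst integral_mult_right_zero[symmetric]) (simp add: abs_mult[symmetric] algebra_simps)
      ultimately show "(\<lambda>n. LBINT x. \<bar>indicator A (x + X n) *\<^sub>R c - indicator A x *\<^sub>R c\<bar>) \<longlonglongrightarrow> 0" by simp
    qed
  next
    case (add f g)
    show ?case unfolding P_def
    proof (intro allI impI)
      fix X :: "nat \<Rightarrow> 'a" assume X: "X \<longlonglongrightarrow> 0"
      have l: "(\<lambda>n. (LBINT x. \<bar>f (x + X n) - f x\<bar>) + (LBINT x. \<bar>g (x + X n) - g x\<bar>)) \<longlonglongrightarrow> 0"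
        using add.IH X unfolding P_def by (intro tendsto_add_zero) blast+
      have b: "norm (LBINT x. \<bar>f (x + X n) + g (x + X n) - (f x + g x)\<bar>) \<le> (LBINT x. \<bar>f (x + X n) - f x\<bar>) + (LBINT x. \<bar>g (x + X n) - g x\<bar>)" for n
      proof -
        note i = add.hyps(1,2) integrable_translate[OF add.hyps(1), of "X n"] integrable_translate[OF add.hyps(2), of "X n"]
        have "(LBINT x. \<bar>f (x + X n) + g (x + X n) - (f x + g x)\<bar>) \<le> (LBINT x. \<bar>f (x + X n) - f x\<bar> + \<bar>g (x + X n) - g x\<bar>)"
          by (intro integral_mono integrable_abs Bochner_Integration.integrable_add Bochner_Integration.integrable_diff i) linarith
        also have "\<dots> = (LBINT x. \<bar>f (x + X n) - f x\<bar>) + (LBINT x. \<bar>g (x + X n) - g x\<bar>)"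
          by (intro Bochner_Integration.integral_add integrable_abs Bochner_Integration.integrable_diff i)
        finally show ?thesis by (simp add: integral_nonneg_AE)
      qed
      show "(\<lambda>n. LBINT x. \<bar>f (x + X n) + g (x + X n) - (f x + g x)\<bar>) \<longlonglongrightarrow> 0"
        by (rule Lim_null_comparison[OF always_eventually[OF allI[OF b]] l])
    qed
  next
    case (lim f s)
    show ?case
    proof (rule approx)
      show "integrable lborel f" by fact
      fix e :: real assume e: "e > 0"
      have "(\<lambda>i. LBINT x. \<bar>f x - s i x\<bar>) \<longlonglongrightarrow> (LINT x|(lborel::'a measure). (0::real))"
      proof (rule integral_dominated_convergence[where w="\<lambda>x. 3 * \<bar>f x\<bar>"])
        have "(\<lambda>i. \<bar>f x - s i x\<bar>) \<longlonglongrightarrow> \<bar>f x - f x\<bar>" for x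
          using lim by (intro tendsto_intros) auto
        then show "AE x in lborel. (\<lambda>i. \<bar>f x - s i x\<bar>) \<longlonglongrightarrow> 0" by simp
        show "AE x in lborel. norm \<bar>f x - s i x\<bar> \<le> 3 * \<bar>f x\<bar>" for i
        proof (intro AE_I2)
          fix x
          have "norm (s i x) \<le> 2 * norm (f x)" using lim by auto
          then show "norm \<bar>f x - s i x\<bar> \<le> 3 * \<bar>f x\<bar>" unfolding real_norm_def by linarith
        qed
        have "f \<in> borel_measurable lborel" "s i \<in> borel_measurable lborel" for i
          using lim.hyps by (auto intro: borel_measurable_integrable)
        then show "(\<lambda>x. \<bar>f x - s i x\<bar>) \<in> borel_measurable lborel" for i by measurable
        show "integrable lborel (\<lambda>x. 3 * \<bar>f x\<bar>)" using lim.hyps by simp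
      qed simp
      then have li: "(\<lambda>i. LBINT x. \<bar>f x - s i x\<bar>) \<longlonglongrightarrow> 0" by simp
      obtain i where "norm ((LBINT x. \<bar>f x - s i x\<bar>) - 0) < e" using LIMSEQ_D[OF li e] by blast
      then show "\<exists>g. integrable lborel g \<and> P g \<and> (LBINT x. \<bar>f x - g x\<bar>) < e"
        using lim.hyps(1) lim.IH by (intro exI[of _ "s i"]) simp
    qed
  qed
  then show ?thesis by (simp add: P_def)
qed

text \<open>The square of the L^2 norm, left without the root so that the contributions of
  components simply add.\<close>

definition e2 :: "('a::euclidean_space \<Rightarrow> real) \<Rightarrow> ennreal" where
  "e2 f = (NNINT x. ennreal ((f x)^2))"

lemma square_diff_le: "(a - b)^2 \<le> 2 * \<bar>a * \<bar>a\<bar> - b * \<bar>b\<bar>\<bar>" for a b :: real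
proof -
  consider "a \<ge> 0" "b \<ge> 0" | "a \<le> 0" "b \<le> 0" | "a \<ge> 0" "b \<le> 0" | "a \<le> 0" "b \<ge> 0" by linarith
  then show ?thesis
  proof cases
    case 1
    have "(a - b)^2 = \<bar>a - b\<bar> * \<bar>a - b\<bar>" by (simp add: power2_eq_square)
    also have "\<dots> \<le> \<bar>a - b\<bar> * (2 * (a + b))" using 1 by (intro mult_left_mono) auto
    also have "\<dots> = 2 * \<bar>a * a - b * b\<bar>" using 1 by (simp add: square_diff_square_factored abs_mult mult_ac)
    finally show ?thesis using 1 by simp
  next
    case 2
    have "(a - b)^2 = \<bar>a - b\<bar> * \<bar>a - b\<bar>" by (simp add: power2_eq_square)
    also have "\<dots> \<le> \<bar>a - b\<bar> * (2 * \<bar>a + b\<bar>)" using 2 by (intro mult_left_mono) auto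
    also have "\<dots> = 2 * \<bar>a * a - b * b\<bar>" by (simp add: square_diff_square_factored abs_mult mult_ac)
    finally show ?thesis using 2 by (simp add: abs_minus_commute)
  next
    case 3
    have "(a - b)^2 \<le> 2 * (a * a + b * b)" using zero_le_power2[of "a + b"] by (simp add: power2_eq_square algebra_simps)
    then show ?thesis using 3 by simp
  next
    case 4
    have "(a - b)^2 \<le> 2 * (a * a + b * b)" using zero_le_power2[of "a + b"] by (simp add: power2_eq_square algebra_simps)
    moreover have "a * \<bar>a\<bar> - b * \<bar>b\<bar> = - (a * a + b * b)" using 4 by simp
    then have "\<bar>a * \<bar>a\<bar> - b * \<bar>b\<bar>\<bar> = a * a + b * b" by (simp only: abs_minus_cancel) simp
    ultimately show ?thesis by simp
  qed
qed

text \<open>The signed square f |f| is integrable, and \<open>square_diff_le\<close> bounds the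
  squared increment of f by the increment of f |f|. Continuity of translations in L^1 for f |f| thus
  gives it in L^2 for f.\<close>

lemma L2_translation_continuous:
  fixes f :: "'a::euclidean_space \<Rightarrow> real"
  assumes [measurable]: "f \<in> borel_measurable borel" and fin: "e2 f < \<infinity>" and e: "\<epsilon> > 0"
  shows "\<exists>d>0. \<forall>y. norm y < d \<longrightarrow> e2 (\<lambda>x. f (x + y) - f x) \<le> ennreal \<epsilon>"
proof -
  define F where "F x = f x * \<bar>f x\<bar>" for x
  have [measurable]: "F \<in> borel_measurable borel" unfolding F_def by measurable
  have F: "integrable lborel F"
  proof (rule integrableI_bounded)
    have "(NNINT x. ennreal (norm (F x))) = e2 f" unfolding e2_def F_def
      by (intro nn_integral_cong) (simp add: abs_mult power2_eq_square)
    then show "(NNINT x. ennreal (norm (F x))) < \<infinity>" using fin by simp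
  qed simp
  have "((\<lambda>y. LBINT x. \<bar>F (x + y) - F x\<bar>) \<longlongrightarrow> 0) (at 0)"
    unfolding tendsto_at_iff_sequentially using L1_translation_continuous[OF F] by (auto simp: o_def)
  then have "eventually (\<lambda>y. dist (LBINT x. \<bar>F (x + y) - F x\<bar>) 0 < \<epsilon> / 2) (at 0)" using e by (intro tendstoD) auto
  then obtain d where d: "d > 0" "\<And>y. y \<noteq> 0 \<Longrightarrow> norm y < d \<Longrightarrow> \<bar>LBINT x. \<bar>F (x + y) - F x\<bar>\<bar> < \<epsilon> / 2"
    unfolding eventually_at by (auto simp: dist_norm)
  show ?thesis
  proof (intro exI[of _ d] conjI allI impI d(1))
    fix y :: 'a assume y: "norm y < d"
    have i: "integrable lborel (\<lambda>x. 2 * \<bar>F (x + y) - F x\<bar>)" by (rule integrable_mult_right[OF integrable_abs[OF Bochner_Integration.integrable_diff[OF integrable_translate[OF F] F]]])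
    have "e2 (\<lambda>x. f (x + y) - f x) \<le> (NNINT x. ennreal (2 * \<bar>F (x + y) - F x\<bar>))"
      unfolding e2_def F_def by (intro nn_integral_mono ennreal_leI square_diff_le)
    also have "\<dots> = ennreal (LBINT x. 2 * \<bar>F (x + y) - F x\<bar>)" by (intro nn_integral_eq_integral i) auto
    also have "\<dots> \<le> ennreal \<epsilon>"
      using d(2)[of y] y e by (cases "y = 0") (auto intro!: ennreal_leI)
    finally show "e2 (\<lambda>x. f (x + y) - f x) \<le> ennreal \<epsilon>" .
  qed
qed

text \<open>Since m is a probability density, Cauchy-Schwarz bounds the squared error at x by the
  m-average of |G(x - y) - G(x)|^2. After exchanging the integrals each y contributes a translation
  error, which is small for |y| < d.\<close>

lemma mollification_converges:
  fixes G :: "'a::euclidean_space \<Rightarrow> real"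
  assumes G: "integrable lborel G" and fin: "e2 G < \<infinity>" and e: "\<epsilon> > 0"
  shows "\<exists>d>0. \<forall>m. continuous_on UNIV m \<longrightarrow> (\<forall>x. m x \<ge> 0) \<longrightarrow> (LBINT x. m x) = 1 \<longrightarrow> (\<forall>x. norm x > d \<longrightarrow> m x = 0) \<longrightarrow>
     e2 (\<lambda>x. G x - (LBINT y. G y * m (x - y))) \<le> ennreal \<epsilon>"
proof -
  have Gm[measurable]: "G \<in> borel_measurable borel" using borel_measurable_integrable[OF G] by simp
  obtain d where d: "d > 0" "\<And>y. norm y < d \<Longrightarrow> e2 (\<lambda>x. G (x + y) - G x) \<le> ennreal \<epsilon>"
    using L2_translation_continuous[OF Gm fin e] by blast
  show ?thesis
  \<comment> \<open>Half of d, since m may be nonzero on the closed ball while the translation bound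
    needs |y| < d.\<close>
  proof (intro exI[of _ "d / 2"] conjI allI impI)
    show "d / 2 > 0" using d by simp
    fix m :: "'a \<Rightarrow> real"
    assume m: "continuous_on UNIV m" "\<forall>x. m x \<ge> 0" "(LBINT x. m x) = 1" "\<forall>x. norm x > d / 2 \<longrightarrow> m x = 0"
    have [measurable]: "m \<in> borel_measurable borel" using m(1) by (rule borel_measurable_continuous_onI)
    have mi: "integrable lborel m" using m by (intro integrable_lborel_compact_support[of _ "d / 2"]) auto
    have m1: "(NNINT y. ennreal (m y)) = 1" using nn_integral_eq_integral[OF mi] m by simp
    obtain M where M: "\<And>x. \<bar>m x\<bar> \<le> M"
    proof -
      have "compact (m ` cball 0 (d / 2))" using m(1) by (intro compact_continuous_image) (auto intro: continuous_on_subset)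
      then obtain M where M: "\<And>x. x \<in> cball 0 (d / 2) \<Longrightarrow> \<bar>m x\<bar> \<le> M" using compact_imp_bounded bounded_iff by (metis imageI real_norm_def)
      have "\<bar>m x\<bar> \<le> max M 0" for x using M[of x] m(4) by (cases "norm x \<le> d / 2") (auto simp: not_le)
      then show ?thesis by (rule that)
    qed
    have key: "ennreal ((G x - (LBINT y. G y * m (x - y)))^2) \<le> (NNINT y. ennreal (m y) * ennreal ((G (x - y) - G x)^2))" for x
    proof -
      have Gx: "integrable lborel (\<lambda>y. G (x - y))"
      proof -
        have "integrable lborel (\<lambda>y. G (x + (-1) *\<^sub>R y))"
          using lborel_integrable_real_affine integrable_distr_eq[of "\<lambda>y. x + (-1) *\<^sub>R y" lborel borel G] G lborel_affine[of "-1" x]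
          by (auto simp: density_1)
        then show ?thesis by simp
      qed
      have c: "(LBINT y. G y * m (x - y)) = (LBINT y. G (x - y) * m y)"
      proof -
        have "(LBINT y. G y * m (x - y)) = (LINT y|distr lborel borel (\<lambda>y. x + (-1) *\<^sub>R y). G y * m (x - y))"
          using lborel_affine[of "-1" x] by (simp add: density_1)
        also have "\<dots> = (LBINT y. G (x - y) * m y)" by (subst integral_distr) auto
        finally show ?thesis .
      qed
      have i1: "integrable lborel (\<lambda>y. G (x - y) * m y)"
      proof (rule Bochner_Integration.integrable_bound[of _ "\<lambda>y. M * G (x - y)"])
        show "integrable lborel (\<lambda>y. M * G (x - y))" using Gx by auto
        have "\<bar>M\<bar> = M" using M[of 0] by linarith
        then show "AE y in lborel. norm (G (x - y) * m y) \<le> norm (M * G (x - y))"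
          using M by (intro AE_I2) (simp add: abs_mult mult.commute mult_right_mono)
      qed simp
      have i2: "integrable lborel (\<lambda>y. m y * (G (x - y) - G x))"
        using i1 mi by (simp add: algebra_simps)
      have "(LBINT y. G y * m (x - y)) - G x = (LBINT y. m y * (G (x - y) - G x))"
        unfolding c using i1 mi m(3) by (simp add: algebra_simps)
      then have "ennreal \<bar>G x - (LBINT y. G y * m (x - y))\<bar> = ennreal (norm (LBINT y. m y * (G (x - y) - G x)))"
        by (simp add: abs_minus_commute)
      also have "\<dots> \<le> (NNINT y. ennreal (norm (m y * (G (x - y) - G x))))" by (rule integral_norm_bound_ennreal[OF i2])
      also have "\<dots> = (NNINT y. ennreal (sqrt (m y)) * ennreal (sqrt (m y) * \<bar>G (x - y) - G x\<bar>))"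
        using m(2) by (intro nn_integral_cong) (simp add: ennreal_mult'[symmetric] abs_mult mult.assoc[symmetric])
      finally have "(ennreal \<bar>G x - (LBINT y. G y * m (x - y))\<bar>)^2 \<le> (NNINT y. ennreal (sqrt (m y)) * ennreal (sqrt (m y) * \<bar>G (x - y) - G x\<bar>))^2"
        by (intro power_mono) auto
      also have "\<dots> \<le> (NNINT y. (ennreal (sqrt (m y)))^2) * (NNINT y. (ennreal (sqrt (m y) * \<bar>G (x - y) - G x\<bar>))^2)"
        by (intro Cauchy_Schwarz_nn_integral) measurable
      also have "\<dots> = (NNINT y. ennreal (m y) * ennreal ((G (x - y) - G x)^2))"
        using m(2) by (simp add: ennreal_power power_mult_distrib m1 ennreal_mult')
      finally show ?thesis by (simp add: ennreal_power)
    qed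
    have "e2 (\<lambda>x. G x - (LBINT y. G y * m (x - y))) \<le> (NNINT x. (NNINT y. ennreal (m y) * ennreal ((G (x - y) - G x)^2)))"
      unfolding e2_def by (intro nn_integral_mono key)
    also have "\<dots> = (NNINT y. (NNINT x. ennreal (m y) * ennreal ((G (x - y) - G x)^2)))"
    proof (rule lborel_pair.Fubini'[symmetric])
      have [measurable]: "(\<lambda>p. G (fst p - snd p)) \<in> borel_measurable (lborel :: ('a \<times> 'a) measure)"
        by (rule measurable_compose[OF _ Gm], simp)
      have [measurable]: "(\<lambda>p. G (fst p)) \<in> borel_measurable (lborel :: ('a \<times> 'a) measure)"
        by (rule measurable_compose[OF _ Gm], simp)
      have [measurable]: "(\<lambda>p. m (snd p)) \<in> borel_measurable (lborel :: ('a \<times> 'a) measure)"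
        by (rule measurable_compose[OF _ borel_measurable_continuous_onI[OF m(1)]], simp)
      have "(\<lambda>p. ennreal (m (snd p)) * ennreal ((G (fst p - snd p) - G (fst p))^2)) \<in> borel_measurable (lborel :: ('a \<times> 'a) measure)"
        by measurable
      then show "(\<lambda>(x, y). ennreal (m y) * ennreal ((G (x - y) - G x)^2)) \<in> borel_measurable (lborel \<Otimes>\<^sub>M lborel)"
        by (simp add: lborel_prod case_prod_unfold)
    qed
    also have "\<dots> = (NNINT y. ennreal (m y) * e2 (\<lambda>x. G (x + - y) - G x))"
      unfolding e2_def by (simp add: nn_integral_cmult)
    also have "\<dots> \<le> (NNINT y. ennreal (m y) * ennreal \<epsilon>)"
    proof (rule nn_integral_mono)
      fix y
      show "ennreal (m y) * e2 (\<lambda>x. G (x + - y) - G x) \<le> ennreal (m y) * ennreal \<epsilon>"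
      proof (cases "norm y > d / 2")
        case False
        then show ?thesis using d(2)[of "- y"] d(1) by (intro mult_left_mono) auto
      qed (use m(4) in simp)
    qed
    also have "\<dots> = ennreal \<epsilon>" by (simp add: nn_integral_multc m1)
    finally show "e2 (\<lambda>x. G x - (LBINT y. G y * m (x - y))) \<le> ennreal \<epsilon>" .
  qed
qed

subsection \<open>Convolution of integrable functions with smooth waves\<close>

lemma integrable_mult_continuous:
  fixes F h :: "'a::euclidean_space \<Rightarrow> real"
  assumes F: "integrable lborel F" and S: "\<And>y. norm y > S \<Longrightarrow> F y = 0" and h: "continuous_on UNIV h"
  shows "integrable lborel (\<lambda>y. F y * h y)"
proof -
  have [measurable]: "F \<in> borel_measurable borel" "h \<in> borel_measurable borel"
    using borel_measurable_integrable[OF F] borel_measurable_continuous_onI[OF h] by simp_all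
  have "compact (h ` cball 0 S)" using h by (intro compact_continuous_image) (auto intro: continuous_on_subset)
  then obtain M where M: "\<And>x. x \<in> cball 0 S \<Longrightarrow> \<bar>h x\<bar> \<le> M" using compact_imp_bounded bounded_iff by (metis imageI real_norm_def)
  have "\<bar>F y * h y\<bar> \<le> \<bar>M * F y\<bar>" for y
  proof (cases "norm y \<le> S")
    case True
    then have "\<bar>h y\<bar> \<le> \<bar>M\<bar>" using M[of y] by simp
    then have "\<bar>F y\<bar> * \<bar>h y\<bar> \<le> \<bar>F y\<bar> * \<bar>M\<bar>" by (intro mult_left_mono) auto
    then show ?thesis by (simp add: abs_mult mult.commute)
  qed (simp add: S)
  then show ?thesis
    by (intro Bochner_Integration.integrable_bound[OF integrable_mult_right[OF F, of M]]) simp_all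
qed

text \<open>Convolution in space only: a superposition of spatial translates of E, hence a wave
  whenever E is one.\<close>

definition conv :: "(real^3 \<Rightarrow> real) \<Rightarrow> (spacetime \<Rightarrow> real) \<Rightarrow> spacetime \<Rightarrow> real" where
  "conv F E q = (LBINT y. F y * E (q - (0, y)))"

text \<open>Supplies a remainder that is uniform over the translates of E, so that differentiation
  under the integral works for densities that are merely integrable with compact support.\<close>

lemma Taylor_second_order:
  fixes E :: "'a::euclidean_space \<Rightarrow> real"
  assumes E: "Cinf E" and M: "\<And>s. 0 \<le> s \<Longrightarrow> s \<le> 1 \<Longrightarrow> (\<Sum>i\<in>Basis. \<Sum>j\<in>Basis. \<bar>dd j (dd i E) (s *\<^sub>R h + q)\<bar>) \<le> M"
  shows "\<bar>E (h + q) - E q - dd h E q\<bar> \<le> M * (norm h)^2"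
proof -
  have d: "E differentiable (at p)" "dd b E differentiable (at p)" for p b
    using E by (intro Cinf_differentiable Cinf_dd; assumption)+
  have "\<exists>s>0. s < 1 \<and> E (1 *\<^sub>R h + q) - E (0 *\<^sub>R h + q) = (1 - 0) * dd h E (s *\<^sub>R h + q)"
    by (intro MVT2 DERIV_line d) auto
  then obtain s where s: "0 < s" "s < 1" "E (h + q) - E q = dd h E (s *\<^sub>R h + q)" by auto
  have "\<exists>r>0. r < s \<and> dd h E (s *\<^sub>R h + q) - dd h E (0 *\<^sub>R h + q) = (s - 0) * dd h (dd h E) (r *\<^sub>R h + q)"
    using s by (intro MVT2 DERIV_line d) auto
  then obtain r where r: "0 < r" "r < s" "dd h E (s *\<^sub>R h + q) - dd h E q = s * dd h (dd h E) (r *\<^sub>R h + q)" by auto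
  define p where "p = r *\<^sub>R h + q"
  have "dd h (dd h E) p = (\<Sum>i\<in>Basis. \<Sum>j\<in>Basis. (h \<bullet> i) * ((h \<bullet> j) * dd j (dd i E) p))"
  proof -
    have "dd h (dd h E) p = (\<Sum>i\<in>Basis. (h \<bullet> i) * dd i (dd h E) p)" by (rule dd_combination[OF d(2)])
    also have "\<dots> = (\<Sum>i\<in>Basis. (h \<bullet> i) * (\<Sum>j\<in>Basis. (h \<bullet> j) * dd j (dd i E) p))"
      unfolding Cinf_dd_commute[OF E, of _ h] using dd_combination[OF d(2), of h] by simp
    finally show ?thesis by (simp add: sum_distrib_left)
  qed
  also have "\<bar>\<dots>\<bar> \<le> (\<Sum>i\<in>Basis. \<Sum>j\<in>Basis. \<bar>(h \<bullet> i) * ((h \<bullet> j) * dd j (dd i E) p)\<bar>)"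
    by (rule order.trans[OF sum_abs sum_mono]) (rule sum_abs)
  also have "\<dots> \<le> (\<Sum>i\<in>Basis. \<Sum>j\<in>Basis. (norm h)^2 * \<bar>dd j (dd i E) p\<bar>)"
  proof (intro sum_mono)
    fix i j :: 'a assume "i \<in> Basis" "j \<in> Basis"
    then have "\<bar>h \<bullet> i\<bar> * \<bar>h \<bullet> j\<bar> \<le> norm h * norm h" by (intro mult_mono Basis_le_norm) auto
    then have "(\<bar>h \<bullet> i\<bar> * \<bar>h \<bullet> j\<bar>) * \<bar>dd j (dd i E) p\<bar> \<le> (norm h * norm h) * \<bar>dd j (dd i E) p\<bar>" by (intro mult_right_mono) auto
    then show "\<bar>(h \<bullet> i) * ((h \<bullet> j) * dd j (dd i E) p)\<bar> \<le> (norm h)^2 * \<bar>dd j (dd i E) p\<bar>"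
      by (simp add: abs_mult power2_eq_square mult.assoc)
  qed
  also have "\<dots> = (norm h)^2 * (\<Sum>i\<in>Basis. \<Sum>j\<in>Basis. \<bar>dd j (dd i E) p\<bar>)" by (simp add: sum_distrib_left)
  also have "\<dots> \<le> (norm h)^2 * M" using M[of r] r s unfolding p_def by (intro mult_left_mono) auto
  finally have b: "\<bar>dd h (dd h E) p\<bar> \<le> M * (norm h)^2" by (simp add: mult.commute)
  have "\<bar>E (h + q) - E q - dd h E q\<bar> = s * \<bar>dd h (dd h E) p\<bar>" unfolding s(3) r(3) p_def using s by (simp add: abs_mult)
  also have "\<dots> \<le> 1 * \<bar>dd h (dd h E) p\<bar>" using s by (intro mult_right_mono) auto
  finally show ?thesis using b by simp
qed

locale compact_density =
  fixes F :: "real^3 \<Rightarrow> real" and S :: real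
  assumes F: "integrable lborel F" and S: "\<And>y. norm y > S \<Longrightarrow> F y = 0"
begin

lemma conv_integrand:
  fixes E :: "spacetime \<Rightarrow> real"
  assumes "continuous_on UNIV E" shows "integrable lborel (\<lambda>y. F y * E (q - (0, y)))"
proof (rule integrable_mult_continuous[OF F S])
  show "continuous_on UNIV (\<lambda>y. E (q - (0, y)))"
    by (rule continuous_on_compose2[OF assms]) (auto intro!: continuous_intros)
qed

lemma conv_combination:
  assumes E: "Cinf E"
  shows "conv F (dd h E) q = (\<Sum>i\<in>Basis. (h \<bullet> i) * conv F (dd i E) q)"
proof -
  have i: "integrable lborel (\<lambda>y. (h \<bullet> i) * (F y * dd i E (q - (0, y))))" for i
    by (intro integrable_mult_right conv_integrand Cinf_continuous Cinf_dd E)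
  have "conv F (dd h E) q = (LBINT y. (\<Sum>i\<in>Basis. (h \<bullet> i) * (F y * dd i E (q - (0, y)))))"
    unfolding conv_def by (intro Bochner_Integration.integral_cong refl, subst dd_combination[OF Cinf_differentiable[OF E]])
       (simp add: sum_distrib_left mult_ac)
  also have "\<dots> = (\<Sum>i\<in>Basis. (h \<bullet> i) * conv F (dd i E) q)"
    unfolding conv_def by (subst Bochner_Integration.integral_sum[OF i]) simp
  finally show ?thesis .
qed

lemma conv_has_derivative:
  assumes E: "Cinf E"
  shows "(conv F E has_derivative (\<lambda>h. conv F (dd h E) q)) (at q)"
  unfolding has_derivative_at_alt
proof (intro conjI allI impI)
  have "(\<lambda>h. conv F (dd h E) q) = (\<lambda>h. \<Sum>i\<in>Basis. (h \<bullet> i) * conv F (dd i E) q)"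
    by (rule ext) (rule conv_combination[OF E])
  moreover have "bounded_linear (\<lambda>h. \<Sum>i\<in>Basis. (h \<bullet> i) * conv F (dd i E) q)"
    by (intro bounded_linear_sum bounded_linear_mult_left[THEN bounded_linear_compose] bounded_linear_inner_left)
  ultimately show "bounded_linear (\<lambda>h. conv F (dd h E) q)" by (simp only:)
  fix e :: real assume e: "e > 0"
  \<comment> \<open>For |h| < 1 and |y| \<le> S this ball contains every point q + s h - (0, y) at
    which second derivatives are evaluated.\<close>
  define R where "R = norm q + \<bar>S\<bar> + 1"
  define D where "D p = (\<Sum>i\<in>Basis. \<Sum>j\<in>Basis. \<bar>dd j (dd i E) p\<bar>)" for p
  have "continuous_on (cball 0 R) D" unfolding D_def
    by (intro continuous_intros continuous_on_subset[OF Cinf_continuous[OF Cinf_dd[OF Cinf_dd[OF E]]]]) auto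
  then have "compact (D ` cball 0 R)" by (intro compact_continuous_image) auto
  then obtain M where "\<And>p. p \<in> cball 0 R \<Longrightarrow> \<bar>D p\<bar> \<le> M" using compact_imp_bounded bounded_iff by (metis imageI real_norm_def)
  then have M: "D p \<le> M" if "norm p \<le> R" for p using that by fastforce
  have D0: "D p \<ge> 0" for p unfolding D_def by (intro sum_nonneg) auto
  have R0: "R \<ge> 0" by (simp add: R_def)
  have M0: "M \<ge> 0" using M[of 0] D0[of 0] R0 by simp
  define I where "I = (LBINT y. \<bar>F y\<bar>)"
  have I0: "I \<ge> 0" unfolding I_def by (intro integral_nonneg_AE) simp
  \<comment> \<open>The remainder is at most M I |h|^2, and this choice makes it at most e |h|; the
    summand 1 excludes a zero denominator.\<close>
  define d where "d = min 1 (e / (M * I + 1))"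
  have MI: "M * I + 1 > 0" using M0 I0 by (simp add: add_nonneg_pos)
  have d: "d > 0" using e MI by (simp add: d_def)
  show "\<exists>d>0. \<forall>p. norm (p - q) < d \<longrightarrow> norm (conv F E p - conv F E q - conv F (dd (p - q) E) q) \<le> e * norm (p - q)"
  proof (intro exI[of _ d] conjI allI impI d)
    fix p assume p: "norm (p - q) < d"
    define h where "h = p - q"
    have h: "norm h < 1" "norm h \<le> e / (M * I + 1)" using p by (simp_all add: h_def d_def)
    have i: "integrable lborel (\<lambda>y. F y * E (p - (0, y)))" "integrable lborel (\<lambda>y. F y * E (q - (0, y)))" "integrable lborel (\<lambda>y. F y * dd h E (q - (0, y)))"
      using E by (intro conv_integrand Cinf_continuous Cinf_dd; assumption)+
    have eq: "conv F E p - conv F E q - conv F (dd h E) q = (LBINT y. F y * E (p - (0, y)) - F y * E (q - (0, y)) - F y * dd h E (q - (0, y)))"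
      unfolding conv_def using i by simp
    have bound: "\<bar>F y * E (p - (0, y)) - F y * E (q - (0, y)) - F y * dd h E (q - (0, y))\<bar> \<le> (M * (norm h)^2) * \<bar>F y\<bar>" for y
    proof (cases "norm y \<le> S")
      case True
      have "\<bar>E (h + (q - (0, y))) - E (q - (0, y)) - dd h E (q - (0, y))\<bar> \<le> M * (norm h)^2"
      proof (rule Taylor_second_order[OF E], unfold D_def[symmetric], rule M)
        fix s :: real assume s: "0 \<le> s" "s \<le> 1"
        have "norm (s *\<^sub>R h + (q - (0, y))) \<le> norm (s *\<^sub>R h) + (norm q + norm (0::real, y))"
          by (intro norm_triangle_le add_left_mono norm_triangle_ineq4)
        also have "norm (s *\<^sub>R h) \<le> 1" using s h by (simp add: mult_le_one)
        finally show "norm (s *\<^sub>R h + (q - (0, y))) \<le> R" using True by (simp add: R_def)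
      qed
      then have "\<bar>F y\<bar> * \<bar>E (p - (0, y)) - E (q - (0, y)) - dd h E (q - (0, y))\<bar> \<le> \<bar>F y\<bar> * (M * (norm h)^2)"
        unfolding h_def by (intro mult_left_mono) (simp_all add: algebra_simps)
      then show ?thesis by (simp add: abs_mult[symmetric] algebra_simps)
    qed (simp add: S)
    have "\<bar>conv F E p - conv F E q - conv F (dd h E) q\<bar> \<le> (LBINT y. \<bar>F y * E (p - (0, y)) - F y * E (q - (0, y)) - F y * dd h E (q - (0, y))\<bar>)"
      unfolding eq by (rule integral_abs_bound)
    also have "\<dots> \<le> (LBINT y. (M * (norm h)^2) * \<bar>F y\<bar>)"
      using bound by (intro integral_mono integrable_abs Bochner_Integration.integrable_diff i integrable_mult_right F)
    also have "\<dots> = (M * I * norm h) * norm h" by (simp add: I_def power2_eq_square mult_ac)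
    also have "\<dots> \<le> e * norm h"
    proof (rule mult_right_mono)
      have "M * I * norm h \<le> M * I * (e / (M * I + 1))" using h M0 I0 by (intro mult_left_mono) auto
      also have "\<dots> \<le> e" using MI e by (simp add: divide_simps)
      finally show "M * I * norm h \<le> e" .
    qed simp
    finally show "norm (conv F E p - conv F E q - conv F (dd (p - q) E) q) \<le> e * norm (p - q)" by (simp add: h_def)
  qed
qed

lemma dd_conv: "Cinf E \<Longrightarrow> dd b (conv F E) = conv F (dd b E)"
  by (intro ext dd_eq conv_has_derivative)

lemma Cinf_conv: "Cinf E \<Longrightarrow> Cinf (conv F E)"
proof (rule Cinf_coinduct[where P="\<lambda>f. \<exists>E. Cinf E \<and> f = conv F E"])
  fix f assume "\<exists>E. Cinf E \<and> f = conv F E"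
  then obtain E where E: "Cinf E" "f = conv F E" by blast
  have "conv F E differentiable (at q)" for q
    using conv_has_derivative[OF E(1)] unfolding differentiable_def by blast
  moreover have "\<exists>E'. Cinf E' \<and> dd b f = conv F E'" for b
    using E Cinf_dd[OF E(1), of b] dd_conv[OF E(1), of b] by blast
  ultimately show "(\<forall>x. f differentiable (at x)) \<and> (\<forall>b. \<exists>E. Cinf E \<and> dd b f = conv F E)" using E by simp
qed blast

lemma nice_wave_conv:
  assumes E: "nice_wave E" shows "nice_wave (conv F E)"
  unfolding nice_wave_def
proof (intro conjI allI)
  have C: "Cinf E" using E by (rule nice_wave_Cinf)
  show "Cinf (conv F E)" by (rule Cinf_conv[OF C])
  obtain R where R: "cone_supp R E" using E by (auto simp: nice_wave_def)
  have "conv F E (t, x) = 0" if "norm x > (R + S) + \<bar>t\<bar>" for t x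
  proof -
    have "F y * E ((t, x) - (0, y)) = 0" for y
    proof (cases "norm y \<le> S")
      case True
      have "norm x - norm y \<le> norm (x - y)" by (rule norm_triangle_ineq2)
      then have "norm (x - y) > R + \<bar>t\<bar>" using that True by linarith
      then show ?thesis using R by (simp add: cone_supp_def)
    qed (simp add: S)
    then show ?thesis by (simp only: conv_def) simp
  qed
  then show "\<exists>R. cone_supp R (conv F E)" unfolding cone_supp_def by blast
  fix p
  have i: "integrable lborel (\<lambda>y. F y * Dx i (Dx i E) (p - (0, y)))" for i
    by (intro conv_integrand Cinf_continuous Cinf_dd C)
  have "Dt (Dt (conv F E)) p = conv F (Dt (Dt E)) p" unfolding dd_conv[OF C] dd_conv[OF Cinf_dd[OF C]] ..
  also have "\<dots> = (LBINT y. (\<Sum>i\<in>UNIV. F y * Dx i (Dx i E) (p - (0, y))))"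
    using E by (simp add: conv_def nice_wave_def sum_distrib_left)
  also have "\<dots> = (\<Sum>i\<in>UNIV. conv F (Dx i (Dx i E)) p)" unfolding conv_def by (rule Bochner_Integration.integral_sum[OF i])
  also have "\<dots> = (\<Sum>i\<in>UNIV. Dx i (Dx i (conv F E)) p)" unfolding dd_conv[OF C] dd_conv[OF Cinf_dd[OF C]] ..
  finally show "Dt (Dt (conv F E)) p = (\<Sum>i\<in>UNIV. Dx i (Dx i (conv F E)) p)" .
qed

end

lemma nice_wave_dd:
  assumes E: "nice_wave E" shows "nice_wave (dd b E)"
  unfolding nice_wave_def
proof (intro conjI allI)
  have C: "Cinf E" using E by (rule nice_wave_Cinf)
  show "Cinf (dd b E)" by (rule Cinf_dd[OF C])
  show "\<exists>R. cone_supp R (dd b E)" using E cone_supp_dd unfolding nice_wave_def by blast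
  fix p
  have c: "dd a (dd a (dd b E)) = dd b (dd a (dd a E))" for a
    by (simp add: Cinf_dd_commute[OF C, of a b] Cinf_dd_commute[OF Cinf_dd[OF C], of a b])
  have w: "Dt (Dt E) = (\<lambda>p. Dx 1 (Dx 1 E) p + Dx 2 (Dx 2 E) p + Dx 3 (Dx 3 E) p)"
    by (rule ext) (rule nice_wave_eq[OF E])
  have d: "dd a (dd a E) differentiable (at p)" for a by (intro Cinf_differentiable Cinf_dd C)
  show "Dt (Dt (dd b E)) p = (\<Sum>i\<in>UNIV. Dx i (Dx i (dd b E)) p)"
    unfolding c w sum_3 by (simp add: dd_add d)
qed

lemma dd_reflected_slice:
  assumes m: "Cinf E"
  shows "dd (axis i 1) (\<lambda>y. E (q - (0, y))) y = - Dx i E (q - (0, y))"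
    and "Cinf (\<lambda>y. E (q - (0, y :: real^3)))"
proof -
  have L: "bounded_linear (\<lambda>y::real^3. (0::real, - y))"
    by (intro bounded_linear_Pair bounded_linear_zero bounded_linear_minus bounded_linear_ident)
  have s: "(0, - y) + q = q - (0, y)" for y by (cases q) simp
  then have e: "(\<lambda>y. E (q - (0, y))) = (\<lambda>y. E ((0, - y) + q))" by (simp only:)
  show "Cinf (\<lambda>y. E (q - (0, y)))" unfolding e by (rule Cinf_compose_affine[OF L m])
  have d: "E differentiable (at p)" for p by (rule Cinf_differentiable[OF m])
  have "dd (axis i 1) (\<lambda>y. E (q - (0, y))) y = dd (0, - axis i 1) E ((0, - y) + q)"
    unfolding e by (rule dd_eq[OF dd_compose_affine[OF L d]])
  also have "(0, - axis i 1) = (- 1) *\<^sub>R (0::real, axis i 1 :: real^3)" by simp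
  also have "dd ((- 1) *\<^sub>R (0, axis i 1)) E ((0, - y) + q) = - Dx i E ((0, - y) + q)"
    by (subst dd_scale(1)[OF d]) simp
  finally show "dd (axis i 1) (\<lambda>y. E (q - (0, y))) y = - Dx i E (q - (0, y))" unfolding s .
qed

lemma test_fnI:
  fixes \<phi> :: "'a::euclidean_space \<Rightarrow> real"
  assumes "Cinf \<phi>" "\<And>x. norm x > R \<Longrightarrow> \<phi> x = 0"
  shows "test_fn UNIV \<phi>"
proof -
  have "{x. \<phi> x \<noteq> 0} \<subseteq> cball 0 R" using assms(2) by (force simp: not_less[symmetric])
  then have "closure {x. \<phi> x \<noteq> 0} \<subseteq> cball 0 R" by (intro closure_minimal) auto
  then have "compact (closure {x. \<phi> x \<noteq> 0})" by (meson bounded_cball bounded_subset closed_closure compact_eq_bounded_closed)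
  then show ?thesis using assms(1) by (simp add: test_fn_def tsupp_def smooth_fn_iff_Cinf)
qed

subsection \<open>Approximation of finite energy data by smooth waves\<close>

text \<open>Continuity from above of the finite measure with density F along the sets \<rho> > n,
  whose intersection is empty.\<close>

lemma nn_integral_tail:
  fixes \<rho> :: "'a \<Rightarrow> real" and F :: "'a \<Rightarrow> ennreal"
  assumes [measurable]: "F \<in> borel_measurable M" "\<rho> \<in> borel_measurable M"
    and fin: "(\<integral>\<^sup>+x. F x \<partial>M) < \<infinity>" and \<delta>: "\<delta> > 0"
  shows "\<exists>R0. \<forall>R\<ge>R0. (\<integral>\<^sup>+x. F x * indicator {x. \<rho> x > R} x \<partial>M) \<le> ennreal \<delta>"
proof -
  define A where "A n = {x \<in> space M. \<rho> x > real n}" for n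
  have [measurable]: "A n \<in> sets M" for n unfolding A_def by measurable
  have em: "emeasure (density M F) (A n) = (\<integral>\<^sup>+x. F x * indicator (A n) x \<partial>M)" for n by (rule emeasure_density) auto
  have "(\<lambda>n. emeasure (density M F) (A n)) \<longlonglongrightarrow> emeasure (density M F) (\<Inter>n. A n)"
  proof (rule Lim_emeasure_decseq)
    show "range A \<subseteq> sets (density M F)" by auto
    show "decseq A" unfolding decseq_def A_def by auto
    fix n
    have "(\<integral>\<^sup>+x. F x * indicator (A n) x \<partial>M) \<le> (\<integral>\<^sup>+x. F x \<partial>M)"
      by (intro nn_integral_mono) (auto simp: indicator_def)
    then show "emeasure (density M F) (A n) \<noteq> \<infinity>" unfolding em using fin by (auto simp: top_unique)
  qed
  moreover have "(\<Inter>n. A n) = {}"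
  proof -
    have "\<exists>n. x \<notin> A n" for x using real_arch_simple[of "\<rho> x"] by (auto simp: A_def not_less)
    then show ?thesis by blast
  qed
  ultimately have "(\<lambda>n. emeasure (density M F) (A n)) \<longlonglongrightarrow> 0" by simp
  then have "eventually (\<lambda>n. emeasure (density M F) (A n) < ennreal \<delta>) sequentially"
    using \<delta> by (intro order_tendstoD) auto
  then obtain n where n: "emeasure (density M F) (A n) < ennreal \<delta>" unfolding eventually_sequentially by blast
  show ?thesis
  proof (intro exI[of _ "real n"] allI impI)
    fix R assume "real n \<le> R"
    then have "(\<integral>\<^sup>+x. F x * indicator {x. \<rho> x > R} x \<partial>M) \<le> (\<integral>\<^sup>+x. F x * indicator (A n) x \<partial>M)"
      by (intro nn_integral_mono mult_left_mono) (auto simp: indicator_def A_def)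
    then show "(\<integral>\<^sup>+x. F x * indicator {x. \<rho> x > R} x \<partial>M) \<le> ennreal \<delta>" using n em by simp
  qed
qed

lemma e2_cong: "(\<And>x. \<bar>f x\<bar> = \<bar>g x\<bar>) \<Longrightarrow> e2 f = e2 g"
  unfolding e2_def by (metis power2_abs)

lemma e2_mono: "(\<And>x. \<bar>f x\<bar> \<le> \<bar>g x\<bar>) \<Longrightarrow> e2 f \<le> e2 g"
  unfolding e2_def by (intro nn_integral_mono ennreal_leI) (simp add: abs_le_square_iff)

lemma e2_add:
  assumes [measurable]: "f \<in> borel_measurable borel" "g \<in> borel_measurable borel"
  shows "e2 (\<lambda>x. f x + g x) \<le> 2 * e2 f + 2 * e2 g"
proof -
  have "ennreal ((f x + g x)^2) \<le> 2 * ennreal ((f x)^2) + 2 * ennreal ((g x)^2)" for x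
  proof -
    have "(f x + g x)^2 \<le> 2 * (f x)^2 + 2 * (g x)^2" using sum_squares_bound[of "f x" "g x"] by (simp add: power2_sum)
    then have "ennreal ((f x + g x)^2) \<le> ennreal (2 * (f x)^2 + 2 * (g x)^2)" by (rule ennreal_leI)
    also have "ennreal (2 * (f x)^2 + 2 * (g x)^2) = 2 * ennreal ((f x)^2) + 2 * ennreal ((g x)^2)"
      by (subst ennreal_plus) (simp_all add: ennreal_mult')
    finally show ?thesis .
  qed
  then have "e2 (\<lambda>x. f x + g x) \<le> (NNINT x. 2 * ennreal ((f x)^2) + 2 * ennreal ((g x)^2))"
    unfolding e2_def by (rule nn_integral_mono)
  also have "\<dots> = 2 * e2 f + 2 * e2 g" unfolding e2_def by (simp add: nn_integral_add nn_integral_cmult)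
  finally show ?thesis .
qed

lemma e2_minus_commute: "e2 (\<lambda>x. f x - g x) = e2 (\<lambda>x. g x - f x)"
  by (rule e2_cong) simp

text \<open>The factors 2 come from (a + b)^2 \<le> 2 a^2 + 2 b^2 and determine the fractions of
  \<delta> chosen in the applications.\<close>

lemma e2_triangle:
  assumes [measurable]: "a \<in> borel_measurable borel" "b \<in> borel_measurable borel" "c \<in> borel_measurable borel"
    and 1: "e2 (\<lambda>x. a x - b x) \<le> ennreal r" and 2: "e2 (\<lambda>x. b x - c x) \<le> ennreal s" and "0 \<le> r" "0 \<le> s" "2 * r + 2 * s \<le> d"
  shows "e2 (\<lambda>x. a x - c x) \<le> ennreal d"
proof -
  have "e2 (\<lambda>x. a x - c x) = e2 (\<lambda>x. (a x - b x) + (b x - c x))" by simp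
  also have "\<dots> \<le> 2 * e2 (\<lambda>x. a x - b x) + 2 * e2 (\<lambda>x. b x - c x)" by (rule e2_add) measurable
  also have "\<dots> \<le> 2 * ennreal r + 2 * ennreal s" by (intro add_mono mult_left_mono 1 2) auto
  also have "\<dots> = ennreal (2 * r + 2 * s)" using assms by (simp add: ennreal_mult')
  also have "\<dots> \<le> ennreal d" using assms by (intro ennreal_leI)
  finally show ?thesis .
qed


lemma epowr_finite: "epowr a p < \<infinity> \<longleftrightarrow> a < \<infinity>"
  by (auto simp: epowr_def less_top[symmetric])

lemma Lpn_2_finite: "Lpn 2 f < \<infinity> \<longleftrightarrow> e2 f < \<infinity>"
proof -
  have "\<bar>f x\<bar> powr 2 = (f x)^2" for x by (cases "f x = 0") (simp_all add: powr_numeral)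
  then show ?thesis unfolding Lpn_def epowr_finite e2_def by simp
qed

lemma Lpn_6_finite: "Lpn 6 f < \<infinity> \<longleftrightarrow> (NNINT x. ennreal (f x ^ 6)) < \<infinity>"
proof -
  have "\<bar>f x\<bar> powr 6 = f x ^ 6" for x by (cases "f x = 0") (simp_all add: powr_numeral power_even_abs)
  then show ?thesis unfolding Lpn_def epowr_finite by simp
qed

section \<open>Cut-off errors for functions in L^6 and L^2\<close>

lemma dd_cutoff: "dd b (cutoff R) x = - (sig ((1 / R^2) * (x \<bullet> x) - 1) * ((2 / R^2) * (b \<bullet> x)))"
proof -
  have "((\<lambda>x::'a. c * (x \<bullet> x) - 1) has_derivative (\<lambda>b. 2 * c * (b \<bullet> x))) (at x)" for c
    by (auto intro!: derivative_eq_intros simp: inner_commute)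
  from this[of "1 / R^2"] have 1: "((\<lambda>x::'a. (1 / R^2) * (x \<bullet> x) - 1) has_derivative (\<lambda>b. (2 / R^2) * (b \<bullet> x))) (at x)"
    by (simp only: times_divide_eq_right mult_1_right)
  have "((\<lambda>x. sstep ((1 / R^2) * (x \<bullet> x) - 1)) has_derivative (\<lambda>b. ((2 / R^2) * (b \<bullet> x)) * sig ((1 / R^2) * (x \<bullet> x) - 1))) (at x)"
    by (rule DERIV_compose_FDERIV[OF sstep_props(2) 1])
  from has_derivative_diff[OF has_derivative_const[of 1] this]
  show ?thesis unfolding cutoff_def[abs_def] by (subst dd_eq) (auto simp: mult.commute)
qed

lemma sig_bounded: "\<exists>M>0. \<forall>s. sig s \<le> M"
proof -
  have "compact (sig ` {0..1})" by (intro compact_continuous_image continuous_on_subset[OF Cinf_continuous[OF Cinf_dd[OF sstep_props(1)]]]) auto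
  then obtain M where M: "\<And>s. s \<in> {0..1} \<Longrightarrow> \<bar>sig s\<bar> \<le> M" using compact_imp_bounded bounded_iff by (metis imageI real_norm_def)
  have "sig s \<le> max M 1" for s
    using M[of s] sstep_props(5)[of s] sstep_props(7)[of s] by (cases "s \<le> 0"; cases "s \<ge> 1") auto
  then show ?thesis by (intro exI[of _ "max M 1"]) auto
qed

lemma dd_cutoff_bound:
  "\<exists>C>0. \<forall>R>0. \<forall>x::real^3. \<forall>i. \<bar>dd (axis i 1) (cutoff R) x\<bar> \<le> C / R \<and> (norm x \<le> R \<or> norm x > 2 * R \<longrightarrow> dd (axis i 1) (cutoff R) x = 0)"
proof -
  obtain M where M: "M > 0" "\<And>s. sig s \<le> M" using sig_bounded by blast
  show ?thesis
  proof (intro exI[of _ "4 * M"] conjI allI impI)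
    show "4 * M > 0" using M by simp
    fix R :: real and x :: "real^3" and i assume R: "R > 0"
    define a where "a = norm x / R"
    have e: "(1 / R^2) * (x \<bullet> x) = a^2" unfolding a_def power_divide dot_square_norm by simp
    have a0: "a \<ge> 0" using R by (simp add: a_def)
    have z: "sig (a^2 - 1) = 0" if "a \<le> 1 \<or> a > 2"
    proof (cases "a \<le> 1")
      case True
      then have "a^2 \<le> 1" using a0 by (simp add: power_le_one)
      then show ?thesis by (intro sstep_props(5)) simp
    next
      case False
      then have "a > 2" using that by simp
      then have "2^2 \<le> a^2" by (intro power_mono) auto
      then show ?thesis by (intro sstep_props(7)) simp
    qed
    show zz: "dd (axis i 1) (cutoff R) x = 0" if "norm x \<le> R \<or> norm x > 2 * R"
    proof -
      have "a \<le> 1 \<or> a > 2" using that R unfolding a_def by (auto simp: pos_less_divide_eq)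
      then show ?thesis unfolding dd_cutoff e using z by simp
    qed
    show "\<bar>dd (axis i 1) (cutoff R) x\<bar> \<le> 4 * M / R"
    proof (cases "norm x > 2 * R")
      case True
      then show ?thesis using zz M R by simp
    next
      case False
      have "\<bar>axis i 1 \<bullet> x\<bar> \<le> norm x" using component_le_norm_cart[of x i] by (simp add: inner_axis')
      then have "\<bar>axis i 1 \<bullet> x\<bar> \<le> 2 * R" using False by simp
      then have "(2 / R^2) * \<bar>axis i 1 \<bullet> x\<bar> \<le> (2 / R^2) * (2 * R)" by (intro mult_left_mono) auto
      also have "\<dots> = 4 / R" using R by (simp add: power2_eq_square)
      finally have 1: "(2 / R^2) * \<bar>axis i 1 \<bullet> x\<bar> \<le> 4 / R" .
      have "\<bar>dd (axis i 1) (cutoff R) x\<bar> = sig (a^2 - 1) * ((2 / R^2) * \<bar>axis i 1 \<bullet> x\<bar>)"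
        unfolding dd_cutoff e using sstep_props(3)[of "a^2 - 1"] by (simp add: abs_mult)
      also have "\<dots> \<le> M * (4 / R)" using M 1 R by (intro mult_mono) auto
      finally show ?thesis by (simp add: mult.commute)
    qed
  qed
qed

text \<open>A pointwise replacement for Hoelder's inequality between L^6 and the volume of a ball of
  radius 2 R: either f^2 is below the threshold 1 / (\<nu> R), or 1 / R is at most \<nu> f^2 and
  both such factors turn into powers of f.\<close>

lemma square_split_bound:
  fixes f R \<nu> :: real
  assumes "R > 0" "\<nu> > 0"
  shows "f^2 / R^2 \<le> \<nu>^2 * f ^ 6 + 1 / (\<nu> * R ^ 3)"
proof (cases "f^2 \<le> 1 / (\<nu> * R)")
  case True
  then have "f^2 / R^2 \<le> (1 / (\<nu> * R)) / R^2" by (intro divide_right_mono) auto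
  also have "\<dots> = 1 / (\<nu> * R ^ 3)" using assms by (simp add: power2_eq_square power3_eq_cube)
  finally show ?thesis by (smt (verit) zero_le_mult_iff zero_le_power2 zero_le_even_power even_numeral)
next
  case False
  then have "1 / R \<le> \<nu> * f^2" using assms by (simp add: field_simps)
  then have "(1 / R)^2 \<le> (\<nu> * f^2)^2" using assms by (intro power_mono) auto
  then have "f^2 * (1 / R)^2 \<le> f^2 * (\<nu> * f^2)^2" by (intro mult_left_mono) auto
  also have "\<dots> = \<nu>^2 * f ^ 6" by (simp add: power_mult_distrib power2_eq_square numeral_eq_Suc)
  finally have "f^2 / R^2 \<le> \<nu>^2 * f ^ 6" by (simp add: power_divide)
  moreover have "0 \<le> 1 / (\<nu> * R ^ 3)" using assms by simp
  ultimately show ?thesis by linarith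
qed

text \<open>As f is only known to be in L^6, the bound C / R for the gradient of the cut-off has to
  compete with the volume of order R^3 of its support. The two balance up to the tail of f^6, which
  provides the smallness.\<close>

lemma cutoff_gradient_small:
  fixes f :: "real^3 \<Rightarrow> real"
  assumes [measurable]: "f \<in> borel_measurable borel" and fin: "(NNINT x. ennreal (f x ^ 6)) < \<infinity>" and \<delta>: "\<delta> > 0"
  shows "\<exists>R0>0. \<forall>R\<ge>R0. \<forall>i. e2 (\<lambda>x. f x * dd (axis i 1) (cutoff R) x) \<le> ennreal \<delta>"
proof -
  obtain C where C: "C > 0" "\<And>R x i. R > 0 \<Longrightarrow> \<bar>dd (axis i 1) (cutoff R) (x::real^3)\<bar> \<le> C / R"
    "\<And>R x i. R > 0 \<Longrightarrow> norm x \<le> R \<or> norm x > 2 * R \<Longrightarrow> dd (axis i 1) (cutoff R) (x::real^3) = 0"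
    using dd_cutoff_bound by blast
  define V where "V = unit_ball_vol 3 * 8"
  have V: "V > 0" by (simp add: V_def unit_ball_vol_pos)
  have vol: "emeasure lborel (cball (0::real^3) (2 * R)) = ennreal (V * R ^ 3)" if "R > 0" for R
    using that by (subst emeasure_cball) (auto simp: V_def power_mult_distrib mult_ac)
  \<comment> \<open>Makes the constant part C^2 V / \<nu> equal to \<delta> / 2; the tail of f^6 is
    then taken small depending on \<nu>.\<close>
  define \<nu> where "\<nu> = 2 * C^2 * V / \<delta>"
  have \<nu>: "\<nu> > 0" using C V \<delta> by (simp add: \<nu>_def)
  have "\<exists>R0. \<forall>R\<ge>R0. (NNINT x. ennreal (f x ^ 6) * indicator {x. norm x > R} x) \<le> ennreal (\<delta> / (2 * C^2 * \<nu>^2))"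
    using fin \<delta> C \<nu> by (intro nn_integral_tail) auto
  then obtain R0 where R0: "\<And>R. R \<ge> R0 \<Longrightarrow> (NNINT x. ennreal (f x ^ 6) * indicator {x. norm x > R} x) \<le> ennreal (\<delta> / (2 * C^2 * \<nu>^2))"
    by blast
  show ?thesis
  proof (intro exI[of _ "max R0 1"] conjI allI impI)
    fix R i assume "R \<ge> max R0 1"
    then have R: "R > 0" "R \<ge> R0" by auto
    have pw: "ennreal ((f x * dd (axis i 1) (cutoff R) x)^2) \<le>
       ennreal (C^2 * \<nu>^2) * (ennreal (f x ^ 6) * indicator {x. norm x > R} x) + ennreal (C^2 / (\<nu> * R ^ 3)) * indicator (cball 0 (2 * R)) x" for x
    proof (cases "norm x \<le> R \<or> norm x > 2 * R")
      case True
      then show ?thesis using C(3)[OF R(1)] by simp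
    next
      case False
      have "(dd (axis i 1) (cutoff R) x)^2 \<le> (C / R)^2"
        using C(2)[OF R(1), of i x] C(1) R by (metis abs_ge_zero power2_abs power_mono)
      then have "(f x * dd (axis i 1) (cutoff R) x)^2 \<le> (f x)^2 * (C / R)^2"
        unfolding power_mult_distrib by (intro mult_left_mono) auto
      also have "\<dots> = C^2 * ((f x)^2 / R^2)" by (simp add: power_divide)
      also have "\<dots> \<le> C^2 * (\<nu>^2 * f x ^ 6 + 1 / (\<nu> * R ^ 3))" using R \<nu> by (intro mult_left_mono square_split_bound) auto
      also have "\<dots> = C^2 * \<nu>^2 * f x ^ 6 + C^2 / (\<nu> * R ^ 3)" by (simp add: algebra_simps)
      finally have "ennreal ((f x * dd (axis i 1) (cutoff R) x)^2) \<le> ennreal (C^2 * \<nu>^2 * f x ^ 6 + C^2 / (\<nu> * R ^ 3))" by (rule ennreal_leI)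
      also have "\<dots> = ennreal (C^2 * \<nu>^2) * ennreal (f x ^ 6) + ennreal (C^2 / (\<nu> * R ^ 3))"
        using R \<nu> by (subst ennreal_plus) (auto simp: ennreal_mult zero_le_even_power)
      finally show ?thesis using False by (simp add: indicator_def)
    qed
    have [measurable]: "cball 0 (2 * R) \<in> sets (borel :: (real^3) measure)" by simp
    have "e2 (\<lambda>x. f x * dd (axis i 1) (cutoff R) x) \<le> (NNINT x. ennreal (C^2 * \<nu>^2) * (ennreal (f x ^ 6) * indicator {x. norm x > R} x)
       + ennreal (C^2 / (\<nu> * R ^ 3)) * indicator (cball 0 (2 * R)) x)"
      unfolding e2_def by (intro nn_integral_mono pw)
    also have "\<dots> = ennreal (C^2 * \<nu>^2) * (NNINT x. ennreal (f x ^ 6) * indicator {x. norm x > R} x)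
       + ennreal (C^2 / (\<nu> * R ^ 3)) * ennreal (V * R ^ 3)"
      by (subst nn_integral_add, measurable, subst nn_integral_cmult, measurable, subst nn_integral_cmult, measurable)
         (simp add: vol[OF R(1)])
    also have "\<dots> \<le> ennreal (C^2 * \<nu>^2) * ennreal (\<delta> / (2 * C^2 * \<nu>^2)) + ennreal (C^2 / (\<nu> * R ^ 3)) * ennreal (V * R ^ 3)"
      by (intro add_right_mono mult_left_mono R0 R) auto
    also have "\<dots> = ennreal (\<delta> / 2) + ennreal (\<delta> / 2)"
    proof -
      have "C^2 * \<nu>^2 * (\<delta> / (2 * C^2 * \<nu>^2)) = \<delta> / 2" using C \<nu> by simp
      moreover have "C^2 / (\<nu> * R ^ 3) * (V * R ^ 3) = \<delta> / 2"
        using C \<delta> V R by (simp add: \<nu>_def)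
      ultimately show ?thesis using C(1) \<nu> \<delta> V R(1)
        by (subst ennreal_mult[symmetric], simp, simp, subst ennreal_mult[symmetric], simp, simp) (simp only:)
    qed
    also have "\<dots> = ennreal \<delta>" using \<delta> by (simp add: ennreal_plus[symmetric] del: ennreal_plus)
    finally show "e2 (\<lambda>x. f x * dd (axis i 1) (cutoff R) x) \<le> ennreal \<delta>" .
  qed simp
qed

lemma cutoff_remainder_small:
  fixes g :: "real^3 \<Rightarrow> real"
  assumes [measurable]: "g \<in> borel_measurable borel" and fin: "e2 g < \<infinity>" and \<delta>: "\<delta> > 0"
  shows "\<exists>R0>0. \<forall>R\<ge>R0. e2 (\<lambda>x. g x - cutoff R x * g x) \<le> ennreal \<delta>"
proof -
  have "\<exists>R0. \<forall>R\<ge>R0. (NNINT x. ennreal ((g x)^2) * indicator {x. norm x > R} x) \<le> ennreal \<delta>"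
    using fin \<delta> unfolding e2_def by (intro nn_integral_tail) auto
  then obtain R0 where R0: "\<And>R. R \<ge> R0 \<Longrightarrow> (NNINT x. ennreal ((g x)^2) * indicator {x. norm x > R} x) \<le> ennreal \<delta>" by blast
  show ?thesis
  proof (intro exI[of _ "max R0 1"] conjI allI impI)
    fix R assume "R \<ge> max R0 1"
    then have R: "R > 0" "R \<ge> R0" by auto
    have "ennreal ((g x - cutoff R x * g x)^2) \<le> ennreal ((g x)^2) * indicator {x. norm x > R} x" for x
    proof (cases "norm x \<le> R")
      case True
      then show ?thesis using cutoff_eq(1)[OF R(1) True] by simp
    next
      case False
      have "\<bar>1 - cutoff R x\<bar> \<le> 1" using cutoff_bounds[of R x] by simp
      then have "\<bar>(1 - cutoff R x) * g x\<bar> \<le> \<bar>g x\<bar>" by (simp add: abs_mult mult_left_le_one_le)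
      then have "(g x - cutoff R x * g x)^2 \<le> (g x)^2" by (simp add: abs_le_square_iff algebra_simps)
      then show ?thesis using False by (simp add: ennreal_leI)
    qed
    then have "e2 (\<lambda>x. g x - cutoff R x * g x) \<le> (NNINT x. ennreal ((g x)^2) * indicator {x. norm x > R} x)"
      unfolding e2_def by (rule nn_integral_mono)
    then show "e2 (\<lambda>x. g x - cutoff R x * g x) \<le> ennreal \<delta>" using R0[OF R(2)] by simp
  qed simp
qed

text \<open>On the ball |g| \<le> 1 + |g|^n; applied with n = 2 and n = 6.\<close>

lemma integrable_compact_power:
  fixes g :: "'a::euclidean_space \<Rightarrow> real"
  assumes [measurable]: "g \<in> borel_measurable borel" and fin: "(NNINT x. ennreal (\<bar>g x\<bar> ^ n)) < \<infinity>"
    and n: "n > 0" and S: "\<And>x. norm x > S \<Longrightarrow> g x = 0"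
  shows "integrable lborel g"
proof (rule integrableI_bounded)
  show "g \<in> borel_measurable lborel" by simp
  have [measurable]: "cball 0 S \<in> sets (borel :: 'a measure)" by simp
  have pw: "ennreal (norm (g x)) \<le> indicator (cball 0 S) x + ennreal (\<bar>g x\<bar> ^ n)" for x
  proof (cases "norm x \<le> S")
    case True
    have "\<bar>g x\<bar> \<le> 1 + \<bar>g x\<bar> ^ n"
    proof (cases "\<bar>g x\<bar> \<le> 1")
      case True then show ?thesis by (simp add: add_increasing2)
    next
      case False
      then have "\<bar>g x\<bar> ^ 1 \<le> \<bar>g x\<bar> ^ n" using n by (intro power_increasing) auto
      then show ?thesis by simp
    qed
    then have "ennreal \<bar>g x\<bar> \<le> ennreal (1 + \<bar>g x\<bar> ^ n)" by (rule ennreal_leI)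
    then show ?thesis using True by (simp add: ennreal_plus)
  qed (simp add: S)
  have "(NNINT x. ennreal (norm (g x))) \<le> (NNINT x. indicator (cball 0 S) x + ennreal (\<bar>g x\<bar> ^ n))"
    by (intro nn_integral_mono pw)
  also have "\<dots> = emeasure lborel (cball (0::'a) S) + (NNINT x. ennreal (\<bar>g x\<bar> ^ n))"
    by (subst nn_integral_add, measurable)
  also have "\<dots> < \<infinity>" using fin emeasure_lborel_cball_finite[of 0 S] by (simp add: ennreal_add_less_top)
  finally show "(NNINT x. ennreal (norm (g x))) < \<infinity>" .
qed

lemma nice_wave_shift:
  assumes z: "nice_wave z"
  shows "nice_wave (\<lambda>p. z (p + (c, 0)))" and "dd b (\<lambda>p. z (p + (c, 0))) = (\<lambda>p. dd b z (p + (c, 0)))"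
proof -
  have d: "dd b (\<lambda>p. f (p + (c, 0))) = (\<lambda>p. dd b f (p + (c, 0)))" if "Cinf f" for f :: "spacetime \<Rightarrow> real" and b
    using dd_eq[OF dd_compose_affine[OF bounded_linear_ident, of f _ "(c, 0)"]] Cinf_differentiable[OF that] by (intro ext) auto
  have C: "Cinf z" using z by (rule nice_wave_Cinf)
  show "dd b (\<lambda>p. z (p + (c, 0))) = (\<lambda>p. dd b z (p + (c, 0)))" by (rule d[OF C])
  show "nice_wave (\<lambda>p. z (p + (c, 0)))" unfolding nice_wave_def d[OF C] d[OF Cinf_dd[OF C]]
  proof (intro conjI allI)
    show "Cinf (\<lambda>p. z (p + (c, 0)))" by (rule Cinf_compose_affine[OF bounded_linear_ident C])
    obtain R where R: "cone_supp R z" using z unfolding nice_wave_def by blast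
    have "z ((t, x) + (c, 0)) = 0" if "norm x > R + \<bar>c\<bar> + \<bar>t\<bar>" for t and x :: "real^3"
      using R that unfolding cone_supp_def by (simp add: abs_triangle_ineq)
    then show "\<exists>R. cone_supp R (\<lambda>p. z (p + (c, 0)))" unfolding cone_supp_def by blast
    show "Dt (Dt z) (p + (c, 0)) = (\<Sum>i\<in>UNIV. Dx i (Dx i z) (p + (c, 0)))" for p using z unfolding nice_wave_def by blast
  qed
qed

text \<open>With \<kappa> a cut-off at radius R and E the mollifying wave, the convolution of
  \<kappa> f with E_t plus that of \<kappa> g with E is a smooth wave whose data at time 0 are the
  mollified cut-off data. Its gradient involves the extra term f grad \<kappa>, which is small for
  large R because f is in L^6.\<close>

lemma nice_approx_0:
  assumes H: "Hdot1 f df" and g: "L2mem g" and \<delta>: "\<delta> > 0"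
  shows "\<exists>w. nice_wave w \<and> e2 (\<lambda>x. g x - Dt w (0, x)) \<le> ennreal \<delta> \<and> (\<forall>i. e2 (\<lambda>x. df x $ i - Dx i w (0, x)) \<le> ennreal \<delta>)"
proof -
  have fm [measurable]: "f \<in> borel_measurable borel" and f6: "(NNINT x. ennreal (f x ^ 6)) < \<infinity>" and wg: "weak_grad f df"
    and dfm: "df \<in> borel_measurable borel" and df2: "e2 (\<lambda>x. norm (df x)) < \<infinity>"
    using H unfolding Hdot1_def Lpn_6_finite Lpn_2_finite by auto
  have gm [measurable]: "g \<in> borel_measurable borel" and g2: "e2 g < \<infinity>" using g unfolding L2mem_def Lpn_2_finite by auto
  have dfim [measurable]: "(\<lambda>x. df x $ i) \<in> borel_measurable borel" for i
    by (rule measurable_compose[OF dfm]) (intro borel_measurable_continuous_onI continuous_intros)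
  have dfi2: "e2 (\<lambda>x. df x $ i) < \<infinity>" for i
    using le_less_trans[OF e2_mono[of "\<lambda>x. df x $ i" "\<lambda>x. norm (df x)"] df2] component_le_norm_cart[of "df _" i] by simp
  \<comment> \<open>Two nested uses of \<open>e2_triangle\<close> add up to 2 (4 \<delta>1) + 2
    \<delta>1 = 10 \<delta>1.\<close>
  define \<delta>1 where "\<delta>1 = \<delta> / 10"
  have \<delta>1: "\<delta>1 > 0" using \<delta> by (simp add: \<delta>1_def)
  obtain Rf where Rf: "Rf > 0" "\<And>R i. R \<ge> Rf \<Longrightarrow> e2 (\<lambda>x. f x * dd (axis i 1) (cutoff R) x) \<le> ennreal \<delta>1"
    using cutoff_gradient_small[OF fm f6 \<delta>1] by blast
  obtain Rg where Rg: "Rg > 0" "\<And>R. R \<ge> Rg \<Longrightarrow> e2 (\<lambda>x. g x - cutoff R x * g x) \<le> ennreal \<delta>1"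
    using cutoff_remainder_small[OF gm g2 \<delta>1] by blast
  have "\<forall>i. \<exists>Ri>0. \<forall>R\<ge>Ri. e2 (\<lambda>x. df x $ i - cutoff R x * df x $ i) \<le> ennreal \<delta>1"
    using cutoff_remainder_small[OF dfim dfi2 \<delta>1] by blast
  from choice[OF this] obtain Ri where Ri: "\<And>i. Ri i > 0" "\<And>i R. R \<ge> Ri i \<Longrightarrow> e2 (\<lambda>x. df x $ i - cutoff R x * df x $ i) \<le> ennreal \<delta>1"
    by blast
  define R where "R = Rf + Rg + Ri 1 + Ri 2 + Ri 3"
  have "R \<ge> Ri 1" "R \<ge> Ri 2" "R \<ge> Ri 3" using Rf(1) Rg(1) Ri(1)[of 1] Ri(1)[of 2] Ri(1)[of 3] by (simp_all add: R_def)
  then have RRi: "R \<ge> Ri i" for i using exhaust_3[of i] by auto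
  have RR: "R > 0" "R \<ge> Rf" "R \<ge> Rg" using Rf(1) Rg(1) Ri(1)[of 1] Ri(1)[of 2] Ri(1)[of 3] by (simp_all add: R_def)
  define \<kappa> where "\<kappa> = (cutoff R :: real^3 \<Rightarrow> real)"
  define D\<kappa> where "D\<kappa> i = dd (axis i 1) \<kappa>" for i
  have C\<kappa>: "Cinf \<kappa>" unfolding \<kappa>_def by (rule Cinf_cutoff)
  have \<kappa>m [measurable]: "\<kappa> \<in> borel_measurable borel" by (rule Cinf_measurable[OF C\<kappa>])
  have D\<kappa>m [measurable]: "D\<kappa> i \<in> borel_measurable borel" for i unfolding D\<kappa>_def by (rule Cinf_measurable[OF Cinf_dd[OF C\<kappa>]])
  have \<kappa>b: "\<bar>\<kappa> x\<bar> \<le> 1" for x unfolding \<kappa>_def using cutoff_bounds[of R x] by simp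
  define S where "S = 2 * R"
  have \<kappa>0: "\<kappa> x = 0" if "norm x > S" for x using cutoff_eq(2)[OF RR(1), of x] that unfolding \<kappa>_def S_def by simp
  have D\<kappa>0: "D\<kappa> i x = 0" if "norm x > S" for i x
    using dd_cutoff_bound RR(1) that unfolding D\<kappa>_def \<kappa>_def S_def by blast
  define fR where "fR x = \<kappa> x * f x" for x
  define h where "h i x = f x * D\<kappa> i x" for i x
  \<comment> \<open>The weak gradient of \<kappa> f, split into its main part and the cut-off error
    h.\<close>
  define G where "G i x = \<kappa> x * df x $ i + h i x" for i x
  define gR where "gR x = \<kappa> x * g x" for x
  have [measurable]: "fR \<in> borel_measurable borel" "h i \<in> borel_measurable borel" "G i \<in> borel_measurable borel" "gR \<in> borel_measurable borel" for i
    unfolding fR_def[abs_def] h_def[abs_def] G_def[abs_def] gR_def[abs_def] by measurable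
  have le1: "\<bar>\<kappa> x * a\<bar> \<le> \<bar>a\<bar>" for x a using \<kappa>b[of x] by (simp add: abs_mult mult_left_le_one_le)
  have h2: "e2 (h i) \<le> ennreal \<delta>1" for i using Rf(2)[OF RR(2), of i] unfolding h_def D\<kappa>_def \<kappa>_def .
  have hfin: "e2 (h i) < \<infinity>" for i using le_less_trans[OF h2] by simp
  have gR2: "e2 gR < \<infinity>" using le_less_trans[OF e2_mono[of gR g] g2] le1 by (simp add: gR_def)
  have \<kappa>df2: "e2 (\<lambda>x. \<kappa> x * df x $ i) < \<infinity>" for i using le_less_trans[OF e2_mono[of "\<lambda>x. \<kappa> x * df x $ i" "\<lambda>x. df x $ i"] dfi2] le1 by simp
  have G2: "e2 (G i) < \<infinity>" for i
  proof -
    have "e2 (G i) \<le> 2 * e2 (\<lambda>x. \<kappa> x * df x $ i) + 2 * e2 (h i)" unfolding G_def by (rule e2_add) measurable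
    also have "\<dots> < \<infinity>" using \<kappa>df2[of i] hfin[of i] by (simp add: ennreal_add_less_top ennreal_mult_less_top)
    finally show ?thesis .
  qed
  have int2: "integrable lborel F" if "F \<in> borel_measurable borel" "e2 F < \<infinity>" "\<And>x. norm x > S \<Longrightarrow> F x = 0" for F :: "real^3 \<Rightarrow> real"
    using that by (intro integrable_compact_power[of F 2 S]) (simp_all add: e2_def)
  have ifR: "integrable lborel fR"
  proof (rule integrable_compact_power[of fR 6 S])
    have "\<bar>fR x\<bar> ^ 6 \<le> f x ^ 6" for x
    proof -
      have "\<bar>fR x\<bar> ^ 6 \<le> \<bar>f x\<bar> ^ 6" unfolding fR_def by (intro power_mono le1) auto
      then show ?thesis by (simp add: power_even_abs)
    qed
    then have "(NNINT x. ennreal (\<bar>fR x\<bar> ^ 6)) \<le> (NNINT x. ennreal (f x ^ 6))" by (intro nn_integral_mono ennreal_leI)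
    then show "(NNINT x. ennreal (\<bar>fR x\<bar> ^ 6)) < \<infinity>" using f6 by (rule le_less_trans)
  qed (simp_all add: fR_def \<kappa>0)
  have igR: "integrable lborel gR" by (rule int2) (use gR2 in \<open>simp_all add: gR_def \<kappa>0\<close>)
  have iG: "integrable lborel (G i)" for i by (rule int2) (use G2 in \<open>simp_all add: G_def h_def \<kappa>0 D\<kappa>0\<close>)
  have ih: "integrable lborel (h i)" for i by (rule int2) (use hfin in \<open>simp_all add: h_def D\<kappa>0\<close>)
  have "\<exists>d>0. \<forall>m. continuous_on UNIV m \<longrightarrow> (\<forall>x. m x \<ge> 0) \<longrightarrow> (LBINT x. m x) = 1 \<longrightarrow> (\<forall>x. norm x > d \<longrightarrow> m x = 0) \<longrightarrow>
     e2 (\<lambda>x. gR x - (LBINT y. gR y * m (x - y))) \<le> ennreal \<delta>1" by (rule mollification_converges[OF igR gR2 \<delta>1])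
  then obtain dg where dg: "dg > 0" "\<And>m. continuous_on UNIV m \<Longrightarrow> (\<forall>x. m x \<ge> 0) \<Longrightarrow> (LBINT x. m x) = 1 \<Longrightarrow> (\<forall>x. norm x > dg \<longrightarrow> m x = 0) \<Longrightarrow>
     e2 (\<lambda>x. gR x - (LBINT y. gR y * m (x - y))) \<le> ennreal \<delta>1" by blast
  have "\<forall>i. \<exists>d>0. \<forall>m. continuous_on UNIV m \<longrightarrow> (\<forall>x. m x \<ge> 0) \<longrightarrow> (LBINT x. m x) = 1 \<longrightarrow> (\<forall>x. norm x > d \<longrightarrow> m x = 0) \<longrightarrow>
     e2 (\<lambda>x. G i x - (LBINT y. G i y * m (x - y))) \<le> ennreal \<delta>1" using mollification_converges[OF iG G2 \<delta>1] by blast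
  from choice[OF this] obtain d where d0: "\<And>i. d i > 0" and d: "\<And>i m. continuous_on UNIV m \<Longrightarrow> (\<forall>x. m x \<ge> 0) \<Longrightarrow> (LBINT x. m x) = 1 \<Longrightarrow> (\<forall>x. norm x > d i \<longrightarrow> m x = 0) \<Longrightarrow>
     e2 (\<lambda>x. G i x - (LBINT y. G i y * m (x - y))) \<le> ennreal \<delta>1" by blast
  define \<epsilon> where "\<epsilon> = min dg (min (d 1) (min (d 2) (d 3)))"
  have \<epsilon>: "\<epsilon> > 0" "\<epsilon> \<le> dg" using dg(1) d0 by (simp_all add: \<epsilon>_def)
  have \<epsilon>i: "\<epsilon> \<le> d i" for i using exhaust_3[of i] unfolding \<epsilon>_def by auto
  obtain E where E: "nice_wave E" "cone_supp \<epsilon> E" "\<And>x. E (0, x) = 0" "\<And>x. Dt E (0, x) \<ge> 0"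
     "(LBINT x. Dt E (0, x)) = 1" "\<And>x. Dt (Dt E) (0, x) = 0" using mollifier_wave[OF \<epsilon>(1)] by blast
  have CE: "Cinf E" using E(1) by (rule nice_wave_Cinf)
  define m where "m x = Dt E (0, x)" for x
  have cm: "continuous_on UNIV m" unfolding m_def by (intro Cinf_continuous Cinf_slice Cinf_dd CE)
  have m0: "\<forall>x. m x \<ge> 0" and m1: "(LBINT x. m x) = 1" unfolding m_def using E by simp_all
  have ms: "m x = 0" if "norm x > \<epsilon>" for x using cone_supp_dd[OF E(2), of "(1,0)"] that unfolding m_def cone_supp_def by simp
  have mg: "e2 (\<lambda>x. gR x - (LBINT y. gR y * m (x - y))) \<le> ennreal \<delta>1"
    by (rule dg(2)[OF cm m0 m1]) (use ms \<epsilon>(2) in force)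
  have mG: "e2 (\<lambda>x. G i x - (LBINT y. G i y * m (x - y))) \<le> ennreal \<delta>1" for i
    by (rule d[OF cm m0 m1]) (use ms \<epsilon>i[of i] in force)
  interpret A: compact_density fR S by unfold_locales (use ifR in \<open>simp_all add: fR_def \<kappa>0\<close>)
  interpret B: compact_density "\<lambda>y. - gR y" S by unfold_locales (use igR in simp, simp add: gR_def \<kappa>0)
  \<comment> \<open>A double negation, so that the closure of smooth waves under differences
    applies.\<close>
  define w where "w p = conv fR (Dt E) p - conv (\<lambda>y. - gR y) E p" for p
  have w: "nice_wave w" unfolding w_def[abs_def]
    by (intro nice_wave_diff A.nice_wave_conv B.nice_wave_conv nice_wave_dd E(1))
  have dw: "dd b w p = conv fR (dd b (Dt E)) p - conv (\<lambda>y. - gR y) (dd b E) p" for b p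
  proof -
    have "dd b w p = dd b (conv fR (Dt E)) p - dd b (conv (\<lambda>y. - gR y) E) p" unfolding w_def[abs_def]
      by (intro dd_diff Cinf_differentiable A.Cinf_conv B.Cinf_conv Cinf_dd CE)
    then show ?thesis unfolding A.dd_conv[OF Cinf_dd[OF CE]] B.dd_conv[OF CE] .
  qed
  have Dtw: "Dt w (0, x) = (LBINT y. gR y * m (x - y))" for x
    unfolding dw conv_def by (simp add: E(6) m_def)
  have DxE: "Dx i E (0, x) = 0" for i x
  proof -
    have "(\<lambda>x. E (0, x)) = (\<lambda>_. 0)" using E(3) by (rule ext)
    then show ?thesis using dd_slice[OF Cinf_differentiable[OF CE], of "axis i 1" 0 x] by simp
  qed
  have Dxw: "Dx i w (0, x) = (LBINT y. G i y * m (x - y))" for i x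
  proof -
    define \<phi> where "\<phi> y = Dt E ((0, x) - (0, y))" for y
    define D\<phi> where "D\<phi> y = Dx i (Dt E) ((0, x) - (0, y))" for y
    have C\<phi>: "Cinf \<phi>" unfolding \<phi>_def by (rule dd_reflected_slice(2)[OF Cinf_dd[OF CE]])
    have d\<phi>: "dd (axis i 1) \<phi> y = - D\<phi> y" for y unfolding \<phi>_def D\<phi>_def by (rule dd_reflected_slice(1)[OF Cinf_dd[OF CE]])
    \<comment> \<open>Testing the weak gradient of f with \<kappa> \<phi>, where \<phi> is the
      reflected mollifier centred at x, yields the derivative of the convolution of \<kappa> f with
      the mollifier.\<close>
    define \<psi> where "\<psi> y = \<kappa> y * \<phi> y" for y
    have t\<psi>: "test_fn UNIV \<psi>" unfolding \<psi>_def using C\<kappa> C\<phi> \<kappa>0 by (intro test_fnI[of _ S] Cinf_mult) simp_all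
    have d\<psi>: "dd (axis i 1) \<psi> y = - (\<kappa> y * D\<phi> y) + D\<kappa> i y * \<phi> y" for y
      unfolding \<psi>_def D\<kappa>_def dd_mult[OF Cinf_differentiable[OF C\<kappa>] Cinf_differentiable[OF C\<phi>]] d\<phi> by simp
    have i1: "integrable lborel (\<lambda>y. f y * dd (axis i 1) \<psi> y)" and i2: "integrable lborel (\<lambda>y. df y $ i * \<psi> y)"
      and eq: "(LBINT y. f y * dd (axis i 1) \<psi> y) = - (LBINT y. df y $ i * \<psi> y)"
      using wg t\<psi> unfolding weak_grad_def by blast+
    have i3: "integrable lborel (\<lambda>y. h i y * \<phi> y)"
      by (rule integrable_mult_continuous[OF ih _ Cinf_continuous[OF C\<phi>], of S]) (simp add: h_def D\<kappa>0)
    have "Dx i w (0, x) = (LBINT y. fR y * D\<phi> y)"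
      unfolding dw conv_def D\<phi>_def by (simp add: DxE)
    also have "\<dots> = (LBINT y. h i y * \<phi> y - f y * dd (axis i 1) \<psi> y)"
      by (intro Bochner_Integration.integral_cong refl) (simp add: d\<psi> fR_def h_def algebra_simps)
    also have "\<dots> = (LBINT y. h i y * \<phi> y) + (LBINT y. df y $ i * \<psi> y)"
      unfolding Bochner_Integration.integral_diff[OF i3 i1] eq by simp
    also have "\<dots> = (LBINT y. h i y * \<phi> y + df y $ i * \<psi> y)"
      by (rule Bochner_Integration.integral_add[OF i3 i2, symmetric])
    also have "\<dots> = (LBINT y. G i y * m (x - y))"
      by (intro Bochner_Integration.integral_cong refl) (simp add: G_def \<psi>_def \<phi>_def m_def algebra_simps)
    finally show ?thesis .
  qed
  have mw [measurable]: "(\<lambda>x. dd b w (0, x)) \<in> borel_measurable borel" for b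
    by (intro Cinf_measurable Cinf_slice Cinf_dd nice_wave_Cinf w)
  have 1: "e2 (\<lambda>x. g x - Dt w (0, x)) \<le> ennreal \<delta>"
  proof (rule e2_triangle[where b=gR and r=\<delta>1 and s=\<delta>1])
    show "e2 (\<lambda>x. g x - gR x) \<le> ennreal \<delta>1" using Rg(2)[OF RR(3)] unfolding gR_def \<kappa>_def .
    show "e2 (\<lambda>x. gR x - Dt w (0, x)) \<le> ennreal \<delta>1" unfolding Dtw by (rule mg)
  qed (measurable, use \<delta> in \<open>simp_all add: \<delta>1_def\<close>)
  have 2: "e2 (\<lambda>x. df x $ i - Dx i w (0, x)) \<le> ennreal \<delta>" for i
  proof (rule e2_triangle[where b="G i" and r="4 * \<delta>1" and s=\<delta>1])
    show "e2 (\<lambda>x. df x $ i - G i x) \<le> ennreal (4 * \<delta>1)"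
    proof (rule e2_triangle[where b="\<lambda>x. \<kappa> x * df x $ i" and r=\<delta>1 and s=\<delta>1])
      show "e2 (\<lambda>x. df x $ i - \<kappa> x * df x $ i) \<le> ennreal \<delta>1" using Ri(2)[OF RRi, of i] unfolding \<kappa>_def .
      show "e2 (\<lambda>x. \<kappa> x * df x $ i - G i x) \<le> ennreal \<delta>1" using h2[of i] e2_cong[of "\<lambda>x. - h i x" "h i"] by (simp add: G_def)
    qed (measurable, use \<delta>1 in simp_all)
    show "e2 (\<lambda>x. G i x - Dx i w (0, x)) \<le> ennreal \<delta>1" unfolding Dxw by (rule mG)
  qed (measurable, use \<delta> in \<open>simp_all add: \<delta>1_def\<close>)
  show ?thesis using w 1 2 by blast
qed

text \<open>A shift of the approximating wave in time moves the statement from time 0 to T.\<close>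

lemma nice_approx:
  assumes H: "Hdot1 f df" and g: "L2mem g" and \<delta>: "\<delta> > 0"
  shows "\<exists>w. nice_wave w \<and> e2 (\<lambda>x. g x - Dt w (T, x)) \<le> ennreal \<delta> \<and> (\<forall>i. e2 (\<lambda>x. df x $ i - Dx i w (T, x)) \<le> ennreal \<delta>)"
proof -
  obtain w where w: "nice_wave w" "e2 (\<lambda>x. g x - Dt w (0, x)) \<le> ennreal \<delta>" "\<And>i. e2 (\<lambda>x. df x $ i - Dx i w (0, x)) \<le> ennreal \<delta>"
    using nice_approx_0[OF assms] by blast
  show ?thesis
    using w(2,3) nice_wave_shift[OF w(1), where c="- T"] by (intro exI[of _ "\<lambda>p. w (p + (- T, 0))"]) simp
qed

section \<open>The Sobolev inequality\<close>

lemma ennreal_square_le_iff: "a^2 \<le> b^2 \<longleftrightarrow> a \<le> b" for a b :: ennreal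
proof
  assume le: "a^2 \<le> b^2"
  show "a \<le> b"
  proof (cases a; cases b)
    fix r s assume *: "a = ennreal r" "0 \<le> r" "b = ennreal s" "0 \<le> s"
    then have "r^2 \<le> s^2" using le by (simp add: ennreal_power)
    then have "r \<le> s" using *(4) by (rule power2_le_imp_le)
    then show ?thesis unfolding *(1) *(3) by (rule ennreal_leI)
  next
    fix s assume *: "a = top" "b = ennreal s" "0 \<le> s"
    then show ?thesis using le by (simp add: power2_eq_square ennreal_mult_top top_unique ennreal_power ennreal_mult'[symmetric])
  qed auto
qed (intro power_mono, simp_all)

lemma ennreal_square_eq_iff: "a^2 = b^2 \<longleftrightarrow> a = b" for a b :: ennreal
  using ennreal_square_le_iff[of a b] ennreal_square_le_iff[of b a] by (metis order.antisym order.refl)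

abbreviation esq :: "ennreal \<Rightarrow> ennreal" where "esq a \<equiv> epowr a (1 / 2)"

lemma esq_square [simp]: "(esq a)^2 = a"
proof (cases a)
  case (real r)
  then have "(r powr (1 / 2))^2 = r" by (simp add: powr_half_sqrt)
  then show ?thesis using real by (simp add: epowr_def ennreal_power)
next
  case top
  then show ?thesis by (simp add: epowr_def power2_eq_square ennreal_mult_top)
qed

lemma esq_measurable [measurable]: "(\<lambda>a. epowr a p) \<in> borel_measurable borel"
proof -
  have e: "(\<lambda>a. epowr a p) = (\<lambda>a. if a \<in> {\<infinity>} then \<infinity> else ennreal (enn2real a powr p))" by (simp add: epowr_def fun_eq_iff)
  show ?thesis unfolding e by (rule measurable_If_set) (simp_all, measurable)
qed

lemma esq_mult: "esq (a * b) = esq a * esq b"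
  by (subst ennreal_square_eq_iff[symmetric]) (simp add: power_mult_distrib)

lemma le_esq_iff: "a \<le> esq b \<longleftrightarrow> a^2 \<le> b"
  by (subst ennreal_square_le_iff[symmetric]) simp

lemma Cauchy_Schwarz_esq:
  assumes [measurable]: "f \<in> borel_measurable M" "g \<in> borel_measurable M"
  shows "(\<integral>\<^sup>+x. esq (f x) * esq (g x) \<partial>M) \<le> esq (\<integral>\<^sup>+x. f x \<partial>M) * esq (\<integral>\<^sup>+x. g x \<partial>M)"
proof -
  have "(\<integral>\<^sup>+x. esq (f x) * esq (g x) \<partial>M)^2 \<le> (\<integral>\<^sup>+x. (esq (f x))^2 \<partial>M) * (\<integral>\<^sup>+x. (esq (g x))^2 \<partial>M)"
    by (rule Cauchy_Schwarz_nn_integral) measurable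
  then show ?thesis by (simp add: esq_mult[symmetric] le_esq_iff)
qed

text \<open>Cauchy-Schwarz in x, then in y, then in z. In each variable exactly two factors are
  affected, and the remaining one is pulled out of the integral.\<close>

lemma Loomis_Whitney:
  fixes b1 b2 b3 :: "real \<Rightarrow> real \<Rightarrow> ennreal" and F :: "real \<Rightarrow> real \<Rightarrow> real \<Rightarrow> ennreal"
  assumes [measurable]: "case_prod b1 \<in> borel_measurable (lborel \<Otimes>\<^sub>M lborel)" "case_prod b2 \<in> borel_measurable (lborel \<Otimes>\<^sub>M lborel)"
      "case_prod b3 \<in> borel_measurable (lborel \<Otimes>\<^sub>M lborel)"
    and F: "\<And>x y z. (F x y z)^2 \<le> b1 y z * b2 x z * b3 x y"
  shows "(NNINT z y x. F x y z)^2 \<le>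
    (NNINT z y. b1 y z) * (NNINT z x. b2 x z) * (NNINT y x. b3 x y)"
proof -
  define B1 where "B1 z = (NNINT y. b1 y z)" for z
  define B2 where "B2 z = (NNINT x. b2 x z)" for z
  define B3 where "B3 y = (NNINT x. b3 x y)" for y
  have sw: "case_prod (\<lambda>z y. b y z) \<in> borel_measurable (lborel \<Otimes>\<^sub>M lborel)" if "case_prod b \<in> borel_measurable (lborel \<Otimes>\<^sub>M lborel)" for b :: "real \<Rightarrow> real \<Rightarrow> ennreal"
    using measurable_compose[OF measurable_pair_swap' that] by (simp add: case_prod_unfold)
  have sl1: "(\<lambda>y. b y z) \<in> borel_measurable lborel" if "case_prod b \<in> borel_measurable (lborel \<Otimes>\<^sub>M lborel)" for b :: "real \<Rightarrow> real \<Rightarrow> ennreal" and z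
    using measurable_compose[OF measurable_Pair1'[of z lborel lborel] sw[OF that]] by simp
  have m: "B1 \<in> borel_measurable lborel" "B2 \<in> borel_measurable lborel" "B3 \<in> borel_measurable lborel"
    unfolding B1_def[abs_def] B2_def[abs_def] B3_def[abs_def]
    using lborel.borel_measurable_nn_integral[OF sw] assms(1-3) by (auto simp: case_prod_unfold)
  note [measurable] = m sl1[OF assms(1)] sl1[OF assms(2)] sl1[OF assms(3)]
  have "(NNINT z y x. F x y z) \<le> (NNINT z y x. esq (b1 y z) * (esq (b2 x z) * esq (b3 x y)))"
    by (intro nn_integral_mono) (use F in \<open>simp add: esq_mult[symmetric] le_esq_iff mult.assoc\<close>)
  also have "\<dots> = (NNINT z y. esq (b1 y z) * (NNINT x. esq (b2 x z) * esq (b3 x y)))"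
    by (intro nn_integral_cong nn_integral_cmult) measurable
  also have "\<dots> \<le> (NNINT z y. esq (b1 y z) * (esq (B2 z) * esq (B3 y)))"
    unfolding B2_def B3_def by (intro nn_integral_mono mult_left_mono Cauchy_Schwarz_esq) auto
  also have "\<dots> = (NNINT z. esq (B2 z) * (NNINT y. esq (b1 y z) * esq (B3 y)))"
    by (intro nn_integral_cong, subst nn_integral_cmult[symmetric]) (auto simp: mult_ac)
  also have "\<dots> \<le> (NNINT z. esq (B2 z) * (esq (B1 z) * esq (NNINT y. B3 y)))"
    unfolding B1_def by (intro nn_integral_mono mult_left_mono Cauchy_Schwarz_esq) auto
  also have "\<dots> = (NNINT z. esq (B1 z) * esq (B2 z)) * esq (NNINT y. B3 y)"
    by (subst nn_integral_multc[symmetric]) (auto simp: mult_ac)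
  also have "\<dots> \<le> (esq (NNINT z. B1 z) * esq (NNINT z. B2 z)) * esq (NNINT y. B3 y)"
    by (intro mult_right_mono Cauchy_Schwarz_esq) auto
  finally show ?thesis unfolding esq_mult[symmetric] le_esq_iff B1_def B2_def B3_def .
qed

definition vec3 :: "real \<Rightarrow> real \<Rightarrow> real \<Rightarrow> real^3" where
  "vec3 x y z = x *\<^sub>R axis 1 1 + y *\<^sub>R axis 2 1 + z *\<^sub>R axis 3 1"

lemma vec3_nth [simp]: "vec3 x y z $ 1 = x" "vec3 x y z $ 2 = y" "vec3 x y z $ 3 = z"
  by (simp_all add: vec3_def axis_def)

text \<open>A comparison on boxes identifies the measure on \<open>real^3\<close> with a product
  measure, which makes iterated integrals in the three coordinates available.\<close>

lemma lborel_vec3: "lborel = distr (lborel :: (real \<times> real \<times> real) measure) borel (\<lambda>p. vec3 (fst p) (fst (snd p)) (snd (snd p)))"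
proof (rule lborel_eqI)
  have m: "(\<lambda>p. vec3 (fst p) (fst (snd p)) (snd (snd p))) \<in> borel_measurable borel"
    unfolding vec3_def by (intro borel_measurable_continuous_onI continuous_intros)
  fix l u :: "real^3" assume "\<And>b. b \<in> Basis \<Longrightarrow> l \<bullet> b \<le> u \<bullet> b"
  then have le: "l $ i \<le> u $ i" for i by (metis axis_in_Basis_iff inner_axis real_inner_1_right zero_neq_one Basis_real_def insertI1)
  have "(\<lambda>p. vec3 (fst p) (fst (snd p)) (snd (snd p))) -` box l u = {l $ 1<..<u $ 1} \<times> ({l $ 2<..<u $ 2} \<times> {l $ 3<..<u $ 3})"
    by (auto simp: mem_box_cart forall_3)
  then have "emeasure (distr lborel borel (\<lambda>p. vec3 (fst p) (fst (snd p)) (snd (snd p)))) (box l u) = emeasure (lborel \<Otimes>\<^sub>M lborel \<Otimes>\<^sub>M lborel) ({l $ 1<..<u $ 1} \<times> ({l $ 2<..<u $ 2} \<times> {l $ 3<..<u $ 3}))"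
    using m by (subst emeasure_distr) (simp_all add: lborel_prod)
  also have "\<dots> = emeasure lborel {l $ 1<..<u $ 1} * emeasure (lborel \<Otimes>\<^sub>M lborel) ({l $ 2<..<u $ 2} \<times> {l $ 3<..<u $ 3})"
    unfolding lborel_prod[where 'a=real and 'b=real] by (rule lborel.emeasure_pair_measure_Times) (simp_all add: borel_Times)
  also have "\<dots> = emeasure lborel {l $ 1<..<u $ 1} * (emeasure lborel {l $ 2<..<u $ 2} * emeasure lborel {l $ 3<..<u $ 3})"
    by (subst lborel.emeasure_pair_measure_Times) simp_all
  also have "\<dots> = ennreal ((u $ 1 - l $ 1) * ((u $ 2 - l $ 2) * (u $ 3 - l $ 3)))"
    using le[of 1] le[of 2] le[of 3] by (simp add: ennreal_mult)
  also have "(u $ 1 - l $ 1) * ((u $ 2 - l $ 2) * (u $ 3 - l $ 3)) = (\<Prod>b\<in>Basis. (u - l) \<bullet> b)"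
  proof -
    have "(\<Prod>b\<in>Basis. (u - l) \<bullet> b) = (\<Prod>i\<in>UNIV. (u - l) $ i)"
      by (rule prod.reindex_bij_witness[of _ "\<lambda>i. axis i 1" "\<lambda>b. axis_index b"])
         (auto simp: axis_index_axis inner_axis axis_in_Basis_iff Basis_vec_def)
    also have "\<dots> = (u $ 1 - l $ 1) * ((u $ 2 - l $ 2) * (u $ 3 - l $ 3))" unfolding UNIV_3
      by (subst prod.insert, simp, simp, subst prod.insert, simp, simp, subst prod.insert, simp, simp) (simp only: prod.empty mult_1_right vector_minus_component)
    finally show ?thesis by simp
  qed
  finally show "emeasure (distr lborel borel (\<lambda>p. vec3 (fst p) (fst (snd p)) (snd (snd p)))) (box l u) = ennreal (\<Prod>b\<in>Basis. (u - l) \<bullet> b)" .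
qed simp

lemma vec3_measurable: "(\<lambda>p. vec3 (fst p) (fst (snd p)) (snd (snd p))) \<in> borel_measurable borel"
  unfolding vec3_def by (intro borel_measurable_continuous_onI continuous_intros)

text \<open>Each coordinate occurs once as the innermost variable, as Loomis-Whitney demands for the
  three partial derivatives.\<close>

lemma nn_integral_vec3:
  fixes F :: "real^3 \<Rightarrow> ennreal"
  assumes F [measurable]: "F \<in> borel_measurable borel"
  shows "(NNINT p. F p) = (NNINT z y x. F (vec3 x y z))"
    and "(NNINT p. F p) = (NNINT z x y. F (vec3 x y z))"
    and "(NNINT p. F p) = (NNINT y x z. F (vec3 x y z))"
proof -
  have mF: "(\<lambda>p. F (vec3 (fst p) (fst (snd p)) (snd (snd p)))) \<in> borel_measurable borel"
    by (rule measurable_compose[OF vec3_measurable F])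
  have 0: "(NNINT p. F p) = (\<integral>\<^sup>+p. F (vec3 (fst p) (fst (snd p)) (snd (snd p))) \<partial>(lborel :: (real \<times> real \<times> real) measure))"
    by (subst lborel_vec3, subst nn_integral_distr) (use vec3_measurable in auto)
  also have "\<dots> = (NNINT x. NNINT q. F (vec3 x (fst q) (snd (q :: real \<times> real))))"
    unfolding lborel_prod[symmetric, where 'a=real and 'b="real \<times> real"]
    using mF by (subst lborel.nn_integral_fst[symmetric]) (simp_all add: lborel_prod)
  also have "\<dots> = (NNINT x y z. F (vec3 x y z))"
  proof (rule nn_integral_cong)
    fix x :: real
    have "(\<lambda>q. F (vec3 x (fst q) (snd q))) \<in> borel_measurable borel"
      by (rule measurable_compose[OF _ F]) (unfold vec3_def, intro borel_measurable_continuous_onI continuous_intros)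
    then show "(\<integral>\<^sup>+q. F (vec3 x (fst q) (snd q)) \<partial>(lborel :: (real \<times> real) measure)) = (NNINT y z. F (vec3 x y z))"
      unfolding lborel_prod[symmetric, where 'a=real and 'b=real]
      by (subst lborel.nn_integral_fst[symmetric]) (simp_all add: lborel_prod)
  qed
  finally have xyz: "(NNINT p. F p) = (NNINT x y z. F (vec3 x y z))" .
  have m1: "(\<lambda>(u, v). NNINT s. F (vv u v s)) \<in> borel_measurable (lborel \<Otimes>\<^sub>M lborel)"
    if "(\<lambda>p. vv (fst (fst p)) (snd (fst p)) (snd p)) \<in> borel_measurable (borel :: ((real \<times> real) \<times> real) measure)" for vv :: "real \<Rightarrow> real \<Rightarrow> real \<Rightarrow> real^3"
  proof -
    have "(\<lambda>p. F (vv (fst (fst p)) (snd (fst p)) (snd p))) \<in> borel_measurable ((lborel \<Otimes>\<^sub>M lborel) \<Otimes>\<^sub>M lborel)"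
      using measurable_compose[OF that F] by (simp add: lborel_prod)
    from lborel.borel_measurable_nn_integral_fst[OF this] show ?thesis by (simp add: case_prod_unfold)
  qed
  have c: "(\<lambda>p. vec3 (fst (fst p)) (snd (fst p)) (snd p)) \<in> borel_measurable (borel :: ((real \<times> real) \<times> real) measure)"
    "(\<lambda>p. vec3 (fst (fst p)) (snd p) (snd (fst p))) \<in> borel_measurable (borel :: ((real \<times> real) \<times> real) measure)"
    unfolding vec3_def by (intro borel_measurable_continuous_onI continuous_intros)+
  show yxz: "(NNINT p. F p) = (NNINT y x z. F (vec3 x y z))"
    unfolding xyz by (rule lborel_pair.Fubini'[OF m1[OF c(1)], symmetric])
  have m2: "(\<lambda>(y, z). F (vec3 x y z)) \<in> borel_measurable (lborel \<Otimes>\<^sub>M lborel)" for x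
  proof -
    have "(\<lambda>q. F (vec3 x (fst q) (snd q))) \<in> borel_measurable borel"
      by (rule measurable_compose[OF _ F]) (unfold vec3_def, intro borel_measurable_continuous_onI continuous_intros)
    then show ?thesis by (simp add: lborel_prod case_prod_unfold)
  qed
  have m3: "(\<lambda>(x, y). F (vec3 x y z)) \<in> borel_measurable (lborel \<Otimes>\<^sub>M lborel)" for z
  proof -
    have "(\<lambda>q. F (vec3 (fst q) (snd q) z)) \<in> borel_measurable borel"
      by (rule measurable_compose[OF _ F]) (unfold vec3_def, intro borel_measurable_continuous_onI continuous_intros)
    then show ?thesis by (simp add: lborel_prod case_prod_unfold)
  qed
  have xzy: "(NNINT p. F p) = (NNINT x z y. F (vec3 x y z))"
    unfolding xyz by (rule nn_integral_cong, rule lborel_pair.Fubini'[OF m2, symmetric])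
  show zxy: "(NNINT p. F p) = (NNINT z x y. F (vec3 x y z))"
    unfolding xzy by (rule lborel_pair.Fubini'[OF m1[OF c(2)], symmetric])
  show "(NNINT p. F p) = (NNINT z y x. F (vec3 x y z))"
    unfolding zxy by (rule nn_integral_cong, rule lborel_pair.Fubini'[OF m3, symmetric])
qed

lemma line_bound:
  fixes g :: "'a::euclidean_space \<Rightarrow> real"
  assumes d: "\<And>x. g differentiable (at x)" and c: "continuous_on UNIV (dd b g)" and s: "\<And>x. norm x > R \<Longrightarrow> g x = 0" and b: "norm b = 1"
  shows "ennreal \<bar>g (u *\<^sub>R b + x)\<bar> \<le> (NNINT s. ennreal \<bar>dd b g (s *\<^sub>R b + x)\<bar>)"
proof -
  \<comment> \<open>So far out that the line has left the support of g.\<close>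
  define l where "l = - (\<bar>R\<bar> + norm x + \<bar>u\<bar> + 1)"
  have lu: "l \<le> u" unfolding l_def using norm_ge_zero[of x] by linarith
  have "norm (l *\<^sub>R b) \<le> norm (l *\<^sub>R b + x) + norm x" using norm_triangle_ineq4[of "l *\<^sub>R b + x" x] by simp
  then have "norm (l *\<^sub>R b + x) > R" using b by (simp add: l_def)
  then have "g (l *\<^sub>R b + x) = 0" by (rule s)
  then have e: "g (u *\<^sub>R b + x) = (LBINT s. indicator {l..u} s * dd b g (s *\<^sub>R b + x))"
    using FTC_line[OF d c lu, of x] by simp
  have i: "integrable lborel (\<lambda>s. indicator {l..u} s *\<^sub>R dd b g (s *\<^sub>R b + x))"
    by (intro borel_integrable_compact continuous_on_compose2[OF c] continuous_intros) auto
  have "ennreal \<bar>g (u *\<^sub>R b + x)\<bar> \<le> (NNINT s. ennreal (norm (indicator {l..u} s *\<^sub>R dd b g (s *\<^sub>R b + x))))"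
    using integral_norm_bound_ennreal[OF i] e by simp
  also have "\<dots> \<le> (NNINT s. ennreal \<bar>dd b g (s *\<^sub>R b + x)\<bar>)"
    by (intro nn_integral_mono ennreal_leI) (auto simp: indicator_def)
  finally show ?thesis .
qed

text \<open>Gagliardo's argument for g = f^4. At each point |g| is at most the integral of |g_i|
  along the line in direction i. As f^6 = |g|^(3/2), Loomis-Whitney bounds X^2 by the product of the
  three integrals of |g_i|, where X is the integral of f^6. Since g_i = 4 f^3 f_i, the square of
  each is at most 16 X times the squared L^2 norm of f_i. Hence X^4 is at most 16^3 X^3 times the
  product of the squared norms, and 16^3 = 4096.\<close>

theorem Sobolev_L6:
  fixes f :: "real^3 \<Rightarrow> real"
  assumes f: "Cinf f" and s: "\<And>x. norm x > R \<Longrightarrow> f x = 0"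
  shows "(NNINT x. ennreal (f x ^ 6)) \<le> 4096 * (e2 (dd (axis 1 1) f) * e2 (dd (axis 2 1) f) * e2 (dd (axis 3 1) f))"
proof -
  define g where "g x = (f x * f x) * (f x * f x)" for x
  define H where "H i x = ennreal \<bar>dd (axis i 1) g x\<bar>" for i x
  define X where "X = (NNINT x. ennreal (f x ^ 6))"
  have Cg: "Cinf g" unfolding g_def by (intro Cinf_mult f)
  have fm [measurable]: "f \<in> borel_measurable borel" by (rule Cinf_measurable[OF f])
  have dfm [measurable]: "dd b f \<in> borel_measurable borel" for b by (intro Cinf_measurable Cinf_dd f)
  have dgm [measurable]: "dd b g \<in> borel_measurable borel" for b by (intro Cinf_measurable Cinf_dd Cg)
  have Hm [measurable]: "H i \<in> borel_measurable borel" for i unfolding H_def by measurable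
  have df: "f differentiable (at x)" for x by (rule Cinf_differentiable[OF f])
  have dg: "dd b g x = 4 * (f x * f x * f x * dd b f x)" for b x
    unfolding g_def by (simp add: dd_mult df algebra_simps)
  have lb: "ennreal \<bar>g (u *\<^sub>R axis i 1 + x)\<bar> \<le> (NNINT s. H i (s *\<^sub>R axis i 1 + x))" for i u x
    unfolding H_def using s by (intro line_bound[of g _ R] Cinf_differentiable Cg Cinf_continuous Cinf_dd) (auto simp: g_def)
  define b1 where "b1 y z = (NNINT x. H 1 (vec3 x y z))" for y z
  define b2 where "b2 x z = (NNINT y. H 2 (vec3 x y z))" for x z
  define b3 where "b3 x y = (NNINT z. H 3 (vec3 x y z))" for x y
  have g1: "ennreal \<bar>g (vec3 x y z)\<bar> \<le> b1 y z" for x y z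
    using lb[of x 1 "y *\<^sub>R axis 2 1 + z *\<^sub>R axis 3 1"] unfolding b1_def vec3_def by (simp add: add_ac)
  have g2: "ennreal \<bar>g (vec3 x y z)\<bar> \<le> b2 x z" for x y z
    using lb[of y 2 "x *\<^sub>R axis 1 1 + z *\<^sub>R axis 3 1"] unfolding b2_def vec3_def by (simp add: add_ac)
  have g3: "ennreal \<bar>g (vec3 x y z)\<bar> \<le> b3 x y" for x y z
    using lb[of z 3 "x *\<^sub>R axis 1 1 + y *\<^sub>R axis 2 1"] unfolding b3_def vec3_def by (simp add: add_ac)
  have mb: "(\<lambda>(u, v). NNINT s. H i (vv u v s)) \<in> borel_measurable (lborel \<Otimes>\<^sub>M lborel)"
    if "(\<lambda>p. vv (fst (fst p)) (snd (fst p)) (snd p)) \<in> borel_measurable (borel :: ((real \<times> real) \<times> real) measure)" for vv i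
  proof -
    have "(\<lambda>p. H i (vv (fst (fst p)) (snd (fst p)) (snd p))) \<in> borel_measurable ((lborel \<Otimes>\<^sub>M lborel) \<Otimes>\<^sub>M lborel)"
      using measurable_compose[OF that Hm] by (simp add: lborel_prod)
    from lborel.borel_measurable_nn_integral_fst[OF this] show ?thesis by (simp add: case_prod_unfold)
  qed
  have c: "(\<lambda>p. vec3 (fst (fst p)) (snd (fst p)) (snd p)) \<in> borel_measurable (borel :: ((real \<times> real) \<times> real) measure)"
    "(\<lambda>p. vec3 (fst (fst p)) (snd p) (snd (fst p))) \<in> borel_measurable (borel :: ((real \<times> real) \<times> real) measure)"
    "(\<lambda>p. vec3 (snd p) (fst (fst p)) (snd (fst p))) \<in> borel_measurable (borel :: ((real \<times> real) \<times> real) measure)"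
    unfolding vec3_def by (intro borel_measurable_continuous_onI continuous_intros)+
  have pw: "(ennreal (f p ^ 6))^2 = ennreal \<bar>g p\<bar> * ennreal \<bar>g p\<bar> * ennreal \<bar>g p\<bar>" for p
  proof -
    have g4: "\<bar>g p\<bar> = f p ^ 4" unfolding g_def by (simp add: power2_eq_square numeral_eq_Suc mult_ac abs_mult)
    have "(f p ^ 6)^2 = \<bar>g p\<bar> * \<bar>g p\<bar> * \<bar>g p\<bar>" unfolding g4 by (simp add: power_add[symmetric] power_mult[symmetric])
    then show ?thesis by (simp add: ennreal_power ennreal_mult'[symmetric] zero_le_even_power)
  qed
  have "(NNINT z y x. ennreal (f (vec3 x y z) ^ 6))^2 \<le>
    (NNINT z y. b1 y z) * (NNINT z x. b2 x z) * (NNINT y x. b3 x y)"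
  proof (rule Loomis_Whitney)
    show "case_prod b1 \<in> borel_measurable (lborel \<Otimes>\<^sub>M lborel)" unfolding b1_def by (rule mb[OF c(3)])
    show "case_prod b2 \<in> borel_measurable (lborel \<Otimes>\<^sub>M lborel)" unfolding b2_def by (rule mb[OF c(2)])
    show "case_prod b3 \<in> borel_measurable (lborel \<Otimes>\<^sub>M lborel)" unfolding b3_def by (rule mb[OF c(1)])
    show "(ennreal (f (vec3 x y z) ^ 6))^2 \<le> b1 y z * b2 x z * b3 x y" for x y z
      unfolding pw by (intro mult_mono g1 g2 g3) auto
  qed
  then have "X^2 \<le> (NNINT p. H 1 p) * (NNINT p. H 2 p) * (NNINT p. H 3 p)"
    unfolding X_def b1_def b2_def b3_def nn_integral_vec3(1)[OF Hm[of 1]] nn_integral_vec3(2)[OF Hm[of 2]] nn_integral_vec3(3)[OF Hm[of 3]]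
    by (subst nn_integral_vec3(1)) simp_all
  \<comment> \<open>Squared once more because Cauchy-Schwarz controls the squares of the three
    integrals.\<close>
  then have X4: "(X^2)^2 \<le> (NNINT p. H 1 p)^2 * (NNINT p. H 2 p)^2 * (NNINT p. H 3 p)^2"
    unfolding power_mult_distrib[symmetric] by (subst ennreal_square_le_iff)
  have HX: "(NNINT p. H i p)^2 \<le> X * (16 * e2 (dd (axis i 1) f))" for i
  proof -
    have "H i p = ennreal (\<bar>f p\<bar> ^ 3) * ennreal (4 * \<bar>dd (axis i 1) f p\<bar>)" for p
      unfolding H_def dg by (subst ennreal_mult[symmetric], simp, simp) (simp only: abs_mult power3_eq_cube mult_ac abs_numeral)
    then have "(NNINT p. H i p)^2 \<le> (NNINT p. (ennreal (\<bar>f p\<bar> ^ 3))^2) * (NNINT p. (ennreal (4 * \<bar>dd (axis i 1) f p\<bar>))^2)"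
      by (simp only:) (rule Cauchy_Schwarz_nn_integral; measurable)
    also have "(NNINT p. (ennreal (\<bar>f p\<bar> ^ 3))^2) = X"
      unfolding X_def by (intro nn_integral_cong) (simp add: ennreal_power power_mult[symmetric] power_even_abs)
    also have "(NNINT p. (ennreal (4 * \<bar>dd (axis i 1) f p\<bar>))^2) = 16 * e2 (dd (axis i 1) f)"
      unfolding e2_def by (subst nn_integral_cmult[symmetric], measurable, intro nn_integral_cong)
        (simp add: ennreal_power power_mult_distrib ennreal_mult')
    finally show ?thesis .
  qed
  define D where "D = e2 (dd (axis 1 1) f) * e2 (dd (axis 2 1) f) * e2 (dd (axis 3 1) f)"
  have "(X^2)^2 \<le> (X * (16 * e2 (dd (axis 1 1) f))) * (X * (16 * e2 (dd (axis 2 1) f))) * (X * (16 * e2 (dd (axis 3 1) f)))"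
    by (rule order.trans[OF X4]) (intro mult_mono HX; simp)
  also have "\<dots> = X ^ 3 * ((16 * 16 * 16) * D)" by (simp only: D_def power3_eq_cube mult_ac)
  also have "(16 * 16 * 16 :: ennreal) = 4096" by simp
  finally have fin: "X ^ 3 * X \<le> X ^ 3 * (4096 * D)" by (simp add: power2_eq_square power3_eq_cube mult_ac)
  \<comment> \<open>Finiteness is what permits cancelling X^3.\<close>
  have "X < \<infinity>"
  proof -
    have "integrable lborel (\<lambda>x. f x ^ 6)"
      using s by (intro integrable_lborel_compact_support[of _ R] continuous_intros Cinf_continuous f) simp
    then show ?thesis unfolding X_def by (subst nn_integral_eq_integral) (simp_all add: zero_le_even_power)
  qed
  then have "X \<le> 4096 * D"
  proof (cases "X = 0")
    case False
    then have "X ^ 3 \<noteq> 0" "X ^ 3 < \<infinity>" using \<open>X < \<infinity>\<close> by (simp_all add: power_less_top_ennreal)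
    then show ?thesis using fin by (simp add: ennreal_mult_le_mult_iff less_top)
  qed simp
  then show ?thesis by (simp add: X_def D_def)
qed

section \<open>Duality with smooth waves\<close>

lemma Lpn_2_esq: "Lpn 2 f = esq (e2 f)"
proof -
  have "\<bar>f x\<bar> powr 2 = (f x)^2" for x by (cases "f x = 0") (simp_all add: powr_numeral)
  then show ?thesis unfolding Lpn_def e2_def by simp
qed

lemma e2_Lpn: "e2 f = (Lpn 2 f)^2" by (simp add: Lpn_2_esq)

lemma tendsto_ennreal_square_zero:
  fixes f :: "'a \<Rightarrow> ennreal"
  shows "((\<lambda>x. (f x)^2) \<longlongrightarrow> 0) F \<longleftrightarrow> (f \<longlongrightarrow> 0) F"
proof
  assume "(f \<longlongrightarrow> 0) F"
  then have "((\<lambda>x. f x * f x) \<longlongrightarrow> 0 * 0) F" by (intro tendsto_mult_ennreal) auto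
  then show "((\<lambda>x. (f x)^2) \<longlongrightarrow> 0) F" by (simp add: power2_eq_square)
next
  assume *: "((\<lambda>x. (f x)^2) \<longlongrightarrow> 0) F"
  show "(f \<longlongrightarrow> 0) F"
  proof (rule order_tendstoI)
    fix a :: ennreal assume "0 < a"
    then have "0 < a^2" by (simp add: zero_less_iff_neq_zero)
    then have "eventually (\<lambda>x. (f x)^2 < a^2) F" using * by (rule order_tendstoD(2)[rotated])
    then show "eventually (\<lambda>x. f x < a) F"
      by eventually_elim (metis ennreal_square_le_iff not_le)
  qed simp
qed

lemma integrable_mult_L2:
  fixes u v :: "'a::euclidean_space \<Rightarrow> real"
  assumes [measurable]: "u \<in> borel_measurable borel" "v \<in> borel_measurable borel" and "e2 u < \<infinity>" "e2 v < \<infinity>"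
  shows "integrable lborel (\<lambda>x. u x * v x)"
proof (rule integrableI_bounded)
  have "(NNINT x. ennreal (norm (u x * v x))) \<le> (NNINT x. ennreal ((u x)^2) + ennreal ((v x)^2))"
  proof (intro nn_integral_mono)
    fix x
    have "norm (u x * v x) \<le> (u x)^2 + (v x)^2"
      unfolding real_norm_def abs_mult
      using sum_squares_bound[of "\<bar>u x\<bar>" "\<bar>v x\<bar>"] mult_nonneg_nonneg[of "\<bar>u x\<bar>" "\<bar>v x\<bar>", OF abs_ge_zero abs_ge_zero]
      unfolding power2_abs by linarith
    then have "ennreal (norm (u x * v x)) \<le> ennreal ((u x)^2 + (v x)^2)" by (rule ennreal_leI)
    then show "ennreal (norm (u x * v x)) \<le> ennreal ((u x)^2) + ennreal ((v x)^2)" by simp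
  qed
  also have "\<dots> = e2 u + e2 v" unfolding e2_def by (rule nn_integral_add) measurable
  also have "\<dots> < \<infinity>" using assms by (simp add: ennreal_add_less_top)
  finally show "(NNINT x. ennreal (norm (u x * v x))) < \<infinity>" .
qed measurable

lemma Cauchy_Schwarz_e2:
  fixes u v :: "'a::euclidean_space \<Rightarrow> real"
  assumes [measurable]: "u \<in> borel_measurable borel" "v \<in> borel_measurable borel" and fin: "e2 u < \<infinity>" "e2 v < \<infinity>"
  shows "ennreal ((LBINT x. u x * v x)^2) \<le> e2 u * e2 v"
proof -
  have "ennreal \<bar>LBINT x. u x * v x\<bar> \<le> (NNINT x. ennreal (norm (u x * v x)))"
    using integral_norm_bound_ennreal[OF integrable_mult_L2[OF assms]] by simp
  also have "\<dots> = (NNINT x. ennreal \<bar>u x\<bar> * ennreal \<bar>v x\<bar>)" by (simp add: abs_mult ennreal_mult)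
  finally have "(ennreal \<bar>LBINT x. u x * v x\<bar>)^2 \<le> (NNINT x. ennreal \<bar>u x\<bar> * ennreal \<bar>v x\<bar>)^2" by (simp add: ennreal_square_le_iff)
  also have "\<dots> \<le> (NNINT x. (ennreal \<bar>u x\<bar>)^2) * (NNINT x. (ennreal \<bar>v x\<bar>)^2)" by (rule Cauchy_Schwarz_nn_integral) measurable
  finally show ?thesis by (simp add: ennreal_power e2_def)
qed

lemma e2_compact_finite:
  fixes v :: "'a::euclidean_space \<Rightarrow> real"
  assumes "continuous_on UNIV v" "\<And>x. norm x > R \<Longrightarrow> v x = 0"
  shows "e2 v < \<infinity>"
proof -
  have "integrable lborel (\<lambda>x. (v x)^2)" using assms by (intro integrable_lborel_compact_support[of _ R] continuous_intros) auto
  then show ?thesis unfolding e2_def by (subst nn_integral_eq_integral) auto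
qed

lemma cone_supp_slice:
  assumes "continuous_on UNIV F" "cone_supp R F"
  shows "continuous_on UNIV (\<lambda>x. F (t, x))" "e2 (\<lambda>x. F (t, x)) < \<infinity>" "(\<lambda>x. F (t, x)) \<in> borel_measurable borel"
proof -
  show c: "continuous_on UNIV (\<lambda>x. F (t, x))" by (rule continuous_on_compose2[OF assms(1)]) (auto intro!: continuous_intros)
  show "e2 (\<lambda>x. F (t, x)) < \<infinity>" using assms(2) by (intro e2_compact_finite[OF c, of "R + \<bar>t\<bar>"]) (simp add: cone_supp_def)
  show "(\<lambda>x. F (t, x)) \<in> borel_measurable borel" by (rule borel_measurable_continuous_onI[OF c])
qed

text \<open>Near t all slices live in one fixed ball, and F is uniformly continuous on the
  corresponding compact slab.\<close>

lemma e2_slice_continuous: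
  assumes F: "continuous_on UNIV F" "cone_supp R F"
  shows "((\<lambda>s. e2 (\<lambda>x. F (s, x) - F (t, x))) \<longlongrightarrow> 0) (at t)"
proof (rule order_tendstoI)
  fix a :: ennreal assume a: "0 < a"
  define S where "S = \<bar>R\<bar> + \<bar>t\<bar> + 1"
  define V where "V = measure lborel (cball (0::real^3) S)"
  have V: "emeasure lborel (cball (0::real^3) S) = ennreal V"
    unfolding V_def by (rule emeasure_eq_ennreal_measure) (use emeasure_lborel_cball_finite[of "0::real^3" S] in auto)
  obtain e where e: "e > 0" "ennreal (e^2 * V) < a"
  proof -
    obtain r where r: "0 < r" "ennreal r < a"
      using a by (metis dense ennreal_less_zero_iff ennreal_cases less_ennreal.rep_eq not_less_zero ennreal_less_iff enn2real_nonneg less_top ennreal_enn2real_if top.not_eq_extremum zero_less_iff_neq_zero ennreal_0)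
    define e where "e = sqrt (r / (V + 1))"
    have V0: "V \<ge> 0" by (simp add: V_def)
    have "e^2 * V = r / (V + 1) * V" using r V0 by (simp add: e_def)
    also have "\<dots> \<le> r" using r V0 by (simp add: divide_simps mult_left_mono)
    finally have "ennreal (e^2 * V) \<le> ennreal r" by (rule ennreal_leI)
    moreover have "e > 0" using r V0 by (simp add: e_def)
    ultimately show ?thesis using that r(2) by (meson le_less_trans)
  qed
  have "uniformly_continuous_on ({t - 1..t + 1} \<times> cball 0 S) F"
    by (intro compact_uniformly_continuous continuous_on_subset[OF F(1)] compact_Times) auto
  then obtain d where d: "d > 0" "\<And>p q. p \<in> {t - 1..t + 1} \<times> cball 0 S \<Longrightarrow> q \<in> {t - 1..t + 1} \<times> cball 0 S \<Longrightarrow> dist q p < d \<Longrightarrow> dist (F q) (F p) < e"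
    using e(1) unfolding uniformly_continuous_on_def by metis
  have "e2 (\<lambda>x. F (s, x) - F (t, x)) < a" if s: "dist s t < min d 1" for s
  proof -
    have st: "\<bar>s - t\<bar> < 1" "\<bar>s - t\<bar> < d" using s by (simp_all add: dist_real_def)
    have "ennreal ((F (s, x) - F (t, x))^2) \<le> ennreal (e^2) * indicator (cball 0 S) x" for x
    proof (cases "norm x \<le> S")
      case True
      have "dist (F (s, x)) (F (t, x)) < e" using st True by (intro d(2)) (auto simp: dist_Pair_Pair dist_real_def)
      then have "\<bar>F (s, x) - F (t, x)\<bar> \<le> e" by (simp add: dist_real_def)
      then have "(F (s, x) - F (t, x))^2 \<le> e^2" by (metis abs_ge_zero power2_abs power_mono)
      then show ?thesis using True by (simp add: ennreal_leI)
    next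
      case False
      have "norm x > R + \<bar>s\<bar>" "norm x > R + \<bar>t\<bar>" using False st unfolding S_def by linarith+
      then have "F (s, x) = 0" "F (t, x) = 0" using F(2) by (auto simp: cone_supp_def)
      then show ?thesis by simp
    qed
    then have "e2 (\<lambda>x. F (s, x) - F (t, x)) \<le> (NNINT x. ennreal (e^2) * indicator (cball 0 S) (x::real^3))"
      unfolding e2_def by (rule nn_integral_mono)
    also have "\<dots> = ennreal (e^2) * ennreal V" by (subst nn_integral_cmult_indicator) (simp_all add: V)
    also have "\<dots> = ennreal (e^2 * V)" by (simp add: ennreal_mult')
    also have "\<dots> < a" by (rule e(2))
    finally show ?thesis .
  qed
  then show "eventually (\<lambda>s. e2 (\<lambda>x. F (s, x) - F (t, x)) < a) (at t)"
    unfolding eventually_at using d(1) by (intro exI[of _ "min d 1"]) auto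
qed simp

text \<open>The increment is (u_s - u_t) F_s + u_t (F_s - F_t), and Cauchy-Schwarz controls either
  part; the norm of F_s is in turn compared with that of F_t.\<close>

lemma pairing_continuous:
  fixes u :: "real \<Rightarrow> real^3 \<Rightarrow> real"
  assumes u: "\<And>s. s \<ge> 0 \<Longrightarrow> u s \<in> borel_measurable borel" "\<And>s. s \<ge> 0 \<Longrightarrow> e2 (u s) < \<infinity>"
    and uc: "((\<lambda>s. e2 (\<lambda>x. u s x - u t x)) \<longlongrightarrow> 0) (at t within {0..})"
    and F: "continuous_on UNIV F" "cone_supp R F" and t: "t \<ge> 0"
  shows "continuous (at t within {0..}) (\<lambda>s. LBINT x. u s x * F (s, x))"
proof -
  define T where "T s = (LBINT x. u s x * F (s, x))" for s
  define A where "A s = e2 (\<lambda>x. u s x - u t x)" for s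
  define B where "B s = e2 (\<lambda>x. F (s, x) - F (t, x))" for s
  note sl = cone_supp_slice[OF F]
  note [measurable] = sl(3)
  have utm [measurable]: "u t \<in> borel_measurable borel" using u(1)[OF t] .
  have Bc: "(B \<longlongrightarrow> 0) (at t within {0..})" unfolding B_def by (rule tendsto_within_subset[OF e2_slice_continuous[OF F]]) simp
  have Ac: "(A \<longlongrightarrow> 0) (at t within {0..})" unfolding A_def by (rule uc)
  have bound: "ennreal ((T s - T t)^2) \<le> 2 * (A s * (2 * B s + 2 * e2 (\<lambda>x. F (t, x)))) + 2 * (e2 (u t) * B s)" if s: "s \<ge> 0" for s
  proof -
    have usm [measurable]: "u s \<in> borel_measurable borel" using u(1)[OF s] .
    have neg: "e2 (\<lambda>x. - f x) = e2 f" for f :: "real^3 \<Rightarrow> real" by (simp add: e2_def)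
    have "e2 (\<lambda>x. u s x + - u t x) \<le> 2 * e2 (u s) + 2 * e2 (\<lambda>x. - u t x)" by (rule e2_add) measurable
    also have "\<dots> < \<infinity>" using u(2)[OF s] u(2)[OF t] by (simp add: neg ennreal_add_less_top ennreal_mult_less_top)
    finally have ufin: "e2 (\<lambda>x. u s x - u t x) < \<infinity>" by simp
    have "e2 (\<lambda>x. F (s, x) + - F (t, x)) \<le> 2 * e2 (\<lambda>x. F (s, x)) + 2 * e2 (\<lambda>x. - F (t, x))" by (rule e2_add) measurable
    also have "\<dots> < \<infinity>" using sl(2)[of s] sl(2)[of t] by (simp add: neg ennreal_add_less_top ennreal_mult_less_top)
    finally have Ffin: "e2 (\<lambda>x. F (s, x) - F (t, x)) < \<infinity>" by simp
    have i1: "integrable lborel (\<lambda>x. (u s x - u t x) * F (s, x))" using ufin sl(2) by (intro integrable_mult_L2) measurable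
    have i2: "integrable lborel (\<lambda>x. u t x * (F (s, x) - F (t, x)))" using Ffin u(2)[OF t] by (intro integrable_mult_L2) measurable
    have i3: "integrable lborel (\<lambda>x. u s x * F (s, x))" "integrable lborel (\<lambda>x. u t x * F (t, x))"
      using u(2)[OF s] u(2)[OF t] sl(2) by (intro integrable_mult_L2; measurable)+
    have "T s - T t = (LBINT x. u s x * F (s, x) - u t x * F (t, x))" unfolding T_def using i3 by simp
    also have "\<dots> = (LBINT x. (u s x - u t x) * F (s, x) + u t x * (F (s, x) - F (t, x)))" by (simp add: algebra_simps)
    also have "\<dots> = (LBINT x. (u s x - u t x) * F (s, x)) + (LBINT x. u t x * (F (s, x) - F (t, x)))" by (rule Bochner_Integration.integral_add[OF i1 i2])
    finally have eq: "T s - T t = (LBINT x. (u s x - u t x) * F (s, x)) + (LBINT x. u t x * (F (s, x) - F (t, x)))" .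
    have "ennreal ((p + q)^2) \<le> 2 * ennreal (p^2) + 2 * ennreal (q^2)" for p q :: real
    proof -
      have "(p + q)^2 \<le> 2 * p^2 + 2 * q^2" using sum_squares_bound[of p q] by (simp add: power2_sum)
      then have "ennreal ((p + q)^2) \<le> ennreal (2 * p^2 + 2 * q^2)" by (rule ennreal_leI)
      then show ?thesis by (simp add: ennreal_mult')
    qed
    from this[of "LBINT x. (u s x - u t x) * F (s, x)" "LBINT x. u t x * (F (s, x) - F (t, x))"]
    have "ennreal ((T s - T t)^2) \<le> 2 * ennreal ((LBINT x. (u s x - u t x) * F (s, x))^2) + 2 * ennreal ((LBINT x. u t x * (F (s, x) - F (t, x)))^2)"
      unfolding eq .
    also have "\<dots> \<le> 2 * (A s * e2 (\<lambda>x. F (s, x))) + 2 * (e2 (u t) * B s)"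
      unfolding A_def B_def using ufin Ffin sl(2) u(2)[OF t] by (intro add_mono mult_left_mono Cauchy_Schwarz_e2) measurable
    also have "e2 (\<lambda>x. F (s, x)) \<le> 2 * B s + 2 * e2 (\<lambda>x. F (t, x))"
      using e2_add[of "\<lambda>x. F (s, x) - F (t, x)" "\<lambda>x. F (t, x)"] sl(3) unfolding B_def by simp
    finally show ?thesis by (simp add: mult_left_mono add_mono)
  qed
  have "((\<lambda>s. 2 * (A s * (2 * B s + 2 * e2 (\<lambda>x. F (t, x)))) + 2 * (e2 (u t) * B s)) \<longlongrightarrow> 2 * (0 * (2 * 0 + 2 * e2 (\<lambda>x. F (t, x)))) + 2 * (e2 (u t) * 0)) (at t within {0..})"
    using sl(2)[of t] u(2)[OF t] by (intro tendsto_intros tendsto_mult_ennreal tendsto_add Ac Bc) (auto simp: ennreal_mult_less_top ennreal_mult_eq_top_iff)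
  then have lim: "((\<lambda>s. 2 * (A s * (2 * B s + 2 * e2 (\<lambda>x. F (t, x)))) + 2 * (e2 (u t) * B s)) \<longlongrightarrow> 0) (at t within {0..})" by simp
  have "((\<lambda>s. ennreal ((T s - T t)^2)) \<longlongrightarrow> 0) (at t within {0..})"
  proof (rule tendsto_sandwich[OF _ _ tendsto_const lim])
    show "\<forall>\<^sub>F s in at t within {0..}. ennreal ((T s - T t)^2) \<le> 2 * (A s * (2 * B s + 2 * e2 (\<lambda>x. F (t, x)))) + 2 * (e2 (u t) * B s)"
      using bound by (auto simp: eventually_at_filter)
  qed simp
  then have "((\<lambda>s. (T s - T t)^2) \<longlongrightarrow> 0) (at t within {0..})" by (subst (asm) ennreal_0[symmetric], subst (asm) tendsto_ennreal_iff) auto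
  from tendsto_real_sqrt[OF this] have "((\<lambda>s. \<bar>T s - T t\<bar>) \<longlongrightarrow> 0) (at t within {0..})" by simp
  then have "((\<lambda>s. T s - T t) \<longlongrightarrow> 0) (at t within {0..})" by (rule tendsto_rabs_zero_cancel)
  then show ?thesis unfolding continuous_within T_def[symmetric] by (rule LIM_zero_cancel)
qed

section \<open>Pairing of a weak solution with smooth waves\<close>

lemma test_fn_slabI:
  fixes \<psi> :: "spacetime \<Rightarrow> real"
  assumes "Cinf \<psi>" "0 < a" and s: "\<And>t x. \<psi> (t, x) \<noteq> 0 \<Longrightarrow> a \<le> t \<and> t \<le> b \<and> norm x \<le> R"
  shows "test_fn ({0<..} \<times> UNIV) \<psi>"
proof -
  have "{p. \<psi> p \<noteq> 0} \<subseteq> {a..b} \<times> cball 0 R" using s by force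
  then have sub: "tsupp \<psi> \<subseteq> {a..b} \<times> cball 0 R" unfolding tsupp_def by (intro closure_minimal) (auto intro: closed_Times)
  have "compact ({a..b} \<times> cball (0::real^3) R)" by (intro compact_Times) auto
  then have "compact (tsupp \<psi>)" unfolding tsupp_def using sub by (metis closed_closure compact_Int_closed inf.absorb2 tsupp_def)
  then show ?thesis using assms(1,2) sub unfolding test_fn_def smooth_fn_iff_Cinf by fastforce
qed

abbreviation tail_pairing :: "(spacetime \<Rightarrow> real) \<Rightarrow> (spacetime \<Rightarrow> real) \<Rightarrow> real \<Rightarrow> ennreal" where
  "tail_pairing G z T \<equiv> (NNINT p. ennreal \<bar>G p * Dt z p\<bar> * indicator {T..} (fst p))"

text \<open>The counterpart of \<open>wpair\<close> with (\<open>ht\<close>, \<open>dh\<close>) in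
  place of the derivatives of one wave; its change in time measures the source.\<close>

definition UZ :: "(real \<Rightarrow> real^3 \<Rightarrow> real^3) \<Rightarrow> (real \<Rightarrow> real^3 \<Rightarrow> real) \<Rightarrow> (spacetime \<Rightarrow> real) \<Rightarrow> real \<Rightarrow> real" where
  "UZ dh ht z t = (LBINT x. ht t x * Dt z (t, x)) + (\<Sum>i\<in>UNIV. LBINT x. dh t x $ i * Dx i z (t, x))"

lemma energy_classD:
  assumes "energy_class h dh ht" "t \<ge> 0"
  shows "Hdot1 (h t) (dh t)" "L2mem (ht t)" "weak_grad (h t) (dh t)"
    "ht t \<in> borel_measurable borel" "e2 (ht t) < \<infinity>" "(\<lambda>x. dh t x $ i) \<in> borel_measurable borel" "e2 (\<lambda>x. dh t x $ i) < \<infinity>"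
    "((\<lambda>s. e2 (\<lambda>x. ht s x - ht t x)) \<longlongrightarrow> 0) (at t within {0..})"
    "((\<lambda>s. e2 (\<lambda>x. dh s x $ i - dh t x $ i)) \<longlongrightarrow> 0) (at t within {0..})"
proof -
  show H: "Hdot1 (h t) (dh t)" "L2mem (ht t)" using assms unfolding energy_class_def by blast+
  then show "weak_grad (h t) (dh t)" "ht t \<in> borel_measurable borel" "e2 (ht t) < \<infinity>"
    unfolding Hdot1_def L2mem_def Lpn_2_finite by auto
  have dm: "dh t \<in> borel_measurable borel" and d2: "e2 (\<lambda>x. norm (dh t x)) < \<infinity>" using H unfolding Hdot1_def Lpn_2_finite by auto
  show "(\<lambda>x. dh t x $ i) \<in> borel_measurable borel"
    by (rule measurable_compose[OF dm]) (intro borel_measurable_continuous_onI continuous_intros)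
  show "e2 (\<lambda>x. dh t x $ i) < \<infinity>"
    using le_less_trans[OF e2_mono[of "\<lambda>x. dh t x $ i" "\<lambda>x. norm (dh t x)"] d2] component_le_norm_cart[of "dh t _" i] by simp
  have "((\<lambda>s. Lpn 2 (\<lambda>x. ht s x - ht t x)) \<longlongrightarrow> 0) (at t within {0..})" using assms unfolding energy_class_def by blast
  then show "((\<lambda>s. e2 (\<lambda>x. ht s x - ht t x)) \<longlongrightarrow> 0) (at t within {0..})" unfolding e2_Lpn tendsto_ennreal_square_zero .
  have "((\<lambda>s. Lpn 2 (\<lambda>x. norm (dh s x - dh t x))) \<longlongrightarrow> 0) (at t within {0..})" using assms unfolding energy_class_def by blast
  then have l: "((\<lambda>s. e2 (\<lambda>x. norm (dh s x - dh t x))) \<longlongrightarrow> 0) (at t within {0..})" unfolding e2_Lpn tendsto_ennreal_square_zero .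
  show "((\<lambda>s. e2 (\<lambda>x. dh s x $ i - dh t x $ i)) \<longlongrightarrow> 0) (at t within {0..})"
  proof (rule tendsto_sandwich[OF _ _ tendsto_const l])
    have "e2 (\<lambda>x. dh s x $ i - dh t x $ i) \<le> e2 (\<lambda>x. norm (dh s x - dh t x))" for s
      using component_le_norm_cart[of "dh s _ - dh t _" i] by (intro e2_mono) simp
    then show "\<forall>\<^sub>F s in at t within {0..}. e2 (\<lambda>x. dh s x $ i - dh t x $ i) \<le> e2 (\<lambda>x. norm (dh s x - dh t x))" by simp
  qed simp
qed

lemma UZ_continuous:
  assumes ec: "energy_class h dh ht" and z: "nice_wave z"
  shows "continuous_on {0..} (UZ dh ht z)"
proof -
  obtain R where R: "cone_supp R z" using z unfolding nice_wave_def by blast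
  have C: "Cinf z" using z by (rule nice_wave_Cinf)
  have F: "continuous_on UNIV (dd b z)" "cone_supp R (dd b z)" for b by (intro Cinf_continuous Cinf_dd C cone_supp_dd R)+
  have "continuous (at t within {0..}) (\<lambda>s. LBINT x. ht s x * Dt z (s, x))" if "t \<ge> 0" for t
    by (rule pairing_continuous[OF _ _ energy_classD(8)[OF ec that] F that]) (use energy_classD(4,5)[OF ec] in auto)
  moreover have "continuous (at t within {0..}) (\<lambda>s. LBINT x. dh s x $ i * Dx i z (s, x))" if "t \<ge> 0" for t i
    by (rule pairing_continuous[OF _ _ energy_classD(9)[OF ec that] F that]) (use energy_classD(6,7)[OF ec] in auto)
  ultimately show ?thesis unfolding UZ_def[abs_def] continuous_on_eq_continuous_within
    by (auto intro!: continuous_add continuous_sum)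
qed

lemma dd_time_factor:
  fixes c :: "real \<Rightarrow> real" and F :: "spacetime \<Rightarrow> real"
  assumes c: "Cinf c" and F: "Cinf F"
  shows "Dt (\<lambda>p. c (fst p) * F p) p = c (fst p) * Dt F p + dd 1 c (fst p) * F p"
    and "Dx i (\<lambda>p. c (fst p) * F p) p = c (fst p) * Dx i F p"
    and "Cinf (\<lambda>p. c (fst p) * F p)"
proof -
  have fC: "Cinf (fst :: spacetime \<Rightarrow> real)" by (rule Cinf_linear[OF bounded_linear_fst])
  have cf: "Cinf (\<lambda>p::spacetime. c (fst p))" by (rule Cinf_compose_real[OF c fC])
  show "Cinf (\<lambda>p. c (fst p) * F p)" by (intro Cinf_mult cf F)
  have d: "dd b (\<lambda>p::spacetime. c (fst p)) p = dd 1 c (fst p) * fst b" for b p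
  proof -
    have "dd b (\<lambda>p::spacetime. c (fst p)) p = dd 1 c (fst p) * dd b fst p"
      by (rule dd_eq[OF dd_compose_real[OF Cinf_differentiable[OF fC] Cinf_differentiable[OF c]]])
    also have "dd b fst p = fst b" by (rule dd_eq[OF bounded_linear_imp_has_derivative[OF bounded_linear_fst]])
    finally show ?thesis .
  qed
  note m = dd_mult[OF Cinf_differentiable[OF cf] Cinf_differentiable[OF F]]
  show "Dt (\<lambda>p. c (fst p) * F p) p = c (fst p) * Dt F p + dd 1 c (fst p) * F p" unfolding m d by simp
  show "Dx i (\<lambda>p. c (fst p) * F p) p = c (fst p) * Dx i F p" unfolding m d by simp
qed

text \<open>The equation is tested with \<psi>1 = c z_t, and the relation that \<open>ht\<close> is
  the time derivative of \<open>h\<close> with \<psi>2 = c z_tt. Their sum no longer contains c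
  \<open>ht\<close> z_tt, and on each slice the weak gradient together with the wave equation for z
  and z_t removes everything except -c' times \<open>UZ\<close>. The function \<open>q\<close> is a
  jointly measurable version of the source at positive times.\<close>

lemma duality_smooth:
  assumes ec: "energy_class h dh ht" and ww: "weak_wave h dh ht P" and z: "nice_wave z"
    and q: "q \<in> borel_measurable borel" "\<And>t x. t > 0 \<Longrightarrow> q (t, x) = P t x (h t x)"
    and fin: "tail_pairing q z a < \<infinity>"
    and a: "0 < a" and c: "Cinf c" "\<And>t. c t \<noteq> 0 \<Longrightarrow> a \<le> t \<and> t \<le> b" "\<And>t. \<bar>c t\<bar> \<le> 1"
  shows "ennreal \<bar>LBINT t. dd 1 c t * UZ dh ht z t\<bar> \<le> tail_pairing q z a"
proof -
  obtain R where R: "cone_supp R z" using z unfolding nice_wave_def by blast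
  have C: "Cinf z" using z by (rule nice_wave_Cinf)
  define z1 where "z1 = Dt z"
  define z2 where "z2 = Dt z1"
  define z3 where "z3 = Dt z2"
  have C1: "Cinf z1" and C2: "Cinf z2" unfolding z1_def z2_def by (intro Cinf_dd C)+
  have n1: "nice_wave z1" unfolding z1_def by (rule nice_wave_dd[OF z])
  define \<psi>1 where "\<psi>1 p = c (fst p) * z1 p" for p
  define \<psi>2 where "\<psi>2 p = c (fst p) * z2 p" for p
  have suppd: "norm x \<le> R + b" if "c t \<noteq> 0" "dd e F (t, x) \<noteq> 0" "cone_supp R F" for t x e F
  proof -
    have "norm x \<le> R + \<bar>t\<bar>" using cone_supp_dd[OF that(3), of e] that(2) unfolding cone_supp_def by (meson not_le)
    then show ?thesis using c(2)[OF that(1)] a by linarith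
  qed
  have t1: "test_fn ({0<..} \<times> UNIV) \<psi>1" unfolding \<psi>1_def
  proof (rule test_fn_slabI[OF dd_time_factor(3)[OF c(1) C1] a])
    fix t x assume "c (fst (t, x)) * z1 (t, x) \<noteq> 0"
    then show "a \<le> t \<and> t \<le> b \<and> norm x \<le> R + b" using c(2)[of t] suppd[of t "(1,0)" z x, OF _ _ R] unfolding z1_def by auto
  qed
  have t2: "test_fn ({0<..} \<times> UNIV) \<psi>2" unfolding \<psi>2_def
  proof (rule test_fn_slabI[OF dd_time_factor(3)[OF c(1) C2] a])
    fix t x assume "c (fst (t, x)) * z2 (t, x) \<noteq> 0"
    then show "a \<le> t \<and> t \<le> b \<and> norm x \<le> R + b" using c(2)[of t] suppd[of t "(1,0)" z1 x, OF _ _ cone_supp_dd[OF R, of "(1,0)", folded z1_def]] unfolding z2_def by auto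
  qed
  define c' where "c' = dd 1 c"
  have D1: "Dt \<psi>1 p = c (fst p) * z2 p + c' (fst p) * z1 p" for p unfolding \<psi>1_def c'_def z2_def by (rule dd_time_factor(1)[OF c(1) C1])
  have D1x: "Dx i \<psi>1 p = c (fst p) * Dx i z1 p" for i p unfolding \<psi>1_def by (rule dd_time_factor(2)[OF c(1) C1])
  have D2: "Dt \<psi>2 p = c (fst p) * z3 p + c' (fst p) * z2 p" for p unfolding \<psi>2_def c'_def z3_def by (rule dd_time_factor(1)[OF c(1) C2])
  define A where "A p = - ht (fst p) (snd p) * Dt \<psi>1 p + (\<Sum>i\<in>UNIV. dh (fst p) (snd p) $ i * Dx i \<psi>1 p) + P (fst p) (snd p) (h (fst p) (snd p)) * \<psi>1 p" for p
  have iA: "integrable lborel A" and eA: "(LBINT p. A p) = 0"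
    using ww t1 unfolding weak_wave_def tderiv_def xgrad_def A_def[abs_def] by (auto simp: case_prod_unfold inner_vec_def)
  define B1 where "B1 p = h (fst p) (snd p) * Dt \<psi>2 p" for p
  define B2 where "B2 p = ht (fst p) (snd p) * \<psi>2 p" for p
  have iB1: "integrable lborel B1" and iB2: "integrable lborel B2" and eB: "(LBINT p. B1 p) = - (LBINT p. B2 p)"
    using ec t2 unfolding energy_class_def tderiv_def B1_def[abs_def] B2_def[abs_def] by (auto simp: case_prod_unfold)
  define Q where "Q p = q p * \<psi>1 p" for p
  have PQ: "P (fst p) (snd p) (h (fst p) (snd p)) * \<psi>1 p = Q p" for p
  proof (cases "fst p > 0")
    case True
    then show ?thesis using q(2)[of "fst p" "snd p"] unfolding Q_def by simp
  next
    case False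
    then have "c (fst p) = 0" using c(2)[of "fst p"] a by auto
    then show ?thesis unfolding Q_def \<psi>1_def by simp
  qed
  have Qb: "ennreal \<bar>Q p\<bar> \<le> ennreal \<bar>q p * Dt z p\<bar> * indicator {a..} (fst p)" for p
  proof (cases "c (fst p) = 0")
    case True then show ?thesis unfolding Q_def \<psi>1_def by simp
  next
    case False
    have "\<bar>c (fst p)\<bar> * \<bar>q p * z1 p\<bar> \<le> 1 * \<bar>q p * z1 p\<bar>" by (intro mult_right_mono c(3)) auto
    then have "\<bar>Q p\<bar> \<le> \<bar>q p * Dt z p\<bar>" unfolding Q_def \<psi>1_def z1_def by (simp add: abs_mult mult_ac)
    then show ?thesis using c(2)[OF False] by (simp add: ennreal_leI)
  qed
  have nQ: "(NNINT p. ennreal \<bar>Q p\<bar>) \<le> tail_pairing q z a" by (intro nn_integral_mono Qb)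
  have C\<psi>1: "Cinf \<psi>1" unfolding \<psi>1_def by (rule dd_time_factor(3)[OF c(1) C1])
  have Qm: "Q \<in> borel_measurable borel" unfolding Q_def[abs_def] using q(1) Cinf_measurable[OF C\<psi>1] by (rule borel_measurable_times)
  have iQ: "integrable lborel Q"
    by (rule integrableI_bounded) (use Qm le_less_trans[OF nQ fin] in auto)
  \<comment> \<open>B1 + B2 has integral zero and is added so that the terms c \<open>ht\<close>
    z_tt cancel.\<close>
  define \<Phi> where "\<Phi> p = A p - Q p + B1 p + B2 p" for p
  have i\<Phi>: "integrable lborel \<Phi>" unfolding \<Phi>_def[abs_def]
    by (intro Bochner_Integration.integrable_add Bochner_Integration.integrable_diff iA iQ iB1 iB2)
  have e\<Phi>: "(LBINT p. \<Phi> p) = - (LBINT p. Q p)"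
    unfolding \<Phi>_def using iA iQ iB1 iB2 eA eB by simp
  have \<Phi>eq: "\<Phi> p = - c' (fst p) * (ht (fst p) (snd p) * z1 p) + (\<Sum>i\<in>UNIV. c (fst p) * (dh (fst p) (snd p) $ i * Dx i z1 p))
      + h (fst p) (snd p) * (c (fst p) * z3 p + c' (fst p) * z2 p)" for p
    unfolding \<Phi>_def A_def B1_def B2_def PQ D1 D1x D2 \<psi>2_def by (simp add: algebra_simps)
  have slice: "(LBINT x. \<Phi> (t, x)) = - (c' t * UZ dh ht z t)" for t
  proof (cases "t > 0")
    case False
    \<comment> \<open>Since a > 0, the cut-off vanishes in a neighbourhood of every t \<le> 0, so
      that the slice contributes nothing.\<close>
    have "c s = 0" if "s < a" for s using c(2)[of s] that by auto
    then have "(c has_real_derivative 0) (at t)"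
      using False a by (intro has_field_derivative_transform_within_open[of "\<lambda>_. 0" 0 t "{..<a}" c]) auto
    then have "c' t = 0" unfolding c'_def using DERIV_unique[OF Cinf_real_deriv[OF c(1)]] by blast
    moreover have "c t = 0" using c(2)[of t] False a by auto
    ultimately show ?thesis unfolding \<Phi>eq by simp
  next
    case True
    then have t0: "t \<ge> 0" by simp
    note E = energy_classD[OF ec t0]
    note [measurable] = E(4) E(6)
    \<comment> \<open>The field whose divergence is c' z_tt + c z_ttt, by the wave equation for z
      and for z_t.\<close>
    define u where "u i x = c' t * Dx i z (t, x) + c t * Dx i z1 (t, x)" for i x
    have Cu: "Cinf (u i)" for i unfolding u_def by (intro Cinf_add Cinf_mult Cinf_const Cinf_slice Cinf_dd C C1)
    have tu: "test_fn UNIV (u i)" for i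
    proof (rule test_fnI[OF Cu, of "R + \<bar>t\<bar>"])
      fix x :: "real^3" assume "R + \<bar>t\<bar> < norm x"
      then show "u i x = 0" using cone_supp_dd[OF R] cone_supp_dd[OF cone_supp_dd[OF R]] unfolding u_def z1_def cone_supp_def by simp
    qed
    have dsl: "dd (axis i 1) (\<lambda>x. F (t, x)) x = Dx i F (t, x)" if "Cinf F" for F i x by (rule dd_slice[OF Cinf_differentiable[OF that]])
    have du: "dd (axis i 1) (u i) x = c' t * Dx i (Dx i z) (t, x) + c t * Dx i (Dx i z1) (t, x)" for i x
    proof -
      have "dd (axis i 1) (u i) x = dd (axis i 1) (\<lambda>x. c' t * Dx i z (t, x)) x + dd (axis i 1) (\<lambda>x. c t * Dx i z1 (t, x)) x"
        unfolding u_def by (intro dd_add Cinf_differentiable Cinf_mult Cinf_const Cinf_slice Cinf_dd C C1)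
      then show ?thesis
        by (simp add: dd_mult[OF differentiable_const Cinf_differentiable[OF Cinf_slice[OF Cinf_dd[OF C]]]]
            dd_mult[OF differentiable_const Cinf_differentiable[OF Cinf_slice[OF Cinf_dd[OF C1]]]] dsl[OF Cinf_dd[OF C]] dsl[OF Cinf_dd[OF C1]])
    qed
    have wgr: "integrable lborel (\<lambda>x. h t x * dd (axis i 1) (u i) x)" "integrable lborel (\<lambda>x. dh t x $ i * u i x)"
      "(LBINT x. h t x * dd (axis i 1) (u i) x) = - (LBINT x. dh t x $ i * u i x)" for i
      using E(3) tu[of i] unfolding weak_grad_def by blast+
    have lap: "c t * z3 (t, x) + c' t * z2 (t, x) = (\<Sum>i\<in>UNIV. dd (axis i 1) (u i) x)" for x
    proof -
      have "z2 (t, x) = (\<Sum>i\<in>UNIV. Dx i (Dx i z) (t, x))" using z unfolding z2_def z1_def nice_wave_def by blast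
      moreover have "z3 (t, x) = (\<Sum>i\<in>UNIV. Dx i (Dx i z1) (t, x))" using n1 unfolding z3_def z2_def nice_wave_def by blast
      ultimately show ?thesis unfolding du by (simp add: sum.distrib sum_distrib_left)
    qed
    have sl: "(\<lambda>x. dd b z (t, x)) \<in> borel_measurable borel" "e2 (\<lambda>x. dd b z (t, x)) < \<infinity>" "(\<lambda>x. dd b z1 (t, x)) \<in> borel_measurable borel" "e2 (\<lambda>x. dd b z1 (t, x)) < \<infinity>" for b
      using cone_supp_slice(2,3)[OF Cinf_continuous[OF Cinf_dd[OF C]] cone_supp_dd[OF R]]
        cone_supp_slice(2,3)[OF Cinf_continuous[OF Cinf_dd[OF C1]] cone_supp_dd[OF cone_supp_dd[OF R, of "(1,0)", folded z1_def]]] by auto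
    have j1: "integrable lborel (\<lambda>x. ht t x * z1 (t, x))" unfolding z1_def by (rule integrable_mult_L2[OF E(4) sl(1) E(5) sl(2)])
    have j2: "integrable lborel (\<lambda>x. dh t x $ i * Dx i z1 (t, x))" for i by (rule integrable_mult_L2[OF E(6) sl(3) E(7) sl(4)])
    have j3: "integrable lborel (\<lambda>x. dh t x $ i * Dx i z (t, x))" for i by (rule integrable_mult_L2[OF E(6) sl(1) E(7) sl(2)])
    have "(LBINT x. \<Phi> (t, x)) = (LBINT x. - c' t * (ht t x * z1 (t, x)) + (\<Sum>i\<in>UNIV. c t * (dh t x $ i * Dx i z1 (t, x)) + h t x * dd (axis i 1) (u i) x))"
      unfolding \<Phi>eq fst_conv snd_conv lap by (simp only: sum.distrib sum_distrib_left add.assoc)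
    also have "\<dots> = (LBINT x. - c' t * (ht t x * z1 (t, x))) + (\<Sum>i\<in>UNIV. LBINT x. c t * (dh t x $ i * Dx i z1 (t, x)) + h t x * dd (axis i 1) (u i) x)"
      by (subst Bochner_Integration.integral_add, intro integrable_mult_right j1,
          intro Bochner_Integration.integrable_sum Bochner_Integration.integrable_add integrable_mult_right j2 wgr,
          subst Bochner_Integration.integral_sum, intro Bochner_Integration.integrable_add integrable_mult_right j2 wgr, rule refl)
    also have "(LBINT x. - c' t * (ht t x * z1 (t, x))) = - c' t * (LBINT x. ht t x * z1 (t, x))" by simp
    also have "(\<Sum>i\<in>UNIV. LBINT x. c t * (dh t x $ i * Dx i z1 (t, x)) + h t x * dd (axis i 1) (u i) x) = (\<Sum>i\<in>UNIV. - (c' t * (LBINT x. dh t x $ i * Dx i z (t, x))))"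
    proof (rule sum.cong[OF refl])
      fix i :: 3
      have "(LBINT x. dh t x $ i * u i x) = (LBINT x. c' t * (dh t x $ i * Dx i z (t, x)) + c t * (dh t x $ i * Dx i z1 (t, x)))"
        unfolding u_def by (simp add: algebra_simps)
      also have "\<dots> = c' t * (LBINT x. dh t x $ i * Dx i z (t, x)) + c t * (LBINT x. dh t x $ i * Dx i z1 (t, x))"
        by (subst Bochner_Integration.integral_add[OF integrable_mult_right[OF j3] integrable_mult_right[OF j2]]) simp
      finally have e: "(LBINT x. dh t x $ i * u i x) = c' t * (LBINT x. dh t x $ i * Dx i z (t, x)) + c t * (LBINT x. dh t x $ i * Dx i z1 (t, x))" .
      show "(LBINT x. c t * (dh t x $ i * Dx i z1 (t, x)) + h t x * dd (axis i 1) (u i) x) = - (c' t * (LBINT x. dh t x $ i * Dx i z (t, x)))"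
        by (subst Bochner_Integration.integral_add[OF integrable_mult_right[OF j2] wgr(1)]) (simp add: wgr(3) e)
    qed
    finally show ?thesis unfolding UZ_def z1_def by (simp add: sum_negf sum_distrib_left algebra_simps)
  qed
  have "(LBINT t. (LBINT x. \<Phi> (t, x))) = (LBINT p. \<Phi> p)"
    using lborel_pair.integral_fst'[of \<Phi>] i\<Phi> by (simp add: lborel_prod)
  then have "(LBINT t. c' t * UZ dh ht z t) = (LBINT p. Q p)"
    unfolding slice e\<Phi> by simp
  then have "ennreal \<bar>LBINT t. c' t * UZ dh ht z t\<bar> = ennreal (norm (LBINT p. Q p))" by simp
  also have "\<dots> \<le> (NNINT p. ennreal (norm (Q p)))" by (rule integral_norm_bound_ennreal[OF iQ])
  also have "\<dots> \<le> tail_pairing q z a" using nQ by simp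
  finally show ?thesis unfolding c'_def .
qed

text \<open>The kernel has mass one and lives on [s, s + 1 / n]. It approaches s from the right, so
  that continuity on the half-line is enough also at s = 0.\<close>

lemma sig_average:
  fixes f :: "real \<Rightarrow> real"
  assumes f: "continuous_on {0..} f" and s: "s \<ge> 0" and e: "e > 0"
  shows "\<exists>n0>0. \<forall>n\<ge>n0. integrable lborel (\<lambda>t. n * sig (n * t - n * s) * f t) \<and> \<bar>(LBINT t. n * sig (n * t - n * s) * f t) - f s\<bar> \<le> e"
proof -
  have "continuous (at s within {0..}) f" using f s unfolding continuous_on_eq_continuous_within by auto
  then obtain d where d: "d > 0" "\<And>t. t \<ge> 0 \<Longrightarrow> dist t s < d \<Longrightarrow> dist (f t) (f s) < e"
    unfolding continuous_within_eps_delta using e by (metis atLeast_iff)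
  show ?thesis
  proof (intro exI[of _ "2 / d"] conjI allI impI)
    show "2 / d > 0" using d by simp
    fix n assume n: "n \<ge> 2 / d"
    have n0: "n > 0" using n d by (smt (verit) divide_pos_pos)
    define k where "k t = n * sig (n * t - n * s)" for t
    have ck: "continuous_on UNIV k" unfolding k_def
      by (intro continuous_intros continuous_on_compose2[OF Cinf_continuous[OF Cinf_dd[OF sstep_props(1)]]]) auto
    have k0: "k t \<ge> 0" for t unfolding k_def using n0 sstep_props(3) by simp
    have ks: "k t = 0" if "t \<notin> {s..s + 1 / n}" for t
    proof -
      have "n * t - n * s \<le> 0 \<or> n * t - n * s \<ge> 1" using that n0 by (auto simp: field_simps not_le)
      then show ?thesis unfolding k_def using sstep_props(5,7) by auto
    qed
    have kmul: "indicator {s..s + 1 / n} t *\<^sub>R (k t * g t) = k t * g t" for t and g :: "real \<Rightarrow> real"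
      using ks[of t] by (cases "t \<in> {s..s + 1 / n}") auto
    have int: "integrable lborel (\<lambda>t. k t * g t)" if "continuous_on {0..} g" for g :: "real \<Rightarrow> real"
    proof -
      have "integrable lborel (\<lambda>t. indicator {s..s + 1 / n} t *\<^sub>R (k t * g t))"
        using s by (intro borel_integrable_compact continuous_intros continuous_on_subset[OF ck] continuous_on_subset[OF that]) auto
      then show ?thesis unfolding kmul .
    qed
    have ki: "integrable lborel k" using int[of "\<lambda>_. 1"] by simp
    have k1: "(LBINT t. k t) = 1"
    proof -
      have "(LBINT t. k t) = (LBINT t. indicator {s..s + 1 / n} t *\<^sub>R k t)" using kmul[of _ "\<lambda>_. 1"] by (simp only: mult_1_right)
      also have "\<dots> = sstep (n * (s + 1 / n) - n * s) - sstep (n * s - n * s)"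
      proof (rule integral_FTC_atLeastAtMost)
        show "s \<le> s + 1 / n" using n0 by simp
        fix t
        have "((\<lambda>t. n * t - n * s) has_real_derivative n) (at t)" by (auto intro!: derivative_eq_intros)
        from DERIV_chain2[OF sstep_props(2) this] have "((\<lambda>t. sstep (n * t - n * s)) has_real_derivative k t) (at t)" by (simp add: k_def mult.commute)
        then show "((\<lambda>t. sstep (n * t - n * s)) has_vector_derivative k t) (at t within {s..s + 1 / n})"
          unfolding has_real_derivative_iff_has_vector_derivative by (rule has_vector_derivative_at_within)
      qed (rule continuous_on_subset[OF ck], simp)
      also have "\<dots> = 1" using n0 by (simp add: algebra_simps sstep_props)
      finally show ?thesis .
    qed
    show "integrable lborel (\<lambda>t. n * sig (n * t - n * s) * f t)" using int[OF f] unfolding k_def .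
    have "(LBINT t. k t * f t) - f s = (LBINT t. k t * f t) - (LBINT t. k t * f s)" using k1 by simp
    also have "\<dots> = (LBINT t. k t * (f t - f s))"
      by (subst Bochner_Integration.integral_diff[symmetric], rule int[OF f], rule integrable_mult_left, rule ki, simp add: algebra_simps)
    finally have eq: "(LBINT t. k t * f t) - f s = (LBINT t. k t * (f t - f s))" .
    have "\<bar>LBINT t. k t * (f t - f s)\<bar> \<le> (LBINT t. \<bar>k t * (f t - f s)\<bar>)" by (rule integral_abs_bound)
    also have "\<dots> \<le> (LBINT t. k t * e)"
    proof (rule integral_mono)
      show "integrable lborel (\<lambda>t. \<bar>k t * (f t - f s)\<bar>)" by (intro integrable_abs int continuous_intros f)
      show "integrable lborel (\<lambda>t. k t * e)" by (intro integrable_mult_left ki)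
      fix t
      show "\<bar>k t * (f t - f s)\<bar> \<le> k t * e"
      proof (cases "t \<in> {s..s + 1 / n}")
        case True
        have "1 / n < d"
        proof -
          have "n * d \<ge> 2" using n d by (simp add: field_simps)
          then show ?thesis using n0 by (simp add: field_simps)
        qed
        then have "dist (f t) (f s) < e" using True s by (intro d(2)) (auto simp: dist_real_def)
        then have "\<bar>f t - f s\<bar> \<le> e" by (simp add: dist_real_def)
        then show ?thesis unfolding abs_mult using k0[of t] by (simp add: mult_left_mono)
      qed (simp add: ks)
    qed
    also have "\<dots> = e" using k1 by simp
    finally have "\<bar>(LBINT t. k t * f t) - f s\<bar> \<le> e" unfolding eq .
    then show "\<bar>(LBINT t. n * sig (n * t - n * s) * f t) - f s\<bar> \<le> e" unfolding k_def .
  qed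
qed

text \<open>The derivative of the time cut-off in \<open>duality_smooth\<close> is sharpened to the
  difference of two point evaluations, while the bound by the tail stays the same
  throughout.\<close>

theorem duality:
  assumes ec: "energy_class h dh ht" and ww: "weak_wave h dh ht P" and z: "nice_wave z"
    and q: "q \<in> borel_measurable borel" "\<And>t x. t > 0 \<Longrightarrow> q (t, x) = P t x (h t x)"
    and fin: "tail_pairing q z t1 < \<infinity>"
    and t: "0 < t1" "t1 < t2"
  shows "ennreal \<bar>UZ dh ht z t2 - UZ dh ht z t1\<bar> \<le> tail_pairing q z t1"
proof -
  define f where "f = UZ dh ht z"
  define B where "B = enn2real (tail_pairing q z t1)"
  have B: "ennreal B = tail_pairing q z t1" unfolding B_def using fin by simp
  have f: "continuous_on {0..} f" unfolding f_def by (rule UZ_continuous[OF ec z])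
  have "\<bar>f t2 - f t1\<bar> \<le> B"
  proof (rule field_le_epsilon)
    fix e :: real assume e: "e > 0"
    obtain n1 where n1: "n1 > 0" "\<And>n. n \<ge> n1 \<Longrightarrow> integrable lborel (\<lambda>t. n * sig (n * t - n * t1) * f t) \<and> \<bar>(LBINT t. n * sig (n * t - n * t1) * f t) - f t1\<bar> \<le> e / 2"
      using sig_average[OF f, of t1 "e / 2"] t e by (meson half_gt_zero less_imp_le)
    obtain n2 where n2: "n2 > 0" "\<And>n. n \<ge> n2 \<Longrightarrow> integrable lborel (\<lambda>t. n * sig (n * t - n * t2) * f t) \<and> \<bar>(LBINT t. n * sig (n * t - n * t2) * f t) - f t2\<bar> \<le> e / 2"
      using sig_average[OF f, of t2 "e / 2"] t e by (meson half_gt_zero less_imp_le less_trans)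
    define n where "n = max n1 n2"
    have n: "n > 0" "n \<ge> n1" "n \<ge> n2" using n1 by (auto simp: n_def)
    \<comment> \<open>A smooth version of the indicator of [t1, t2]. It is supported in
      [t1, t2 + 1 / n], hence the tail may start at t1 itself, and its derivative is the difference
      of two averaging kernels.\<close>
    define c where "c s = sstep (n * s + (- (n * t1))) - sstep (n * s + (- (n * t2)))" for s
    have lin: "bounded_linear (\<lambda>s::real. n * s)" by (rule bounded_linear_mult_right)
    have Cs: "Cinf (\<lambda>s. sstep (n * s + a))" for a by (rule Cinf_compose_affine[OF lin sstep_props(1)])
    have Cc: "Cinf c" unfolding c_def by (intro Cinf_diff Cs)
    have dc: "dd 1 c s = n * sig (n * s - n * t1) - n * sig (n * s - n * t2)" for s
    proof -
      have d1: "dd 1 (\<lambda>s. sstep (n * s + a)) s = n * sig (n * s + a)" for a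
      proof -
        have "dd 1 (\<lambda>s. sstep (n * s + a)) s = dd (n * 1) sstep (n * s + a)"
          by (rule dd_eq[OF dd_compose_affine[OF lin Cinf_differentiable[OF sstep_props(1)]]])
        also have "\<dots> = n * sig (n * s + a)" using dd_scale(1)[OF Cinf_differentiable[OF sstep_props(1)], of n 1] by simp
        finally show ?thesis .
      qed
      show ?thesis unfolding c_def dd_diff[OF Cinf_differentiable[OF Cs] Cinf_differentiable[OF Cs]] d1 by simp
    qed
    have "ennreal \<bar>LBINT s. dd 1 c s * UZ dh ht z s\<bar> \<le> tail_pairing q z t1"
    proof (rule duality_smooth[OF ec ww z q fin t(1) Cc])
      fix s
      show "\<bar>c s\<bar> \<le> 1" unfolding c_def using sstep_bounds[of "n * s + - (n * t1)"] sstep_bounds[of "n * s + - (n * t2)"] by linarith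
      assume ne: "c s \<noteq> 0"
      have "t1 \<le> s"
      proof (rule ccontr)
        assume "\<not> t1 \<le> s"
        then have "n * s + - (n * t1) \<le> 0" "n * s + - (n * t2) \<le> 0" using n t by simp_all
        then show False using ne unfolding c_def by (simp add: sstep_props(4))
      qed
      moreover have "s \<le> t2 + 1 / n"
      proof (rule ccontr)
        assume "\<not> s \<le> t2 + 1 / n"
        then have "n * (t2 + 1 / n) \<le> n * s" using n by (intro mult_left_mono) auto
        then have 1: "n * s + - (n * t2) \<ge> 1" using n by (simp add: algebra_simps)
        moreover have "n * t1 \<le> n * t2" using n t by simp
        ultimately have "n * s + - (n * t1) \<ge> 1" by linarith
        then show False using ne 1 unfolding c_def by (simp add: sstep_props(6))
      qed
      ultimately show "t1 \<le> s \<and> s \<le> t2 + 1 / n" by simp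
    qed
    then have b: "\<bar>LBINT s. dd 1 c s * f s\<bar> \<le> B" unfolding B[symmetric] f_def by (simp add: ennreal_le_iff B_def)
    have "(LBINT s. dd 1 c s * f s) = (LBINT s. n * sig (n * s - n * t1) * f s - n * sig (n * s - n * t2) * f s)"
      unfolding dc by (simp add: algebra_simps)
    also have "\<dots> = (LBINT s. n * sig (n * s - n * t1) * f s) - (LBINT s. n * sig (n * s - n * t2) * f s)"
      using n1(2)[OF n(2)] n2(2)[OF n(3)] by (intro Bochner_Integration.integral_diff) auto
    finally show "\<bar>f t2 - f t1\<bar> \<le> B + e" using b n1(2)[OF n(2)] n2(2)[OF n(3)] by linarith
  qed
  then show ?thesis unfolding B[symmetric] f_def by (rule ennreal_leI)
qed

section \<open>Tail estimates for the source terms\<close>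

text \<open>The functional sending z to the integral of |G z_t| over t \<ge> T has norm tending to 0
  on the energy space. Squares appear because \<open>en\<close> is quadratic; absolute values under
  the integral make the notion monotone in |G|.\<close>

definition small_tail :: "(spacetime \<Rightarrow> real) \<Rightarrow> bool" where
  "small_tail G \<longleftrightarrow> (\<forall>\<delta>>0. \<exists>T0>0. \<forall>T\<ge>T0. \<forall>z. nice_wave z \<longrightarrow>
     (tail_pairing G z T)\<^sup>2 \<le> ennreal (\<delta> * en z))"

lemma small_tail_mono:
  assumes H: "small_tail H" and le: "\<And>p. fst p > 0 \<Longrightarrow> \<bar>G p\<bar> \<le> \<bar>H p\<bar>"
  shows "small_tail G"
  unfolding small_tail_def
proof (intro allI impI)
  fix \<delta> :: real assume "\<delta> > 0"
  then obtain T0 where T0: "T0 > 0" "\<And>T z. T \<ge> T0 \<Longrightarrow> nice_wave z \<Longrightarrow> (tail_pairing H z T)^2 \<le> ennreal (\<delta> * en z)"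
    using H unfolding small_tail_def by blast
  show "\<exists>T0>0. \<forall>T\<ge>T0. \<forall>z. nice_wave z \<longrightarrow> (tail_pairing G z T)^2 \<le> ennreal (\<delta> * en z)"
  proof (intro exI[of _ T0] conjI allI impI T0(1))
    fix T z assume T: "T \<ge> T0" and z: "nice_wave z"
    have "tail_pairing G z T \<le> tail_pairing H z T"
    proof (rule nn_integral_mono)
      fix p :: "spacetime"
      show "ennreal \<bar>G p * Dt z p\<bar> * indicator {T..} (fst p) \<le> ennreal \<bar>H p * Dt z p\<bar> * indicator {T..} (fst p)"
      proof (cases "fst p \<ge> T")
        case True
        then have "fst p > 0" using T T0(1) by simp
        then have "\<bar>G p * Dt z p\<bar> \<le> \<bar>H p * Dt z p\<bar>" unfolding abs_mult by (intro mult_right_mono le) auto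
        then show ?thesis by (intro mult_right_mono ennreal_leI) auto
      qed simp
    qed
    then have "(tail_pairing G z T)^2 \<le> (tail_pairing H z T)^2"
      by (simp add: ennreal_square_le_iff)
    then show "(tail_pairing G z T)^2 \<le> ennreal (\<delta> * en z)"
      using T0(2)[OF T z] by simp
  qed
qed

lemma nice_wave_Dt_measurable: "nice_wave z \<Longrightarrow> dd b z \<in> borel_measurable borel"
  by (intro Cinf_measurable Cinf_dd nice_wave_Cinf)

lemma small_tail_cmult:
  assumes G: "small_tail G" and Gm: "G \<in> borel_measurable borel"
  shows "small_tail (\<lambda>p. K * G p)"
  unfolding small_tail_def
proof (intro allI impI)
  fix \<delta> :: real assume \<delta>: "\<delta> > 0"
  \<comment> \<open>The summand 1 covers K = 0.\<close>
  define \<delta>' where "\<delta>' = \<delta> / (K^2 + 1)"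
  have K1: "K^2 + 1 > 0" by (simp add: add_nonneg_pos)
  have "\<delta>' > 0" using \<delta> K1 by (simp add: \<delta>'_def)
  then obtain T0 where T0: "T0 > 0" "\<And>T z. T \<ge> T0 \<Longrightarrow> nice_wave z \<Longrightarrow> (tail_pairing G z T)^2 \<le> ennreal (\<delta>' * en z)"
    using G unfolding small_tail_def by blast
  show "\<exists>T0>0. \<forall>T\<ge>T0. \<forall>z. nice_wave z \<longrightarrow> (tail_pairing (\<lambda>p. K * G p) z T)^2 \<le> ennreal (\<delta> * en z)"
  proof (intro exI[of _ T0] conjI allI impI T0(1))
    fix T z assume T: "T \<ge> T0" and z: "nice_wave z"
    note [measurable] = Gm nice_wave_Dt_measurable[OF z]
    have "tail_pairing (\<lambda>p. K * G p) z T = (NNINT p. ennreal \<bar>K\<bar> * (ennreal \<bar>G p * Dt z p\<bar> * indicator {T..} (fst p)))"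
      by (simp add: abs_mult ennreal_mult' mult.assoc)
    also have "\<dots> = ennreal \<bar>K\<bar> * tail_pairing G z T" by (rule nn_integral_cmult) measurable
    finally have "(tail_pairing (\<lambda>p. K * G p) z T)^2 = ennreal (K^2) * (tail_pairing G z T)^2"
      by (simp add: power_mult_distrib ennreal_power)
    also have "\<dots> \<le> ennreal (K^2) * ennreal (\<delta>' * en z)" by (intro mult_left_mono T0(2) T z) simp
    also have "\<dots> = ennreal (K^2 * (\<delta>' * en z))" by (simp add: ennreal_mult')
    also have "\<dots> \<le> ennreal (\<delta> * en z)"
    proof (rule ennreal_leI)
      have "K^2 * \<delta>' \<le> \<delta>" using \<delta> K1 by (simp add: \<delta>'_def divide_simps)
      then show "K^2 * (\<delta>' * en z) \<le> \<delta> * en z" using edens_conserved(4)[OF z] by (simp add: mult.assoc[symmetric] mult_right_mono)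
    qed
    finally show "(tail_pairing (\<lambda>p. K * G p) z T)^2 \<le> ennreal (\<delta> * en z)" .
  qed
qed

lemma ennreal_square_add_le: "(a + b)^2 \<le> 2 * a^2 + 2 * b^2" for a b :: ennreal
proof (cases "a = top \<or> b = top")
  case True
  then show ?thesis by (auto simp: power2_eq_square ennreal_mult_top ennreal_mult_eq_top_iff)
next
  case False
  then obtain r s where rs: "a = ennreal r" "b = ennreal s" "0 \<le> r" "0 \<le> s" by (metis ennreal_cases)
  have "(r + s)^2 \<le> 2 * r^2 + 2 * s^2" using sum_squares_bound[of r s] by (simp add: power2_sum)
  then have "ennreal ((r + s)^2) \<le> ennreal (2 * r^2 + 2 * s^2)" by (rule ennreal_leI)
  moreover have "ennreal (2 * r^2 + 2 * s^2) = 2 * ennreal (r^2) + 2 * ennreal (s^2)" by (subst ennreal_plus) (simp_all add: ennreal_mult')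
  moreover have "(a + b)^2 = ennreal ((r + s)^2)" "a^2 = ennreal (r^2)" "b^2 = ennreal (s^2)"
    using rs by (simp_all add: ennreal_power del: ennreal_plus add: ennreal_plus[symmetric])
  ultimately show ?thesis by simp
qed

lemma small_tail_add:
  assumes G: "small_tail G" and H: "small_tail H" and Gm: "G \<in> borel_measurable borel" and Hm: "H \<in> borel_measurable borel"
  shows "small_tail (\<lambda>p. \<bar>G p\<bar> + \<bar>H p\<bar>)"
  unfolding small_tail_def
proof (intro allI impI)
  fix \<delta> :: real assume \<delta>: "\<delta> > 0"
  then have "\<delta> / 4 > 0" by simp
  then obtain T1 where T1: "T1 > 0" "\<And>T z. T \<ge> T1 \<Longrightarrow> nice_wave z \<Longrightarrow> (tail_pairing G z T)^2 \<le> ennreal (\<delta> / 4 * en z)"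
    using G unfolding small_tail_def by blast
  obtain T2 where T2: "T2 > 0" "\<And>T z. T \<ge> T2 \<Longrightarrow> nice_wave z \<Longrightarrow> (tail_pairing H z T)^2 \<le> ennreal (\<delta> / 4 * en z)"
    using H \<open>\<delta> / 4 > 0\<close> unfolding small_tail_def by blast
  show "\<exists>T0>0. \<forall>T\<ge>T0. \<forall>z. nice_wave z \<longrightarrow> (tail_pairing (\<lambda>p. \<bar>G p\<bar> + \<bar>H p\<bar>) z T)^2 \<le> ennreal (\<delta> * en z)"
  proof (intro exI[of _ "max T1 T2"] conjI allI impI)
    show "max T1 T2 > 0" using T1 by simp
    fix T z assume T: "T \<ge> max T1 T2" and z: "nice_wave z"
    note [measurable] = Gm Hm nice_wave_Dt_measurable[OF z]
    have "\<bar>(\<bar>G p\<bar> + \<bar>H p\<bar>) * Dt z p\<bar> = \<bar>G p * Dt z p\<bar> + \<bar>H p * Dt z p\<bar>" for p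
    proof -
      have "\<bar>(\<bar>G p\<bar> + \<bar>H p\<bar>) * Dt z p\<bar> = (\<bar>G p\<bar> + \<bar>H p\<bar>) * \<bar>Dt z p\<bar>" by (subst abs_mult) simp
      then show ?thesis by (simp only: abs_mult distrib_right)
    qed
    then have "tail_pairing (\<lambda>p. \<bar>G p\<bar> + \<bar>H p\<bar>) z T =
       (NNINT p. ennreal \<bar>G p * Dt z p\<bar> * indicator {T..} (fst p) + ennreal \<bar>H p * Dt z p\<bar> * indicator {T..} (fst p))"
      by (simp add: distrib_right)
    also have "\<dots> = tail_pairing G z T + tail_pairing H z T"
      by (rule nn_integral_add) measurable
    finally have "(tail_pairing (\<lambda>p. \<bar>G p\<bar> + \<bar>H p\<bar>) z T)^2 \<le>
       2 * (tail_pairing G z T)^2 + 2 * (tail_pairing H z T)^2"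
      by (simp add: ennreal_square_add_le)
    also have "\<dots> \<le> 2 * ennreal (\<delta> / 4 * en z) + 2 * ennreal (\<delta> / 4 * en z)"
      using T by (intro add_mono mult_left_mono T1(2) T2(2) z) auto
    also have "\<dots> = ennreal (2 * (\<delta> / 4 * en z)) + ennreal (2 * (\<delta> / 4 * en z))" by (simp only: ennreal_mult' ennreal_numeral zero_le_numeral)
    also have "\<dots> = ennreal (\<delta> * en z)" using \<delta> edens_conserved(4)[OF z] by (simp add: ennreal_plus[symmetric] del: ennreal_plus)
    finally show "(tail_pairing (\<lambda>p. \<bar>G p\<bar> + \<bar>H p\<bar>) z T)^2 \<le> ennreal (\<delta> * en z)" .
  qed
qed

lemma Dt_square_le_edens: "(Dt z p)^2 \<le> edens z p"
  unfolding edens_def by (simp add: sum_nonneg)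

text \<open>Cauchy-Schwarz with the weight w: the first factor is the tail of a convergent integral,
  the second is bounded by the energy through local energy decay.\<close>

lemma small_tail_weighted:
  assumes Gm [measurable]: "G \<in> borel_measurable borel" and wm [measurable]: "w \<in> borel_measurable borel" and w: "\<And>p. w p > 0"
    and fin: "(NNINT p. ennreal ((G p)^2 / w p) * indicator {0<..} (fst p)) < \<infinity>"
    and C: "C \<ge> 0" "\<And>z. nice_wave z \<Longrightarrow> (NNINT p. ennreal (w p * (Dt z p)^2)) \<le> ennreal (C * en z)"
  shows "small_tail G"
  unfolding small_tail_def
proof (intro allI impI)
  fix \<delta> :: real assume \<delta>: "\<delta> > 0"
  have "\<exists>R0. \<forall>R\<ge>R0. (NNINT p. (ennreal ((G p)^2 / w p) * indicator {0<..} (fst p)) * indicator {p. fst p > R} p) \<le> ennreal (\<delta> / (C + 1))"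
    using fin \<delta> C by (intro nn_integral_tail) auto
  then obtain R0 where R0: "\<And>R. R \<ge> R0 \<Longrightarrow> (NNINT p. (ennreal ((G p)^2 / w p) * indicator {0<..} (fst p)) * indicator {p. fst p > R} p) \<le> ennreal (\<delta> / (C + 1))" by blast
  show "\<exists>T0>0. \<forall>T\<ge>T0. \<forall>z. nice_wave z \<longrightarrow> (tail_pairing G z T)^2 \<le> ennreal (\<delta> * en z)"
  \<comment> \<open>The tail lemma speaks of the open set \<open>fst p > R\<close>; taking R = T - 1
    makes it contain the closed half-line starting at T.\<close>
  proof (intro exI[of _ "max 1 (R0 + 1)"] conjI allI impI)
    fix T z assume T: "T \<ge> max 1 (R0 + 1)" and z: "nice_wave z"
    note [measurable] = nice_wave_Dt_measurable[OF z]
    have pw: "ennreal \<bar>G p * Dt z p\<bar> * indicator {T..} (fst p) \<le> esq (ennreal ((G p)^2 / w p) * indicator {T..} (fst p)) * esq (ennreal (w p * (Dt z p)^2))" for p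
    proof (cases "fst p \<ge> T")
      case True
      have "(ennreal \<bar>G p * Dt z p\<bar>)^2 = ennreal ((G p)^2 / w p) * ennreal (w p * (Dt z p)^2)"
        using w[of p] by (simp add: ennreal_mult'[symmetric] ennreal_power power_mult_distrib)
      then show ?thesis using True by (simp add: esq_mult[symmetric] le_esq_iff)
    qed simp
    have "tail_pairing G z T \<le>
        (NNINT p. esq (ennreal ((G p)^2 / w p) * indicator {T..} (fst p)) * esq (ennreal (w p * (Dt z p)^2)))" by (intro nn_integral_mono pw)
    also have "\<dots> \<le> esq (NNINT p. ennreal ((G p)^2 / w p) * indicator {T..} (fst p)) * esq (NNINT p. ennreal (w p * (Dt z p)^2))"
      by (rule Cauchy_Schwarz_esq) measurable
    finally have "(tail_pairing G z T)^2 \<le>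
       (NNINT p. ennreal ((G p)^2 / w p) * indicator {T..} (fst p)) * (NNINT p. ennreal (w p * (Dt z p)^2))"
      by (simp add: esq_mult[symmetric] le_esq_iff)
    also have "\<dots> \<le> ennreal (\<delta> / (C + 1)) * ennreal (C * en z)"
    proof (intro mult_mono C(2) z)
      have "(NNINT p. ennreal ((G p)^2 / w p) * indicator {T..} (fst p)) \<le> (NNINT p. (ennreal ((G p)^2 / w p) * indicator {0<..} (fst p)) * indicator {p. fst p > T - 1} p)"
        using T by (intro nn_integral_mono) (auto simp: indicator_def)
      also have "\<dots> \<le> ennreal (\<delta> / (C + 1))" using T by (intro R0) auto
      finally show "(NNINT p. ennreal ((G p)^2 / w p) * indicator {T..} (fst p)) \<le> ennreal (\<delta> / (C + 1))" .
    qed auto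
    also have "\<dots> = ennreal (\<delta> / (C + 1) * (C * en z))" using \<delta> C by (intro ennreal_mult'[symmetric]) simp
    also have "\<dots> \<le> ennreal (\<delta> * en z)"
    proof (rule ennreal_leI)
      have "\<delta> / (C + 1) * C \<le> \<delta>" using \<delta> C by (simp add: divide_simps)
      then show "\<delta> / (C + 1) * (C * en z) \<le> \<delta> * en z" using edens_conserved(4)[OF z] by (simp only: mult.assoc[symmetric]) (rule mult_right_mono)
    qed
    finally show "(tail_pairing G z T)^2 \<le> ennreal (\<delta> * en z)" .
  qed simp
qed

lemma nn_integral_spacetime:
  fixes F :: "spacetime \<Rightarrow> ennreal"
  assumes "F \<in> borel_measurable borel"
  shows "(NNINT p. F p) = (NNINT t x. F (t, x))"
    and "(NNINT p. F p) = (NNINT x t. F (t, x))"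
    and "(\<lambda>t. NNINT x. F (t, x)) \<in> borel_measurable borel"
    and "(\<lambda>x. NNINT t. F (t, x)) \<in> borel_measurable borel"
    and "(\<lambda>x. F (t, x)) \<in> borel_measurable borel" and "(\<lambda>t. F (t, x)) \<in> borel_measurable borel"
proof -
  have m: "F \<in> borel_measurable (lborel \<Otimes>\<^sub>M lborel)" using assms by (simp add: lborel_prod)
  have m': "(\<lambda>(t, x). F (t, x)) \<in> borel_measurable (lborel \<Otimes>\<^sub>M lborel)" using m by (simp add: case_prod_unfold)
  show "(NNINT p. F p) = (NNINT t x. F (t, x))"
    using lborel.nn_integral_fst[OF m] by (simp add: lborel_prod)
  show "(NNINT p. F p) = (NNINT x t. F (t, x))"
    using lborel_pair.nn_integral_snd[OF m'] by (simp add: lborel_prod case_prod_unfold)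
  show "(\<lambda>t. NNINT x. F (t, x)) \<in> borel_measurable borel"
    using lborel.borel_measurable_nn_integral_fst[OF m] by simp
  have "(\<lambda>(x, t). F (t, x)) \<in> borel_measurable (lborel \<Otimes>\<^sub>M lborel)"
    using measurable_compose[OF measurable_pair_swap' m'] by (simp add: case_prod_unfold)
  from lborel.borel_measurable_nn_integral_fst[OF this] show "(\<lambda>x. NNINT t. F (t, x)) \<in> borel_measurable borel" by (simp add: case_prod_unfold)
  show "(\<lambda>x. F (t, x)) \<in> borel_measurable borel" "(\<lambda>t. F (t, x)) \<in> borel_measurable borel"
    by (rule measurable_compose[OF _ assms], intro borel_measurable_continuous_onI continuous_intros)+
qed

text \<open>At fixed time Cauchy-Schwarz in space pairs G with z_t, whose L^2 norm is at most the
  square root of the conserved energy.\<close>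

lemma small_tail_L1L2:
  assumes Gm [measurable]: "G \<in> borel_measurable borel"
    and fin: "(NNINT t. esq (NNINT x. ennreal ((G (t, x))^2)) * indicator {0<..} t) < \<infinity>"
  shows "small_tail G"
  unfolding small_tail_def
proof (intro allI impI)
  fix \<delta> :: real assume \<delta>: "\<delta> > 0"
  define N where "N t = (NNINT x. ennreal ((G (t, x))^2))" for t
  have Nm [measurable]: "N \<in> borel_measurable borel" unfolding N_def[abs_def] by (rule nn_integral_spacetime(3)[of "\<lambda>p. ennreal ((G p)^2)"]) measurable
  have "\<exists>R0. \<forall>R\<ge>R0. (NNINT t. (esq (N t) * indicator {0<..} t) * indicator {t. t > R} t) \<le> ennreal (sqrt \<delta>)"
    using fin \<delta> unfolding N_def[symmetric] by (intro nn_integral_tail) (auto simp: N_def[symmetric])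
  then obtain R0 where R0: "\<And>R. R \<ge> R0 \<Longrightarrow> (NNINT t. (esq (N t) * indicator {0<..} t) * indicator {t. t > R} t) \<le> ennreal (sqrt \<delta>)" by blast
  show "\<exists>T0>0. \<forall>T\<ge>T0. \<forall>z. nice_wave z \<longrightarrow> (tail_pairing G z T)^2 \<le> ennreal (\<delta> * en z)"
  proof (intro exI[of _ "max 1 (R0 + 1)"] conjI allI impI)
    fix T z assume T: "T \<ge> max 1 (R0 + 1)" and z: "nice_wave z"
    note [measurable] = nice_wave_Dt_measurable[OF z]
    have mG: "(\<lambda>x. ennreal ((G (t, x))^2)) \<in> borel_measurable borel" for t by (rule nn_integral_spacetime(5)[of "\<lambda>p. ennreal ((G p)^2)"]) measurable
    have mD: "(\<lambda>x. ennreal ((Dt z (t, x))^2)) \<in> borel_measurable borel" for t by (rule nn_integral_spacetime(5)[of "\<lambda>p. ennreal ((Dt z p)^2)"]) measurable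
    have inner: "(NNINT x. ennreal \<bar>G (t, x) * Dt z (t, x)\<bar> * indicator {T..} t) \<le> esq (ennreal (en z)) * (esq (N t) * indicator {T..} t)" for t
    proof (cases "t \<ge> T")
      case True
      have "ennreal \<bar>G (t, x) * Dt z (t, x)\<bar> = esq (ennreal ((G (t, x))^2)) * esq (ennreal ((Dt z (t, x))^2))" for x
        by (subst ennreal_square_eq_iff[symmetric]) (simp add: power_mult_distrib ennreal_power ennreal_mult')
      then have "(NNINT x. ennreal \<bar>G (t, x) * Dt z (t, x)\<bar>) = (NNINT x. esq (ennreal ((G (t, x))^2)) * esq (ennreal ((Dt z (t, x))^2)))" by simp
      also have "\<dots> \<le> esq (N t) * esq (NNINT x. ennreal ((Dt z (t, x))^2))"
        unfolding N_def by (rule Cauchy_Schwarz_esq) (use mG mD in simp_all)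
      also have "\<dots> \<le> esq (N t) * esq (ennreal (en z))"
      proof (rule mult_left_mono)
        have "(NNINT x. ennreal ((Dt z (t, x))^2)) \<le> (NNINT x. ennreal (edens z (t, x)))"
          by (intro nn_integral_mono ennreal_leI Dt_square_le_edens)
        then show "esq (NNINT x. ennreal ((Dt z (t, x))^2)) \<le> esq (ennreal (en z))"
          unfolding edens_conserved(3)[OF z] by (simp add: le_esq_iff)
      qed simp
      finally show ?thesis using True by (simp add: mult.commute)
    qed simp
    have "tail_pairing G z T = (NNINT t x. ennreal \<bar>G (t, x) * Dt z (t, x)\<bar> * indicator {T..} t)"
      by (subst nn_integral_spacetime(1)) simp_all
    also have "\<dots> \<le> (NNINT t. esq (ennreal (en z)) * (esq (N t) * indicator {T..} t))" by (intro nn_integral_mono inner)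
    also have "\<dots> = esq (ennreal (en z)) * (NNINT t. esq (N t) * indicator {T..} t)" by (rule nn_integral_cmult) measurable
    also have "\<dots> \<le> esq (ennreal (en z)) * ennreal (sqrt \<delta>)"
    proof (rule mult_left_mono)
      have "(NNINT t. esq (N t) * indicator {T..} t) \<le> (NNINT t. (esq (N t) * indicator {0<..} t) * indicator {t. t > T - 1} t)"
        using T by (intro nn_integral_mono) (auto simp: indicator_def)
      also have "\<dots> \<le> ennreal (sqrt \<delta>)" using T by (intro R0) auto
      finally show "(NNINT t. esq (N t) * indicator {T..} t) \<le> ennreal (sqrt \<delta>)" .
    qed simp
    finally have "(tail_pairing G z T)^2 \<le> (esq (ennreal (en z)) * ennreal (sqrt \<delta>))^2"
      by (simp add: ennreal_square_le_iff)
    also have "\<dots> = ennreal (\<delta> * en z)" using \<delta> by (simp add: power_mult_distrib ennreal_power ennreal_mult' mult.commute)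
    finally show "(tail_pairing G z T)^2 \<le> ennreal (\<delta> * en z)" .
  qed simp
qed

section \<open>Ingredients for the source: integrable weight, joint measurability, pointwise
  bounds\<close>

lemma jb_power_integrable: "(NNINT x. ennreal (jb x powr (- 4))) < \<infinity>"
proof -
  define V where "V = unit_ball_vol 3"
  have vol: "emeasure lborel (cball (0::real^3) (2 ^ k)) = ennreal (V * 8 ^ k)" for k :: nat
  proof -
    have "(2 ^ k :: real) ^ 3 = 8 ^ k" by (simp add: power_mult[symmetric] mult.commute[of k]) (simp add: power_mult)
    then show ?thesis by (subst emeasure_cball) (auto simp: V_def)
  qed
  \<comment> \<open>For <x> of size 2^k the weight is at most 16 / 16^k, while the ball of radius
    2^k has volume V 8^k; the resulting series is geometric with ratio 1/2.\<close>
  have pw: "ennreal (jb x powr (- 4)) \<le> (\<Sum>k. ennreal (16 * (1 / 16) ^ k) * indicator (cball 0 (2 ^ k)) x)" for x :: "real^3"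
  proof -
    define k where "k = nat \<lceil>log 2 (jb x)\<rceil>"
    have l0: "log 2 (jb x) \<ge> 0" using jb_ge_1[of x] by simp
    have kk: "real k = of_int \<lceil>log 2 (jb x)\<rceil>" using l0 by (simp add: k_def)
    have "log 2 (jb x) \<le> real k" unfolding kk by linarith
    then have "2 powr (log 2 (jb x)) \<le> 2 powr real k" by (intro powr_mono) auto
    then have le: "jb x \<le> 2 ^ k" using jb_pos[of x] by (simp add: powr_realpow)
    have "real k \<le> log 2 (jb x) + 1" unfolding kk by linarith
    then have "2 powr (real k) \<le> 2 powr (log 2 (jb x) + 1)" by (intro powr_mono) auto
    then have ge: "2 ^ k \<le> 2 * jb x" using jb_pos[of x] by (simp add: powr_realpow powr_add)
    have "norm x \<le> jb x" unfolding jb_def by (simp add: real_le_rsqrt)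
    then have x: "x \<in> cball 0 (2 ^ k)" using le by simp
    have "(2 ^ k / 2) ^ 4 \<le> jb x ^ 4" using ge by (intro power_mono) auto
    then have "1 / jb x ^ 4 \<le> 1 / (2 ^ k / 2) ^ 4" by (intro divide_left_mono mult_pos_pos zero_less_power jb_pos) simp_all
    also have "1 / (2 ^ k / 2) ^ 4 = 16 * (1 / 16 :: real) ^ k"
    proof -
      have "((2::real) ^ k) ^ 4 = 16 ^ k" by (subst power_mult[symmetric], subst mult.commute, subst power_mult) simp
      then show ?thesis by (simp add: power_divide)
    qed
    finally have "jb x powr (- 4) \<le> 16 * (1 / 16) ^ k" using jb_pos[of x] by (simp add: powr_minus_divide powr_numeral)
    then have "ennreal (jb x powr (- 4)) \<le> ennreal (16 * (1 / 16) ^ k) * indicator (cball 0 (2 ^ k)) x" using x by (simp add: ennreal_leI)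
    also have "\<dots> \<le> (\<Sum>k. ennreal (16 * (1 / 16) ^ k) * indicator (cball 0 (2 ^ k)) x)"
    proof -
      have "f k \<le> suminf f" for f :: "nat \<Rightarrow> ennreal" using sum_le_suminf[of f "{k}"] by simp
      then show ?thesis .
    qed
    finally show ?thesis .
  qed
  have "(NNINT x. ennreal (jb x powr (- 4))) \<le> (NNINT x. (\<Sum>k. ennreal (16 * (1 / 16) ^ k) * indicator (cball 0 (2 ^ k)) (x::real^3)))"
    by (intro nn_integral_mono pw)
  also have "\<dots> = (\<Sum>k. ennreal (16 * (1 / 16) ^ k) * ennreal (V * 8 ^ k))"
  proof -
    have [measurable]: "cball (0::real^3) (2 ^ k) \<in> sets borel" for k :: nat by simp
    have "(NNINT x. (\<Sum>k. ennreal (16 * (1 / 16) ^ k) * indicator (cball 0 (2 ^ k)) (x::real^3))) = (\<Sum>k. NNINT x. ennreal (16 * (1 / 16) ^ k) * indicator (cball 0 (2 ^ k)) (x::real^3))"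
      by (rule nn_integral_suminf) measurable
    then show ?thesis by (simp add: nn_integral_cmult_indicator vol)
  qed
  also have "\<dots> = (\<Sum>k. ennreal (16 * V * (1 / 2) ^ k))"
  proof (rule suminf_cong)
    fix k :: nat
    have "16 * (1 / 16) ^ k * (V * 8 ^ k) = 16 * V * ((1 / 16) * 8) ^ k" by (simp only: power_mult_distrib) simp
    also have "(1 / 16) * 8 = (1 / 2 :: real)" by simp
    finally have "ennreal (16 * (1 / 16) ^ k * (V * 8 ^ k)) = ennreal (16 * V * (1 / 2) ^ k)" by (rule arg_cong)
    then show "ennreal (16 * (1 / 16) ^ k) * ennreal (V * 8 ^ k) = ennreal (16 * V * (1 / 2) ^ k)"
      by (subst (asm) ennreal_mult') simp_all
  qed
  also have "\<dots> = ennreal (\<Sum>k. 16 * V * (1 / 2) ^ k)"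
    by (intro suminf_ennreal2) (auto simp: V_def unit_ball_vol_nonneg intro!: summable_mult summable_geometric)
  also have "\<dots> < \<infinity>" by simp
  finally show ?thesis .
qed

text \<open>The solution class makes each \<open>h t\<close> measurable in space. Joint
  measurability is read off from the integrability of \<open>h\<close> times the time derivative of
  a test function, for test functions that equal t on an exhausting sequence of sets, where that
  derivative is 1.\<close>

lemma energy_class_jointly_measurable:
  assumes "energy_class h dh ht"
  shows "(\<lambda>p. if fst p > 0 then h (fst p) (snd p) else 0) \<in> borel_measurable borel"
proof -
  \<comment> \<open>The step vanishes for t \<le> 1 / (2 n) and equals 1 for t \<ge> 1 / n; the
    cut-off makes the support compact.\<close>
  define \<psi> :: "nat \<Rightarrow> spacetime \<Rightarrow> real" where "\<psi> n p = (fst p * sstep ((- 1) + (2 * real n) * fst p)) * cutoff (real n) p" for n p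
  define \<Phi> where "\<Phi> n p = (if fst p > 0 then h (fst p) (snd p) * Dt (\<psi> n) p else 0)" for n p
  have bl: "bounded_linear (\<lambda>p::spacetime. fst p)" by (rule bounded_linear_fst)
  have meas: "\<Phi> n \<in> borel_measurable borel" if n: "n > 0" for n
  proof -
    have lin: "Cinf (\<lambda>p::spacetime. fst p)" by (rule Cinf_linear[OF bl])
    have "Cinf (\<lambda>p::spacetime. sstep ((- 1) + (2 * real n) * fst p))"
      by (rule Cinf_compose_real[OF sstep_props(1)]) (intro Cinf_add Cinf_mult Cinf_const lin)
    then have "Cinf (\<psi> n)" unfolding \<psi>_def[abs_def] by (intro Cinf_mult Cinf_cutoff lin)
    moreover have "1 / (2 * real n) \<le> t \<and> t \<le> 2 * real n \<and> norm x \<le> 2 * real n" if ne: "\<psi> n (t, x) \<noteq> 0" for t x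
    proof -
      have "norm (t, x) < 2 * real n" using cutoff_eq(2)[of "real n" "(t, x)"] n ne by (auto simp: \<psi>_def not_less[symmetric])
      then have "\<bar>t\<bar> \<le> 2 * real n" "norm x \<le> 2 * real n" using norm_fst_le[of t x] norm_snd_le[of x t] by auto
      moreover have "2 * real n * t \<ge> 1" using sstep_props(4)[of "(- 1) + (2 * real n) * t"] ne by (force simp: \<psi>_def)
      ultimately show ?thesis using n by (simp add: field_simps)
    qed
    ultimately have "test_fn ({0<..} \<times> UNIV) (\<psi> n)" using n by (intro test_fn_slabI[where a="1 / (2 * real n)" and b="2 * real n" and R="2 * real n"]) auto
    then have "integrable lborel (\<lambda>(t, x). h t x * tderiv (t, x) (\<psi> n))" using assms unfolding energy_class_def by blast
    then have m: "(\<lambda>p. h (fst p) (snd p) * Dt (\<psi> n) p) \<in> borel_measurable borel"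
      by (auto dest!: borel_measurable_integrable simp: case_prod_unfold tderiv_def)
    have "\<Phi> n = (\<lambda>p. h (fst p) (snd p) * Dt (\<psi> n) p * indicator {0<..} (fst p))" by (auto simp: \<Phi>_def indicator_def)
    also have "\<dots> \<in> borel_measurable borel" by (rule borel_measurable_times[OF m]) measurable
    finally show ?thesis .
  qed
  have lim: "(\<lambda>n. \<Phi> (Suc n) p) \<longlonglongrightarrow> (if fst p > 0 then h (fst p) (snd p) else 0)" for p
  proof (cases "fst p > 0")
    case True
    obtain N :: nat where N: "norm p < real N" "1 / fst p < real N"
      using reals_Archimedean2[of "max (norm p) (1 / fst p)"] by auto
    have "Dt (\<psi> (Suc n)) p = 1" if "n \<ge> N" for n
    proof -
      define U where "U = {p::spacetime. fst p > 1 / real (Suc n)} \<inter> ball 0 (real (Suc n))"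
      have oU: "open U" unfolding U_def by (intro open_Int open_ball open_Collect_less continuous_intros)
      have nN: "real N < real (Suc n)" using that by simp
      then have "1 / fst p < real (Suc n)" using N by simp
      then have pU: "p \<in> U" using N nN True by (auto simp: U_def divide_simps mult.commute)
      have eq: "\<psi> (Suc n) r = fst r" if r: "r \<in> U" for r
      proof -
        have "1 < fst r * real (Suc n)" using r by (auto simp: U_def divide_simps)
        then have "sstep ((- 1) + (2 * real (Suc n)) * fst r) = 1" by (intro sstep_props(6)) (simp add: algebra_simps)
        moreover have "cutoff (real (Suc n)) r = 1" using r by (intro cutoff_eq(1)) (auto simp: U_def)
        ultimately show ?thesis by (simp add: \<psi>_def)
      qed
      have "(\<psi> (Suc n) has_derivative fst) (at p)"
        by (rule has_derivative_transform_within_open[OF bounded_linear_imp_has_derivative[OF bl] oU pU]) (simp add: eq)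
      then show ?thesis by (simp add: dd_eq)
    qed
    then have "\<forall>\<^sub>F n in sequentially. \<Phi> (Suc n) p = (if fst p > 0 then h (fst p) (snd p) else 0)"
      using True unfolding eventually_sequentially by (intro exI[of _ N]) (auto simp: \<Phi>_def)
    then show ?thesis by (rule tendsto_eventually)
  qed (simp add: \<Phi>_def)
  show ?thesis by (rule borel_measurable_LIMSEQ_real[OF lim meas]) simp
qed

text \<open>Each product m^a r^b with a + b = 4 is at most max(m, r)^4. A further factor r reduces
  all mixed terms to the two extreme ones, for which norms are available.\<close>

lemma mixed_power_bound:
  fixes m r :: real
  assumes "0 \<le> m" "0 \<le> r"
  shows "m ^ 3 * r^2 \<le> m ^ 4 * r + r ^ 5" "m^2 * r ^ 3 \<le> m ^ 4 * r + r ^ 5" "m * r ^ 4 \<le> m ^ 4 * r + r ^ 5"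
proof -
  have *: "m ^ a * r ^ b \<le> m ^ 4 + r ^ 4" if "a + b = 4" for a b
  proof -
    have "m ^ a * r ^ b \<le> max m r ^ a * max m r ^ b" using assms by (intro mult_mono power_mono) auto
    also have "\<dots> = max m r ^ 4" using that by (simp add: power_add[symmetric])
    also have "\<dots> \<le> m ^ 4 + r ^ 4" using assms by (cases "m \<le> r") (auto simp: max_def)
    finally show ?thesis .
  qed
  have "(m ^ a * r ^ b) * r \<le> (m ^ 4 + r ^ 4) * r" if "a + b = 4" for a b using *[OF that] assms by (intro mult_right_mono)
  from this[of 3 1] this[of 2 2] this[of 1 3]
  show "m ^ 3 * r^2 \<le> m ^ 4 * r + r ^ 5" "m^2 * r ^ 3 \<le> m ^ 4 * r + r ^ 5" "m * r ^ 4 \<le> m ^ 4 * r + r ^ 5"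
    by (simp_all add: algebra_simps eval_nat_numeral)
qed

text \<open>With m = |W1| + |W2| the binomial theorem bounds the coefficients of the powers 1 to 4
  of r, apart from the potentials, by 5 m^4, 10 m^3, 10 m^2 and 5 m. Hence 26 = 1 + 10 + 10 + 5, and
  240 = 8 (5 + 10 + 10 + 5) because m^4 \<le> 8 (|W1|^4 + |W2|^4).\<close>

lemma Pterm_bound:
  fixes x :: "real^3" and t v :: real
  defines "y \<equiv> x - t *\<^sub>R vv v"
  shows "\<bar>Pterm V1 V2 W1 W2 v t x r\<bar> \<le> 26 * \<bar>r\<bar> ^ 5 + (\<bar>V1 x\<bar> + \<bar>V2 y\<bar> + 240 * (\<bar>W1 x\<bar> ^ 4 + \<bar>W2 y\<bar> ^ 4)) * \<bar>r\<bar>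
     + \<bar>F1fn V1 W1 W2 v t x\<bar> + \<bar>F2fn V2 W1 W2 v t x\<bar> + \<bar>Ffn W1 W2 v t x\<bar>"
proof -
  define a b where "a = W1 x" and "b = W2 y"
  define A B \<rho> where "A = \<bar>a\<bar>" and "B = \<bar>b\<bar>" and "\<rho> = \<bar>r\<bar>"
  have nn: "0 \<le> A" "0 \<le> B" "0 \<le> \<rho>" by (simp_all add: A_def B_def \<rho>_def)
  define lin where "lin = 5 * a ^ 4 + 5 * b ^ 4 + (20 * a ^ 3 * b + 30 * a^2 * b^2 + 20 * a * b ^ 3)"
  define N2 N3 N4 where "N2 = 10 * a ^ 3 + 30 * a^2 * b + 30 * a * b^2 + 10 * b ^ 3"
    and "N3 = 10 * a^2 + 3 * a * b + 10 * b^2" and "N4 = 5 * a + 5 * b"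
  define m where "m = A + B"
  have m0: "m \<ge> 0" using nn by (simp add: m_def)
  have t3: "\<bar>x + y + z\<bar> \<le> \<bar>x\<bar> + \<bar>y\<bar> + \<bar>z\<bar>" for x y z :: real by linarith
  have t4: "\<bar>x + y + z + w\<bar> \<le> \<bar>x\<bar> + \<bar>y\<bar> + \<bar>z\<bar> + \<bar>w\<bar>" for x y z w :: real by linarith
  have "\<bar>lin\<bar> \<le> 5 * A ^ 4 + 5 * B ^ 4 + (20 * A ^ 3 * B + 30 * A^2 * B^2 + 20 * A * B ^ 3)"
    unfolding lin_def by (rule order.trans[OF t3]) (use t3 in \<open>simp add: A_def B_def abs_mult power_abs; fail\<close> | (intro add_mono order.trans[OF t3], simp_all add: A_def B_def abs_mult power_abs))
  also have "\<dots> = 5 * m ^ 4" by (simp add: m_def algebra_simps eval_nat_numeral)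
  finally have lin: "\<bar>lin\<bar> \<le> 5 * m ^ 4" .
  have "\<bar>N2\<bar> \<le> 10 * A ^ 3 + 30 * A^2 * B + 30 * A * B^2 + 10 * B ^ 3"
    unfolding N2_def by (rule order.trans[OF t4]) (simp add: A_def B_def abs_mult power_abs)
  also have "\<dots> = 10 * m ^ 3" by (simp add: m_def algebra_simps eval_nat_numeral)
  finally have N2: "\<bar>N2\<bar> \<le> 10 * m ^ 3" .
  have "\<bar>N3\<bar> \<le> 10 * A^2 + 3 * (A * B) + 10 * B^2"
    unfolding N3_def by (rule order.trans[OF t3]) (simp add: A_def B_def abs_mult power_abs)
  \<comment> \<open>The coefficient 3 is enlarged to 20 in order to complete the square.\<close>
  also have "\<dots> \<le> 10 * A^2 + 20 * (A * B) + 10 * B^2" using nn by simp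
  also have "\<dots> = 10 * m^2" by (simp add: m_def algebra_simps eval_nat_numeral)
  finally have N3: "\<bar>N3\<bar> \<le> 10 * m^2" .
  have N4: "\<bar>N4\<bar> \<le> 5 * m" using abs_triangle_ineq[of "5 * a" "5 * b"] unfolding N4_def m_def A_def B_def by (simp add: abs_mult)
  have m4: "m ^ 4 \<le> 8 * (A ^ 4 + B ^ 4)"
  proof -
    have "m^2 \<le> 2 * (A^2 + B^2)" using sum_squares_bound[of A B] by (simp add: m_def power2_sum)
    then have "(m^2)^2 \<le> (2 * (A^2 + B^2))^2" by (intro power_mono) auto
    also have "\<dots> \<le> 8 * ((A^2)^2 + (B^2)^2)" using sum_squares_bound[of "A^2" "B^2"] by (simp add: power_mult_distrib power2_sum)
    finally show ?thesis by simp
  qed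
  have "Pterm V1 V2 W1 W2 v t x r = r ^ 5 + (V1 x + V2 y) * r + lin * r - (N2 * r^2 + N3 * r ^ 3 + N4 * r ^ 4)
      - (F1fn V1 W1 W2 v t x + F2fn V2 W1 W2 v t x + Ffn W1 W2 v t x)"
    unfolding Pterm_def acoef_def Nfn_def Let_def y_def[symmetric] lin_def N2_def N3_def N4_def a_def b_def by (simp add: algebra_simps)
  then have "\<bar>Pterm V1 V2 W1 W2 v t x r\<bar> \<le> \<bar>r ^ 5\<bar> + \<bar>(V1 x + V2 y) * r\<bar> + \<bar>lin * r\<bar> + (\<bar>N2 * r^2\<bar> + \<bar>N3 * r ^ 3\<bar> + \<bar>N4 * r ^ 4\<bar>)
      + (\<bar>F1fn V1 W1 W2 v t x\<bar> + \<bar>F2fn V2 W1 W2 v t x\<bar> + \<bar>Ffn W1 W2 v t x\<bar>)"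
    by (simp only:) (intro order.trans[OF abs_triangle_ineq4] order.trans[OF abs_triangle_ineq] add_mono order.refl)
  moreover have "\<bar>r ^ 5\<bar> = \<rho> ^ 5" by (simp add: \<rho>_def power_abs)
  moreover have "\<bar>(V1 x + V2 y) * r\<bar> \<le> (\<bar>V1 x\<bar> + \<bar>V2 y\<bar>) * \<rho>" unfolding abs_mult \<rho>_def by (intro mult_right_mono) auto
  moreover have "\<bar>lin * r\<bar> \<le> 5 * (m ^ 4 * \<rho>)" using mult_right_mono[OF lin nn(3)] by (simp add: abs_mult \<rho>_def mult.assoc)
  moreover have "\<bar>N2 * r^2\<bar> \<le> 10 * (m ^ 3 * \<rho>^2)" using mult_right_mono[OF N2, of "\<rho>^2"] by (simp add: abs_mult \<rho>_def mult.assoc)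
  moreover have "\<bar>N3 * r ^ 3\<bar> \<le> 10 * (m^2 * \<rho> ^ 3)" using mult_right_mono[OF N3, of "\<rho> ^ 3"] nn by (simp add: abs_mult \<rho>_def mult.assoc power_abs)
  moreover have "\<bar>N4 * r ^ 4\<bar> \<le> 5 * (m * \<rho> ^ 4)" using mult_right_mono[OF N4, of "\<rho> ^ 4"] nn by (simp add: abs_mult \<rho>_def mult.assoc power_abs)
  moreover note mixed_power_bound[OF m0 nn(3)]
  moreover have "m ^ 4 * \<rho> \<le> 8 * (A ^ 4 + B ^ 4) * \<rho>" using m4 nn by (intro mult_right_mono)
  ultimately have "\<bar>Pterm V1 V2 W1 W2 v t x r\<bar> \<le> 26 * \<rho> ^ 5 + (\<bar>V1 x\<bar> + \<bar>V2 y\<bar>) * \<rho> + 30 * (8 * (A ^ 4 + B ^ 4) * \<rho>)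
      + \<bar>F1fn V1 W1 W2 v t x\<bar> + \<bar>F2fn V2 W1 W2 v t x\<bar> + \<bar>Ffn W1 W2 v t x\<bar>" by linarith
  then show ?thesis by (simp add: \<rho>_def A_def B_def a_def b_def algebra_simps)
qed

text \<open>For almost every x the time integral is at most the square of the essential supremum,
  and <x>^(-4) is integrable in space.\<close>

lemma LinfxL2t_weighted:
  assumes fin: "LinfxL2t G < \<infinity>" and [measurable]: "H \<in> borel_measurable borel" and eq: "\<And>t x. t > 0 \<Longrightarrow> H (t, x) = G t x"
  shows "(NNINT p. ennreal (jb (snd p) powr (- 4) * (H p)^2) * indicator {0<..} (fst p)) < \<infinity>"
proof -
  define N where "N x = (\<integral>\<^sup>+t\<in>{0..}. ennreal ((G t x)^2) \<partial>lborel)" for x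
  define M where "M = LinfxL2t G"
  have "AE x in lborel. esq (N x) \<le> M" unfolding M_def LinfxL2t_def N_def by (rule esssup_AE)
  then have AE: "AE x in lborel. N x \<le> M^2" by eventually_elim (metis ennreal_square_le_iff esq_square)
  have "(NNINT p. ennreal (jb (snd p) powr (- 4) * (H p)^2) * indicator {0<..} (fst p))
      = (NNINT x t. ennreal (jb x powr (- 4) * (H (t, x))^2) * indicator {0<..} t)"
    by (subst nn_integral_spacetime(2)) simp_all
  also have "\<dots> \<le> (NNINT x. ennreal (jb x powr (- 4)) * M^2)"
  proof (rule nn_integral_mono_AE, use AE in eventually_elim)
    fix x assume x: "N x \<le> M^2"
    have m: "(\<lambda>t. ennreal ((H (t, x))^2) * indicator {0<..} t) \<in> borel_measurable borel"
      using nn_integral_spacetime(6)[of "\<lambda>p. ennreal ((H p)^2) * indicator {0<..} (fst p)" x] by simp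
    have "(NNINT t. ennreal (jb x powr (- 4) * (H (t, x))^2) * indicator {0<..} t) = (NNINT t. ennreal (jb x powr (- 4)) * (ennreal ((H (t, x))^2) * indicator {0<..} t))"
      by (simp add: ennreal_mult' mult.assoc)
    also have "\<dots> = ennreal (jb x powr (- 4)) * (NNINT t. ennreal ((H (t, x))^2) * indicator {0<..} t)"
      by (rule nn_integral_cmult) (use m in simp)
    also have "\<dots> \<le> ennreal (jb x powr (- 4)) * N x"
      unfolding N_def by (intro mult_left_mono nn_integral_mono) (auto simp: eq indicator_def)
    also have "\<dots> \<le> ennreal (jb x powr (- 4)) * M^2" by (intro mult_left_mono x) simp
    finally show "(NNINT t. ennreal (jb x powr (- 4) * (H (t, x))^2) * indicator {0<..} t) \<le> ennreal (jb x powr (- 4)) * M^2" .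
  qed
  also have "\<dots> = (NNINT x. ennreal (jb x powr (- 4))) * M^2" by (rule nn_integral_multc) measurable
  also have "\<dots> < \<infinity>" using jb_power_integrable fin by (simp add: M_def ennreal_mult_less_top power2_eq_square)
  finally show ?thesis .
qed

lemma shear_measurable:
  fixes H :: "spacetime \<Rightarrow> 'b::topological_space"
  assumes "H \<in> borel_measurable borel"
  shows "(\<lambda>p. H (fst p, snd p + fst p *\<^sub>R e)) \<in> borel_measurable borel"
  by (rule measurable_compose[OF _ assms], intro borel_measurable_continuous_onI continuous_intros)

lemma jb_shear_measurable: "(\<lambda>p::spacetime. jb (snd p - fst p *\<^sub>R e)) \<in> borel_measurable borel"
  by (rule measurable_compose[OF _ jb_measurable], intro borel_measurable_continuous_onI continuous_intros)

lemma jb_snd_measurable: "(\<lambda>p::spacetime. jb (snd p)) \<in> borel_measurable borel"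
  using jb_shear_measurable[of 0] by simp

lemma divide_jb_powr: "c / jb y powr (- 1 - \<delta>) = jb y powr (1 + \<delta>) * c"
proof -
  have "- 1 - \<delta> = - (1 + \<delta>)" by simp
  then show ?thesis by (simp only: powr_minus divide_inverse inverse_inverse_eq mult.commute)
qed

lemma small_tail_static:
  assumes Gm [measurable]: "G \<in> borel_measurable borel" and \<delta>: "\<delta> > 0"
    and fin: "(NNINT p. ennreal (jb (snd p) powr (1 + \<delta>) * (G p)^2) * indicator {0<..} (fst p)) < \<infinity>"
  shows "small_tail G"
proof -
  obtain C where C: "C \<ge> 0" "\<And>z. nice_wave z \<Longrightarrow> (NNINT p. ennreal (jb (snd p) powr (- 1 - \<delta>) * edens z p)) \<le> ennreal (C * en z)"
    using local_energy_decay[OF \<delta>] by blast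
  note [measurable] = jb_snd_measurable
  from fin have fin': "(NNINT p. ennreal ((G p)^2 / jb (snd p) powr (- 1 - \<delta>)) * indicator {0<..} (fst p)) < \<infinity>" unfolding divide_jb_powr .
  show ?thesis
  proof (rule small_tail_weighted[OF Gm _ _ fin' C(1)])
    fix z assume z: "nice_wave z"
    have "(NNINT p. ennreal (jb (snd p) powr (- 1 - \<delta>) * (Dt z p)^2)) \<le> (NNINT p. ennreal (jb (snd p) powr (- 1 - \<delta>) * edens z p))"
      by (intro nn_integral_mono ennreal_leI mult_left_mono Dt_square_le_edens) simp
    then show "(NNINT p. ennreal (jb (snd p) powr (- 1 - \<delta>) * (Dt z p)^2)) \<le> ennreal (C * en z)" using C(2)[OF z] by simp
  qed (use jb_pos in \<open>simp_all add: less_imp_neq[symmetric]\<close>)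
qed

text \<open>A shear in space moves the centre of the weight to the origin without changing the
  space-time integral.\<close>

lemma small_tail_moving:
  assumes Gm [measurable]: "G \<in> borel_measurable borel" and \<delta>: "\<delta> > 0" and v: "\<bar>v\<bar> < 1"
    and fin: "(NNINT p. ennreal (jb (snd p) powr (1 + \<delta>) * (G (fst p, snd p + fst p *\<^sub>R vv v))^2) * indicator {0<..} (fst p)) < \<infinity>"
  shows "small_tail G"
proof -
  obtain C where C: "C \<ge> 0" "\<And>z. nice_wave z \<Longrightarrow> (NNINT p. ennreal (jb (snd p - fst p *\<^sub>R vv v) powr (- 1 - \<delta>) * (Dt z p)^2)) \<le> ennreal (C * en z)"
    using moving_local_energy_decay[OF v \<delta>] by blast
  note [measurable] = jb_shear_measurable
  have "(NNINT p. ennreal (jb (snd p - fst p *\<^sub>R vv v) powr (1 + \<delta>) * (G p)^2) * indicator {0<..} (fst p)) < \<infinity>"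
    using fin by (subst nn_integral_shear_space[where b=1 and e="vv v", symmetric]) simp_all
  then have fin': "(NNINT p. ennreal ((G p)^2 / jb (snd p - fst p *\<^sub>R vv v) powr (- 1 - \<delta>)) * indicator {0<..} (fst p)) < \<infinity>" unfolding divide_jb_powr .
  show ?thesis
    by (rule small_tail_weighted[OF Gm _ _ fin' C]) (use jb_pos in \<open>simp_all add: less_imp_neq[symmetric]\<close>)
qed

text \<open>Applied with n = 1 to the potentials and with n = 4 to W1 and W2, so that all linear
  coefficients share the decay <x>^(-3).\<close>

lemma jb_powr_decay:
  assumes "\<forall>x. \<bar>V x\<bar> \<le> C * jb x powr (- \<beta>)"
  shows "C \<ge> 0" and "n \<ge> 1 \<Longrightarrow> \<beta> * real n \<ge> 3 \<Longrightarrow> \<bar>V x\<bar> ^ n \<le> C ^ n * jb x powr (- 3)"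
proof -
  have "0 \<le> C * jb 0 powr (- \<beta>)" using assms by (meson abs_ge_zero order.trans)
  then show C: "C \<ge> 0" using jb_pos[of 0] by (simp add: zero_le_mult_iff)
  assume n: "n \<ge> 1" "\<beta> * real n \<ge> 3"
  have "\<bar>V x\<bar> ^ n \<le> (C * jb x powr (- \<beta>)) ^ n" using assms by (intro power_mono) auto
  also have "\<dots> = C ^ n * jb x powr (- \<beta> * real n)" proof -
    have "(jb x powr (- \<beta>)) ^ n = jb x powr (- \<beta> * real n)" using jb_pos[of x] by (subst powr_realpow[symmetric]) (simp_all add: powr_powr)
    then show ?thesis by (simp only: power_mult_distrib)
  qed
  also have "\<dots> \<le> C ^ n * jb x powr (- 3)" using C n jb_ge_1[of x] by (intro mult_left_mono powr_mono) auto
  finally show "\<bar>V x\<bar> ^ n \<le> C ^ n * jb x powr (- 3)" .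
qed

theorem small_tail_source:
  fixes v \<beta> \<epsilon> :: real
  assumes V: "smooth_fn V1" "smooth_fn V2" and beta: "\<beta> > 3"
    and V1d: "\<forall>x. \<bar>V1 x\<bar> \<le> C1 * jb x powr (- \<beta>)" and V2d: "\<forall>x. \<bar>V2 x\<bar> \<le> C2 * jb x powr (- \<beta>)"
    and v: "\<bar>v\<bar> < 1" and W: "continuous_on UNIV W1" "continuous_on UNIV W2"
    and W1d: "\<forall>x. \<bar>W1 x\<bar> \<le> D1 * jb x powr (- 1)" and W2d: "\<forall>x. \<bar>W2 x\<bar> \<le> D2 * jb x powr (- 1)"
    and ec: "energy_class h dh ht" and S: "Snorm v h dh ht < \<infinity>" and eps: "\<epsilon> > 0"
    and F1: "(\<integral>\<^sup>+ t\<in>{0..}. (NNINT x. ennreal ((jb x powr (1/2 + \<epsilon>) * F1fn V1 W1 W2 v t x)^2)) \<partial>lborel) < \<infinity>"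
    and F2: "(\<integral>\<^sup>+ t\<in>{0..}. (NNINT x. ennreal ((jb x powr (1/2 + \<epsilon>) * shiftS v (F2fn V2 W1 W2 v) t x)^2)) \<partial>lborel) < \<infinity>"
    and F: "LpLq 1 2 (Ffn W1 W2 v) < \<infinity>"
  shows "\<exists>q \<in> borel_measurable borel. small_tail q \<and> (\<forall>t x. t > 0 \<longrightarrow> q (t, x) = Pterm V1 V2 W1 W2 v t x (h t x))"
proof -
  have Sfin: "Strich h < \<infinity>" "LinfxL2t h < \<infinity>" "LinfxL2t (shiftS v h) < \<infinity>"
    using S unfolding Snorm_def by (auto simp: Max_less_iff)
  have cV: "continuous_on UNIV V1" "continuous_on UNIV V2" using V by (auto simp: smooth_fn_iff_Cinf intro: Cinf_continuous)
  have comp: "(\<lambda>p::spacetime. f (snd p)) \<in> borel_measurable borel" "(\<lambda>p::spacetime. f (snd p - fst p *\<^sub>R vv v)) \<in> borel_measurable borel"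
    if "continuous_on UNIV f" for f :: "real^3 \<Rightarrow> real"
    by (rule measurable_compose[OF _ borel_measurable_continuous_onI[OF that]], intro borel_measurable_continuous_onI continuous_intros)+
  note [measurable] = comp[OF cV(1)] comp[OF cV(2)] comp[OF W(1)] comp[OF W(2)] jb_snd_measurable jb_shear_measurable
  \<comment> \<open>Cut off to positive times, where joint measurability has been
    established.\<close>
  define h0 where "h0 p = (if fst p > 0 then h (fst p) (snd p) else 0)" for p
  have h0m [measurable]: "h0 \<in> borel_measurable borel" unfolding h0_def[abs_def] by (rule energy_class_jointly_measurable[OF ec])
  have h0: "h0 (t, x) = h t x" if "t > 0" for t x using that by (simp add: h0_def)
  define q where "q p = Pterm V1 V2 W1 W2 v (fst p) (snd p) (h0 p)" for p
  have qm: "q \<in> borel_measurable borel"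
    unfolding q_def[abs_def] Pterm_def acoef_def F1fn_def F2fn_def Ffn_def Nfn_def Let_def by measurable
  define f1 where "f1 p = F1fn V1 W1 W2 v (fst p) (snd p)" for p
  define f2 where "f2 p = F2fn V2 W1 W2 v (fst p) (snd p)" for p
  define f3 where "f3 p = Ffn W1 W2 v (fst p) (snd p)" for p
  have fm [measurable]: "f1 \<in> borel_measurable borel" "f2 \<in> borel_measurable borel" "f3 \<in> borel_measurable borel"
    unfolding f1_def[abs_def] f2_def[abs_def] f3_def[abs_def] F1fn_def F2fn_def Ffn_def Let_def by measurable
  \<comment> \<open>Taken with \<delta> = 1, the dual weight <x>^2 times the square of A is <x>^(-4)
    h^2, which is integrable by the bound on \<open>LinfxL2t\<close>; B is its analogue around the
    moving centre.\<close>
  define A where "A p = jb (snd p) powr (- 3) * h0 p" for p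
  define B where "B p = jb (snd p - fst p *\<^sub>R vv v) powr (- 3) * h0 p" for p
  have AB [measurable]: "A \<in> borel_measurable borel" "B \<in> borel_measurable borel" unfolding A_def[abs_def] B_def[abs_def] by measurable
  have jb4: "jb x powr (1 + 1) * (jb x powr (- 3) * c)^2 = jb x powr (- 4) * c^2" for x c
  proof -
    have "jb x powr (1 + 1) * (jb x powr (- 3))^2 = jb x powr (- 4)" using jb_pos[of x] by (simp add: power2_eq_square powr_add[symmetric] del: powr_numeral)
    then show ?thesis by (simp add: power_mult_distrib)
  qed
  have "small_tail A"
    by (rule small_tail_static[where \<delta>=1]) (use LinfxL2t_weighted[OF Sfin(2) h0m h0] in \<open>simp_all only: A_def jb4 AB zero_less_one\<close>)
  moreover have "small_tail B"
  proof (rule small_tail_moving[where \<delta>=1, OF _ _ v])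
    have "(NNINT p. ennreal (jb (snd p) powr (- 4) * (h0 (fst p, snd p + fst p *\<^sub>R vv v))^2) * indicator {0<..} (fst p)) < \<infinity>"
      by (rule LinfxL2t_weighted[OF Sfin(3) shear_measurable[OF h0m]]) (simp add: h0 shiftS_def)
    then show "(NNINT p. ennreal (jb (snd p) powr (1 + 1) * (B (fst p, snd p + fst p *\<^sub>R vv v))^2) * indicator {0<..} (fst p)) < \<infinity>"
      by (simp only: B_def fst_conv snd_conv add_diff_cancel_right' jb4)
  qed simp_all
  \<comment> \<open>Squaring the weight with exponent 1/2 + \<epsilon> gives the exponent 1 + 2
    \<epsilon>, so that \<delta> = 2 \<epsilon> below.\<close>
  moreover have fold: "(jb x powr (1/2 + \<epsilon>) * c)^2 = jb x powr (1 + 2 * \<epsilon>) * c^2" for x c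
    by (simp add: power_mult_distrib power2_eq_square powr_add[symmetric])
  have drop0: "(NNINT p. \<Phi> p * indicator {0<..} (fst p)) \<le> (\<integral>\<^sup>+t\<in>{0..}. \<integral>\<^sup>+x. \<Phi> (t, x) \<partial>lborel \<partial>lborel)"
    if [measurable]: "\<Phi> \<in> borel_measurable borel" for \<Phi> :: "spacetime \<Rightarrow> ennreal"
  proof -
    have "(NNINT p. \<Phi> p * indicator {0<..} (fst p)) = (NNINT t x. \<Phi> (t, x) * indicator {0<..} t)" by (subst nn_integral_spacetime(1)) simp_all
    also have "\<dots> \<le> (\<integral>\<^sup>+t\<in>{0..}. \<integral>\<^sup>+x. \<Phi> (t, x) \<partial>lborel \<partial>lborel)" by (intro nn_integral_mono) (auto simp: indicator_def)
    finally show ?thesis .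
  qed
  have "small_tail f1"
  proof (rule small_tail_static[where \<delta>="2 * \<epsilon>"])
    have m: "(\<lambda>p. ennreal (jb (snd p) powr (1 + 2 * \<epsilon>) * (f1 p)^2)) \<in> borel_measurable borel" by measurable
    show "(NNINT p. ennreal (jb (snd p) powr (1 + 2 * \<epsilon>) * (f1 p)^2) * indicator {0<..} (fst p)) < \<infinity>"
      by (rule order.strict_trans1[OF drop0[OF m]]) (use F1 in \<open>simp add: fold f1_def\<close>)
  qed (use eps in simp_all)
  moreover have "small_tail f2"
  proof (rule small_tail_moving[where \<delta>="2 * \<epsilon>", OF _ _ v])
    note [measurable] = shear_measurable[OF fm(2)]
    have m: "(\<lambda>p. ennreal (jb (snd p) powr (1 + 2 * \<epsilon>) * (f2 (fst p, snd p + fst p *\<^sub>R vv v))^2)) \<in> borel_measurable borel" by measurable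
    show "(NNINT p. ennreal (jb (snd p) powr (1 + 2 * \<epsilon>) * (f2 (fst p, snd p + fst p *\<^sub>R vv v))^2) * indicator {0<..} (fst p)) < \<infinity>"
      by (rule order.strict_trans1[OF drop0[OF m]]) (use F2 in \<open>simp add: fold f2_def shiftS_def\<close>)
  qed (use eps in simp_all)
  moreover have "small_tail f3"
  proof (rule small_tail_L1L2)
    have "(NNINT t. esq (NNINT x. ennreal ((f3 (t, x))^2)) * indicator {0<..} t) \<le> (\<integral>\<^sup>+t\<in>{0..}. esq (NNINT x. ennreal (\<bar>Ffn W1 W2 v t x\<bar> powr 2)) \<partial>lborel)"
      by (intro nn_integral_mono) (auto simp: indicator_def f3_def powr_numeral)
    also have "\<dots> < \<infinity>" using F unfolding LpLq_def epowr_finite by simp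
    finally show "(NNINT t. esq (NNINT x. ennreal ((f3 (t, x))^2)) * indicator {0<..} t) < \<infinity>" .
  qed simp
  moreover have "small_tail (\<lambda>p. h0 p ^ 5)"
  proof (rule small_tail_L1L2)
    \<comment> \<open>The fifth power of \<open>h\<close> has finite L^1 L^2 norm because
      \<open>h\<close> has finite L^5 L^10 norm.\<close>
    have "LpLq 5 10 h < \<infinity>" using Sfin(1) unfolding Strich_def by simp
    then have "(\<integral>\<^sup>+t\<in>{0..}. epowr (NNINT x. ennreal (\<bar>h t x\<bar> powr 10)) (5 / 10) \<partial>lborel) < \<infinity>" unfolding LpLq_def epowr_finite .
    moreover have "ennreal ((h t x ^ 5)^2) = ennreal (\<bar>h t x\<bar> powr 10)" for t x by (simp add: powr_numeral flip: power_mult)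
    ultimately have "(\<integral>\<^sup>+t\<in>{0..}. esq (NNINT x. ennreal ((h t x ^ 5)^2)) \<partial>lborel) < \<infinity>" by simp
    then show "(NNINT t. esq (NNINT x. ennreal ((h0 (t, x) ^ 5)^2)) * indicator {0<..} t) < \<infinity>"
      by (rule order.strict_trans1[rotated]) (intro nn_integral_mono, auto simp: indicator_def h0)
  qed simp
  ultimately have st: "small_tail A" "small_tail B" "small_tail f1" "small_tail f2" "small_tail f3" "small_tail (\<lambda>p. h0 p ^ 5)" by blast+
  \<comment> \<open>One constant for both centres; the products it adds, such as C2 times the weight
    at the origin, are nonnegative.\<close>
  define K where "K = C1 + C2 + 240 * (D1 ^ 4 + D2 ^ 4)"
  \<comment> \<open>The nested absolute values are the form that \<open>small_tail_add\<close>
    delivers.\<close>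
  define R1 where "R1 p = \<bar>K * A p\<bar> + \<bar>K * B p\<bar>" for p
  define R2 where "R2 p = \<bar>26 * h0 p ^ 5\<bar> + \<bar>R1 p\<bar>" for p
  define R3 where "R3 p = \<bar>R2 p\<bar> + \<bar>f1 p\<bar>" for p
  define R4 where "R4 p = \<bar>R3 p\<bar> + \<bar>f2 p\<bar>" for p
  define R where "R p = \<bar>R4 p\<bar> + \<bar>f3 p\<bar>" for p
  have "small_tail R1" unfolding R1_def[abs_def] by (intro small_tail_add small_tail_cmult st) measurable
  moreover have [measurable]: "R1 \<in> borel_measurable borel" unfolding R1_def[abs_def] by measurable
  ultimately have "small_tail R2" unfolding R2_def[abs_def] by (intro small_tail_add small_tail_cmult st) measurable
  moreover have [measurable]: "R2 \<in> borel_measurable borel" unfolding R2_def[abs_def] by measurable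
  ultimately have "small_tail R3" unfolding R3_def[abs_def] by (intro small_tail_add st) measurable
  moreover have [measurable]: "R3 \<in> borel_measurable borel" unfolding R3_def[abs_def] by measurable
  ultimately have "small_tail R4" unfolding R4_def[abs_def] by (intro small_tail_add st) measurable
  moreover have [measurable]: "R4 \<in> borel_measurable borel" unfolding R4_def[abs_def] by measurable
  ultimately have "small_tail R" unfolding R_def[abs_def] by (intro small_tail_add st) measurable
  moreover have "\<bar>q p\<bar> \<le> \<bar>R p\<bar>" for p
  proof -
    define y where "y = snd p - fst p *\<^sub>R vv v"
    define r where "r = \<bar>h0 p\<bar>"
    define a b where "a = jb (snd p) powr (- 3)" and "b = jb y powr (- 3)"
    have ab: "0 \<le> a" "0 \<le> b" "0 \<le> r" by (simp_all add: a_def b_def r_def)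
    note nn = jb_powr_decay(1)[OF V1d] jb_powr_decay(1)[OF V2d] jb_powr_decay(1)[OF W1d] jb_powr_decay(1)[OF W2d]
    have "\<bar>V1 (snd p)\<bar> \<le> C1 * a" "\<bar>V2 y\<bar> \<le> C2 * b"
      using jb_powr_decay(2)[OF V1d, of 1] jb_powr_decay(2)[OF V2d, of 1] beta by (auto simp: a_def b_def)
    moreover have "\<bar>W1 (snd p)\<bar> ^ 4 \<le> D1 ^ 4 * a" "\<bar>W2 y\<bar> ^ 4 \<le> D2 ^ 4 * b"
      using jb_powr_decay(2)[OF W1d, of 4] jb_powr_decay(2)[OF W2d, of 4] by (auto simp: a_def b_def)
    moreover have "0 \<le> C2 * a" "0 \<le> C1 * b" "0 \<le> D2 ^ 4 * a" "0 \<le> D1 ^ 4 * b" using nn ab by auto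
    ultimately have "\<bar>V1 (snd p)\<bar> + \<bar>V2 y\<bar> + 240 * (\<bar>W1 (snd p)\<bar> ^ 4 + \<bar>W2 y\<bar> ^ 4) \<le> K * a + K * b" unfolding K_def by (simp add: algebra_simps)
    then have le: "(\<bar>V1 (snd p)\<bar> + \<bar>V2 y\<bar> + 240 * (\<bar>W1 (snd p)\<bar> ^ 4 + \<bar>W2 y\<bar> ^ 4)) * r \<le> (K * a + K * b) * r" by (rule mult_right_mono) (rule ab)
    have "K \<ge> 0" using nn by (simp add: K_def)
    then have eq: "(K * a + K * b) * r = \<bar>K * A p\<bar> + \<bar>K * B p\<bar>" using ab by (simp add: A_def B_def a_def b_def y_def r_def abs_mult algebra_simps)
    have eq': "26 * r ^ 5 = \<bar>26 * h0 p ^ 5\<bar>" by (simp add: r_def abs_mult power_abs)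
    have "\<bar>q p\<bar> \<le> 26 * r ^ 5 + (\<bar>V1 (snd p)\<bar> + \<bar>V2 y\<bar> + 240 * (\<bar>W1 (snd p)\<bar> ^ 4 + \<bar>W2 y\<bar> ^ 4)) * r + \<bar>f1 p\<bar> + \<bar>f2 p\<bar> + \<bar>f3 p\<bar>"
      unfolding q_def y_def r_def f1_def f2_def f3_def by (rule Pterm_bound)
    also have "\<dots> \<le> 26 * r ^ 5 + (K * a + K * b) * r + \<bar>f1 p\<bar> + \<bar>f2 p\<bar> + \<bar>f3 p\<bar>" by (intro add_mono le order.refl)
    also have "\<dots> = \<bar>R p\<bar>" unfolding eq eq' by (simp add: R_def R4_def R3_def R2_def R1_def)
    finally show ?thesis .
  qed
  ultimately have "small_tail q" by (rule small_tail_mono)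
  then show ?thesis by (intro bexI[of _ q] conjI qm allI impI) (simp_all add: q_def h0)
qed

section \<open>Approximation by smooth waves, uniformly for large times\<close>

lemma square_le_imp_abs_le: "a^2 \<le> (b::real) \<Longrightarrow> \<bar>a\<bar> \<le> sqrt b"
  by (metis real_sqrt_abs real_sqrt_le_iff)

lemma nice_wave_slice:
  assumes "nice_wave z"
  shows "continuous_on UNIV (\<lambda>x. dd b z (t, x))" "e2 (\<lambda>x. dd b z (t, x)) < \<infinity>" "(\<lambda>x. dd b z (t, x)) \<in> borel_measurable borel"
proof -
  obtain R where "cone_supp R z" using assms by (auto simp: nice_wave_def)
  then have *: "continuous_on UNIV (dd b z)" "cone_supp R (dd b z)"
    using assms by (auto intro: cone_supp_dd Cinf_continuous Cinf_dd nice_wave_Cinf)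
  show "continuous_on UNIV (\<lambda>x. dd b z (t, x))" "e2 (\<lambda>x. dd b z (t, x)) < \<infinity>" "(\<lambda>x. dd b z (t, x)) \<in> borel_measurable borel"
    by (rule cone_supp_slice[OF *])+
qed

lemma e2_slice_le_en:
  assumes "nice_wave z"
  shows "e2 (\<lambda>x. Dt z (t, x)) \<le> ennreal (en z)" "e2 (\<lambda>x. Dx i z (t, x)) \<le> ennreal (en z)"
proof -
  have "(Dx i z p)^2 \<le> edens z p" for p
    unfolding edens_def using member_le_sum[of i UNIV "\<lambda>i. (Dx i z p)^2"] by (simp add: add_increasing)
  then show "e2 (\<lambda>x. Dx i z (t, x)) \<le> ennreal (en z)"
    unfolding e2_def edens_conserved(3)[OF assms, of t, symmetric] by (intro nn_integral_mono ennreal_leI)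
  show "e2 (\<lambda>x. Dt z (t, x)) \<le> ennreal (en z)"
    unfolding e2_def edens_conserved(3)[OF assms, of t, symmetric] by (intro nn_integral_mono ennreal_leI Dt_square_le_edens)
qed

lemma en_slice:
  assumes "nice_wave z"
  shows "ennreal (en z) = e2 (\<lambda>x. Dt z (t, x)) + (\<Sum>i\<in>UNIV. e2 (\<lambda>x. Dx i z (t, x)))"
proof -
  note [measurable] = nice_wave_slice(3)[OF assms]
  have "ennreal (edens z (t, x)) = ennreal ((Dt z (t, x))^2) + (\<Sum>i\<in>UNIV. ennreal ((Dx i z (t, x))^2))" for x
    by (simp add: edens_def sum_nonneg)
  then have "ennreal (en z) = (NNINT x. (ennreal ((Dt z (t, x))^2) + (\<Sum>i\<in>UNIV. ennreal ((Dx i z (t, x))^2))))"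
    unfolding edens_conserved(3)[OF assms, of t, symmetric] by simp
  also have "\<dots> = e2 (\<lambda>x. Dt z (t, x)) + (\<Sum>i\<in>UNIV. e2 (\<lambda>x. Dx i z (t, x)))"
    unfolding e2_def by (subst nn_integral_add, measurable, subst nn_integral_sum) simp_all
  finally show ?thesis .
qed

lemma pairing_bound:
  fixes u k :: "real^3 \<Rightarrow> real"
  assumes m: "u \<in> borel_measurable borel" "k \<in> borel_measurable borel" and "e2 u \<le> ennreal \<delta>" "e2 k \<le> ennreal E" and nn: "0 \<le> \<delta>" "0 \<le> E"
  shows "\<bar>LBINT x. u x * k x\<bar> \<le> sqrt (\<delta> * E)"
proof -
  have "ennreal ((LBINT x. u x * k x)^2) \<le> e2 u * e2 k"
    using assms by (intro Cauchy_Schwarz_e2 m) (auto intro: le_less_trans)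
  also have "\<dots> \<le> ennreal \<delta> * ennreal E" using assms by (intro mult_mono) auto
  finally have "(LBINT x. u x * k x)^2 \<le> \<delta> * E" using nn by (simp add: ennreal_mult'[symmetric])
  then show ?thesis by (rule square_le_imp_abs_le)
qed

text \<open>Four Cauchy-Schwarz estimates, one for the time derivative and three for the gradient.
  The pairing of the two waves may be evaluated at time 0 because it is conserved.\<close>

lemma UZ_diff_bound:
  assumes ec: "energy_class h dh ht" and z: "nice_wave z" and w: "nice_wave w" and t: "t \<ge> 0" and \<delta>: "\<delta> \<ge> 0"
    and le: "e2 (\<lambda>x. ht t x - Dt w (t, x)) \<le> ennreal \<delta>" "\<And>i. e2 (\<lambda>x. dh t x $ i - Dx i w (t, x)) \<le> ennreal \<delta>"
  shows "\<bar>UZ dh ht z t - (LBINT x. wpair w z (0, x))\<bar> \<le> 4 * sqrt (\<delta> * en z)"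
proof -
  note mz = nice_wave_slice[OF z] and mw = nice_wave_slice[OF w] and E = energy_classD[OF ec t]
  have I1: "integrable lborel (\<lambda>x. ht t x * Dt z (t, x))" "integrable lborel (\<lambda>x. Dt w (t, x) * Dt z (t, x))"
    by (rule integrable_mult_L2[OF E(4) mz(3) E(5) mz(2)], rule integrable_mult_L2[OF mw(3) mz(3) mw(2) mz(2)])
  have I2: "integrable lborel (\<lambda>x. dh t x $ i * Dx i z (t, x))" "integrable lborel (\<lambda>x. Dx i w (t, x) * Dx i z (t, x))" for i
    by (rule integrable_mult_L2[OF E(6) mz(3) E(7) mz(2)], rule integrable_mult_L2[OF mw(3) mz(3) mw(2) mz(2)])
  have "(LBINT x. wpair w z (0, x)) = (LBINT x. wpair w z (t, x))" by (rule wpair_conserved[OF w z, symmetric])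
  also have "\<dots> = (LBINT x. Dt w (t, x) * Dt z (t, x)) + (\<Sum>i\<in>UNIV. LBINT x. Dx i w (t, x) * Dx i z (t, x))"
    unfolding wpair_def Bochner_Integration.integral_add[OF I1(2) Bochner_Integration.integrable_sum[OF I2(2)]]
      Bochner_Integration.integral_sum[OF I2(2)] ..
  finally have W: "(LBINT x. wpair w z (0, x)) = (LBINT x. Dt w (t, x) * Dt z (t, x)) + (\<Sum>i\<in>UNIV. LBINT x. Dx i w (t, x) * Dx i z (t, x))" .
  have eq: "UZ dh ht z t - (LBINT x. wpair w z (0, x))
     = (LBINT x. (ht t x - Dt w (t, x)) * Dt z (t, x)) + (\<Sum>i\<in>UNIV. LBINT x. (dh t x $ i - Dx i w (t, x)) * Dx i z (t, x))"
    unfolding UZ_def W left_diff_distrib Bochner_Integration.integral_diff[OF I1] Bochner_Integration.integral_diff[OF I2] sum_subtractf by simp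
  have "\<bar>UZ dh ht z t - (LBINT x. wpair w z (0, x))\<bar> \<le> \<bar>LBINT x. (ht t x - Dt w (t, x)) * Dt z (t, x)\<bar> + (\<Sum>i\<in>UNIV. \<bar>LBINT x. (dh t x $ i - Dx i w (t, x)) * Dx i z (t, x)\<bar>)"
    unfolding eq by (intro order.trans[OF abs_triangle_ineq] add_mono sum_abs order.refl)
  also have "\<dots> \<le> sqrt (\<delta> * en z) + (\<Sum>i\<in>(UNIV::3 set). sqrt (\<delta> * en z))"
  proof (intro add_mono sum_mono)
    have "(\<lambda>x. ht t x - Dt w (t, x)) \<in> borel_measurable borel" using E(4) mw(3)[where b="(1, 0)" and t=t] by (rule borel_measurable_diff)
    from pairing_bound[OF this mz(3)[where b="(1, 0)" and t=t] le(1)]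
    show "\<bar>LBINT x. (ht t x - Dt w (t, x)) * Dt z (t, x)\<bar> \<le> sqrt (\<delta> * en z)"
      using e2_slice_le_en(1)[OF z, of t] \<delta> edens_conserved(4)[OF z] by blast
    fix i :: 3
    have "(\<lambda>x. dh t x $ i - Dx i w (t, x)) \<in> borel_measurable borel" using E(6)[of i] mw(3)[where b="(0, axis i 1)" and t=t] by (rule borel_measurable_diff)
    from pairing_bound[OF this mz(3)[where b="(0, axis i 1)" and t=t] le(2)]
    show "\<bar>LBINT x. (dh t x $ i - Dx i w (t, x)) * Dx i z (t, x)\<bar> \<le> sqrt (\<delta> * en z)"
      using e2_slice_le_en(2)[OF z, of i t] \<delta> edens_conserved(4)[OF z] by blast
  qed
  finally show ?thesis by simp
qed

text \<open>Let w approximate the solution at T and u at a later time t. When z = u - w itself is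
  the test wave, its energy E is the difference of the pairings of u and w with z, hence at most the
  two approximation errors plus the tail, each of order sqrt(\<eta> E). Dividing by sqrt E bounds E
  uniformly in t.\<close>

lemma uniform_approx:
  assumes ec: "energy_class h dh ht" and ww: "weak_wave h dh ht P"
    and q: "q \<in> borel_measurable borel" "\<And>t x. t > 0 \<Longrightarrow> q (t, x) = P t x (h t x)" and st: "small_tail q" and \<delta>: "\<delta> > 0"
  shows "\<exists>T>0. \<exists>w. nice_wave w \<and> (\<forall>t\<ge>T. e2 (\<lambda>x. ht t x - Dt w (t, x)) \<le> ennreal \<delta> \<and> (\<forall>i. e2 (\<lambda>x. dh t x $ i - Dx i w (t, x)) \<le> ennreal \<delta>))"
proof -
  \<comment> \<open>The final triangle inequality costs 2 \<eta> + 2 E, at most 164 \<eta> since E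
    \<le> 81 \<eta>.\<close>
  define \<eta> where "\<eta> = \<delta> / 200"
  have \<eta>: "\<eta> > 0" using \<delta> by (simp add: \<eta>_def)
  obtain T where T: "T > 0" "\<And>z. nice_wave z \<Longrightarrow> (tail_pairing q z T)^2 \<le> ennreal (\<eta> * en z)"
    using st \<eta> unfolding small_tail_def by blast
  obtain w where w: "nice_wave w" "e2 (\<lambda>x. ht T x - Dt w (T, x)) \<le> ennreal \<eta>" "\<And>i. e2 (\<lambda>x. dh T x $ i - Dx i w (T, x)) \<le> ennreal \<eta>"
    using nice_approx[OF energy_classD(1,2)[OF ec] \<eta>, of T T] T(1) by auto
  have "e2 (\<lambda>x. ht t x - Dt w (t, x)) \<le> ennreal \<delta> \<and> (\<forall>i. e2 (\<lambda>x. dh t x $ i - Dx i w (t, x)) \<le> ennreal \<delta>)" if t: "t \<ge> T" for t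
  proof (cases "t = T")
    case True
    have "ennreal \<eta> \<le> ennreal \<delta>" using \<delta> by (intro ennreal_leI) (simp add: \<eta>_def)
    then show ?thesis using w True by (auto intro: order.trans)
  next
    case False
    with t have t: "t > T" "t \<ge> 0" using T(1) by auto
    obtain u where u: "nice_wave u" "e2 (\<lambda>x. ht t x - Dt u (t, x)) \<le> ennreal \<eta>" "\<And>i. e2 (\<lambda>x. dh t x $ i - Dx i u (t, x)) \<le> ennreal \<eta>"
      using nice_approx[OF energy_classD(1,2)[OF ec] \<eta>, of t t] t by auto
    define z where "z = (\<lambda>p. u p - w p)"
    have z: "nice_wave z" unfolding z_def by (rule nice_wave_diff[OF u(1) w(1)])
    have ddz: "dd b z p = dd b u p - dd b w p" for b p
      unfolding z_def by (intro dd_diff Cinf_differentiable nice_wave_Cinf u w)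
    define E where "E = en z"
    have E0: "E \<ge> 0" unfolding E_def by (rule edens_conserved(4)[OF z])
    have "(tail_pairing q z T)^2 \<le> ennreal (\<eta> * E)" unfolding E_def by (rule T(2)[OF z])
    then have tp: "tail_pairing q z T \<le> ennreal (sqrt (\<eta> * E))" using \<eta> E0
      by (subst ennreal_square_le_iff[symmetric]) (simp add: ennreal_power)
    then have "tail_pairing q z T < \<infinity>" using le_less_trans by fastforce
    from duality[OF ec ww z q this T(1) t(1)] tp have "ennreal \<bar>UZ dh ht z t - UZ dh ht z T\<bar> \<le> ennreal (sqrt (\<eta> * E))" by (rule order.trans)
    then have b1: "\<bar>UZ dh ht z t - UZ dh ht z T\<bar> \<le> sqrt (\<eta> * E)" using \<eta> E0 by simp
    have b2: "\<bar>UZ dh ht z T - (LBINT x. wpair w z (0, x))\<bar> \<le> 4 * sqrt (\<eta> * E)"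
      unfolding E_def by (rule UZ_diff_bound[OF ec z w(1)]) (use T \<eta> w in auto)
    have b3: "\<bar>UZ dh ht z t - (LBINT x. wpair u z (0, x))\<bar> \<le> 4 * sqrt (\<eta> * E)"
      unfolding E_def by (rule UZ_diff_bound[OF ec z u(1)]) (use t \<eta> u in auto)
    have I: "integrable lborel (\<lambda>x. wpair y z (0, x))" if y: "nice_wave y" for y unfolding wpair_def
      by (intro Bochner_Integration.integrable_add Bochner_Integration.integrable_sum integrable_mult_L2 nice_wave_slice(2,3)[OF y] nice_wave_slice(2,3)[OF z])
    have "wpair u z p - wpair w z p = edens z p" for p
      unfolding edens_wpair wpair_sum3 by (simp add: ddz algebra_simps)
    then have "E = (LBINT x. wpair u z (0, x)) - (LBINT x. wpair w z (0, x))"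
      unfolding E_def en_def using I[OF u(1)] I[OF w(1)] by (simp flip: Bochner_Integration.integral_diff)
    \<comment> \<open>9 = 1 + 4 + 4, from the tail and from the two approximations.\<close>
    then have "E \<le> 9 * sqrt (\<eta> * E)" using b1 b2 b3 by linarith
    then have "E^2 \<le> (9 * sqrt (\<eta> * E))^2" using E0 by (intro power_mono)
    also have "\<dots> = 81 * \<eta> * E" using \<eta> E0 by (simp add: power_mult_distrib)
    finally have E: "E \<le> 81 * \<eta>" using E0 \<eta> by (cases "E = 0") (auto simp: power2_eq_square)
    have comb: "e2 (\<lambda>x. a x - dd b w (t, x)) \<le> ennreal \<delta>" if "a \<in> borel_measurable borel" "e2 (\<lambda>x. a x - dd b u (t, x)) \<le> ennreal \<eta>"
      and b: "e2 (\<lambda>x. dd b z (t, x)) \<le> ennreal E" for a b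
    proof (rule e2_triangle[where b="\<lambda>x. dd b u (t, x)" and r=\<eta> and s=E])
      show "e2 (\<lambda>x. dd b u (t, x) - dd b w (t, x)) \<le> ennreal E" using b by (simp add: ddz)
    qed (use that nice_wave_slice(3)[OF u(1)] nice_wave_slice(3)[OF w(1)] E E0 \<eta> in \<open>simp_all add: \<eta>_def\<close>)
    show ?thesis
      by (intro conjI allI comb energy_classD(4,6)[OF ec t(2)] u(2,3)) (use e2_slice_le_en[OF z] in \<open>simp_all add: E_def\<close>)
  qed
  with T(1) w(1) show ?thesis by blast
qed

section \<open>Passage to the limit\<close>

text \<open>The rate 1/128 beats (2^n)^k for every k \<le> 6, since 2^6 / 128 = 1/2. Hence at almost
  every point 2^n |f_(n+1) - f_n| is bounded in n, and the whole sequence converges there, with one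
  and the same rate for k = 2 and k = 6. Fatou's lemma then gives the estimate. Divergence is
  confined to a null set, where the value of \<open>lim\<close> is immaterial.\<close>

lemma lim_of_fast_Cauchy:
  fixes f :: "nat \<Rightarrow> 'a \<Rightarrow> real"
  assumes m [measurable]: "\<And>n. f n \<in> borel_measurable M" and k: "even k" "0 < k" "k \<le> 6" and A: "A \<ge> 0"
    and C: "\<And>n m. n \<le> m \<Longrightarrow> (\<integral>\<^sup>+x. ennreal ((f m x - f n x) ^ k) \<partial>M) \<le> ennreal (A * (1/128) ^ n)"
  shows "(\<integral>\<^sup>+x. ennreal ((lim (\<lambda>n. f n x) - f n x) ^ k) \<partial>M) \<le> ennreal (A * (1/128) ^ n)"
proof -
  have AE: "AE x in M. (\<lambda>n. f n x) \<longlonglongrightarrow> lim (\<lambda>n. f n x)"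
  proof -
    have summand: "(\<integral>\<^sup>+x. ennreal ((2 ^ n * (f (Suc n) x - f n x)) ^ k) \<partial>M) \<le> ennreal (A * (1/2) ^ n)" for n
    proof -
      have "(\<integral>\<^sup>+x. ennreal ((2 ^ n * (f (Suc n) x - f n x)) ^ k) \<partial>M) = (\<integral>\<^sup>+x. ennreal ((2 ^ n) ^ k) * ennreal ((f (Suc n) x - f n x) ^ k) \<partial>M)"
        by (simp add: power_mult_distrib ennreal_mult')
      also have "\<dots> = ennreal ((2 ^ n) ^ k) * (\<integral>\<^sup>+x. ennreal ((f (Suc n) x - f n x) ^ k) \<partial>M)" by (rule nn_integral_cmult) measurable
      also have "\<dots> \<le> ennreal (64 ^ n) * ennreal (A * (1/128) ^ n)"
      proof (intro mult_mono C ennreal_leI)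
        have "(2 ^ n) ^ k \<le> (2 ^ n :: real) ^ 6" using k by (intro power_increasing) auto
        also have "\<dots> = 64 ^ n" by (subst power_mult[symmetric], subst mult.commute, subst power_mult) simp
        finally show "(2 ^ n) ^ k \<le> (64 ^ n :: real)" .
      qed auto
      also have "\<dots> = ennreal (64 ^ n * (A * (1/128) ^ n))" by (rule ennreal_mult'[symmetric]) simp
      also have "64 ^ n * (A * (1/128) ^ n) = A * (64 * (1/128)) ^ n" by (simp only: power_mult_distrib) simp
      also have "64 * (1/128) = (1/2::real)" by simp
      finally show ?thesis .
    qed
    have "(\<integral>\<^sup>+x. (\<Sum>n. ennreal ((2 ^ n * (f (Suc n) x - f n x)) ^ k)) \<partial>M) = (\<Sum>n. \<integral>\<^sup>+x. ennreal ((2 ^ n * (f (Suc n) x - f n x)) ^ k) \<partial>M)"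
      by (rule nn_integral_suminf) measurable
    also have "\<dots> \<le> (\<Sum>n. ennreal (A * (1/2) ^ n))" by (intro suminf_le summand) auto
    also have "\<dots> = ennreal (\<Sum>n. A * (1/2) ^ n)" by (intro suminf_ennreal2) (use A in \<open>auto intro!: summable_mult summable_geometric\<close>)
    finally have "(\<integral>\<^sup>+x. (\<Sum>n. ennreal ((2 ^ n * (f (Suc n) x - f n x)) ^ k)) \<partial>M) < \<infinity>" by (rule le_less_trans) simp
    then have "AE x in M. (\<Sum>n. ennreal ((2 ^ n * (f (Suc n) x - f n x)) ^ k)) \<noteq> \<infinity>"
      by (intro nn_integral_PInf_AE) (auto simp: less_top)
    then show ?thesis
    proof eventually_elim
      fix x assume fin: "(\<Sum>n. ennreal ((2 ^ n * (f (Suc n) x - f n x)) ^ k)) \<noteq> \<infinity>"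
      define d where "d n = f (Suc n) x - f n x" for n
      define S where "S = (\<Sum>n. ennreal ((2 ^ n * d n) ^ k))"
      have "S \<noteq> top" using fin by (simp add: S_def d_def)
      then obtain B where "B \<ge> 0" "S = ennreal B" by (cases S) auto
      then have B: "B \<ge> 0" "(\<Sum>n. ennreal ((2 ^ n * d n) ^ k)) = ennreal B" by (simp_all add: S_def)
      have "\<bar>d n\<bar> \<le> (1 + B) * (1/2) ^ n" for n
      proof -
        define y where "y = \<bar>2 ^ n * d n\<bar>"
        have "F n \<le> suminf F" for F :: "nat \<Rightarrow> ennreal" using sum_le_suminf[of F "{n}"] by simp
        from this[of "\<lambda>n. ennreal ((2 ^ n * d n) ^ k)"] B have yk: "y ^ k \<le> B" unfolding y_def using k(1) by (simp add: power_even_abs)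
        have "y \<le> 1 + B"
        proof (cases "y \<le> 1")
          case False
          then have "y ^ 1 \<le> y ^ k" using k by (intro power_increasing) auto
          then show ?thesis using yk by simp
        qed (use B in simp)
        then show ?thesis unfolding y_def by (simp add: abs_mult field_simps power_divide)
      qed
      moreover have g: "summable (\<lambda>n. (1 + B) * (1/2) ^ n)" by (intro summable_mult summable_geometric) simp
      ultimately have "summable d" using summable_comparison_test'[OF g, of 0 d] by simp
      then have "(\<lambda>n. (\<Sum>i<n. d i) + f 0 x) \<longlonglongrightarrow> suminf d + f 0 x" by (intro tendsto_add tendsto_const summable_LIMSEQ)
      moreover have "(\<Sum>i<n. d i) + f 0 x = f n x" for n using sum_lessThan_telescope[of "\<lambda>i. f i x" n] by (simp add: d_def)
      ultimately have "convergent (\<lambda>n. f n x)" by (auto simp: convergent_def)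
      then show "(\<lambda>n. f n x) \<longlonglongrightarrow> lim (\<lambda>n. f n x)" by (simp add: convergent_LIMSEQ_iff)
    qed
  qed
  have "(\<integral>\<^sup>+x. ennreal ((lim (\<lambda>n. f n x) - f n x) ^ k) \<partial>M) = (\<integral>\<^sup>+x. liminf (\<lambda>m. ennreal ((f m x - f n x) ^ k)) \<partial>M)"
  proof (rule nn_integral_cong_AE, use AE in eventually_elim)
    fix x assume "(\<lambda>n. f n x) \<longlonglongrightarrow> lim (\<lambda>n. f n x)"
    then have "(\<lambda>m. ennreal ((f m x - f n x) ^ k)) \<longlonglongrightarrow> ennreal ((lim (\<lambda>n. f n x) - f n x) ^ k)"
      by (intro tendsto_ennrealI tendsto_power tendsto_diff tendsto_const)
    then show "ennreal ((lim (\<lambda>n. f n x) - f n x) ^ k) = liminf (\<lambda>m. ennreal ((f m x - f n x) ^ k))"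
      by (simp add: lim_imp_Liminf)
  qed
  also have "\<dots> \<le> liminf (\<lambda>m. \<integral>\<^sup>+x. ennreal ((f m x - f n x) ^ k) \<partial>M)" by (rule nn_integral_liminf) measurable
  also have "\<dots> \<le> limsup (\<lambda>m. \<integral>\<^sup>+x. ennreal ((f m x - f n x) ^ k) \<partial>M)" by (rule Liminf_le_Limsup) simp
  also have "\<dots> \<le> ennreal (A * (1/128) ^ n)"
    by (rule Limsup_bounded) (use C in \<open>auto simp: eventually_sequentially\<close>)
  finally show ?thesis .
qed

section \<open>Weak limits of fast converging families\<close>

lemma ennreal_dense_real:
  fixes y :: ennreal
  assumes "0 < y"
  obtains r where "0 < r" "ennreal r < y"
proof -
  obtain c where c: "0 < c" "c < y" using assms dense by blast
  then have "c \<noteq> top" by auto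
  then obtain r where "c = ennreal r" "0 \<le> r" by (cases c) auto
  then show ?thesis using c by (intro that[of r]) auto
qed

text \<open>If |y| > 2^(-n), then |y|^(k-1) is at least 2^(-5n), since k - 1 \<le> 5. This turns
  smallness in L^k on a ball into smallness in L^1, with the rate 32^n / 128^n = 4^(-n).\<close>

lemma abs_le_interpolate:
  fixes y :: real
  assumes "even k" "0 < k" "k \<le> 6"
  shows "\<bar>y\<bar> \<le> (1/2) ^ n + 32 ^ n * y ^ k"
proof (cases "\<bar>y\<bar> \<le> (1/2) ^ n")
  case True
  have "0 \<le> 32 ^ n * y ^ k" using assms by (simp add: zero_le_even_power)
  then show ?thesis using True by simp
next
  case False
  have k: "k = Suc (k - 1)" using assms by simp
  have "((1/2) ^ n) ^ 5 \<le> ((1/2::real) ^ n) ^ (k - 1)" using assms by (intro power_decreasing) (auto simp: power_le_one)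
  also have "\<dots> \<le> \<bar>y\<bar> ^ (k - 1)" using False by (intro power_mono) auto
  finally have "\<bar>y\<bar> * ((1/2) ^ n) ^ 5 \<le> \<bar>y\<bar> * \<bar>y\<bar> ^ (k - 1)" by (intro mult_left_mono) auto
  also have "\<dots> = y ^ k" using k assms(1) by (metis power_Suc power_even_abs)
  finally have "32 ^ n * (\<bar>y\<bar> * ((1/2) ^ n) ^ 5) \<le> 32 ^ n * y ^ k" by (intro mult_left_mono) auto
  moreover have "32 ^ n * (\<bar>y\<bar> * ((1/2) ^ n) ^ 5) = \<bar>y\<bar>"
  proof -
    have "((1/2::real) ^ n) ^ 5 = (1/32) ^ n" by (subst power_mult[symmetric], subst mult.commute, subst power_mult) (simp add: power_divide)
    then show ?thesis by (simp add: power_divide)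
  qed
  moreover have "0 \<le> (1/2::real) ^ n" by simp
  ultimately show ?thesis by linarith
qed

text \<open>By \<open>abs_le_interpolate\<close> the difference of g and G_n has on the ball an L^1
  norm of order 2^(-n) plus 32^n times the L^k error. So the pairings converge, and g \<phi>
  inherits integrability from its approximants.\<close>

lemma local_limit:
  fixes g \<phi> :: "'a::euclidean_space \<Rightarrow> real" and G :: "nat \<Rightarrow> 'a \<Rightarrow> real"
  assumes [measurable]: "g \<in> borel_measurable borel" and G: "\<And>n. continuous_on UNIV (G n)"
    and k: "even k" "0 < k" "k \<le> 6" and K: "K \<ge> 0"
    and le: "\<And>n. (NNINT p. ennreal ((g p - G n p) ^ k) * indicator (cball 0 R) p) \<le> ennreal (K * (1/128) ^ n)"
    and \<phi>: "continuous_on UNIV \<phi>" "\<And>p. norm p > R \<Longrightarrow> \<phi> p = 0"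
  shows "integrable lborel (\<lambda>p. g p * \<phi> p)" "(\<lambda>n. LBINT p. G n p * \<phi> p) \<longlonglongrightarrow> (LBINT p. g p * \<phi> p)"
proof -
  have [measurable]: "G n \<in> borel_measurable borel" "\<phi> \<in> borel_measurable borel" for n
    using G \<phi> by (auto intro: borel_measurable_continuous_onI)
  have "bounded (\<phi> ` cball 0 R)" by (intro compact_imp_bounded compact_continuous_image continuous_on_subset[OF \<phi>(1)]) auto
  then obtain M where M: "M > 0" "\<And>p. p \<in> cball 0 R \<Longrightarrow> \<bar>\<phi> p\<bar> \<le> M" unfolding bounded_pos by auto
  define V where "V = measure lborel (cball (0::'a) R)"
  have V: "emeasure lborel (cball (0::'a) R) = ennreal V" unfolding V_def by (rule emeasure_eq_ennreal_measure) (use emeasure_lborel_cball_finite[of "0::'a" R] in auto)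
  define e where "e n = M * ((1/2) ^ n * V + K * (1/4) ^ n)" for n
  have diff: "(NNINT p. ennreal (norm ((g p - G n p) * \<phi> p))) \<le> ennreal (e n)" for n
  proof -
    have "(NNINT p. ennreal (norm ((g p - G n p) * \<phi> p)))
        \<le> (NNINT p. ennreal (M * (1/2) ^ n) * indicator (cball 0 R) p + ennreal (M * 32 ^ n) * (ennreal ((g p - G n p) ^ k) * indicator (cball 0 R) p))"
    proof (rule nn_integral_mono)
      fix p :: 'a
      show "ennreal (norm ((g p - G n p) * \<phi> p)) \<le> ennreal (M * (1/2) ^ n) * indicator (cball 0 R) p + ennreal (M * 32 ^ n) * (ennreal ((g p - G n p) ^ k) * indicator (cball 0 R) p)"
      proof (cases "p \<in> cball 0 R")
        case True
        have "norm ((g p - G n p) * \<phi> p) = \<bar>\<phi> p\<bar> * \<bar>g p - G n p\<bar>" by (simp add: abs_mult)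
        also have "\<dots> \<le> M * ((1/2) ^ n + 32 ^ n * (g p - G n p) ^ k)" using M True by (intro mult_mono abs_le_interpolate k) auto
        also have "\<dots> = M * (1/2) ^ n + M * 32 ^ n * (g p - G n p) ^ k" by (simp add: algebra_simps)
        finally have "ennreal (norm ((g p - G n p) * \<phi> p)) \<le> ennreal (M * (1/2) ^ n + M * 32 ^ n * (g p - G n p) ^ k)" by (rule ennreal_leI)
        also have "\<dots> = ennreal (M * (1/2) ^ n) + ennreal (M * 32 ^ n) * ennreal ((g p - G n p) ^ k)"
          using M k by (subst ennreal_plus) (simp_all add: ennreal_mult' zero_le_even_power)
        finally show ?thesis using True by simp
      qed (use \<phi>(2)[of p] in simp)
    qed
    also have "\<dots> = ennreal (M * (1/2) ^ n) * ennreal V + ennreal (M * 32 ^ n) * (NNINT p. ennreal ((g p - G n p) ^ k) * indicator (cball 0 R) p)"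
    proof -
      have [measurable]: "cball (0::'a) R \<in> sets borel" by simp
      have "(NNINT p. ennreal (M * (1/2) ^ n) * indicator (cball 0 R) p + ennreal (M * 32 ^ n) * (ennreal ((g p - G n p) ^ k) * indicator (cball 0 R) p))
        = (NNINT p. ennreal (M * (1/2) ^ n) * indicator (cball 0 R) (p::'a)) + (NNINT p. ennreal (M * 32 ^ n) * (ennreal ((g p - G n p) ^ k) * indicator (cball 0 R) p))"
        by (rule nn_integral_add) measurable
      moreover have "(NNINT p. ennreal (M * 32 ^ n) * (ennreal ((g p - G n p) ^ k) * indicator (cball 0 R) p)) = ennreal (M * 32 ^ n) * (NNINT p. ennreal ((g p - G n p) ^ k) * indicator (cball 0 R) p)"
        by (rule nn_integral_cmult) measurable
      ultimately show ?thesis by (simp add: nn_integral_cmult_indicator V)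
    qed
    also have "\<dots> \<le> ennreal (M * (1/2) ^ n) * ennreal V + ennreal (M * 32 ^ n) * ennreal (K * (1/128) ^ n)"
      by (intro add_mono mult_left_mono le) auto
    also have "\<dots> = ennreal (M * (1/2) ^ n * V + M * 32 ^ n * (K * (1/128) ^ n))"
      using M K by (subst ennreal_plus) (simp_all add: ennreal_mult' V_def)
    also have "M * (1/2) ^ n * V + M * 32 ^ n * (K * (1/128) ^ n) = e n"
    proof -
      have "(32::real) ^ n * (1/128) ^ n = (1/4) ^ n" by (simp add: power_mult_distrib[symmetric])
      then show ?thesis by (simp add: e_def algebra_simps)
    qed
    finally show ?thesis .
  qed
  have I1: "integrable lborel (\<lambda>p. (g p - G n p) * \<phi> p)" for n
    by (rule integrableI_bounded) (use le_less_trans[OF diff[of n]] in auto)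
  have I2: "integrable lborel (\<lambda>p. G n p * \<phi> p)" for n
    by (rule integrable_lborel_compact_support[of _ R]) (use G \<phi> in \<open>auto intro: continuous_on_mult\<close>)
  have "(\<lambda>p. g p * \<phi> p) = (\<lambda>p. (g p - G 0 p) * \<phi> p + G 0 p * \<phi> p)" by (simp add: algebra_simps)
  then show I: "integrable lborel (\<lambda>p. g p * \<phi> p)" using Bochner_Integration.integrable_add[OF I1[of 0] I2[of 0]] by simp
  have e0: "e n \<ge> 0" for n using M K by (simp add: e_def V_def)
  have "\<bar>(LBINT p. G n p * \<phi> p) - (LBINT p. g p * \<phi> p)\<bar> \<le> e n" for n
  proof -
    have "(LBINT p. g p * \<phi> p) - (LBINT p. G n p * \<phi> p) = (LBINT p. (g p - G n p) * \<phi> p)"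
      using Bochner_Integration.integral_diff[OF I I2[of n]] by (simp add: left_diff_distrib)
    moreover have "ennreal (norm (LBINT p. (g p - G n p) * \<phi> p)) \<le> ennreal (e n)"
      using integral_norm_bound_ennreal[OF I1[of n]] diff[of n] by (rule order.trans)
    ultimately show ?thesis using e0[of n] by simp
  qed
  then have ev: "\<forall>\<^sub>F n in sequentially. norm ((LBINT p. G n p * \<phi> p) - (LBINT p. g p * \<phi> p)) \<le> e n" by simp
  have "e \<longlonglongrightarrow> M * (0 * V + K * 0)" unfolding e_def[abs_def] by (intro tendsto_intros LIMSEQ_power_zero) auto
  then have "e \<longlonglongrightarrow> 0" by simp
  from Lim_null_comparison[OF ev this] have "(\<lambda>n. (LBINT p. G n p * \<phi> p) - (LBINT p. g p * \<phi> p)) \<longlonglongrightarrow> 0" .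
  then show "(\<lambda>n. LBINT p. G n p * \<phi> p) \<longlonglongrightarrow> (LBINT p. g p * \<phi> p)" by (simp add: LIM_zero_iff)
qed

text \<open>Used with k = 2 for first derivatives and k = 6 for the functions themselves. The
  estimate holds on every time slice, uniformly in t.\<close>

definition fast_limit :: "nat \<Rightarrow> real \<Rightarrow> (nat \<Rightarrow> spacetime \<Rightarrow> real) \<Rightarrow> (spacetime \<Rightarrow> real) \<Rightarrow> bool" where
  "fast_limit k A f F \<longleftrightarrow> even k \<and> 0 < k \<and> k \<le> 6 \<and> A \<ge> 0 \<and> F \<in> borel_measurable borel \<and> (\<forall>n. continuous_on UNIV (f n)) \<and>
     (\<forall>n t. (NNINT x. ennreal ((F (t, x) - f n (t, x)) ^ k)) \<le> ennreal (A * (1/128) ^ n))"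

lemma slice_continuous: "continuous_on UNIV (f :: spacetime \<Rightarrow> real) \<Longrightarrow> continuous_on UNIV (\<lambda>x. f (t, x))"
  by (rule continuous_on_compose2[of UNIV f]) (auto intro!: continuous_intros)

lemma slice_measurable: "(f :: spacetime \<Rightarrow> real) \<in> borel_measurable borel \<Longrightarrow> (\<lambda>x. f (t, x)) \<in> borel_measurable borel"
  by (erule measurable_compose[rotated], intro borel_measurable_continuous_onI continuous_intros)

lemma fast_limit_lim:
  assumes k: "even k" "0 < k" "k \<le> 6" and A: "A \<ge> 0" and c: "\<And>n. continuous_on UNIV (f n)"
    and C: "\<And>n m t. n \<le> m \<Longrightarrow> (NNINT x. ennreal ((f m (t, x) - f n (t, x)) ^ k)) \<le> ennreal (A * (1/128) ^ n)"
  shows "fast_limit k A f (\<lambda>p. lim (\<lambda>n. f n p))"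
proof -
  have [measurable]: "f n \<in> borel_measurable borel" for n by (rule borel_measurable_continuous_onI[OF c])
  have "(\<lambda>p. lim (\<lambda>n. f n p)) \<in> borel_measurable borel" by measurable
  moreover have "(NNINT x. ennreal ((lim (\<lambda>n. f n (t, x)) - f n (t, x)) ^ k)) \<le> ennreal (A * (1/128) ^ n)" for n t
    using lim_of_fast_Cauchy[of "\<lambda>n x. f n (t, x)" lborel k A n] slice_measurable[of "f _" t] k A C by simp
  ultimately show ?thesis using assms unfolding fast_limit_def by simp
qed

text \<open>In space-time the bound on slices is integrated over |t| \<le> |R|, which costs the
  factor 2 |R|.\<close>

lemma fast_limit_pairing:
  assumes F: "fast_limit k A f F"
  shows "continuous_on UNIV \<phi> \<Longrightarrow> (\<And>p. norm p > R \<Longrightarrow> \<phi> p = 0) \<Longrightarrow>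
      integrable lborel (\<lambda>p. F p * \<phi> p) \<and> (\<lambda>n. LBINT p. f n p * \<phi> p) \<longlonglongrightarrow> (LBINT p. F p * \<phi> p)"
    and "continuous_on UNIV \<psi> \<Longrightarrow> (\<And>x. norm x > R \<Longrightarrow> \<psi> x = 0) \<Longrightarrow>
      integrable lborel (\<lambda>x. F (t, x) * \<psi> x) \<and> (\<lambda>n. LBINT x. f n (t, x) * \<psi> x) \<longlonglongrightarrow> (LBINT x. F (t, x) * \<psi> x)"
proof -
  have k: "even k" "0 < k" "k \<le> 6" and A: "A \<ge> 0" and Fm [measurable]: "F \<in> borel_measurable borel" and c: "\<And>n. continuous_on UNIV (f n)"
    and le: "\<And>n t. (NNINT x. ennreal ((F (t, x) - f n (t, x)) ^ k)) \<le> ennreal (A * (1/128) ^ n)"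
    using F unfolding fast_limit_def by auto
  have [measurable]: "f n \<in> borel_measurable borel" for n by (rule borel_measurable_continuous_onI[OF c])
  {
    assume \<phi>: "continuous_on UNIV \<phi>" "\<And>p. norm p > R \<Longrightarrow> \<phi> p = 0"
    have "(NNINT p. ennreal ((F p - f n p) ^ k) * indicator (cball 0 R) p) \<le> ennreal ((A * (2 * \<bar>R\<bar>)) * (1/128) ^ n)" for n
    proof -
      have "(NNINT p. ennreal ((F p - f n p) ^ k) * indicator (cball 0 R) p) \<le> (NNINT p. ennreal ((F p - f n p) ^ k) * indicator {-\<bar>R\<bar>..\<bar>R\<bar>} (fst p))"
      proof (intro nn_integral_mono mult_left_mono)
        fix p :: "spacetime"
        show "indicator (cball 0 R) p \<le> (indicator {-\<bar>R\<bar>..\<bar>R\<bar>} (fst p) :: ennreal)"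
          using norm_fst_le[of "fst p" "snd p"] by (auto simp: indicator_def)
      qed simp
      also have "\<dots> = (NNINT t x. ennreal ((F (t, x) - f n (t, x)) ^ k) * indicator {-\<bar>R\<bar>..\<bar>R\<bar>} t)"
        by (subst nn_integral_spacetime(1)) simp_all
      also have "\<dots> \<le> (NNINT t. ennreal (A * (1/128) ^ n) * indicator {-\<bar>R\<bar>..\<bar>R\<bar>} t)"
        by (intro nn_integral_mono) (use le in \<open>auto simp: indicator_def\<close>)
      also have "\<dots> = ennreal (A * (1/128) ^ n) * ennreal (2 * \<bar>R\<bar>)" by (subst nn_integral_cmult_indicator) auto
      also have "\<dots> = ennreal ((A * (2 * \<bar>R\<bar>)) * (1/128) ^ n)" using A by (simp add: ennreal_mult'[symmetric] mult_ac)
      finally show ?thesis .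
    qed
    from local_limit[OF Fm c k _ this \<phi>] A show "integrable lborel (\<lambda>p. F p * \<phi> p) \<and> (\<lambda>n. LBINT p. f n p * \<phi> p) \<longlonglongrightarrow> (LBINT p. F p * \<phi> p)" by simp
  next
    assume \<psi>: "continuous_on UNIV \<psi>" "\<And>x. norm x > R \<Longrightarrow> \<psi> x = 0"
    have "(NNINT x. ennreal ((F (t, x) - f n (t, x)) ^ k) * indicator (cball 0 R) x) \<le> ennreal (A * (1/128) ^ n)" for n
      by (rule order.trans[OF nn_integral_mono le]) (auto simp: indicator_def)
    from local_limit[OF slice_measurable[OF Fm] slice_continuous[OF c] k A this \<psi>]
    show "integrable lborel (\<lambda>x. F (t, x) * \<psi> x) \<and> (\<lambda>n. LBINT x. f n (t, x) * \<psi> x) \<longlonglongrightarrow> (LBINT x. F (t, x) * \<psi> x)" by blast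
  }
qed

lemma fast_limit_2:
  assumes "fast_limit 2 A f F"
  shows "e2 (\<lambda>x. F (t, x) - f n (t, x)) \<le> ennreal (A * (1/128) ^ n)" "(\<lambda>x. F (t, x)) \<in> borel_measurable borel" "(\<lambda>x. f n (t, x)) \<in> borel_measurable borel"
  using assms unfolding fast_limit_def e2_def by (auto intro: slice_measurable borel_measurable_continuous_onI)

lemma fast_limit_L2_finite:
  assumes F: "fast_limit 2 A f F" and s: "\<And>n. \<exists>R. cone_supp R (f n)"
  shows "e2 (\<lambda>x. F (t, x)) < \<infinity>"
proof -
  obtain R where "cone_supp R (f 0)" using s by blast
  then have fin: "e2 (\<lambda>x. f 0 (t, x)) < \<infinity>" using F by (intro cone_supp_slice(2)[of _ R]) (auto simp: fast_limit_def)
  have "e2 (\<lambda>x. F (t, x)) = e2 (\<lambda>x. (F (t, x) - f 0 (t, x)) + f 0 (t, x))" by simp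
  also have "\<dots> \<le> 2 * e2 (\<lambda>x. F (t, x) - f 0 (t, x)) + 2 * e2 (\<lambda>x. f 0 (t, x))" by (intro e2_add borel_measurable_diff fast_limit_2[OF F])
  also have "\<dots> < \<infinity>" using fin le_less_trans[OF fast_limit_2(1)[OF F, of t 0]] by (simp add: ennreal_mult_less_top)
  finally show ?thesis .
qed

text \<open>The error on slices is uniform in time, so continuity in time passes from the
  approximants to the limit.\<close>

lemma fast_limit_continuous:
  assumes F: "fast_limit 2 A f F" and s: "\<And>n. \<exists>R. cone_supp R (f n)"
  shows "((\<lambda>s. e2 (\<lambda>x. F (s, x) - F (t, x))) \<longlongrightarrow> 0) (at t within S)"
proof (rule order_tendstoI)
  fix y :: ennreal assume "0 < y"
  then obtain r where r: "0 < r" "ennreal r < y" by (rule ennreal_dense_real)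
  have A: "A \<ge> 0" using F by (simp add: fast_limit_def)
  \<comment> \<open>Two uses of \<open>e2_triangle\<close> yield 2 a + 2 (2 (r / 8) + 2 a) = 6 a + r
    / 2.\<close>
  have "(\<lambda>n. 6 * (A * (1/128) ^ n)) \<longlonglongrightarrow> 6 * (A * 0)" by (intro tendsto_intros LIMSEQ_power_zero) auto
  from order_tendstoD(2)[OF this, of "r / 2"] r have "\<forall>\<^sub>F n in sequentially. 6 * (A * (1/128) ^ n) < r / 2" by simp
  then obtain n where n: "6 * (A * (1/128) ^ n) < r / 2" by (auto simp: eventually_sequentially)
  define a where "a = A * (1/128) ^ n"
  have a0: "a \<ge> 0" using A by (simp add: a_def)
  obtain R where R: "cone_supp R (f n)" using s by blast
  note m = fast_limit_2(2,3)[OF F]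
  have "((\<lambda>s. e2 (\<lambda>x. f n (s, x) - f n (t, x))) \<longlongrightarrow> 0) (at t)"
    by (rule e2_slice_continuous[OF _ R]) (use F in \<open>simp add: fast_limit_def\<close>)
  then have "\<forall>\<^sub>F s in at t. e2 (\<lambda>x. f n (s, x) - f n (t, x)) < ennreal (r / 8)" using r by (intro order_tendstoD(2)) auto
  then have "\<forall>\<^sub>F s in at t within S. e2 (\<lambda>x. f n (s, x) - f n (t, x)) < ennreal (r / 8)" by (rule filter_leD[OF at_le, rotated]) simp
  then show "\<forall>\<^sub>F s in at t within S. e2 (\<lambda>x. F (s, x) - F (t, x)) < y"
  proof eventually_elim
    fix s assume s: "e2 (\<lambda>x. f n (s, x) - f n (t, x)) < ennreal (r / 8)"
    have "e2 (\<lambda>x. f n (s, x) - F (t, x)) \<le> ennreal (2 * (r / 8) + 2 * a)"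
      by (rule e2_triangle[where s=a, OF m(2) m(2) m(1) less_imp_le[OF s]])
        (use fast_limit_2(1)[OF F, of t n] r a0 in \<open>simp_all add: a_def e2_minus_commute[of "\<lambda>x. f n (t, x)"]\<close>)
    then have "e2 (\<lambda>x. F (s, x) - F (t, x)) \<le> ennreal r"
      by (rule e2_triangle[OF m(1) m(2) m(1) fast_limit_2(1)[OF F]]) (use r a0 n in \<open>simp_all add: a_def\<close>)
    then show "e2 (\<lambda>x. F (s, x) - F (t, x)) < y" using r by simp
  qed
qed simp

lemma integral_by_parts:
  fixes u \<psi> :: "'a::euclidean_space \<Rightarrow> real"
  assumes u: "Cinf u" and \<psi>: "Cinf \<psi>" "\<And>x. norm x > R \<Longrightarrow> \<psi> x = 0"
  shows "(LBINT x. u x * dd b \<psi> x) = - (LBINT x. dd b u x * \<psi> x)"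
proof -
  have C: "Cinf (\<lambda>x. u x * \<psi> x)" by (intro Cinf_mult u \<psi>)
  have z: "dd b \<psi> x = 0" if "norm x > R" for x using \<psi>(2) that by (rule dd_zero_outside)
  have "continuous_on UNIV (\<lambda>x. u x * dd b \<psi> x)" "continuous_on UNIV (\<lambda>x. dd b u x * \<psi> x)"
    by (intro continuous_on_mult Cinf_continuous Cinf_dd u \<psi>)+
  then have I: "integrable lborel (\<lambda>x. u x * dd b \<psi> x)" "integrable lborel (\<lambda>x. dd b u x * \<psi> x)"
    by (auto intro!: integrable_lborel_compact_support[of _ R] simp: z \<psi>)
  have "dd b (\<lambda>x. u x * \<psi> x) = (\<lambda>x. u x * dd b \<psi> x + dd b u x * \<psi> x)"
    using u \<psi> by (intro ext) (subst dd_mult, auto intro: Cinf_differentiable)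
  moreover have "(LBINT x. dd b (\<lambda>x. u x * \<psi> x) x) = 0"
    by (rule integral_dd_eq_0[of _ _ R]) (use C \<psi>(2) in \<open>auto intro: Cinf_differentiable Cinf_continuous Cinf_dd\<close>)
  ultimately show ?thesis using Bochner_Integration.integral_add[OF I] by simp
qed

lemma test_fnE:
  assumes "test_fn U \<phi>"
  obtains R where "Cinf \<phi>" "\<And>x. norm x > R \<Longrightarrow> \<phi> x = 0" "\<And>b x. norm x > R \<Longrightarrow> dd b \<phi> x = 0"
proof -
  have C: "Cinf \<phi>" and "bounded (tsupp \<phi>)" using assms by (auto simp: test_fn_def smooth_fn_iff_Cinf compact_imp_bounded)
  then obtain R where R: "\<And>x. x \<in> tsupp \<phi> \<Longrightarrow> norm x \<le> R" unfolding bounded_iff by blast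
  have z: "\<phi> x = 0" if "norm x > R" for x using R[of x] that closure_subset[of "{z. \<phi> z \<noteq> 0}"] unfolding tsupp_def by fastforce
  have "dd b \<phi> x = 0" if "norm x > R" for b x using z that by (rule dd_zero_outside)
  with C z that show ?thesis by blast
qed

lemma e2_norm_vec:
  fixes g :: "real^3 \<Rightarrow> real^3"
  assumes [measurable]: "\<And>i. (\<lambda>x. g x $ i) \<in> borel_measurable borel"
  shows "e2 (\<lambda>x. norm (g x)) = e2 (\<lambda>x. g x $ 1) + (e2 (\<lambda>x. g x $ 2) + e2 (\<lambda>x. g x $ 3))"
proof -
  have "ennreal ((norm (g x))^2) = ennreal ((g x $ 1)^2) + (ennreal ((g x $ 2)^2) + ennreal ((g x $ 3)^2))" for x
    unfolding norm3 by (simp add: add.assoc)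
  then show ?thesis unfolding e2_def by (simp add: nn_integral_add)
qed

text \<open>The energy of a difference controls all its first derivatives in L^2 on every slice, and
  Sobolev's inequality controls the function in L^6, so all these quantities converge fast.
  Integration by parts and the wave equation are linear identities for the smooth waves and pass to
  the limit against test functions.\<close>

theorem limit_wave:
  assumes w: "\<And>n. nice_wave (w n)" and C: "\<And>n m. n \<le> m \<Longrightarrow> en (\<lambda>p. w m p - w n p) \<le> 4 * (1/128) ^ n"
  shows "\<exists>u du ut. energy_class u du ut \<and> weak_wave u du ut (\<lambda>t x y. 0) \<and>
     (\<forall>n t. e2 (\<lambda>x. ut t x - Dt (w n) (t, x)) \<le> ennreal (4 * (1/128) ^ n) \<and>
        (\<forall>i. e2 (\<lambda>x. du t x $ i - Dx i (w n) (t, x)) \<le> ennreal (4 * (1/128) ^ n))) \<and>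
     (\<forall>t. ut t \<in> borel_measurable borel \<and> (\<forall>i. (\<lambda>x. du t x $ i) \<in> borel_measurable borel))"
proof -
  have Cw: "Cinf (w n)" for n by (rule nice_wave_Cinf[OF w])
  have supp: "\<exists>R. cone_supp R (w n)" "\<exists>R. cone_supp R (dd b (w n))" for b n using w[of n] by (auto simp: nice_wave_def intro: cone_supp_dd)
  have nd: "nice_wave (\<lambda>p. w m p - w n p)" for m n by (rule nice_wave_diff[OF w w])
  have ddiff: "dd b (\<lambda>p. w m p - w n p) p = dd b (w m) p - dd b (w n) p" for b m n p
    by (intro dd_diff Cinf_differentiable Cw)
  define W0 where "W0 p = lim (\<lambda>n. w n p)" for p
  define Wt where "Wt p = lim (\<lambda>n. Dt (w n) p)" for p
  define Wx where "Wx i p = lim (\<lambda>n. Dx i (w n) p)" for i p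
  have enC: "ennreal (en (\<lambda>p. w m p - w n p)) \<le> ennreal (4 * (1/128) ^ n)" if "n \<le> m" for m n by (intro ennreal_leI C that)
  have Ft: "fast_limit 2 4 (\<lambda>n. Dt (w n)) Wt" unfolding Wt_def[abs_def]
  proof (rule fast_limit_lim)
    fix n m :: nat and t :: real assume nm: "n \<le> m"
    show "(NNINT x. ennreal ((Dt (w m) (t, x) - Dt (w n) (t, x)) ^ 2)) \<le> ennreal (4 * (1/128) ^ n)"
      using order.trans[OF e2_slice_le_en(1)[OF nd, of m n t] enC[OF nm]] by (simp add: e2_def ddiff)
  qed (auto intro: Cinf_continuous Cinf_dd Cw)
  have Fx: "fast_limit 2 4 (\<lambda>n. Dx i (w n)) (Wx i)" for i unfolding Wx_def[abs_def]
  proof (rule fast_limit_lim)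
    fix n m :: nat and t :: real assume nm: "n \<le> m"
    show "(NNINT x. ennreal ((Dx i (w m) (t, x) - Dx i (w n) (t, x)) ^ 2)) \<le> ennreal (4 * (1/128) ^ n)"
      using order.trans[OF e2_slice_le_en(2)[OF nd, of i m n t] enC[OF nm]] by (simp add: e2_def ddiff)
  qed (auto intro: Cinf_continuous Cinf_dd Cw)
  \<comment> \<open>4096 is the Sobolev constant and 64 = 4^3; the cube of (1/128)^n is estimated by
    its first power.\<close>
  have F0: "fast_limit 6 (4096 * 64) w W0" unfolding W0_def[abs_def]
  proof (rule fast_limit_lim)
    fix n m :: nat and t :: real assume nm: "n \<le> m"
    define z where "z = (\<lambda>p. w m p - w n p)"
    have z: "nice_wave z" unfolding z_def by (rule nd)
    obtain R where R: "cone_supp R z" using z by (auto simp: nice_wave_def)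
    have sl: "dd (axis i 1) (\<lambda>x. z (t, x)) = (\<lambda>x. Dx i z (t, x))" for i
      by (intro ext dd_slice Cinf_differentiable nice_wave_Cinf z)
    have e: "e2 (\<lambda>x. Dx i z (t, x)) \<le> ennreal (4 * (1/128) ^ n)" for i
      using order.trans[OF e2_slice_le_en(2)[OF z, of i t]] enC[OF nm] by (simp add: z_def)
    have "(NNINT x. ennreal (z (t, x) ^ 6)) \<le> 4096 * (e2 (\<lambda>x. Dx 1 z (t, x)) * e2 (\<lambda>x. Dx 2 z (t, x)) * e2 (\<lambda>x. Dx 3 z (t, x)))"
      using Sobolev_L6[OF Cinf_slice[OF nice_wave_Cinf[OF z]], of "R + \<bar>t\<bar>" t] R unfolding sl by (simp add: cone_supp_def)
    also have "\<dots> \<le> 4096 * (ennreal (4 * (1/128) ^ n) * ennreal (4 * (1/128) ^ n) * ennreal (4 * (1/128) ^ n))" by (intro mult_left_mono mult_mono e) auto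
    also have "\<dots> = ennreal (4096 * ((4 * (1/128) ^ n) * (4 * (1/128) ^ n) * (4 * (1/128) ^ n)))" by (simp only: ennreal_mult' ennreal_numeral zero_le_numeral zero_le_power mult_nonneg_nonneg zero_le_divide_1_iff)
    also have "\<dots> \<le> ennreal (4096 * 64 * (1/128) ^ n)"
    proof (rule ennreal_leI)
      define s :: real where "s = (1/128) ^ n"
      have s: "0 \<le> s" "s \<le> 1" by (simp_all add: s_def power_le_one)
      then have "s * (s * s) \<le> s" using mult_left_le[of "s * s" s] mult_le_one[of s s] by simp
      moreover have "4096 * ((4 * s) * (4 * s) * (4 * s)) = 4096 * 64 * (s * (s * s))" by simp
      ultimately have "4096 * ((4 * s) * (4 * s) * (4 * s)) \<le> 4096 * 64 * s" by linarith
      then show "(4096::real) * ((4 * (1/128) ^ n) * (4 * (1/128) ^ n) * (4 * (1/128) ^ n)) \<le> 4096 * 64 * (1/128) ^ n" unfolding s_def .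
    qed
    finally show "(NNINT x. ennreal ((w m (t, x) - w n (t, x)) ^ 6)) \<le> ennreal (4096 * 64 * (1/128) ^ n)" unfolding z_def .
  qed (auto intro: Cinf_continuous Cw)
  define u where "u t x = W0 (t, x)" for t x
  define ut where "ut t x = Wt (t, x)" for t x
  define du :: "real \<Rightarrow> real^3 \<Rightarrow> real^3" where "du t x = (\<chi> i. Wx i (t, x))" for t x
  have du [simp]: "du t x $ i = Wx i (t, x)" for t x i by (simp add: du_def)
  have dum: "(\<lambda>x. du t x $ i) \<in> borel_measurable borel" "ut t \<in> borel_measurable borel" for t i
    using fast_limit_2(2)[OF Fx] fast_limit_2(2)[OF Ft] by (auto simp: ut_def[abs_def])
  have duv: "du t \<in> borel_measurable borel" for t
    unfolding borel_measurable_euclidean_space[of "du t"] using dum(1)[of t] by (auto simp: Basis_vec_def inner_axis)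
  have L2: "L2mem (ut t)" for t
    unfolding L2mem_def Lpn_2_finite using dum(2) fast_limit_L2_finite[OF Ft supp(2)] by (simp add: ut_def[abs_def])
  have H1: "Hdot1 (u t) (du t)" for t unfolding Hdot1_def
  proof (intro conjI)
    show um: "u t \<in> borel_measurable lborel" using F0 by (simp add: u_def[abs_def] fast_limit_def slice_measurable)
    show "du t \<in> borel_measurable lborel" using duv by simp
    show "Lpn 2 (\<lambda>x. norm (du t x)) < \<infinity>" unfolding Lpn_2_finite
      using fast_limit_L2_finite[OF Fx supp(2)] by (subst e2_norm_vec[OF dum(1)]) simp
    show "Lpn 6 (u t) < \<infinity>" unfolding Lpn_6_finite
    proof -
      have [measurable]: "u t \<in> borel_measurable borel" "(\<lambda>x. w 0 (t, x)) \<in> borel_measurable borel"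
        using um slice_measurable[OF Cinf_measurable[OF Cw]] by simp_all
      have pw: "ennreal (a ^ 6) \<le> ennreal 64 * ennreal ((a - b) ^ 6) + ennreal 64 * ennreal (b ^ 6)" for a b :: real
      proof -
        have "\<bar>a\<bar> \<le> 2 * max \<bar>a - b\<bar> \<bar>b\<bar>" by (auto simp: max_def abs_if split: if_splits)
        then have "\<bar>a\<bar> ^ 6 \<le> (2 * max \<bar>a - b\<bar> \<bar>b\<bar>) ^ 6" by (intro power_mono) auto
        also have "\<dots> \<le> 64 * ((a - b) ^ 6 + b ^ 6)" by (cases "\<bar>a - b\<bar> \<le> \<bar>b\<bar>") (auto simp: max_def power_mult_distrib)
        finally have "ennreal (a ^ 6) \<le> ennreal (64 * (a - b) ^ 6 + 64 * b ^ 6)" by (intro ennreal_leI) simp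
        also have "\<dots> = ennreal 64 * ennreal ((a - b) ^ 6) + ennreal 64 * ennreal (b ^ 6)" by (subst ennreal_plus) (simp_all add: ennreal_mult')
        finally show ?thesis .
      qed
      have "(NNINT x. ennreal (u t x ^ 6)) \<le> (NNINT x. ennreal 64 * ennreal ((u t x - w 0 (t, x)) ^ 6) + ennreal 64 * ennreal (w 0 (t, x) ^ 6))"
        by (intro nn_integral_mono pw)
      also have "\<dots> = ennreal 64 * (NNINT x. ennreal ((u t x - w 0 (t, x)) ^ 6)) + ennreal 64 * (NNINT x. ennreal (w 0 (t, x) ^ 6))"
        by (simp add: nn_integral_add nn_integral_cmult)
      also have "\<dots> < \<infinity>"
      proof -
        have "(NNINT x. ennreal ((u t x - w 0 (t, x)) ^ 6)) \<le> ennreal (4096 * 64 * (1/128) ^ 0)" unfolding u_def using F0 unfolding fast_limit_def by blast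
        then have 1: "(NNINT x. ennreal ((u t x - w 0 (t, x)) ^ 6)) < \<infinity>" by (rule le_less_trans) simp
        obtain R where R: "cone_supp R (w 0)" using supp by blast
        have "continuous_on UNIV (\<lambda>x. w 0 (t, x) ^ 3)" by (intro continuous_on_power slice_continuous Cinf_continuous Cw)
        then have "e2 (\<lambda>x. w 0 (t, x) ^ 3) < \<infinity>" using R by (intro e2_compact_finite[of _ "R + \<bar>t\<bar>"]) (auto simp: cone_supp_def)
        then have "(NNINT x. ennreal (w 0 (t, x) ^ 6)) < \<infinity>" unfolding e2_def by (simp flip: power_mult)
        with 1 show ?thesis by (simp add: ennreal_mult_less_top)
      qed
      finally show "(NNINT x. ennreal (u t x ^ 6)) < \<infinity>" .
    qed
    show "weak_grad (u t) (du t)" unfolding weak_grad_def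
    proof (intro allI impI)
      fix \<phi> :: "real^3 \<Rightarrow> real" and i :: 3 assume "test_fn UNIV \<phi>"
      then obtain R where \<phi>: "Cinf \<phi>" "\<And>x. norm x > R \<Longrightarrow> \<phi> x = 0" "\<And>b x. norm x > R \<Longrightarrow> dd b \<phi> x = 0" by (rule test_fnE) blast
      have a: "integrable lborel (\<lambda>x. u t x * dd (axis i 1) \<phi> x)" "(\<lambda>n. LBINT x. w n (t, x) * dd (axis i 1) \<phi> x) \<longlonglongrightarrow> (LBINT x. u t x * dd (axis i 1) \<phi> x)"
        using fast_limit_pairing(2)[OF F0 Cinf_continuous[OF Cinf_dd[OF \<phi>(1)]] \<phi>(3)] unfolding u_def by blast+
      have b: "integrable lborel (\<lambda>x. du t x $ i * \<phi> x)" "(\<lambda>n. LBINT x. Dx i (w n) (t, x) * \<phi> x) \<longlonglongrightarrow> (LBINT x. du t x $ i * \<phi> x)"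
        using fast_limit_pairing(2)[OF Fx Cinf_continuous[OF \<phi>(1)] \<phi>(2)] unfolding du by blast+
      have sl: "dd (axis i 1) (\<lambda>x. w n (t, x)) = (\<lambda>x. Dx i (w n) (t, x))" for n
        by (intro ext dd_slice Cinf_differentiable Cw)
      have "(LBINT x. w n (t, x) * dd (axis i 1) \<phi> x) = - (LBINT x. Dx i (w n) (t, x) * \<phi> x)" for n
        using integral_by_parts[OF Cinf_slice[OF Cw[of n], of t] \<phi>(1,2), where b="axis i 1"] unfolding sl .
      note LIMSEQ_unique[OF a(2)[unfolded this] tendsto_minus[OF b(2)]]
      with a(1) b(1) show "integrable lborel (\<lambda>x. u t x * dd (axis i 1) \<phi> x) \<and> integrable lborel (\<lambda>x. du t x $ i * \<phi> x) \<and>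
        (LBINT x. u t x * dd (axis i 1) \<phi> x) = - (LBINT x. du t x $ i * \<phi> x)" by blast
    qed
  qed
  have "energy_class u du ut" unfolding energy_class_def
  proof (intro conjI allI impI)
    fix t :: real
    show "Hdot1 (u t) (du t)" "L2mem (ut t)" by (rule H1 L2)+
    have "((\<lambda>s. e2 (\<lambda>x. norm (du s x - du t x))) \<longlongrightarrow> 0 + (0 + 0)) (at t within {0..})"
    proof -
      have m: "(\<lambda>x. (du s x - du t x) $ i) \<in> borel_measurable borel" for s i
        using borel_measurable_diff[OF dum(1)[of s i] dum(1)[of t i]] by simp
      have "((\<lambda>s. e2 (\<lambda>x. (du s x - du t x) $ i)) \<longlongrightarrow> 0) (at t within {0..})" for i
        using fast_limit_continuous[OF Fx supp(2), of i t "{0..}"] by simp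
      then show ?thesis unfolding e2_norm_vec[OF m] by (intro tendsto_add)
    qed
    then have "((\<lambda>s. e2 (\<lambda>x. norm (du s x - du t x))) \<longlongrightarrow> 0) (at t within {0..})" by simp
    then show "((\<lambda>s. Lpn 2 (\<lambda>x. norm (du s x - du t x))) \<longlongrightarrow> 0) (at t within {0..})" unfolding e2_Lpn tendsto_ennreal_square_zero .
    show "((\<lambda>s. Lpn 2 (\<lambda>x. ut s x - ut t x)) \<longlongrightarrow> 0) (at t within {0..})"
      using fast_limit_continuous[OF Ft supp(2), of t "{0..}"] unfolding e2_Lpn tendsto_ennreal_square_zero ut_def .
  next
    fix \<psi> :: "spacetime \<Rightarrow> real" assume "test_fn ({0<..} \<times> UNIV) \<psi>"
    then obtain R where \<psi>: "Cinf \<psi>" "\<And>x. norm x > R \<Longrightarrow> \<psi> x = 0" "\<And>b x. norm x > R \<Longrightarrow> dd b \<psi> x = 0" by (rule test_fnE) blast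
    have a: "integrable lborel (\<lambda>p. W0 p * Dt \<psi> p)" "(\<lambda>n. LBINT p. w n p * Dt \<psi> p) \<longlonglongrightarrow> (LBINT p. W0 p * Dt \<psi> p)"
      using fast_limit_pairing(1)[OF F0 Cinf_continuous[OF Cinf_dd[OF \<psi>(1)]] \<psi>(3)] by blast+
    have b: "integrable lborel (\<lambda>p. Wt p * \<psi> p)" "(\<lambda>n. LBINT p. Dt (w n) p * \<psi> p) \<longlonglongrightarrow> (LBINT p. Wt p * \<psi> p)"
      using fast_limit_pairing(1)[OF Ft Cinf_continuous[OF \<psi>(1)] \<psi>(2)] by blast+
    have "(LBINT p. w n p * Dt \<psi> p) = - (LBINT p. Dt (w n) p * \<psi> p)" for n by (rule integral_by_parts[OF Cw \<psi>(1,2)])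
    note LIMSEQ_unique[OF a(2)[unfolded this] tendsto_minus[OF b(2)]]
    with a(1) b(1) show "integrable lborel (\<lambda>(t, x). u t x * tderiv (t, x) \<psi>)" "integrable lborel (\<lambda>(t, x). ut t x * \<psi> (t, x))"
      "(LBINT z. (case z of (t, x) \<Rightarrow> u t x * tderiv (t, x) \<psi>)) = - (LBINT z. (case z of (t, x) \<Rightarrow> ut t x * \<psi> (t, x)))"
      by (simp_all add: u_def ut_def tderiv_def case_prod_unfold)
  qed
  moreover have "weak_wave u du ut (\<lambda>t x y. 0)" unfolding weak_wave_def
  proof (intro allI impI)
    fix \<psi> :: "spacetime \<Rightarrow> real" assume "test_fn ({0<..} \<times> UNIV) \<psi>"
    then obtain R where \<psi>: "Cinf \<psi>" "\<And>x. norm x > R \<Longrightarrow> \<psi> x = 0" "\<And>b x. norm x > R \<Longrightarrow> dd b \<psi> x = 0" by (rule test_fnE) blast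
    note c = Cinf_continuous[OF Cinf_dd[OF \<psi>(1)]]
    have a: "integrable lborel (\<lambda>p. Wt p * Dt \<psi> p)" "(\<lambda>n. LBINT p. Dt (w n) p * Dt \<psi> p) \<longlonglongrightarrow> (LBINT p. Wt p * Dt \<psi> p)"
      using fast_limit_pairing(1)[OF Ft c \<psi>(3)] by blast+
    have b: "integrable lborel (\<lambda>p. Wx i p * Dx i \<psi> p)" "(\<lambda>n. LBINT p. Dx i (w n) p * Dx i \<psi> p) \<longlonglongrightarrow> (LBINT p. Wx i p * Dx i \<psi> p)" for i
      using fast_limit_pairing(1)[OF Fx c \<psi>(3)] by blast+
    have I: "integrable lborel (\<lambda>p. dd b (dd b' (w n)) p * \<psi> p)" for b b' n
      by (rule integrable_lborel_compact_support[of _ R]) (auto intro!: continuous_on_mult Cinf_continuous Cinf_dd Cw simp: \<psi>)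
    have "(\<Sum>i\<in>UNIV. LBINT p. Dx i (w n) p * Dx i \<psi> p) - (LBINT p. Dt (w n) p * Dt \<psi> p) = 0" for n
    proof -
      have "(\<Sum>i\<in>UNIV. LBINT p. Dx i (Dx i (w n)) p * \<psi> p) = (LBINT p. (\<Sum>i\<in>UNIV. Dx i (Dx i (w n)) p * \<psi> p))"
        by (rule Bochner_Integration.integral_sum[symmetric]) (rule I)
      also have "\<dots> = (LBINT p. Dt (Dt (w n)) p * \<psi> p)" using w[of n] by (simp add: nice_wave_def sum_distrib_right)
      finally have "(\<Sum>i\<in>UNIV. LBINT p. Dx i (Dx i (w n)) p * \<psi> p) = (LBINT p. Dt (Dt (w n)) p * \<psi> p)" .
      moreover have "(LBINT p. dd b (w n) p * dd b \<psi> p) = - (LBINT p. dd b (dd b (w n)) p * \<psi> p)" for b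
        by (rule integral_by_parts[OF Cinf_dd[OF Cw] \<psi>(1,2)])
      ultimately show ?thesis by (simp add: sum_negf)
    qed
    moreover have "(\<lambda>n. (\<Sum>i\<in>UNIV. LBINT p. Dx i (w n) p * Dx i \<psi> p) - (LBINT p. Dt (w n) p * Dt \<psi> p))
       \<longlonglongrightarrow> (\<Sum>i\<in>UNIV. LBINT p. Wx i p * Dx i \<psi> p) - (LBINT p. Wt p * Dt \<psi> p)"
      by (intro tendsto_diff tendsto_sum a b)
    ultimately have z: "(\<Sum>i\<in>UNIV. LBINT p. Wx i p * Dx i \<psi> p) - (LBINT p. Wt p * Dt \<psi> p) = 0"
      by (simp only: LIMSEQ_const_iff)
    have eq: "(\<lambda>(t, x). - ut t x * tderiv (t, x) \<psi> + du t x \<bullet> xgrad (t, x) \<psi> + 0 * \<psi> (t, x)) = (\<lambda>p. (\<Sum>i\<in>UNIV. Wx i p * Dx i \<psi> p) - Wt p * Dt \<psi> p)"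
      by (auto simp: ut_def tderiv_def xgrad_def inner_vec_def)
    have bs: "integrable lborel (\<lambda>p. \<Sum>i\<in>UNIV. Wx i p * Dx i \<psi> p)" by (rule Bochner_Integration.integrable_sum) (rule b)
    have "(LBINT p. (\<Sum>i\<in>UNIV. Wx i p * Dx i \<psi> p) - Wt p * Dt \<psi> p) = 0"
      unfolding Bochner_Integration.integral_diff[OF bs a(1)] Bochner_Integration.integral_sum[OF b(1)] by (rule z)
    with Bochner_Integration.integrable_diff[OF bs a(1)]
    show "integrable lborel (\<lambda>(t, x). - ut t x * tderiv (t, x) \<psi> + du t x \<bullet> xgrad (t, x) \<psi> + 0 * \<psi> (t, x)) \<and>
       (LBINT z. (case z of (t, x) \<Rightarrow> - ut t x * tderiv (t, x) \<psi> + du t x \<bullet> xgrad (t, x) \<psi> + 0 * \<psi> (t, x))) = 0"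
      unfolding eq by blast
  qed
  moreover have "e2 (\<lambda>x. ut t x - Dt (w n) (t, x)) \<le> ennreal (4 * (1/128) ^ n) \<and> (\<forall>i. e2 (\<lambda>x. du t x $ i - Dx i (w n) (t, x)) \<le> ennreal (4 * (1/128) ^ n))" for n t
    using fast_limit_2(1)[OF Ft] fast_limit_2(1)[OF Fx] unfolding ut_def du by blast
  ultimately show ?thesis using dum by blast
qed

section \<open>The scattering state\<close>

lemma tendsto_zero_at_top_ennreal:
  fixes f :: "real \<Rightarrow> ennreal"
  assumes "\<And>n t. t \<ge> T n \<Longrightarrow> f t \<le> ennreal (9 * (1/128) ^ n)"
  shows "(f \<longlongrightarrow> 0) at_top"
proof (rule order_tendstoI)
  fix y :: ennreal assume "0 < y"
  then obtain r where r: "0 < r" "ennreal r < y" by (rule ennreal_dense_real)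
  have "(\<lambda>n. 9 * (1/128::real) ^ n) \<longlonglongrightarrow> 9 * 0" by (intro tendsto_intros LIMSEQ_power_zero) auto
  from order_tendstoD(2)[OF this, of r] r have "\<forall>\<^sub>F n in sequentially. 9 * (1/128::real) ^ n < r" by simp
  then obtain n where n: "9 * (1/128::real) ^ n < r" by (auto simp: eventually_sequentially)
  show "\<forall>\<^sub>F t in at_top. f t < y"
    using eventually_ge_at_top[of "T n"]
  proof eventually_elim
    fix t assume "t \<ge> T n"
    then have "f t \<le> ennreal (9 * (1/128) ^ n)" by (rule assms)
    also have "\<dots> \<le> ennreal r" using n by (intro ennreal_leI) simp
    finally show "f t < y" using r(2) by simp
  qed
qed simp

theorem theorem4p5:
  fixes V1 V2 W1 W2 :: "real^3 \<Rightarrow> real"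
    and v \<beta> \<epsilon> :: real
    and h ht :: "real \<Rightarrow> real^3 \<Rightarrow> real"
    and dh :: "real \<Rightarrow> real^3 \<Rightarrow> real^3"
    and f g :: "real^3 \<Rightarrow> real"
  assumes V1_smooth: "smooth_fn V1" and V2_smooth: "smooth_fn V2"
    and beta: "\<beta> > 3"
    and V1_decay: "\<exists>C. \<forall>x. \<bar>V1 x\<bar> \<le> C * jb x powr (- \<beta>)"
    and V2_decay: "\<exists>C. \<forall>x. \<bar>V2 x\<bar> \<le> C * jb x powr (- \<beta>)"
    and v: "0 < \<bar>v\<bar>" "\<bar>v\<bar> < 1"
    and W1_cont: "continuous_on UNIV W1" and W2_cont: "continuous_on UNIV W2"
    and W1_decay: "\<exists>C. \<forall>x. \<bar>W1 x\<bar> \<le> C * jb x powr (- 1)"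
    and W2_decay: "\<exists>C. \<forall>x. \<bar>W2 x\<bar> \<le> C * jb x powr (- 1)"
    and sol_class: "energy_class h dh ht"
    and sol_eq: "weak_wave h dh ht (Pterm V1 V2 W1 W2 v)"
    and data: "h 0 = f" "ht 0 = g"
    and S_fin: "Snorm v h dh ht < \<infinity>"
    and eps: "\<epsilon> > 0"
    and F1_fin: "(\<integral>\<^sup>+ t\<in>{0..}. (\<integral>\<^sup>+ x. ennreal ((jb x powr (1/2 + \<epsilon>) * F1fn V1 W1 W2 v t x)^2) \<partial>lborel) \<partial>lborel) < \<infinity>"
    and F2_fin: "(\<integral>\<^sup>+ t\<in>{0..}. (\<integral>\<^sup>+ x. ennreal ((jb x powr (1/2 + \<epsilon>) * shiftS v (F2fn V2 W1 W2 v) t x)^2) \<partial>lborel) \<partial>lborel) < \<infinity>"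
    and F_fin: "LpLq 1 2 (Ffn W1 W2 v) < \<infinity>"
  shows "\<exists>f0 df0 g0 w dw wt.
           Hdot1 f0 df0 \<and> L2mem g0 \<and>
           energy_class w dw wt \<and> weak_wave w dw wt (\<lambda>t x y. 0) \<and>
           w 0 = f0 \<and> wt 0 = g0 \<and>
           ((\<lambda>t. Lpn 2 (\<lambda>x. norm (dh t x - dw t x)) + Lpn 2 (\<lambda>x. ht t x - wt t x))
              \<longlongrightarrow> 0) at_top"
proof -
  obtain C1 C2 D1 D2 where d: "\<forall>x. \<bar>V1 x\<bar> \<le> C1 * jb x powr (- \<beta>)" "\<forall>x. \<bar>V2 x\<bar> \<le> C2 * jb x powr (- \<beta>)"
    "\<forall>x. \<bar>W1 x\<bar> \<le> D1 * jb x powr (- 1)" "\<forall>x. \<bar>W2 x\<bar> \<le> D2 * jb x powr (- 1)"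
    using V1_decay V2_decay W1_decay W2_decay by blast
  obtain q where q: "q \<in> borel_measurable borel" "small_tail q" "\<And>t x. t > 0 \<Longrightarrow> q (t, x) = Pterm V1 V2 W1 W2 v t x (h t x)"
    using small_tail_source[OF V1_smooth V2_smooth beta d(1,2) v(2) W1_cont W2_cont d(3,4) sol_class S_fin eps F1_fin F2_fin F_fin] by blast
  \<comment> \<open>The rate for which convergence almost everywhere holds in L^2 and L^6
    alike.\<close>
  define \<delta> :: "nat \<Rightarrow> real" where "\<delta> n = (1/128) ^ n" for n
  have \<delta>: "\<delta> n > 0" for n by (simp add: \<delta>_def)
  have approx: "\<exists>T>0. \<exists>w. nice_wave w \<and> (\<forall>t\<ge>T. e2 (\<lambda>x. ht t x - Dt w (t, x)) \<le> ennreal (\<delta> n / 4) \<and> (\<forall>i. e2 (\<lambda>x. dh t x $ i - Dx i w (t, x)) \<le> ennreal (\<delta> n / 4)))" for n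
    by (rule uniform_approx[OF sol_class sol_eq q(1,3,2)]) (use \<delta>[of n] in simp_all)
  have "\<forall>n. \<exists>X. fst X > 0 \<and> nice_wave (snd X) \<and> (\<forall>t\<ge>fst X. e2 (\<lambda>x. ht t x - Dt (snd X) (t, x)) \<le> ennreal (\<delta> n / 4) \<and> (\<forall>i. e2 (\<lambda>x. dh t x $ i - Dx i (snd X) (t, x)) \<le> ennreal (\<delta> n / 4)))"
  proof
    fix n
    obtain T w where "T > 0" "nice_wave w" "\<forall>t\<ge>T. e2 (\<lambda>x. ht t x - Dt w (t, x)) \<le> ennreal (\<delta> n / 4) \<and> (\<forall>i. e2 (\<lambda>x. dh t x $ i - Dx i w (t, x)) \<le> ennreal (\<delta> n / 4))"
      using approx[of n] by blast
    then show "\<exists>X. fst X > 0 \<and> nice_wave (snd X) \<and> (\<forall>t\<ge>fst X. e2 (\<lambda>x. ht t x - Dt (snd X) (t, x)) \<le> ennreal (\<delta> n / 4) \<and> (\<forall>i. e2 (\<lambda>x. dh t x $ i - Dx i (snd X) (t, x)) \<le> ennreal (\<delta> n / 4)))"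
      by (intro exI[of _ "(T, w)"]) simp
  qed
  from choice[OF this] obtain X where X: "\<And>n. fst (X n) > 0 \<and> nice_wave (snd (X n)) \<and> (\<forall>t\<ge>fst (X n). e2 (\<lambda>x. ht t x - Dt (snd (X n)) (t, x)) \<le> ennreal (\<delta> n / 4) \<and> (\<forall>i. e2 (\<lambda>x. dh t x $ i - Dx i (snd (X n)) (t, x)) \<le> ennreal (\<delta> n / 4)))"
    by blast
  define T where "T n = fst (X n)" for n
  define u where "u n = snd (X n)" for n
  have T: "T n > 0" and u: "nice_wave (u n)" for n using X[of n] by (auto simp: T_def u_def)
  have ut: "e2 (\<lambda>x. ht t x - Dt (u n) (t, x)) \<le> ennreal (\<delta> n / 4)" and ux: "e2 (\<lambda>x. dh t x $ i - Dx i (u n) (t, x)) \<le> ennreal (\<delta> n / 4)" if "t \<ge> T n" for t n i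
    using X[of n] that by (auto simp: T_def u_def)
  have Cauchy: "en (\<lambda>p. u m p - u n p) \<le> 4 * (1/128) ^ n" if nm: "n \<le> m" for n m
  proof -
    \<comment> \<open>Beyond both thresholds each of the two waves is close to the solution, and as
      energy is conserved it suffices to compare them at this time. The quarters give 2 (\<delta> /
      4) + 2 (\<delta> / 4) = \<delta> for each of the four components.\<close>
    define t where "t = max (T n) (T m)"
    have t: "t \<ge> T n" "t \<ge> T m" "t \<ge> 0" using T[of n] by (auto simp: t_def)
    have z: "nice_wave (\<lambda>p. u m p - u n p)" by (rule nice_wave_diff[OF u u])
    have "\<delta> m \<le> \<delta> n" unfolding \<delta>_def using nm by (intro power_decreasing) auto
    then have dm: "ennreal (\<delta> m / 4) \<le> ennreal (\<delta> n / 4)" by (intro ennreal_leI) simp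
    have c: "e2 (\<lambda>x. dd b (\<lambda>p. u m p - u n p) (t, x)) \<le> ennreal (\<delta> n)"
      if a: "a \<in> borel_measurable borel" and n: "e2 (\<lambda>x. a x - dd b (u n) (t, x)) \<le> ennreal (\<delta> n / 4)" and m: "e2 (\<lambda>x. a x - dd b (u m) (t, x)) \<le> ennreal (\<delta> m / 4)" for a b
    proof -
      have "dd b (\<lambda>p. u m p - u n p) p = dd b (u m) p - dd b (u n) p" for p
        by (intro dd_diff Cinf_differentiable nice_wave_Cinf u)
      moreover have "e2 (\<lambda>x. dd b (u m) (t, x) - dd b (u n) (t, x)) \<le> ennreal (\<delta> n)"
        by (rule e2_triangle[where b=a and r="\<delta> n / 4" and s="\<delta> n / 4", OF nice_wave_slice(3)[OF u] a nice_wave_slice(3)[OF u] _ n])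
          (use order.trans[OF m dm] \<delta>[of n] in \<open>simp_all add: e2_minus_commute[of _ a]\<close>)
      ultimately show ?thesis by simp
    qed
    have "ennreal (en (\<lambda>p. u m p - u n p)) \<le> ennreal (\<delta> n) + (\<Sum>i\<in>(UNIV::3 set). ennreal (\<delta> n))"
      unfolding en_slice[OF z, of t] by (intro add_mono sum_mono, rule c[OF energy_classD(4)[OF sol_class t(3)] ut[OF t(1)] ut[OF t(2)]],
        rule c[OF energy_classD(6)[OF sol_class t(3)] ux[OF t(1)] ux[OF t(2)]])
    also have "\<dots> = ennreal (4 * \<delta> n)" using \<delta>[of n] by (simp add: ennreal_mult' distrib_right[symmetric] flip: distrib_right[of 1 3 "ennreal (\<delta> n)", simplified])
    finally show ?thesis using \<delta>[of n] by (simp add: \<delta>_def)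
  qed
  obtain w dw wt where w: "energy_class w dw wt" "weak_wave w dw wt (\<lambda>t x y. 0)"
    and wu: "\<And>n t. e2 (\<lambda>x. wt t x - Dt (u n) (t, x)) \<le> ennreal (4 * (1/128) ^ n)" "\<And>n t i. e2 (\<lambda>x. dw t x $ i - Dx i (u n) (t, x)) \<le> ennreal (4 * (1/128) ^ n)"
    and wm: "\<And>t. wt t \<in> borel_measurable borel" "\<And>t i. (\<lambda>x. dw t x $ i) \<in> borel_measurable borel"
    using limit_wave[OF u Cauchy] by blast
  \<comment> \<open>The constant 9 leaves room for 2 / 4 + 2 times 4.\<close>
  have close: "e2 (\<lambda>x. a x - b x) \<le> ennreal (9 * (1/128) ^ n)"
    if "a \<in> borel_measurable borel" "b \<in> borel_measurable borel" "c \<in> borel_measurable borel"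
      and "e2 (\<lambda>x. a x - c x) \<le> ennreal (\<delta> n / 4)" "e2 (\<lambda>x. b x - c x) \<le> ennreal (4 * (1/128) ^ n)" for a b c :: "real^3 \<Rightarrow> real" and n
    by (rule e2_triangle[where b=c and r="\<delta> n / 4" and s="4 * (1/128) ^ n"]) (use that in \<open>simp_all add: e2_minus_commute[of c b] \<delta>_def\<close>)
  have t0: "t \<ge> 0" if "t \<ge> T n" for t n using T[of n] that by simp
  have "((\<lambda>t. e2 (\<lambda>x. ht t x - wt t x)) \<longlongrightarrow> 0) at_top"
  proof (rule tendsto_zero_at_top_ennreal[of T])
    fix n t assume t: "T n \<le> t"
    show "e2 (\<lambda>x. ht t x - wt t x) \<le> ennreal (9 * (1/128) ^ n)"
      by (rule close[OF energy_classD(4)[OF sol_class t0[OF t]] wm(1) nice_wave_slice(3)[OF u] ut[OF t] wu(1)])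
  qed
  then have 1: "((\<lambda>t. Lpn 2 (\<lambda>x. ht t x - wt t x)) \<longlongrightarrow> 0) at_top" unfolding e2_Lpn tendsto_ennreal_square_zero .
  have comp: "((\<lambda>t. e2 (\<lambda>x. dh t x $ i - dw t x $ i)) \<longlongrightarrow> 0) at_top" for i
  proof (rule tendsto_zero_at_top_ennreal[of T])
    fix n t assume t: "T n \<le> t"
    show "e2 (\<lambda>x. dh t x $ i - dw t x $ i) \<le> ennreal (9 * (1/128) ^ n)"
      by (rule close[OF energy_classD(6)[OF sol_class t0[OF t]] wm(2) nice_wave_slice(3)[OF u] ux[OF t] wu(2)])
  qed
  have "((\<lambda>t. e2 (\<lambda>x. norm (dh t x - dw t x))) \<longlongrightarrow> 0) at_top"
  proof (rule Lim_transform_eventually)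
    show "((\<lambda>t. e2 (\<lambda>x. dh t x $ 1 - dw t x $ 1) + (e2 (\<lambda>x. dh t x $ 2 - dw t x $ 2) + e2 (\<lambda>x. dh t x $ 3 - dw t x $ 3))) \<longlongrightarrow> 0) at_top"
      using tendsto_add[OF comp tendsto_add[OF comp comp]] by simp
    show "\<forall>\<^sub>F t in at_top. e2 (\<lambda>x. dh t x $ 1 - dw t x $ 1) + (e2 (\<lambda>x. dh t x $ 2 - dw t x $ 2) + e2 (\<lambda>x. dh t x $ 3 - dw t x $ 3)) = e2 (\<lambda>x. norm (dh t x - dw t x))"
      using eventually_ge_at_top[of 0]
    proof eventually_elim
      fix t :: real assume t: "0 \<le> t"
      have "(\<lambda>x. (dh t x - dw t x) $ i) \<in> borel_measurable borel" for i
        using borel_measurable_diff[OF energy_classD(6)[OF sol_class t] wm(2)[of t i]] by simp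
      from e2_norm_vec[OF this] show "e2 (\<lambda>x. dh t x $ 1 - dw t x $ 1) + (e2 (\<lambda>x. dh t x $ 2 - dw t x $ 2) + e2 (\<lambda>x. dh t x $ 3 - dw t x $ 3)) = e2 (\<lambda>x. norm (dh t x - dw t x))" by simp
    qed
  qed
  then have "((\<lambda>t. Lpn 2 (\<lambda>x. norm (dh t x - dw t x))) \<longlongrightarrow> 0) at_top" unfolding e2_Lpn tendsto_ennreal_square_zero .
  from tendsto_add[OF this 1] have "((\<lambda>t. Lpn 2 (\<lambda>x. norm (dh t x - dw t x)) + Lpn 2 (\<lambda>x. ht t x - wt t x)) \<longlongrightarrow> 0) at_top" by simp
  \<comment> \<open>The free data are the values of the limit wave at time 0.\<close>
  with w energy_classD(1,2)[OF w(1), of 0]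
  have "Hdot1 (w 0) (dw 0) \<and> L2mem (wt 0) \<and> energy_class w dw wt \<and> weak_wave w dw wt (\<lambda>t x y. 0) \<and> w 0 = w 0 \<and> wt 0 = wt 0 \<and>
     ((\<lambda>t. Lpn 2 (\<lambda>x. norm (dh t x - dw t x)) + Lpn 2 (\<lambda>x. ht t x - wt t x)) \<longlongrightarrow> 0) at_top" by simp
  then show ?thesis by (intro exI)
qed

end
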